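(* Let $E$ be a Banach space and $k\in\mathbb{N}$. Consider the assertions: (a) $E$ has property (V) and $\mathcal{P}({}^kE)=\mathcal{P}_{\mathrm{wb}}({}^kE)$; (b) for each Banach space $F$, every unconditionally converging polynomial $P\in\mathcal{P}({}^kE,F)$ is weakly compact. Then (a) implies (b). If, moreover, $E$ has an unconditional finite dimensional expansion of the identity, then (b) implies (a).
   Context: Banach spaces are over $\mathbb{K}=\mathbb{R}$ or $\mathbb{C}$, and $\mathbb{N}=\{1,2,\ldots\}$. $\mathcal{P}({}^kE,F)$ is the Banach space of all continuous $k$-homogeneous polynomials $P:E\to F$ (i.e. $P(x)=A(x,\ldots,x)$ for a continuous $k$-linear map $A:E^k\to F$), with norm $\|P\|=\sup_{\|x\|\le 1}\|P(x)\|$. $\mathcal{P}_{\mathrm{wb}}({}^kE,F)$ is the subspace of those polynomials whose restriction to every bounded subset of $E$ is continuous from the weak topology of $E$ to the norm topology of $F$. When $F=\mathbb{K}$ one writes $\mathcal{P}({}^kE)$ and $\mathcal{P}_{\mathrm{wb}}({}^kE)$. A formal series $\sum x_n$ in $E$ is weakly unconditionally Cauchy (w.u.C.) if $\sum|\phi(x_n)|<\infty$ for every $\phi\in E^*$. A polynomial $P\in\mathcal{P}({}^kE,F)$ is unconditionally converging if, for each w.u.C. series $\sum x_n$ in $E$, the sequence $\left(P\left(\sum_{i=1}^n x_i\right)\right)_n$ converges in norm in $F$; for $k=1$ this defines unconditionally converging operators. $P$ is weakly compact if $P(B_E)$ is relatively weakly compact in $F$, where $B_E$ is the closed unit ball of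 $E$. $E$ has property (V) if, for every Banach space $F$, every unconditionally converging bounded linear operator $E\to F$ is weakly compact. An unconditional finite dimensional expansion of the identity for $E$ is a sequence of bounded finite-rank linear operators $A_n:E\to E$ such that, for each $x\in E$, $x=\sum_{n=1}^\infty A_n(x)$ with the series unconditionally convergent. *)

theory Defs
  imports "HOL-Analysis.Analysis" "HOL-Library.Function_Algebras"
begin

text \<open>
  The scalar field is \<open>\<real>\<close> or \<open>\<complex>\<close> with its usual absolute value.
\<close>

class rc_field = real_normed_field +
  assumes real_or_complex:
    "(\<forall>z. \<exists>a. z = a *\<^sub>R 1) \<or>
     (\<exists>i. i * i = - 1 \<and>
        (\<forall>z. \<exists>a b. z = a *\<^sub>R 1 + b *\<^sub>R i \<and> norm z = sqrt (a\<^sup>2 + b\<^sup>2)))"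

instance real :: rc_field
  by standard simp

instance complex :: rc_field
proof
  have "z = Re z *\<^sub>R 1 + Im z *\<^sub>R \<i> \<and> norm z = sqrt ((Re z)\<^sup>2 + (Im z)\<^sup>2)" for z
    by (simp add: complex_eq_iff cmod_def)
  moreover have "\<i> * \<i> = - 1"
    by simp
  ultimately show "(\<forall>z::complex. \<exists>a. z = a *\<^sub>R 1) \<or> (\<exists>i::complex. i * i = - 1 \<and>
      (\<forall>z. \<exists>a b. z = a *\<^sub>R 1 + b *\<^sub>R i \<and> norm z = sqrt (a\<^sup>2 + b\<^sup>2)))"
    by blast
qed

text \<open>
  The range of a quantifier over all Banach spaces must be a type, so Banach spaces are
  structures: a linear subspace \<open>vecs E\<close> of a vector space on the type \<open>'v\<close>, with a norm which
  matters on \<open>vecs E\<close> only.  All maps between spaces below are likewise only relevant on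
  \<open>vecs E\<close>.
\<close>

record ('k, 'v) nspace =
  vecs :: "'v set"
  scl :: "'k \<Rightarrow> 'v \<Rightarrow> 'v"
  nrm :: "'v \<Rightarrow> real"

text \<open>
  The library's \<open>Metric_space\<close> wants a distance that is nonnegative and symmetric on the whole
  type, hence the case distinction.
\<close>

definition ndist :: "('k, 'v::ab_group_add) nspace \<Rightarrow> 'v \<Rightarrow> 'v \<Rightarrow> real" where
  "ndist E x y = (if x \<in> vecs E \<and> y \<in> vecs E then nrm E (x - y) else 0)"

definition norm_top :: "('k, 'v::ab_group_add) nspace \<Rightarrow> 'v topology" where
  "norm_top E = Metric_space.mtopology (vecs E) (ndist E)"

locale banach_space = vector_space "scl E"
  for E :: "('k::rc_field, 'v::ab_group_add) nspace" +
  assumes subspace_vecs: "module.subspace (scl E) (vecs E)"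
    and nrm_nonneg: "x \<in> vecs E \<Longrightarrow> 0 \<le> nrm E x"
    and nrm_eq_0: "x \<in> vecs E \<Longrightarrow> nrm E x = 0 \<longleftrightarrow> x = 0"
    and nrm_scl: "x \<in> vecs E \<Longrightarrow> nrm E (scl E c x) = norm c * nrm E x"
    and nrm_triangle: "x \<in> vecs E \<Longrightarrow> y \<in> vecs E \<Longrightarrow> nrm E (x + y) \<le> nrm E x + nrm E y"
    and complete: "Metric_space.mcomplete (vecs E) (ndist E)"

definition scalar_space :: "('k::rc_field, 'k) nspace" where
  "scalar_space = \<lparr>vecs = UNIV, scl = (*), nrm = norm\<rparr>"

definition bounded_ops ::
    "('k::rc_field, 'v::ab_group_add) nspace \<Rightarrow> ('k, 'w::ab_group_add) nspace \<Rightarrow> ('v \<Rightarrow> 'w) set"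
  where
  "bounded_ops E F = {T \<in> vecs E \<rightarrow> vecs F.
     (\<forall>x\<in>vecs E. \<forall>y\<in>vecs E. T (x + y) = T x + T y) \<and>
     (\<forall>c. \<forall>x\<in>vecs E. T (scl E c x) = scl F c (T x)) \<and>
     (\<exists>C. \<forall>x\<in>vecs E. nrm F (T x) \<le> C * nrm E x)}"

definition dual :: "('k::rc_field, 'v::ab_group_add) nspace \<Rightarrow> ('v \<Rightarrow> 'k) set" where
  "dual E = bounded_ops E scalar_space"

definition weak_top :: "('k::rc_field, 'v::ab_group_add) nspace \<Rightarrow> 'v topology" where
  "weak_top E = topology_generated_by
     {{x \<in> vecs E. \<phi> x \<in> U} |\<phi> U. \<phi> \<in> dual E \<and> open U}"

text \<open>
  \<open>E\<^sup>k\<close> is the set of extensional functions from \<open>{..<k}\<close> to \<open>vecs E\<close>.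
\<close>

definition multilinear_map ::
    "nat \<Rightarrow> ('k::rc_field, 'v::ab_group_add) nspace \<Rightarrow> ('k, 'w::ab_group_add) nspace
      \<Rightarrow> ((nat \<Rightarrow> 'v) \<Rightarrow> 'w) \<Rightarrow> bool"
  where
  "multilinear_map k E F A \<longleftrightarrow>
     A \<in> ({..<k} \<rightarrow>\<^sub>E vecs E) \<rightarrow> vecs F \<and>
     (\<forall>x \<in> {..<k} \<rightarrow>\<^sub>E vecs E. \<forall>i<k. \<forall>u\<in>vecs E. \<forall>v\<in>vecs E.
        A (x(i := u + v)) = A (x(i := u)) + A (x(i := v))) \<and>
     (\<forall>x \<in> {..<k} \<rightarrow>\<^sub>E vecs E. \<forall>i<k. \<forall>c. \<forall>u\<in>vecs E.
        A (x(i := scl E c u)) = scl F c (A (x(i := u))))"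

definition polys ::
    "nat \<Rightarrow> ('k::rc_field, 'v::ab_group_add) nspace \<Rightarrow> ('k, 'w::ab_group_add) nspace
      \<Rightarrow> ('v \<Rightarrow> 'w) set"
  where
  "polys k E F = {P. \<exists>A. multilinear_map k E F A \<and>
     continuous_map (product_topology (\<lambda>_. norm_top E) {..<k}) (norm_top F) A \<and>
     (\<forall>x\<in>vecs E. P x = A (\<lambda>i\<in>{..<k}. x))}"

definition polys_wb ::
    "nat \<Rightarrow> ('k::rc_field, 'v::ab_group_add) nspace \<Rightarrow> ('k, 'w::ab_group_add) nspace
      \<Rightarrow> ('v \<Rightarrow> 'w) set"
  where
  "polys_wb k E F = {P \<in> polys k E F.
     \<forall>B. Metric_space.mbounded (vecs E) (ndist E) B \<longrightarrow>
       continuous_map (subtopology (weak_top E) B) (norm_top F) P}"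

definition wuC :: "('k::rc_field, 'v::ab_group_add) nspace \<Rightarrow> (nat \<Rightarrow> 'v) \<Rightarrow> bool" where
  "wuC E x \<longleftrightarrow> range x \<subseteq> vecs E \<and> (\<forall>\<phi>\<in>dual E. summable (\<lambda>n. norm (\<phi> (x n))))"

definition unconditionally_converging ::
    "('k::rc_field, 'v::ab_group_add) nspace \<Rightarrow> ('k, 'w::ab_group_add) nspace
      \<Rightarrow> ('v \<Rightarrow> 'w) \<Rightarrow> bool"
  where
  "unconditionally_converging E F P \<longleftrightarrow>
     (\<forall>x. wuC E x \<longrightarrow> (\<exists>l. limitin (norm_top F) (\<lambda>n. P (\<Sum>i\<le>n. x i)) l sequentially))"

definition weakly_compact ::
    "('k::rc_field, 'v::ab_group_add) nspace \<Rightarrow> ('k, 'w::ab_group_add) nspace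
      \<Rightarrow> ('v \<Rightarrow> 'w) \<Rightarrow> bool"
  where
  "weakly_compact E F P \<longleftrightarrow>
     compactin (weak_top F) (weak_top F closure_of (P ` {x \<in> vecs E. nrm E x \<le> 1}))"

text \<open>
  The next two properties quantify over all Banach spaces \<open>F\<close> carried by subsets of the type
  \<open>'w\<close>.  For the type \<open>'w = ('v \<Rightarrow> 'k) \<Rightarrow> 'k\<close> this is no restriction.  To test an operator
  or polynomial \<open>P\<close> from \<open>E\<close> to some \<open>F\<close>, one may replace \<open>F\<close> by the closed linear span \<open>G\<close> of
  the range of \<open>P\<close>.  A functional \<open>\<psi>\<close> in the dual of \<open>G\<close> is determined by \<open>\<psi> \<circ> P\<close>, so the map
  that sends \<open>y\<close> to the function with value \<open>\<psi> y\<close> at \<open>\<psi> \<circ> P\<close> (and \<open>0\<close> at all other arguments)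
  is linear and, by Hahn--Banach, injective on \<open>G\<close>.  A statement which has such a property as
  a hypothesis uses this type; as a conclusion the property is stated for every type \<open>'w\<close>.
\<close>

definition property_V ::
    "'w::ab_group_add itself \<Rightarrow> ('k::rc_field, 'v::ab_group_add) nspace \<Rightarrow> bool"
  where
  "property_V _ E \<longleftrightarrow>
     (\<forall>F :: ('k, 'w) nspace. banach_space F \<longrightarrow>
        (\<forall>T \<in> bounded_ops E F. unconditionally_converging E F T \<longrightarrow> weakly_compact E F T))"

definition uc_polys_weakly_compact ::
    "'w::ab_group_add itself \<Rightarrow> nat \<Rightarrow> ('k::rc_field, 'v::ab_group_add) nspace \<Rightarrow> bool"
  where
  "uc_polys_weakly_compact _ k E \<longleftrightarrow>
     (\<forall>F :: ('k, 'w) nspace. banach_space F \<longrightarrow>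
        (\<forall>P \<in> polys k E F. unconditionally_converging E F P \<longrightarrow> weakly_compact E F P))"

definition finite_rank ::
    "('k::rc_field, 'v::ab_group_add) nspace \<Rightarrow> ('v \<Rightarrow> 'v) \<Rightarrow> bool"
  where
  "finite_rank E T \<longleftrightarrow> (\<exists>B \<subseteq> vecs E. finite B \<and> T ` vecs E \<subseteq> module.span (scl E) B)"

definition unconditionally_convergent_series ::
    "('k::rc_field, 'v::ab_group_add) nspace \<Rightarrow> (nat \<Rightarrow> 'v) \<Rightarrow> bool"
  where
  "unconditionally_convergent_series E x \<longleftrightarrow>
     (\<forall>\<pi>. bij \<pi> \<longrightarrow> (\<exists>l. limitin (norm_top E) (\<lambda>n. \<Sum>i<n. x (\<pi> i)) l sequentially))"

definition unconditional_fd_expansion ::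
    "('k::rc_field, 'v::ab_group_add) nspace \<Rightarrow> (nat \<Rightarrow> 'v \<Rightarrow> 'v) \<Rightarrow> bool"
  where
  "unconditional_fd_expansion E A \<longleftrightarrow>
     (\<forall>n. A n \<in> bounded_ops E E \<and> finite_rank E (A n)) \<and>
     (\<forall>x\<in>vecs E. limitin (norm_top E) (\<lambda>n. \<Sum>i<n. A i x) x sequentially \<and>
        unconditionally_convergent_series E (\<lambda>n. A n x))"

subsection \<open>Consistency checks\<close>

lemma (in banach_space) Metric_space_ndist: "Metric_space (vecs E) (ndist E)"
proof
  fix x y
  have diff: "u - v \<in> vecs E" if "u \<in> vecs E" "v \<in> vecs E" for u v
    using that by (rule subspace_diff[OF subspace_vecs])
  show "0 \<le> ndist E x y"
    by (simp add: ndist_def nrm_nonneg diff)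
  show "ndist E x y = ndist E y x"
    using nrm_scl[of "y - x" "-1"] by (auto simp: ndist_def diff)
  assume x: "x \<in> vecs E" and y: "y \<in> vecs E"
  show "ndist E x y = 0 \<longleftrightarrow> x = y"
    using nrm_eq_0[OF diff[OF x y]] x y by (simp add: ndist_def)
  fix z
  assume z: "z \<in> vecs E"
  show "ndist E x z \<le> ndist E x y + ndist E y z"
    using nrm_triangle[OF diff[OF x y] diff[OF y z]] x y z by (simp add: ndist_def)
qed

lemma (in banach_space) topspace_norm_top: "topspace (norm_top E) = vecs E"
  by (simp add: norm_top_def Metric_space.topspace_mtopology Metric_space_ndist)

lemma topspace_weak_top: "topspace (weak_top E) = vecs E"
proof -
  have "(\<lambda>_. 0) \<in> dual E"
    by (auto simp: dual_def bounded_ops_def scalar_space_def intro: exI[of _ 0])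
  then have "vecs E \<in> {{x \<in> vecs E. \<phi> x \<in> U} |\<phi> U. \<phi> \<in> dual E \<and> open U}"
    by (intro CollectI exI[of _ "\<lambda>_. 0"] exI[of _ UNIV]) auto
  then show ?thesis
    unfolding weak_top_def topology_generated_by_topspace by blast
qed

lemma ndist_scalar_space: "ndist scalar_space = (dist :: 'k::rc_field \<Rightarrow> 'k \<Rightarrow> real)"
  by (intro ext) (simp add: ndist_def scalar_space_def dist_norm)

lemma norm_top_scalar_space: "norm_top (scalar_space :: ('k::rc_field, 'k) nspace) = euclidean"
  by (simp add: norm_top_def ndist_scalar_space) (simp add: scalar_space_def)

lemma banach_space_scalar_space:
  assumes "complete (UNIV :: 'k::rc_field set)"
  shows "banach_space (scalar_space :: ('k, 'k) nspace)"
proof -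
  interpret vector_space "(*) :: 'k \<Rightarrow> 'k \<Rightarrow> 'k"
    by standard (auto simp: algebra_simps)
  have "Metric_space.mcomplete (vecs scalar_space)
      (ndist (scalar_space :: ('k, 'k) nspace))"
    unfolding ndist_scalar_space using assms
    by (simp add: scalar_space_def mcomplete_iff_complete)
  moreover have "vector_space (scl (scalar_space :: ('k, 'k) nspace))"
    by standard (auto simp: scalar_space_def algebra_simps)
  ultimately show ?thesis
    by (simp add: banach_space_def banach_space_axioms_def)
      (simp add: scalar_space_def norm_mult norm_triangle_ineq)
qed

lemma "banach_space (scalar_space :: (real, real) nspace)"
  by (rule banach_space_scalar_space[OF complete_UNIV])

lemma "banach_space (scalar_space :: (complex, complex) nspace)"
  by (rule banach_space_scalar_space[OF complete_UNIV])

end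

theory Submission
  imports Defs
begin

text \<open>
  From (a) to (b): let \<open>P(x) = A(x, \<dots>, x)\<close> converge unconditionally and let \<open>U\<close> be an ultrafilter
  on the unit ball.  By polarization \<open>A\<close> sends partial sums of w.u.C. series to Cauchy
  sequences, so the operator obtained by fixing all slots but one is weakly compact by property
  (V), and the weak limit along \<open>U\<close> in that slot again converges unconditionally in the other
  slots: otherwise one gets an unconditionally converging operator into \<open>c\<^sub>0\<close> which is not weakly
  compact.  Iterating over the slots gives \<open>L\<close> in \<open>F\<close>.  For \<open>\<psi>\<close> in the dual of \<open>F\<close>, weak continuity
  of \<open>\<psi> \<circ> P\<close> on bounded sets makes \<open>\<psi> \<circ> A\<close> jointly Cauchy along \<open>U\<close>, so that \<open>\<psi>(P(x))\<close> tends to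
  the iterated limit \<open>\<psi>(L)\<close>.

  From (b) to (a): property (V) follows by applying (b) to \<open>\<phi>\<^sup>k\<^sup>-\<^sup>1 T\<close>.  For a form \<open>B\<close> in at most \<open>k\<close>
  slots and disjoint blocks \<open>\<sigma> n\<close> of the expansion, the sequence of the numbers
  \<open>B(\<sigma> n x, \<dots>, \<sigma> n x)\<close>, multiplied by a power of a functional \<open>\<phi>(x)\<close>, is a \<open>k\<close>-homogeneous
  polynomial into \<open>\<ell>\<^sub>1\<close>.  It converges unconditionally by the Schur property, so it is weakly
  compact and its coordinates tend to \<open>0\<close> uniformly on the ball.  Hence \<open>B(x - S x, \<dots>, x - S x)\<close>
  is uniformly small for some partial sum \<open>S\<close> of the expansion.  Its difference to \<open>B(x, \<dots>, x)\<close>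
  is a sum of functionals times forms in fewer slots because \<open>S\<close> has finite rank, and
  induction on the number of slots gives the weak continuity.
\<close>

section \<open>Preliminaries on scalars, ultrafilters and index sequences\<close>

section \<open>Scalars and ultrafilters\<close>

text \<open>Property (V) speaks of linear operators only, so from (a) to (b) a weak limit is
  available in one slot at a time, and the candidate \<open>L\<close> is an iterated limit. It lies
  in \<open>F\<close> and serves all \<open>\<psi>\<close> at once. Two obstacles remain. The map
  left after a limit in one slot must again be accessible to property (V), so its Cauchy property on
  partial sums has to survive a merely weak limit. And the diagonal limit has to agree with the
  iterated one. Partial sums rather than series are the working objects, because a fixed argument is
  then a constant sequence. Moreover \<open>c0_space\<close> is not carried by the type in the
  hypothesis, so property (V) is transferred to every type beforehand. From (b) to (a), the
  hypothesis covers the single degree \<open>k\<close>, while the induction needs forms in fewer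
  slots. The power of \<open>\<phi>\<close> that fills the missing slots must be cancelled again,
  although \<open>\<phi>\<close> may vanish; a translation keeps it away from
  \<open>0\<close>.\<close>

lemma rc_field_bounded_decomposition:
  obtains i :: "'k::rc_field" where
    "norm i \<le> 1"
    "\<And>z::'k. \<exists>a b. \<bar>a\<bar> \<le> norm z \<and> \<bar>b\<bar> \<le> norm z \<and> z = a *\<^sub>R 1 + b *\<^sub>R i"
  using real_or_complex[where 'a='k]
proof
  assume r: "\<forall>z::'k. \<exists>a. z = a *\<^sub>R 1"
  show ?thesis
  proof (rule that[of 0])
    show "\<exists>a b. \<bar>a\<bar> \<le> norm z \<and> \<bar>b\<bar> \<le> norm z \<and> z = a *\<^sub>R 1 + b *\<^sub>R 0" for z :: 'k
      using r[rule_format, of z] by (force intro: exI[of _ 0])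
  qed simp
next
  assume "\<exists>i::'k. i * i = - 1 \<and>
        (\<forall>z. \<exists>a b. z = a *\<^sub>R 1 + b *\<^sub>R i \<and> norm z = sqrt (a\<^sup>2 + b\<^sup>2))"
  then obtain i :: 'k where i: "i * i = - 1"
      "\<And>z. \<exists>a b. z = a *\<^sub>R 1 + b *\<^sub>R i \<and> norm z = sqrt (a\<^sup>2 + b\<^sup>2)"
    by blast
  have "norm i * norm i = 1"
    by (metis i(1) norm_minus_cancel norm_mult norm_one)
  then have "norm i \<le> 1"
    using square_eq_1_iff[of "norm i"] by auto
  moreover have "\<exists>a b. \<bar>a\<bar> \<le> norm z \<and> \<bar>b\<bar> \<le> norm z \<and> z = a *\<^sub>R 1 + b *\<^sub>R i" for z
  proof -
    obtain a b where ab: "z = a *\<^sub>R 1 + b *\<^sub>R i" "norm z = sqrt (a\<^sup>2 + b\<^sup>2)"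
      using i(2) by blast
    have "\<bar>a\<bar> \<le> norm z" "\<bar>b\<bar> \<le> norm z"
      unfolding ab(2) by (rule real_sqrt_ge_abs1 real_sqrt_ge_abs2)+
    then show ?thesis using ab(1) by blast
  qed
  ultimately show ?thesis using that by blast
qed

text \<open>The ball is a closed part of the image of a compact square under the continuous map
  \<open>(a, b) \<mapsto> a 1 + b i\<close>. In the real case \<open>i = 0\<close> serves, so both
  alternatives of the class axiom are treated alike.\<close>

lemma rc_field_compact_cball: "compact (cball (0::'k::rc_field) r)"
proof -
  obtain i :: "'k" where i: "\<And>z::'k. \<exists>a b. \<bar>a\<bar> \<le> norm z \<and> \<bar>b\<bar> \<le> norm z \<and> z = a *\<^sub>R 1 + b *\<^sub>R i"
    using rc_field_bounded_decomposition by blast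
  let ?g = "\<lambda>p::real \<times> real. fst p *\<^sub>R 1 + snd p *\<^sub>R i"
  have "compact (?g ` (cbox (-r) r \<times> cbox (-r) r))"
    by (intro compact_continuous_image compact_Times compact_cbox continuous_intros)
  moreover have "cball 0 r \<subseteq> ?g ` (cbox (-r) r \<times> cbox (-r) r)"
  proof
    fix z :: 'k assume "z \<in> cball 0 r"
    then have z: "norm z \<le> r" by simp
    obtain a b where "\<bar>a\<bar> \<le> norm z" "\<bar>b\<bar> \<le> norm z" "z = a *\<^sub>R 1 + b *\<^sub>R i"
      using i by blast
    then show "z \<in> ?g ` (cbox (-r) r \<times> cbox (-r) r)"
      using z by (intro image_eqI[of _ _ "(a, b)"]) auto
  qed
  ultimately show ?thesis
    using compact_Int_closed[of "?g ` (cbox (-r) r \<times> cbox (-r) r)" "cball 0 r"]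
    by (simp add: Int_absorb1)
qed

lemma complete_rc_field: "complete (UNIV :: 'k::rc_field set)"
  unfolding complete_def
proof (intro allI impI)
  fix f :: "nat \<Rightarrow> 'k" assume f: "(\<forall>n. f n \<in> UNIV) \<and> Cauchy f"
  then obtain r where "\<And>n. norm (f n) \<le> r"
    using cauchy_imp_bounded[of f] unfolding bounded_iff by auto
  then have "complete (cball (0::'k) r)" "\<And>n. f n \<in> cball 0 r"
    using compact_imp_complete rc_field_compact_cball by auto
  then show "\<exists>l\<in>UNIV. f \<longlonglongrightarrow> l"
    using f unfolding complete_def by blast
qed

lemma rc_Cauchy_convergent:
  fixes f :: "nat \<Rightarrow> 'k::rc_field"
  assumes "\<And>e. e > 0 \<Longrightarrow> \<exists>N. \<forall>m\<ge>N. \<forall>n\<ge>N. norm (f m - f n) < e"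
  shows "\<exists>l. f \<longlonglongrightarrow> l"
  using complete_rc_field assms unfolding complete_def
  by (metis CauchyI UNIV_I)

text \<open>The conjugate of the sign of \<open>z\<close>, written as a quotient because
  \<open>rc_field\<close> has no conjugation.\<close>

definition rsgn :: "'k::rc_field \<Rightarrow> 'k" where
  "rsgn z = (if z = 0 then 0 else of_real (norm z) / z)"

lemma norm_rsgn: "norm (rsgn z) \<le> 1"
  by (simp add: rsgn_def norm_divide)

lemma rsgn_mult: "rsgn z * z = of_real (norm z)"
  by (simp add: rsgn_def)

definition ultra :: "'a filter \<Rightarrow> bool" where
  "ultra U \<longleftrightarrow> U \<noteq> bot \<and> (\<forall>P. eventually P U \<or> eventually (\<lambda>x. \<not> P x) U)"

text \<open>Zorn's lemma for the proper filters below \<open>F\<close>. The infimum of a chain stays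
  proper, because an event that holds eventually in \<open>Inf C\<close> already does so in a member
  of the chain.\<close>

lemma ultra_exists:
  assumes "F \<noteq> (bot::'a filter)"
  obtains U where "U \<le> F" "ultra U"
proof -
  let ?A = "{G. G \<noteq> bot \<and> G \<le> F}"
  have "\<exists>m\<in>?A. \<forall>a\<in>?A. a \<le> m \<longrightarrow> a = m"
  proof (rule predicate_Zorn[where P = "\<lambda>x y. y \<le> x"])
    show "partial_order_on ?A (relation_of (\<lambda>x y. y \<le> x) ?A)"
      by (rule partial_order_on_relation_ofI) auto
  next
    fix C assume C: "C \<in> Chains (relation_of (\<lambda>x y. y \<le> x) ?A)"
    then have CA: "C \<subseteq> ?A" and ch: "\<And>x y. x \<in> C \<Longrightarrow> y \<in> C \<Longrightarrow> x \<le> y \<or> y \<le> x"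
      unfolding Chains_def relation_of_def by blast+
    show "\<exists>u\<in>?A. \<forall>a\<in>C. u \<le> a"
    proof (cases "C = {}")
      case True then show ?thesis using assms by auto
    next
      case False
      have "Inf C \<noteq> bot"
      proof
        assume "Inf C = bot"
        then have "eventually (\<lambda>_. False) (Inf C)" by simp
        then obtain b where "b \<in> C" "eventually (\<lambda>_. False) b"
          using eventually_Inf_base[OF False, of "\<lambda>_. False"] ch
          by (metis inf.absorb1 inf.absorb2 order_refl)
        then show False using CA by (auto simp: eventually_False)
      qed
      moreover have "Inf C \<le> F"
        using False CA by (auto intro: Inf_lower2)
      ultimately show ?thesis by (intro bexI[of _ "Inf C"]) (auto intro: Inf_lower)
    qed
  qed
  then obtain U where U: "U \<noteq> bot" "U \<le> F"
      and max: "\<And>G. G \<in> ?A \<Longrightarrow> G \<le> U \<Longrightarrow> G = U"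
    by blast
  have min: "G = U" if "G \<noteq> bot" "G \<le> U" for G
    using max[of G] that U(2) by (simp add: order_trans[of G U F])
  have "eventually P U \<or> eventually (\<lambda>x. \<not> P x) U" for P
  proof (cases "inf U (principal {x. P x}) = bot")
    case True
    then have "eventually (\<lambda>_. False) (inf U (principal {x. P x}))" by simp
    then show ?thesis by (simp add: eventually_inf_principal)
  next
    case False
    then have "inf U (principal {x. P x}) = U"
      by (intro min inf_le1)
    then have "U \<le> principal {x. P x}" by (simp add: inf.absorb_iff1)
    then show ?thesis by (simp add: le_principal)
  qed
  then show ?thesis using that U unfolding ultra_def by blast
qed

lemma ultra_filtermap: "ultra U \<Longrightarrow> ultra (filtermap f U)"
  unfolding ultra_def by (auto simp: eventually_filtermap filtermap_bot_iff)

lemma ultra_not_bot: "ultra U \<Longrightarrow> U \<noteq> bot"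
  unfolding ultra_def by blast

text \<open>With a neighbourhood filter for \<open>N\<close>: a cluster point of an ultrafilter is a
  limit.\<close>

lemma ultra_le_if_inf_nonbot: "ultra U \<Longrightarrow> inf N U \<noteq> bot \<Longrightarrow> U \<le> N"
proof (rule filter_leI)
  fix P assume U: "ultra U" "inf N U \<noteq> bot" and P: "eventually P N"
  show "eventually P U"
  proof (rule ccontr)
    assume "\<not> eventually P U"
    then have "eventually (\<lambda>x. \<not> P x) U" using U unfolding ultra_def by blast
    then have "eventually (\<lambda>x. P x \<and> \<not> P x) (inf N U)"
      using P by (auto simp: eventually_inf)
    then show False using U(2) by (simp add: trivial_limit_def)
  qed
qed

lemma ultra_bounded_tendsto:
  fixes f :: "'a \<Rightarrow> 'k::rc_field"
  assumes "ultra U" "eventually (\<lambda>x. norm (f x) \<le> r) U"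
  obtains l where "(f \<longlongrightarrow> l) U"
proof -
  have "filtermap f U \<noteq> bot" "filtermap f U \<le> principal (cball 0 r)"
    using assms by (auto simp: ultra_def filtermap_bot_iff le_principal eventually_filtermap)
  then obtain l where "inf (nhds l) (filtermap f U) \<noteq> bot"
    using rc_field_compact_cball[of r] unfolding compact_filter le_principal by blast
  then have "filtermap f U \<le> nhds l"
    by (intro ultra_le_if_inf_nonbot ultra_filtermap assms)
  then show ?thesis using that by (simp add: filterlim_def)
qed

section \<open>Sequences\<close>

text \<open>Symmetry and \<open>d n n = 0\<close> allow a bad pair beyond \<open>N\<close> to be put
  in increasing order, and each search starts at the right end of the previous block. All arguments
  that cut a w.u.C. series into disjoint blocks start here.\<close>

lemma not_Cauchy_blocks:
  fixes d :: "nat \<Rightarrow> nat \<Rightarrow> real"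
  assumes sym: "\<And>m n. d m n = d n m" and zero: "\<And>n. d n n = 0"
    and not: "\<not> (\<forall>e>0. \<exists>N. \<forall>m\<ge>N. \<forall>n\<ge>N. d m n < e)"
  obtains e p q where "e > 0" "\<And>j. p j < q j" "\<And>j. q j \<le> p (Suc j)" "\<And>j. d (p j) (q j) \<ge> e"
proof -
  obtain e where e: "e > 0" "\<And>N. \<exists>m\<ge>N. \<exists>n\<ge>N. d m n \<ge> e"
    using not by (meson linorder_not_less)
  have "\<exists>m n. N \<le> m \<and> m < n \<and> d m n \<ge> e" for N
  proof -
    obtain m n where "m \<ge> N" "n \<ge> N" "d m n \<ge> e" using e(2) by blast
    moreover have "m \<noteq> n" using \<open>d m n \<ge> e\<close> zero[of n] e(1) by auto
    ultimately show ?thesis by (metis sym linorder_neqE_nat)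
  qed
  then obtain p q where pq: "\<And>N. N \<le> p N \<and> p N < q N \<and> d (p N) (q N) \<ge> e" by metis
  define r where "r = rec_nat 0 (\<lambda>_ N. q N)"
  have r: "r (Suc j) = q (r j)" for j by (simp add: r_def)
  show thesis
    by (rule that[of e "\<lambda>j. p (r j)" "\<lambda>j. q (r j)"]) (simp_all add: pq e(1) r)
qed

lemma mono_blocks:
  fixes p q :: "nat \<Rightarrow> nat"
  assumes "\<And>j. p j \<le> q j" "\<And>j. q j \<le> p (Suc j)"
  shows "mono p" "mono q"
  using assms by (auto intro!: incseq_SucI intro: order_trans simp: mono_iff_le_Suc)

text \<open>A decreasing sequence of natural numbers is constant from the index of its least value
  on, so a monotone subsequence can always be taken nondecreasing.\<close>

lemma nat_seq_incseq_subseq: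
  fixes s :: "nat \<Rightarrow> nat"
  obtains r :: "nat \<Rightarrow> nat" where "strict_mono r" "mono (s \<circ> r)"
proof -
  obtain r where r: "strict_mono r" "monoseq (\<lambda>n. s (r n))"
    using seq_monosub[of s] by (auto simp: o_def)
  show ?thesis
  proof (cases "incseq (\<lambda>n. s (r n))")
    case True
    then show ?thesis using r(1) by (intro that[of r]) (simp_all add: o_def incseq_def mono_def)
  next
    case False
    then have dec: "decseq (\<lambda>n. s (r n))" using r(2) by (simp add: monoseq_iff)
    obtain m where m: "\<And>n. s (r m) \<le> s (r n)"
      using ex_has_least_nat[of "\<lambda>_. True" _ "\<lambda>n. s (r n)"] by auto
    have "s (r (n + m)) = s (r m)" for n
      using m[of "n + m"] decseqD[OF dec, of m "n + m"] by auto
    then have "mono (s \<circ> (\<lambda>n. r (n + m)))" by (simp add: mono_def)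
    moreover have "strict_mono (\<lambda>n. r (n + m))"
      using r(1) by (simp add: strict_mono_def)
    ultimately show ?thesis using that by blast
  qed
qed

lemma extract_strict_mono:
  assumes "\<And>N::nat. \<exists>n\<ge>N. P n"
  obtains r where "strict_mono r" "\<And>j. P (r (j::nat))"
proof -
  have "infinite {n. P n}" using assms by (auto simp: infinite_nat_iff_unbounded_le)
  then show ?thesis
    using that[of "enumerate {n. P n}"] strict_mono_enumerate enumerate_in_set by blast
qed

lemma not_Cauchy_blocks_ex:
  fixes d :: "nat \<Rightarrow> nat \<Rightarrow> real"
  assumes "\<And>m n. d m n = d n m" "\<And>n. d n n = 0" "\<not> (\<forall>e>0. \<exists>N. \<forall>m\<ge>N. \<forall>n\<ge>N. d m n < e)"
  shows "\<exists>e p q. e > 0 \<and> (\<forall>j. p j < q j) \<and> (\<forall>j. q j \<le> p (Suc j)) \<and> (\<forall>j. d (p j) (q j) \<ge> e)"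
proof (rule not_Cauchy_blocks[OF assms])
  fix e :: real and p q :: "nat \<Rightarrow> nat"
  assume "e > 0" "\<And>j. p j < q j" "\<And>j. q j \<le> p (Suc j)" "\<And>j. d (p j) (q j) \<ge> e"
  then show ?thesis by (intro exI[of _ e] exI[of _ p] exI[of _ q]) simp
qed

section \<open>Functional analysis in structures: Hahn-Banach, uniform boundedness, w.u.C. series,
  weak compactness\<close>

section \<open>Normed spaces as structures\<close>

context banach_space
begin

lemma vecs_0 [simp]: "0 \<in> vecs E"
  by (rule subspace_0[OF subspace_vecs])

lemma vecs_add [simp]: "x \<in> vecs E \<Longrightarrow> y \<in> vecs E \<Longrightarrow> x + y \<in> vecs E"
  by (rule subspace_add[OF subspace_vecs])

lemma vecs_diff [simp]: "x \<in> vecs E \<Longrightarrow> y \<in> vecs E \<Longrightarrow> x - y \<in> vecs E"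
  by (rule subspace_diff[OF subspace_vecs])

lemma vecs_minus [simp]: "x \<in> vecs E \<Longrightarrow> - x \<in> vecs E"
  by (rule subspace_neg[OF subspace_vecs])

lemma vecs_scl [simp]: "x \<in> vecs E \<Longrightarrow> scl E c x \<in> vecs E"
  by (rule subspace_scale[OF subspace_vecs])

lemma vecs_sum: "(\<And>i. i \<in> S \<Longrightarrow> f i \<in> vecs E) \<Longrightarrow> (\<Sum>i\<in>S. f i) \<in> vecs E"
  by (rule subspace_sum[OF subspace_vecs])

lemma nrm_0 [simp]: "nrm E 0 = 0"
  using nrm_eq_0[of 0] by simp

lemma nrm_minus: "x \<in> vecs E \<Longrightarrow> nrm E (- x) = nrm E x"
  using nrm_scl[of x "-1"] by simp

lemma nrm_minus_commute: "x \<in> vecs E \<Longrightarrow> y \<in> vecs E \<Longrightarrow> nrm E (x - y) = nrm E (y - x)"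
  using nrm_minus[of "x - y"] by simp

lemma nrm_diff_triangle: "x \<in> vecs E \<Longrightarrow> y \<in> vecs E \<Longrightarrow> nrm E (x - y) \<le> nrm E x + nrm E y"
  using nrm_triangle[of x "- y"] by (simp add: nrm_minus)

lemma nrm_diff_via:
  "x \<in> vecs E \<Longrightarrow> y \<in> vecs E \<Longrightarrow> z \<in> vecs E \<Longrightarrow> nrm E (x - z) \<le> nrm E (x - y) + nrm E (y - z)"
  using nrm_triangle[of "x - y" "y - z"] by simp

lemma nrm_reverse_triangle:
  "x \<in> vecs E \<Longrightarrow> y \<in> vecs E \<Longrightarrow> \<bar>nrm E x - nrm E y\<bar> \<le> nrm E (x - y)"
  using nrm_triangle[of "x - y" y] nrm_triangle[of "y - x" x]
  by (simp add: nrm_minus_commute[of y x])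

lemma nrm_sum: "(\<And>i. i \<in> S \<Longrightarrow> f i \<in> vecs E) \<Longrightarrow> nrm E (\<Sum>i\<in>S. f i) \<le> (\<Sum>i\<in>S. nrm E (f i))"
proof (induction S rule: infinite_finite_induct)
  case (insert a S)
  then have "nrm E (f a + (\<Sum>i\<in>S. f i)) \<le> nrm E (f a) + nrm E (\<Sum>i\<in>S. f i)"
    by (intro nrm_triangle) (auto intro: vecs_sum)
  with insert show ?case by force
qed auto

lemma limitin_norm_top:
  "limitin (norm_top E) f l U \<longleftrightarrow>
    l \<in> vecs E \<and> eventually (\<lambda>x. f x \<in> vecs E) U \<and> ((\<lambda>x. nrm E (f x - l)) \<longlongrightarrow> 0) U"
    (is "?L \<longleftrightarrow> ?R")
proof -
  interpret M: Metric_space "vecs E" "ndist E" by (rule Metric_space_ndist)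
  have L: "?L \<longleftrightarrow> l \<in> vecs E \<and> (\<forall>e>0. eventually (\<lambda>x. f x \<in> vecs E \<and> ndist E (f x) l < e) U)"
    unfolding norm_top_def M.limitin_metric ..
  have "?L" if R: ?R
    unfolding L
  proof (intro conjI allI impI)
    fix e :: real assume e: "e > 0"
    have "eventually (\<lambda>x. nrm E (f x - l) < e) U"
      using R order_tendstoD(2) e by blast
    moreover have "eventually (\<lambda>x. f x \<in> vecs E) U" using R by blast
    ultimately show "eventually (\<lambda>x. f x \<in> vecs E \<and> ndist E (f x) l < e) U"
      by eventually_elim (use R in \<open>simp add: ndist_def\<close>)
  qed (use R in blast)
  moreover have ?R if "?L"
  proof (intro conjI)
    show l: "l \<in> vecs E" using that L by blast
    have ev: "eventually (\<lambda>x. f x \<in> vecs E \<and> ndist E (f x) l < e) U" if "e > 0" for e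
      using \<open>?L\<close> L that by blast
    then show "eventually (\<lambda>x. f x \<in> vecs E) U"
      using eventually_mono[OF ev[of 1]] by auto
    show "((\<lambda>x. nrm E (f x - l)) \<longlongrightarrow> 0) U"
    proof (rule tendstoI)
      fix e :: real assume "e > 0"
      from ev[OF this] show "eventually (\<lambda>x. dist (nrm E (f x - l)) 0 < e) U"
        by eventually_elim (use l in \<open>auto simp: ndist_def nrm_nonneg split: if_splits\<close>)
    qed
  qed
  ultimately show ?thesis by blast
qed

lemma nrm_Cauchy_convergent:
  assumes s: "\<And>n::nat. s n \<in> vecs E"
    and C: "\<And>e. e > 0 \<Longrightarrow> \<exists>N. \<forall>m\<ge>N. \<forall>n\<ge>N. nrm E (s m - s n) < e"
  obtains l where "l \<in> vecs E" "(\<lambda>n. nrm E (s n - l)) \<longlonglongrightarrow> 0"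
proof -
  interpret M: Metric_space "vecs E" "ndist E" by (rule Metric_space_ndist)
  have "M.MCauchy s"
    unfolding M.MCauchy_def using s C by (fastforce simp: ndist_def)
  then obtain l where "limitin M.mtopology s l sequentially"
    using complete unfolding M.mcomplete_def by blast
  then show ?thesis
    using limitin_norm_top[of s l] that unfolding norm_top_def by blast
qed

lemma nrm_Cauchy_if_convergent:
  assumes s: "\<And>n::nat. s n \<in> vecs E" and l: "l \<in> vecs E" "(\<lambda>n. nrm E (s n - l)) \<longlonglongrightarrow> 0" and e: "e > 0"
  shows "\<exists>N. \<forall>m\<ge>N. \<forall>n\<ge>N. nrm E (s m - s n) < e"
proof -
  obtain N where N: "\<And>n. n \<ge> N \<Longrightarrow> nrm E (s n - l) < e/2"
    using order_tendstoD(2)[OF l(2), of "e/2"] e by (auto simp: eventually_sequentially)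
  have "nrm E (s m - s n) < e" if "m \<ge> N" "n \<ge> N" for m n
    using N[OF that(1)] N[OF that(2)] nrm_diff_via[of "s m" l "s n"] s l(1)
      nrm_minus_commute[of l "s n"] by simp
  then show ?thesis by blast
qed

lemma nrm_tendsto_nrm:
  assumes "eventually (\<lambda>n. s n \<in> vecs E) U" and l: "l \<in> vecs E" "((\<lambda>n. nrm E (s n - l)) \<longlongrightarrow> 0) U"
  shows "((\<lambda>n. nrm E (s n)) \<longlongrightarrow> nrm E l) U"
proof -
  have "((\<lambda>n. nrm E (s n) - nrm E l) \<longlongrightarrow> 0) U"
    by (rule Lim_null_comparison[OF _ l(2)])
      (use assms(1) in \<open>eventually_elim, use l nrm_reverse_triangle in auto\<close>)
  then show ?thesis by (simp add: LIM_zero_iff)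
qed

end

text \<open>Completeness enters through Cauchy sequences in the norm, so that no later construction
  of a space has to deal with \<open>ndist\<close>.\<close>

lemma banach_spaceI:
  fixes E :: "('k::rc_field, 'v::ab_group_add) nspace"
  assumes vs: "vector_space (scl E)" and sub: "module.subspace (scl E) (vecs E)"
    and "\<And>x. x \<in> vecs E \<Longrightarrow> 0 \<le> nrm E x"
    and z: "\<And>x. x \<in> vecs E \<Longrightarrow> nrm E x = 0 \<Longrightarrow> x = 0"
    and s: "\<And>c x. x \<in> vecs E \<Longrightarrow> nrm E (scl E c x) = norm c * nrm E x"
    and "\<And>x y. x \<in> vecs E \<Longrightarrow> y \<in> vecs E \<Longrightarrow> nrm E (x + y) \<le> nrm E x + nrm E y"
    and compl: "\<And>s. (\<And>n::nat. s n \<in> vecs E) \<Longrightarrow>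
      (\<And>e. e > 0 \<Longrightarrow> \<exists>N. \<forall>m\<ge>N. \<forall>n\<ge>N. nrm E (s m - s n) < e) \<Longrightarrow>
      \<exists>l\<in>vecs E. (\<lambda>n. nrm E (s n - l)) \<longlonglongrightarrow> 0"
  shows "banach_space E"
proof -
  interpret vector_space "scl E" by (rule vs)
  have z0: "nrm E 0 = 0" using s[of 0 0] subspace_0[OF sub] by simp
  have diff: "x - y \<in> vecs E" if "x \<in> vecs E" "y \<in> vecs E" for x y
    by (rule subspace_diff[OF sub that])
  interpret M: Metric_space "vecs E" "ndist E"
  proof
    fix x y
    show "0 \<le> ndist E x y" by (simp add: ndist_def assms diff)
    show "ndist E x y = ndist E y x"
      using s[of "y - x" "-1"] by (auto simp: ndist_def diff)
    assume x: "x \<in> vecs E" and y: "y \<in> vecs E"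
    show "ndist E x y = 0 \<longleftrightarrow> x = y"
      using z[OF diff[OF x y]] x y z0 by (auto simp: ndist_def)
    fix z assume z: "z \<in> vecs E"
    show "ndist E x z \<le> ndist E x y + ndist E y z"
      using assms(6)[OF diff[OF x y] diff[OF y z]] x y z by (simp add: ndist_def)
  qed
  have "M.mcomplete"
    unfolding M.mcomplete_def
  proof (intro allI impI)
    fix \<sigma> assume C: "M.MCauchy \<sigma>"
    then have v: "\<sigma> n \<in> vecs E" for n unfolding M.MCauchy_def by auto
    have "\<exists>N. \<forall>m\<ge>N. \<forall>n\<ge>N. nrm E (\<sigma> m - \<sigma> n) < e" if "e > 0" for e
      using C that v unfolding M.MCauchy_def ndist_def by fastforce
    then obtain l where l: "l \<in> vecs E" "(\<lambda>n. nrm E (\<sigma> n - l)) \<longlonglongrightarrow> 0"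
      using compl[of \<sigma>] v by blast
    have "(\<lambda>n. ndist E (\<sigma> n) l) \<longlonglongrightarrow> 0"
      using l v by (simp add: ndist_def)
    then have "limitin M.mtopology \<sigma> l sequentially"
      using l(1) v unfolding M.limitin_metric by (auto dest: order_tendstoD)
    then show "\<exists>x. limitin M.mtopology \<sigma> x sequentially" by blast
  qed
  then show ?thesis
    by unfold_locales (use assms z0 in auto)
qed

section \<open>Bounded operators and functionals\<close>

lemma bounded_opsI:
  assumes "\<And>x. x \<in> vecs E \<Longrightarrow> T x \<in> vecs F"
    "\<And>x y. x \<in> vecs E \<Longrightarrow> y \<in> vecs E \<Longrightarrow> T (x + y) = T x + T y"
    "\<And>c x. x \<in> vecs E \<Longrightarrow> T (scl E c x) = scl F c (T x)"
    "\<And>x. x \<in> vecs E \<Longrightarrow> nrm F (T x) \<le> C * nrm E x"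
  shows "T \<in> bounded_ops E F"
  unfolding bounded_ops_def using assms by blast

lemma bounded_ops_vecs: "T \<in> bounded_ops E F \<Longrightarrow> x \<in> vecs E \<Longrightarrow> T x \<in> vecs F"
  and bounded_ops_add: "T \<in> bounded_ops E F \<Longrightarrow> x \<in> vecs E \<Longrightarrow> y \<in> vecs E \<Longrightarrow> T (x + y) = T x + T y"
  and bounded_ops_scl: "T \<in> bounded_ops E F \<Longrightarrow> x \<in> vecs E \<Longrightarrow> T (scl E c x) = scl F c (T x)"
  unfolding bounded_ops_def by auto

lemma bounded_ops_bound:
  assumes "banach_space E" "T \<in> bounded_ops E F"
  obtains C where "C \<ge> 0" "\<And>x. x \<in> vecs E \<Longrightarrow> nrm F (T x) \<le> C * nrm E x"
proof -
  interpret banach_space E by fact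
  obtain C where C: "\<And>x. x \<in> vecs E \<Longrightarrow> nrm F (T x) \<le> C * nrm E x"
    using assms(2) unfolding bounded_ops_def by blast
  show ?thesis
    by (rule that[of "max C 0"])
      (use C nrm_nonneg in \<open>auto intro!: order_trans[OF C] mult_right_mono\<close>)
qed

lemma bounded_ops_0:
  assumes "banach_space E" "banach_space F" "T \<in> bounded_ops E F" shows "T 0 = 0"
  using bounded_ops_add[OF assms(3), of 0 0] banach_space.vecs_0[OF assms(1)] by simp

lemma bounded_ops_minus:
  assumes "banach_space E" "banach_space F" "T \<in> bounded_ops E F" "x \<in> vecs E"
  shows "T (- x) = - T x"
proof -
  interpret E: banach_space E by fact
  interpret F: banach_space F by fact
  show ?thesis using bounded_ops_scl[OF assms(3,4), of "-1"] by simp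
qed

lemma bounded_ops_diff:
  assumes "banach_space E" "banach_space F" "T \<in> bounded_ops E F" "x \<in> vecs E" "y \<in> vecs E"
  shows "T (x - y) = T x - T y"
  using bounded_ops_add[OF assms(3,4), of "- y"] bounded_ops_minus[OF assms(1-3,5)]
    banach_space.vecs_minus[OF assms(1,5)] by simp

lemma bounded_ops_sum:
  assumes "banach_space E" "banach_space F" "T \<in> bounded_ops E F" "\<And>i. i \<in> S \<Longrightarrow> f i \<in> vecs E"
  shows "T (\<Sum>i\<in>S. f i) = (\<Sum>i\<in>S. T (f i))"
  using assms(4)
proof (induction S rule: infinite_finite_induct)
  case (insert a S)
  then show ?case
    using bounded_ops_add[OF assms(3), of "f a" "\<Sum>i\<in>S. f i"] banach_space.vecs_sum[OF assms(1), of S f]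
    by simp
qed (use bounded_ops_0[OF assms(1-3)] in auto)

lemma bounded_ops_comp:
  assumes "banach_space E" "banach_space F" "S \<in> bounded_ops E F" "T \<in> bounded_ops F G"
  shows "(\<lambda>x. T (S x)) \<in> bounded_ops E G"
proof -
  obtain C D where C: "C \<ge> 0" "\<And>x. x \<in> vecs E \<Longrightarrow> nrm F (S x) \<le> C * nrm E x"
    and D: "D \<ge> 0" "\<And>x. x \<in> vecs F \<Longrightarrow> nrm G (T x) \<le> D * nrm F x"
    using bounded_ops_bound assms by metis
  show ?thesis
  proof (rule bounded_opsI[where C = "D * C"])
    fix x assume x: "x \<in> vecs E"
    have "nrm G (T (S x)) \<le> D * nrm F (S x)" using D x assms bounded_ops_vecs by blast
    also have "\<dots> \<le> D * (C * nrm E x)" using C(2)[OF x] D(1) by (rule mult_left_mono)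
    finally show "nrm G (T (S x)) \<le> D * C * nrm E x" by simp
  qed (use assms in \<open>auto simp: bounded_ops_add bounded_ops_scl bounded_ops_vecs\<close>)
qed

lemma scalar_space_simps [simp]:
  "vecs scalar_space = UNIV" "scl scalar_space = (*)" "nrm scalar_space = norm"
  by (simp_all add: scalar_space_def)

lemma banach_scalar: "banach_space (scalar_space :: ('k::rc_field, 'k) nspace)"
  by (rule banach_space_scalar_space[OF complete_rc_field])

lemma dualI:
  assumes "\<And>x y. x \<in> vecs E \<Longrightarrow> y \<in> vecs E \<Longrightarrow> \<phi> (x + y) = \<phi> x + \<phi> y"
    "\<And>c x. x \<in> vecs E \<Longrightarrow> \<phi> (scl E c x) = c * \<phi> x"
    "\<And>x. x \<in> vecs E \<Longrightarrow> norm (\<phi> x) \<le> C * nrm E x"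
  shows "\<phi> \<in> dual E"
  unfolding dual_def by (rule bounded_opsI[where C = C]) (use assms in auto)

lemma dual_add: "\<phi> \<in> dual E \<Longrightarrow> x \<in> vecs E \<Longrightarrow> y \<in> vecs E \<Longrightarrow> \<phi> (x + y) = \<phi> x + \<phi> y"
  unfolding dual_def by (rule bounded_ops_add)

lemma dual_scl: "\<phi> \<in> dual E \<Longrightarrow> x \<in> vecs E \<Longrightarrow> \<phi> (scl E c x) = c * \<phi> x"
  unfolding dual_def by (simp add: bounded_ops_scl)

lemma dual_comp:
  assumes "banach_space E" "banach_space F" "T \<in> bounded_ops E F" "\<psi> \<in> dual F"
  shows "(\<lambda>x. \<psi> (T x)) \<in> dual E"
  using bounded_ops_comp[OF assms(1,2,3), of \<psi> scalar_space] assms(4) by (simp add: dual_def)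

context banach_space
begin

lemma dual_bound:
  assumes "\<phi> \<in> dual E"
  obtains C where "C \<ge> 0" "\<And>x. x \<in> vecs E \<Longrightarrow> norm (\<phi> x) \<le> C * nrm E x"
  using bounded_ops_bound[OF banach_space_axioms assms[unfolded dual_def]] by auto

lemma dual_0: "\<phi> \<in> dual E \<Longrightarrow> \<phi> 0 = 0"
  unfolding dual_def by (rule bounded_ops_0[OF banach_space_axioms banach_scalar])

lemma dual_diff: "\<phi> \<in> dual E \<Longrightarrow> x \<in> vecs E \<Longrightarrow> y \<in> vecs E \<Longrightarrow> \<phi> (x - y) = \<phi> x - \<phi> y"
  unfolding dual_def by (rule bounded_ops_diff[OF banach_space_axioms banach_scalar])

lemma dual_sum: "\<phi> \<in> dual E \<Longrightarrow> (\<And>i. i \<in> S \<Longrightarrow> f i \<in> vecs E) \<Longrightarrow> \<phi> (\<Sum>i\<in>S. f i) = (\<Sum>i\<in>S. \<phi> (f i))"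
  unfolding dual_def by (rule bounded_ops_sum[OF banach_space_axioms banach_scalar])

lemma dual_tendsto:
  assumes "\<phi> \<in> dual E" "eventually (\<lambda>n. s n \<in> vecs E) U" "l \<in> vecs E" "((\<lambda>n. nrm E (s n - l)) \<longlongrightarrow> 0) U"
  shows "((\<lambda>n. \<phi> (s n)) \<longlongrightarrow> \<phi> l) U"
proof -
  obtain C where C: "C \<ge> 0" "\<And>x. x \<in> vecs E \<Longrightarrow> norm (\<phi> x) \<le> C * nrm E x"
    using dual_bound assms by blast
  have "((\<lambda>n. C * nrm E (s n - l)) \<longlongrightarrow> C * 0) U"
    by (intro tendsto_intros assms)
  then have *: "((\<lambda>n. C * nrm E (s n - l)) \<longlongrightarrow> 0) U" by simp
  have "eventually (\<lambda>n. norm (\<phi> (s n) - \<phi> l) \<le> C * nrm E (s n - l)) U"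
    using assms(2) by eventually_elim (metis C(2) assms(1,3) dual_diff vecs_diff)
  then have "((\<lambda>n. \<phi> (s n) - \<phi> l) \<longlongrightarrow> 0) U"
    by (rule Lim_null_comparison[OF _ *])
  then show ?thesis by (simp add: LIM_zero_iff)
qed

lemma dual_add_fun: "\<phi> \<in> dual E \<Longrightarrow> \<psi> \<in> dual E \<Longrightarrow> (\<lambda>x. \<phi> x + \<psi> x) \<in> dual E"
proof -
  assume a: "\<phi> \<in> dual E" "\<psi> \<in> dual E"
  obtain C where C: "\<And>x. x \<in> vecs E \<Longrightarrow> norm (\<phi> x) \<le> C * nrm E x" using dual_bound a by blast
  obtain D where D: "\<And>x. x \<in> vecs E \<Longrightarrow> norm (\<psi> x) \<le> D * nrm E x" using dual_bound a by blast
  have "norm (\<phi> x + \<psi> x) \<le> (C + D) * nrm E x" if "x \<in> vecs E" for x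
    using order_trans[OF norm_triangle_ineq add_mono[OF C[OF that] D[OF that]]]
    by (simp add: distrib_right)
  then show ?thesis
    by (rule dualI[rotated 2]) (simp_all add: dual_add[OF a(1)] dual_scl[OF a(1)] dual_add[OF a(2)] dual_scl[OF a(2)] distrib_left)
qed

lemma dual_scl_fun: "\<phi> \<in> dual E \<Longrightarrow> (\<lambda>x. c * \<phi> x) \<in> dual E"
proof -
  assume a: "\<phi> \<in> dual E"
  obtain C where C: "\<And>x. x \<in> vecs E \<Longrightarrow> norm (\<phi> x) \<le> C * nrm E x" using dual_bound a by blast
  have "norm (c * \<phi> x) \<le> norm c * C * nrm E x" if "x \<in> vecs E" for x
    using mult_left_mono[OF C[OF that], of "norm c"] by (simp add: norm_mult mult.assoc)
  then show ?thesis
    by (rule dualI[rotated 2]) (simp_all add: dual_add[OF a] dual_scl[OF a] distrib_left mult.left_commute)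
qed

end

section \<open>The Hahn--Banach theorem\<close>

context banach_space
begin

text \<open>Zorn's lemma will use the pointwise order on all functions, so the values off
  \<open>vecs E\<close> are pinned to \<open>0\<close>; otherwise they could be lowered forever.
  Homogeneity is asked for as an inequality only, which is easier to verify;
  \<open>sublinear_scl\<close> recovers equality.\<close>

definition sublinear :: "('v \<Rightarrow> real) \<Rightarrow> bool" where
  "sublinear q \<longleftrightarrow> q 0 = 0 \<and> (\<forall>x. x \<notin> vecs E \<longrightarrow> q x = 0) \<and>
     (\<forall>x\<in>vecs E. \<forall>y\<in>vecs E. q (x + y) \<le> q x + q y) \<and>
     (\<forall>r>0. \<forall>x\<in>vecs E. q (scl E (of_real r) x) \<le> r * q x)"

lemma sublinear_0: "sublinear q \<Longrightarrow> q 0 = 0"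
  and sublinear_out: "sublinear q \<Longrightarrow> x \<notin> vecs E \<Longrightarrow> q x = 0"
  and sublinear_add: "sublinear q \<Longrightarrow> x \<in> vecs E \<Longrightarrow> y \<in> vecs E \<Longrightarrow> q (x + y) \<le> q x + q y"
  and sublinear_scl_le: "sublinear q \<Longrightarrow> r > 0 \<Longrightarrow> x \<in> vecs E \<Longrightarrow> q (scl E (of_real r) x) \<le> r * q x"
  unfolding sublinear_def by auto

lemma sublinear_scl:
  assumes q: "sublinear q" and "r \<ge> 0" and x: "x \<in> vecs E"
  shows "q (scl E (of_real r) x) = r * q x"
proof (cases "r = 0")
  case False
  then have r: "r > 0" using assms by simp
  have "q (scl E (of_real (1 / r)) (scl E (of_real r) x)) \<le> 1 / r * q (scl E (of_real r) x)"
    using r x by (intro sublinear_scl_le[OF q]) auto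
  moreover have "scl E (of_real (1 / r)) (scl E (of_real r) x) = x"
    using r by (simp add: of_real_divide)
  ultimately have "r * q x \<le> q (scl E (of_real r) x)"
    using r by (simp add: field_simps)
  then show ?thesis using sublinear_scl_le[OF q r x] by simp
qed (use sublinear_0[OF q] in simp)

lemma sublinear_neg_le: "sublinear q \<Longrightarrow> x \<in> vecs E \<Longrightarrow> - q (- x) \<le> q x"
  using sublinear_add[of q x "- x"] by (simp add: sublinear_0)

lemma sublinear_nrm: "sublinear (\<lambda>x. if x \<in> vecs E then nrm E x else 0)"
  unfolding sublinear_def by (auto simp: nrm_triangle nrm_scl)

text \<open>The largest sublinear functional below \<open>q\<close> which is linear in the direction of \<open>y\<close>.\<close>

definition flatten :: "('v \<Rightarrow> real) \<Rightarrow> 'v \<Rightarrow> 'v \<Rightarrow> real" where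
  "flatten q y x = (if x \<in> vecs E
     then INF t\<in>{0..}. q (x + scl E (of_real t) y) - t * q y else 0)"

lemma flatten_bdd:
  assumes q: "sublinear q" and y: "y \<in> vecs E" and x: "x \<in> vecs E"
  shows "bdd_below ((\<lambda>t. q (x + scl E (of_real t) y) - t * q y) ` {0..})"
proof (rule bdd_belowI2)
  fix t :: real assume "t \<in> {0..}"
  then have "t * q y = q ((x + scl E (of_real t) y) + - x)"
    using sublinear_scl[OF q _ y, of t] by simp
  also have "\<dots> \<le> q (x + scl E (of_real t) y) + q (- x)"
    using x y by (intro sublinear_add[OF q]) auto
  finally show "- q (- x) \<le> q (x + scl E (of_real t) y) - t * q y" by simp
qed

lemma flatten_le:
  assumes "sublinear q" "y \<in> vecs E" "x \<in> vecs E" "t \<ge> 0"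
  shows "flatten q y x \<le> q (x + scl E (of_real t) y) - t * q y"
  unfolding flatten_def using assms cINF_lower[OF flatten_bdd[OF assms(1-3)], of t] by simp

lemma flatten_greatest:
  assumes "x \<in> vecs E" "\<And>t. t \<ge> 0 \<Longrightarrow> c \<le> q (x + scl E (of_real t) y) - t * q y"
  shows "c \<le> flatten q y x"
  unfolding flatten_def using assms by (auto intro!: cINF_greatest)

text \<open>For subadditivity the two infima run over independent parameters \<open>s\<close> and
  \<open>t\<close>; the estimate at \<open>s + t\<close> serves both, and each infimum is taken with
  the other parameter fixed.\<close>

lemma sublinear_flatten:
  assumes q: "sublinear q" and y: "y \<in> vecs E"
  shows "sublinear (flatten q y)"
  unfolding sublinear_def
proof (intro conjI ballI allI impI)
  have "flatten q y 0 \<le> 0"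
    using flatten_le[OF q y, of 0 0] sublinear_0[OF q] by simp
  moreover have "0 \<le> flatten q y 0"
    by (rule flatten_greatest) (use sublinear_scl[OF q _ y] in auto)
  ultimately show "flatten q y 0 = 0" by simp
next
  fix x x' assume x: "x \<in> vecs E" "x' \<in> vecs E"
  have *: "flatten q y (x + x') \<le> (q (x + scl E (of_real s) y) - s * q y) + (q (x' + scl E (of_real t) y) - t * q y)"
    if "s \<ge> 0" "t \<ge> 0" for s t
  proof -
    have "flatten q y (x + x') \<le> q (x + x' + scl E (of_real (s + t)) y) - (s + t) * q y"
      using x that by (intro flatten_le[OF q y]) auto
    also have "x + x' + scl E (of_real (s + t)) y = (x + scl E (of_real s) y) + (x' + scl E (of_real t) y)"
      by (simp add: scale_left_distrib)
    also have "q \<dots> \<le> q (x + scl E (of_real s) y) + q (x' + scl E (of_real t) y)"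
      using x y by (intro sublinear_add[OF q]) auto
    finally show ?thesis by (simp add: algebra_simps)
  qed
  have "flatten q y (x + x') - (q (x' + scl E (of_real t) y) - t * q y) \<le> flatten q y x" if "t \<ge> 0" for t
    using * that by (intro flatten_greatest x) (simp add: algebra_simps)
  then have "flatten q y (x + x') - flatten q y x \<le> flatten q y x'"
    by (intro flatten_greatest x) (simp add: algebra_simps)
  then show "flatten q y (x + x') \<le> flatten q y x + flatten q y x'" by simp
next
  fix r :: real and x assume r: "r > 0" and x: "x \<in> vecs E"
  have "flatten q y (scl E (of_real r) x) / r \<le> flatten q y x"
  proof (rule flatten_greatest[OF x])
    fix t :: real assume t: "t \<ge> 0"
    have "flatten q y (scl E (of_real r) x) \<le> q (scl E (of_real r) x + scl E (of_real (r * t)) y) - r * t * q y"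
      using x r t by (intro flatten_le[OF q y]) auto
    also have "scl E (of_real r) x + scl E (of_real (r * t)) y = scl E (of_real r) (x + scl E (of_real t) y)"
      by (simp add: scale_right_distrib)
    also have "q \<dots> \<le> r * q (x + scl E (of_real t) y)"
      using x y r by (intro sublinear_scl_le[OF q]) auto
    finally show "flatten q y (scl E (of_real r) x) / r \<le> q (x + scl E (of_real t) y) - t * q y"
      using r by (simp add: field_simps)
  qed
  then show "flatten q y (scl E (of_real r) x) \<le> r * flatten q y x"
    using r by (simp add: field_simps)
qed (simp add: flatten_def)

lemma flatten_le_self: "sublinear q \<Longrightarrow> y \<in> vecs E \<Longrightarrow> flatten q y x \<le> q x"
  using flatten_le[of q y x 0] by (cases "x \<in> vecs E") (auto simp: flatten_def sublinear_out)

text \<open>At \<open>t = 1\<close> the first term is \<open>q 0 = 0\<close>. For a minimal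
  \<open>q\<close>, which equals \<open>flatten q y\<close>, this makes \<open>q\<close>
  odd.\<close>

lemma flatten_neg: "sublinear q \<Longrightarrow> y \<in> vecs E \<Longrightarrow> flatten q y (- y) \<le> - q y"
  using flatten_le[of q y "- y" 1] by (simp add: sublinear_0)

text \<open>A chain has its pointwise infimum as a lower bound. Subadditivity survives because any
  two members of a chain dominate a common third one, the smaller of the two.\<close>

lemma minimal_sublinear:
  assumes p: "sublinear p"
  obtains q where "sublinear q" "q \<le> p" "\<And>q'. sublinear q' \<Longrightarrow> q' \<le> q \<Longrightarrow> q' = q"
proof -
  let ?A = "{q. sublinear q \<and> q \<le> p}"
  have "\<exists>m\<in>?A. \<forall>a\<in>?A. a \<le> m \<longrightarrow> a = m"
  proof (rule predicate_Zorn[where P = "\<lambda>x y. y \<le> x"])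
    show "partial_order_on ?A (relation_of (\<lambda>x y. y \<le> x) ?A)"
      by (rule partial_order_on_relation_ofI) auto
  next
    fix C assume C: "C \<in> Chains (relation_of (\<lambda>x y. y \<le> x) ?A)"
    then have CA: "C \<subseteq> ?A" and ch: "\<And>x y. x \<in> C \<Longrightarrow> y \<in> C \<Longrightarrow> x \<le> y \<or> y \<le> x"
      unfolding Chains_def relation_of_def by blast+
    have sub: "sublinear q" "q \<le> p" if "q \<in> C" for q using CA that by auto
    show "\<exists>u\<in>?A. \<forall>a\<in>C. u \<le> a"
    proof (cases "C = {}")
      case True then show ?thesis using p by blast
    next
      case False
      define u where "u x = (INF q\<in>C. q x)" for x
      have bdd: "bdd_below ((\<lambda>q. q x) ` C)" for x
      proof (rule bdd_belowI2)
        fix q assume q: "q \<in> C"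
        \<comment> \<open>\<open>- p (- x)\<close> is the lower bound inside \<open>vecs E\<close>;
          the \<open>min\<close> with \<open>0\<close> covers the points outside, where every member
          vanishes.\<close>
        show "min 0 (- p (- x)) \<le> q x"
        proof (cases "x \<in> vecs E")
          case True
          have "- p (- x) \<le> - q (- x)" using sub(2)[OF q] by (simp add: le_fun_def)
          also have "\<dots> \<le> q x" by (rule sublinear_neg_le[OF sub(1)[OF q] True])
          finally show ?thesis by simp
        qed (use sublinear_out[OF sub(1)[OF q]] in simp)
      qed
      have lower: "u x \<le> q x" if "q \<in> C" for q x
        unfolding u_def by (rule cINF_lower[OF bdd that])
      have greatest: "c \<le> u x" if "\<And>q. q \<in> C \<Longrightarrow> c \<le> q x" for c x
        unfolding u_def using False that by (intro cINF_greatest)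
      have "sublinear u"
        unfolding sublinear_def
      proof (intro conjI ballI allI impI)
        have "(\<lambda>q. q 0) ` C = {0}" using False sublinear_0[OF sub(1)] by force
        then show "u 0 = 0" unfolding u_def by simp
      next
        fix x assume "x \<notin> vecs E"
        then have "(\<lambda>q. q x) ` C = {0}" using False sublinear_out[OF sub(1)] by force
        then show "u x = 0" unfolding u_def by simp
      next
        fix x y assume xy: "x \<in> vecs E" "y \<in> vecs E"
        have *: "u (x + y) \<le> q1 x + q2 y" if q12: "q1 \<in> C" "q2 \<in> C" for q1 q2
        proof -
          obtain q where q: "q \<in> C" "q \<le> q1" "q \<le> q2" using ch q12 by blast
          have "u (x + y) \<le> q (x + y)" by (rule lower[OF q(1)])
          also have "\<dots> \<le> q x + q y" by (rule sublinear_add[OF sub(1)[OF q(1)] xy])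
          also have "\<dots> \<le> q1 x + q2 y" using q by (intro add_mono) (auto simp: le_fun_def)
          finally show ?thesis .
        qed
        have "u (x + y) - q2 y \<le> u x" if "q2 \<in> C" for q2
          using *[OF _ that] by (intro greatest) (simp add: algebra_simps)
        then have "u (x + y) - u x \<le> u y"
          by (intro greatest) (simp add: algebra_simps)
        then show "u (x + y) \<le> u x + u y" by simp
      next
        fix r :: real and x assume r: "r > 0" and x: "x \<in> vecs E"
        have "u (scl E (of_real r) x) / r \<le> u x"
        proof (rule greatest)
          fix q assume q: "q \<in> C"
          show "u (scl E (of_real r) x) / r \<le> q x"
            using lower[OF q, of "scl E (of_real r) x"] sublinear_scl_le[OF sub(1)[OF q] r x] r
            by (simp add: field_simps)
        qed
        then show "u (scl E (of_real r) x) \<le> r * u x" using r by (simp add: field_simps)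
      qed
      moreover have "u \<le> p"
        using False lower sub(2) by (meson ex_in_conv le_funE le_funI order_trans)
      ultimately show ?thesis using lower by (intro bexI[of _ u]) (auto simp: le_fun_def)
    qed
  qed
  then obtain q where q: "sublinear q" "q \<le> p"
      and m: "\<And>q'. q' \<in> ?A \<Longrightarrow> q' \<le> q \<Longrightarrow> q' = q"
    by blast
  show ?thesis
  proof (rule that[OF q])
    fix q' assume "sublinear q'" "q' \<le> q"
    then show "q' = q" using m[of q'] q(2) by (simp add: order_trans[of q' q p])
  qed
qed

text \<open>A minimal sublinear functional is odd, hence additive. Taking it below the norm
  flattened at \<open>y\<close>, instead of the norm, forces \<open>q (- y) \<le> - nrm E y\<close>,
  so it attains the norm at \<open>y\<close> and no functional has to be extended from a
  subspace.\<close>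

lemma real_norming_functional:
  assumes y: "y \<in> vecs E"
  obtains f where "\<And>u v. u \<in> vecs E \<Longrightarrow> v \<in> vecs E \<Longrightarrow> f (u + v) = f u + f v"
    "\<And>r u. u \<in> vecs E \<Longrightarrow> f (scl E (of_real r) u) = r * f u"
    "\<And>u. u \<in> vecs E \<Longrightarrow> f u \<le> nrm E u" "f y = nrm E y"
proof -
  let ?p = "\<lambda>x. if x \<in> vecs E then nrm E x else 0"
  obtain q where q: "sublinear q" "q \<le> flatten ?p y"
      and min: "\<And>q'. sublinear q' \<Longrightarrow> q' \<le> q \<Longrightarrow> q' = q"
    using minimal_sublinear[OF sublinear_flatten[OF sublinear_nrm y]] by blast
  have neg: "q (- u) = - q u" if u: "u \<in> vecs E" for u
  proof -
    have "flatten q u = q"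
      by (intro min sublinear_flatten q u le_funI flatten_le_self)
    then have "q (- u) \<le> - q u" using flatten_neg[OF q(1) u] by simp
    then show ?thesis using sublinear_neg_le[OF q(1) u] by simp
  qed
  have add: "q (u + v) = q u + q v" if "u \<in> vecs E" "v \<in> vecs E" for u v
    using sublinear_add[OF q(1) that] sublinear_add[OF q(1), of "u + v" "- v"] that neg[of v] by simp
  have scl: "q (scl E (of_real r) u) = r * q u" if u: "u \<in> vecs E" for r u
  proof (cases "r \<ge> 0")
    case False
    have "q (scl E (of_real (- r)) u) = - r * q u" using False u by (intro sublinear_scl[OF q(1)]) auto
    then show ?thesis using neg[of "scl E (of_real r) u"] u by simp
  qed (use sublinear_scl[OF q(1)] u in auto)
  have le: "q u \<le> nrm E u" if u: "u \<in> vecs E" for u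
    using le_funD[OF q(2), of u] flatten_le_self[OF sublinear_nrm y, of u] u by simp
  have "q (- y) \<le> - nrm E y"
    using le_funD[OF q(2), of "- y"] flatten_neg[OF sublinear_nrm y] y by simp
  then have "q y = nrm E y" using neg[OF y] le[OF y] by simp
  then show ?thesis using that add scl le by blast
qed

theorem norming_functional:
  assumes y: "y \<in> vecs E"
  obtains \<psi> where "\<psi> \<in> dual E" "\<And>x. x \<in> vecs E \<Longrightarrow> norm (\<psi> x) \<le> nrm E x" "\<psi> y = of_real (nrm E y)"
proof -
  obtain f where f: "\<And>u v. u \<in> vecs E \<Longrightarrow> v \<in> vecs E \<Longrightarrow> f (u + v) = f u + f v"
    "\<And>r u. u \<in> vecs E \<Longrightarrow> f (scl E (of_real r) u) = r * f u"
    "\<And>u. u \<in> vecs E \<Longrightarrow> f u \<le> nrm E u" "f y = nrm E y"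
    using real_norming_functional[OF y] by blast
  have fneg: "f (- u) = - f u" if "u \<in> vecs E" for u
    using f(2)[of u "-1"] that by simp
  show ?thesis
    using real_or_complex[where 'a='k]
  proof
    assume r: "\<forall>z::'k. \<exists>a. z = a *\<^sub>R 1"
    have b: "norm (of_real (f x) :: 'k) \<le> nrm E x" if "x \<in> vecs E" for x
      using f(3)[of x] f(3)[of "- x"] fneg[of x] that nrm_minus[of x] by simp
    have "(\<lambda>x. of_real (f x)) \<in> dual E"
    proof (rule dualI[where C = 1])
      fix c :: 'k and x assume x: "x \<in> vecs E"
      obtain a where "c = of_real a" using r by (metis of_real_def)
      then show "(of_real (f (scl E c x)) :: 'k) = c * of_real (f x)" using f(2) x by simp
    qed (use f b in auto)
    then show ?thesis using that[of "\<lambda>x. of_real (f x)"] b f(4) by simp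
  next
    assume "\<exists>i::'k. i * i = - 1 \<and> (\<forall>z. \<exists>a b. z = a *\<^sub>R 1 + b *\<^sub>R i \<and> norm z = sqrt (a\<^sup>2 + b\<^sup>2))"
    then obtain i :: 'k where ii: "i * i = - 1"
      and rep: "\<And>z. \<exists>a b. z = of_real a + of_real b * i \<and> norm z = sqrt (a\<^sup>2 + b\<^sup>2)"
      by (auto simp: scaleR_conv_of_real)
    have ii': "i * (i * z) = - z" for z using ii by (simp flip: mult.assoc)
    \<comment> \<open>Independence of \<open>1\<close> and \<open>i\<close> over the reals. The
      class axiom gives the formula for the norm in some representation only; uniqueness makes it
      valid in each.\<close>
    have ind: "a = 0 \<and> b = 0" if "of_real a + of_real b * i = 0" for a b
    proof -
      have "(of_real (a\<^sup>2 + b\<^sup>2) :: 'k) = (of_real a + of_real b * i) * (of_real a - of_real b * i)"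
        by (simp add: algebra_simps power2_eq_square ii')
      then have "a\<^sup>2 + b\<^sup>2 = 0" using that by (metis mult_zero_left of_real_eq_0_iff)
      then show ?thesis by (simp add: sum_power2_eq_zero_iff)
    qed
    have nrm: "norm (of_real a + of_real b * i) = sqrt (a\<^sup>2 + b\<^sup>2)" for a b
    proof -
      obtain a' b' where *: "of_real a + of_real b * i = of_real a' + of_real b' * i"
        "norm (of_real a + of_real b * i) = sqrt (a'\<^sup>2 + b'\<^sup>2)" using rep by blast
      have "of_real (a - a') + of_real (b - b') * i = 0" using *(1) by (simp add: algebra_simps)
      from ind[OF this] show ?thesis using *(2) by simp
    qed
    \<comment> \<open>The only complex-linear functional with real part \<open>f\<close>. Rotating
      its value by \<open>rsgn\<close> makes it real, so the bound for \<open>f\<close> carries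
      over.\<close>
    define \<psi> where "\<psi> x = of_real (f x) - i * of_real (f (scl E i x))" for x
    have \<psi>': "\<psi> x = of_real (f x) + of_real (- f (scl E i x)) * i" for x
      by (simp add: \<psi>_def)
    have add: "\<psi> (u + v) = \<psi> u + \<psi> v" if "u \<in> vecs E" "v \<in> vecs E" for u v
      using that by (simp add: \<psi>_def f scale_right_distrib algebra_simps)
    have sr: "\<psi> (scl E (of_real a) u) = of_real a * \<psi> u" if "u \<in> vecs E" for a u
    proof -
      have "f (scl E (of_real a) (scl E i u)) = a * f (scl E i u)" using that by (intro f(2)) simp
      then have "f (scl E (i * of_real a) u) = a * f (scl E i u)" by (simp add: mult.commute)
      then show ?thesis using that by (simp add: \<psi>_def f(2) algebra_simps)
    qed
    have si: "\<psi> (scl E i u) = i * \<psi> u" if "u \<in> vecs E" for u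
    proof -
      have "scl E i (scl E i u) = - u" using ii by simp
      then have "\<psi> (scl E i u) = of_real (f (scl E i u)) + i * of_real (f u)"
        using fneg[OF that] by (simp add: \<psi>_def)
      also have "\<dots> = i * \<psi> u"
        by (simp add: \<psi>_def algebra_simps ii')
      finally show ?thesis .
    qed
    have scl: "\<psi> (scl E c u) = c * \<psi> u" if u: "u \<in> vecs E" for c u
    proof -
      obtain a b where c: "c = of_real a + of_real b * i" using rep by blast
      have "scl E c u = scl E (of_real a) u + scl E (of_real b) (scl E i u)"
        by (simp add: c scale_left_distrib)
      then have "\<psi> (scl E c u) = \<psi> (scl E (of_real a) u) + \<psi> (scl E (of_real b) (scl E i u))"
        using u add by (metis vecs_scl)
      also have "\<dots> = of_real a * \<psi> u + of_real b * (i * \<psi> u)"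
        using u sr[of u a] sr[of "scl E i u" b] si[of u] by (metis vecs_scl)
      finally show ?thesis by (simp add: c algebra_simps)
    qed
    have b: "norm (\<psi> x) \<le> nrm E x" if x: "x \<in> vecs E" for x
    proof -
      define u where "u = rsgn (\<psi> x)"
      have "\<psi> (scl E u x) = of_real (norm (\<psi> x))" using scl[OF x] rsgn_mult u_def by metis
      then have "of_real (f (scl E u x) - norm (\<psi> x)) + of_real (- f (scl E i (scl E u x))) * i = 0"
        unfolding \<psi>'[of "scl E u x"] of_real_diff by (metis add.commute add_diff_eq diff_self)
      from ind[OF this] have "norm (\<psi> x) = f (scl E u x)" by linarith
      also have "\<dots> \<le> norm u * nrm E x" using f(3)[of "scl E u x"] x by (simp add: nrm_scl)
      also have "\<dots> \<le> 1 * nrm E x" unfolding u_def by (intro mult_right_mono norm_rsgn nrm_nonneg x)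
      finally show ?thesis by simp
    qed
    have d: "\<psi> \<in> dual E" by (rule dualI[where C = 1]) (use add scl b in auto)
    \<comment> \<open>At \<open>y\<close> the real part alone exhausts the bound, so the imaginary
      part is \<open>0\<close>.\<close>
    have "sqrt ((nrm E y)\<^sup>2 + (f (scl E i y))\<^sup>2) \<le> nrm E y"
      using b[OF y] nrm[of "f y" "- f (scl E i y)"] f(4) unfolding \<psi>' by simp
    then have "(nrm E y)\<^sup>2 + (f (scl E i y))\<^sup>2 \<le> (nrm E y)\<^sup>2"
      by (rule sqrt_le_D)
    then have "\<psi> y = of_real (nrm E y)" by (simp add: \<psi>_def f(4))
    then show ?thesis using that d b by blast
  qed
qed

lemma dual_separates:
  assumes "x \<in> vecs E" "y \<in> vecs E" "\<And>\<phi>. \<phi> \<in> dual E \<Longrightarrow> \<phi> x = \<phi> y"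
  shows "x = y"
proof -
  obtain \<psi> where p: "\<psi> \<in> dual E" "\<psi> (x - y) = of_real (nrm E (x - y))"
    using norming_functional[OF vecs_diff[OF assms(1,2)]] by blast
  then have "nrm E (x - y) = 0"
    using assms(3)[OF p(1)] assms(1,2) by (simp add: dual_diff)
  then show ?thesis using nrm_eq_0[of "x - y"] assms by simp
qed

end

lemma (in banach_space) norming_functional_ex:
  assumes "y \<in> vecs E"
  shows "\<exists>\<psi>. \<psi> \<in> dual E \<and> (\<forall>x\<in>vecs E. norm (\<psi> x) \<le> nrm E x) \<and> \<psi> y = of_real (nrm E y)"
proof -
  obtain \<psi> where "\<psi> \<in> dual E" "\<And>x. x \<in> vecs E \<Longrightarrow> norm (\<psi> x) \<le> nrm E x" "\<psi> y = of_real (nrm E y)"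
    using norming_functional[OF assms] by blast
  then show ?thesis by (intro exI[of _ \<psi>]) simp
qed

section \<open>Function spaces and the uniform boundedness principle\<close>

lemma vector_space_fun: "vector_space (\<lambda>(c::'k::field) f (a::'a). c * f a)"
  by standard (auto simp: fun_eq_iff algebra_simps)

text \<open>One construction for all concrete spaces: initial sums as \<open>p j\<close> give the
  space of summable sequences, single coordinates give bounded sequences, and evaluations on the
  unit ball give the dual. By \<open>dom\<close> evaluations are continuous, so Cauchy sequences
  converge pointwise, and \<open>closed\<close> keeps the limit in \<open>V\<close>.\<close>

lemma banach_function_space:
  fixes V :: "('a \<Rightarrow> 'k::rc_field) set" and S :: "'j \<Rightarrow> 'a set" and J :: "'j set"
  defines "p \<equiv> \<lambda>j f. \<Sum>a\<in>S j. norm (f a)"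
  defines "E \<equiv> \<lparr>vecs = {f \<in> V. bdd_above ((\<lambda>j. p j f) ` J)}, scl = (\<lambda>c f a. c * f a),
      nrm = (\<lambda>f. SUP j\<in>J. p j f)\<rparr>"
  assumes J: "J \<noteq> {}"
    and V: "(\<lambda>_. 0) \<in> V" "\<And>f g. f \<in> V \<Longrightarrow> g \<in> V \<Longrightarrow> (\<lambda>a. f a + g a) \<in> V"
      "\<And>c f. f \<in> V \<Longrightarrow> (\<lambda>a. c * f a) \<in> V"
    and closed: "\<And>s l. (\<And>n::nat. s n \<in> V) \<Longrightarrow> (\<And>a. (\<lambda>n. s n a) \<longlonglongrightarrow> l a) \<Longrightarrow> l \<in> V"
    and dom: "\<And>a. \<exists>c\<ge>0. \<exists>j\<in>J. \<forall>f\<in>V. norm (f a) \<le> c * p j f"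
  shows "banach_space E \<and> (\<forall>f\<in>vecs E. \<forall>j\<in>J. p j f \<le> nrm E f)"
proof -
  interpret vector_space "\<lambda>(c::'k) f (a::'a). c * f a" by (rule vector_space_fun)
  have E [simp]: "vecs E = {f \<in> V. bdd_above ((\<lambda>j. p j f) ` J)}" "scl E = (\<lambda>c f a. c * f a)"
    "nrm E = (\<lambda>f. SUP j\<in>J. p j f)"
    by (simp_all add: E_def)
  have p0: "p j f \<ge> 0" for j f by (simp add: p_def sum_nonneg)
  have p_add: "p j (\<lambda>a. f a + g a) \<le> p j f + p j g" for j f g
    unfolding p_def sum.distrib[symmetric] by (intro sum_mono norm_triangle_ineq)
  have p_scl: "p j (\<lambda>a. c * f a) = norm c * p j f" for j c f
    by (simp add: p_def norm_mult sum_distrib_left)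
  have ple: "p j f \<le> nrm E f" if "f \<in> vecs E" "j \<in> J" for f j
    using that by (auto intro: cSUP_upper)
  have nle: "nrm E f \<le> c" if "\<And>j. j \<in> J \<Longrightarrow> p j f \<le> c" for f c
    using that J by (auto intro: cSUP_least)
  have n0: "nrm E f \<ge> 0" if "f \<in> vecs E" for f
    using J ple[OF that] p0 order_trans by blast
  have V_in: "f \<in> V" if "f \<in> vecs E" for f using that by simp
  have add: "(\<lambda>a. f a + g a) \<in> vecs E" if "f \<in> vecs E" "g \<in> vecs E" for f g
  proof -
    have "p j (\<lambda>a. f a + g a) \<le> nrm E f + nrm E g" if "j \<in> J" for j
      using p_add[of j f g] ple[OF \<open>f \<in> vecs E\<close> that] ple[OF \<open>g \<in> vecs E\<close> that] by linarith
    then have "bdd_above ((\<lambda>j. p j (\<lambda>a. f a + g a)) ` J)" by (rule bdd_aboveI2)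
    then show ?thesis using V(2)[OF V_in[OF that(1)] V_in[OF that(2)]] by simp
  qed
  have scl: "(\<lambda>a. c * f a) \<in> vecs E" if "f \<in> vecs E" for c f
  proof -
    have "p j (\<lambda>a. c * f a) \<le> norm c * nrm E f" if "j \<in> J" for j
      unfolding p_scl using ple[OF \<open>f \<in> vecs E\<close> that] by (intro mult_left_mono) auto
    then have "bdd_above ((\<lambda>j. p j (\<lambda>a. c * f a)) ` J)" by (rule bdd_aboveI2)
    then show ?thesis using V(3)[OF V_in[OF that]] by simp
  qed
  have diff: "f - g \<in> vecs E" if "f \<in> vecs E" "g \<in> vecs E" for f g
    using add[OF that(1) scl[OF that(2), of "-1"]] by (simp add: fun_diff_def)
  have dom': "\<exists>c\<ge>0. \<forall>f\<in>vecs E. norm (f a) \<le> c * nrm E f" for a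
  proof -
    obtain c j where c: "c \<ge> 0" "j \<in> J" "\<And>f. f \<in> V \<Longrightarrow> norm (f a) \<le> c * p j f" using dom by blast
    have "norm (f a) \<le> c * nrm E f" if "f \<in> vecs E" for f
      using c(3)[OF V_in[OF that]] mult_left_mono[OF ple[OF that c(2)] c(1)] by linarith
    then show ?thesis using c(1) by blast
  qed
  have "banach_space E"
  proof (rule banach_spaceI)
    show "vector_space (scl E)" unfolding E by (rule vector_space_fun)
    show "module.subspace (scl E) (vecs E)"
      unfolding E(2)
    proof (rule subspaceI)
      show "0 \<in> vecs E" using V(1) by (auto simp: zero_fun_def p_def intro: bdd_aboveI2)
    qed (use add scl in \<open>auto simp: plus_fun_def\<close>)
    fix x assume x: "x \<in> vecs E"
    show "0 \<le> nrm E x" by (rule n0[OF x])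
    show "x = 0" if "nrm E x = 0"
    proof
      fix a
      obtain c where "norm (x a) \<le> c * nrm E x" using dom' x by blast
      then show "x a = 0 a" using that by simp
    qed
    fix c
    show "nrm E (scl E c x) = norm c * nrm E x"
    proof (rule antisym)
      show "nrm E (scl E c x) \<le> norm c * nrm E x"
        using ple[OF x] by (intro nle) (auto simp: p_scl simp del: E(3) intro!: mult_left_mono)
      show "norm c * nrm E x \<le> nrm E (scl E c x)"
      proof (cases "c = 0")
        case False
        have "nrm E x \<le> nrm E (scl E c x) / norm c"
        proof (rule nle)
          fix j assume "j \<in> J"
          then have "p j (scl E c x) \<le> nrm E (scl E c x)" using ple[of "scl E c x" j] scl[OF x, of c] by simp
          then show "p j x \<le> nrm E (scl E c x) / norm c" using False by (simp add: p_scl field_simps del: E(3))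
        qed
        then show ?thesis using False by (simp add: field_simps del: E(3))
      qed (use n0[OF scl[OF x, of 0]] in \<open>simp del: E(3)\<close>)
    qed
  next
    fix x y assume x: "x \<in> vecs E" and y: "y \<in> vecs E"
    show "nrm E (x + y) \<le> nrm E x + nrm E y"
    proof (rule nle)
      fix j assume j: "j \<in> J"
      show "p j (x + y) \<le> nrm E x + nrm E y"
        using p_add[of j x y] ple[OF x j] ple[OF y j] unfolding plus_fun_def by linarith
    qed
  next
    fix s :: "nat \<Rightarrow> 'a \<Rightarrow> 'k"
    assume s: "\<And>n. s n \<in> vecs E"
      and C: "\<And>e. e > 0 \<Longrightarrow> \<exists>N. \<forall>m\<ge>N. \<forall>n\<ge>N. nrm E (s m - s n) < e"
    have "\<exists>l. (\<lambda>n. s n a) \<longlonglongrightarrow> l" for a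
    proof (rule rc_Cauchy_convergent)
      fix e :: real assume e: "e > 0"
      obtain c where c: "c \<ge> 0" "\<And>f. f \<in> vecs E \<Longrightarrow> norm (f a) \<le> c * nrm E f" using dom' by blast
      obtain N where N: "\<And>m n. m \<ge> N \<Longrightarrow> n \<ge> N \<Longrightarrow> nrm E (s m - s n) < e / (c + 1)"
        using C[of "e / (c + 1)"] e c(1) by auto
      have "norm (s m a - s n a) < e" if "m \<ge> N" "n \<ge> N" for m n
      proof -
        have "norm (s m a - s n a) \<le> c * nrm E (s m - s n)" using c(2)[OF diff[OF s s], of m n] by simp
        also have "\<dots> \<le> (c + 1) * nrm E (s m - s n)" using n0[OF diff[OF s s]] by (intro mult_right_mono) auto
        also have "\<dots> < e" using N[OF that] c(1) by (simp add: field_simps del: E(3))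
        finally show ?thesis .
      qed
      then show "\<exists>N. \<forall>m\<ge>N. \<forall>n\<ge>N. norm (s m a - s n a) < e" by blast
    qed
    then obtain l where l: "\<And>a. (\<lambda>n. s n a) \<longlonglongrightarrow> l a" by metis
    have lV: "l \<in> V" by (rule closed[OF V_in[OF s] l])
    \<comment> \<open>\<open>p j\<close> involves finitely many coordinates, so the limit
      \<open>m \<rightarrow> \<infinity>\<close> can be taken inside it; the bound does not depend
      on \<open>j\<close>.\<close>
    have est: "\<exists>N. \<forall>n\<ge>N. \<forall>j\<in>J. p j (s n - l) \<le> e" if e0: "e > 0" for e
    proof -
      obtain N where N: "\<And>m n. m \<ge> N \<Longrightarrow> n \<ge> N \<Longrightarrow> nrm E (s m - s n) < e"
        using C[OF e0] by auto
      have "p j (s n - l) \<le> e" if n: "n \<ge> N" and j: "j \<in> J" for n j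
      proof (rule tendsto_upperbound)
        show "(\<lambda>m. p j (s n - s m)) \<longlonglongrightarrow> p j (s n - l)"
          unfolding p_def fun_diff_def by (intro tendsto_intros l)
        show "\<forall>\<^sub>F m in sequentially. p j (s n - s m) \<le> e"
          using ple[OF diff[OF s s] j, of n] N[OF n] unfolding eventually_sequentially
          by (meson le_less_trans less_imp_le)
      qed simp
      then show ?thesis by blast
    qed
    obtain N where N: "\<And>n j. n \<ge> N \<Longrightarrow> j \<in> J \<Longrightarrow> p j (s n - l) \<le> 1" using est[of 1] by auto
    have "p j l \<le> nrm E (s N) + 1" if j: "j \<in> J" for j
    proof -
      have "p j l \<le> p j (s N) + p j (\<lambda>a. l a - s N a)"
        using p_add[of j "s N" "\<lambda>a. l a - s N a"] by simp
      also have "p j (\<lambda>a. l a - s N a) = p j (s N - l)" by (simp add: p_def norm_minus_commute)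
      finally show ?thesis using N[OF order_refl j] ple[OF s j, of N] by linarith
    qed
    then have "bdd_above ((\<lambda>j. p j l) ` J)" by (rule bdd_aboveI2)
    then have lE: "l \<in> vecs E" using lV by simp
    moreover have "(\<lambda>n. nrm E (s n - l)) \<longlonglongrightarrow> 0"
    proof (rule LIMSEQ_I)
      fix r :: real assume r: "r > 0"
      obtain N where N: "\<And>n j. n \<ge> N \<Longrightarrow> j \<in> J \<Longrightarrow> p j (s n - l) \<le> r/2" using est[of "r/2"] r by auto
      have "norm (nrm E (s n - l) - 0) < r" if "n \<ge> N" for n
        using nle[of "s n - l" "r/2"] N[OF that] n0[OF diff[OF s lE], of n] r by (simp del: E(3))
      then show "\<exists>no. \<forall>n\<ge>no. norm (nrm E (s n - l) - 0) < r" by blast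
    qed
    ultimately show "\<exists>l\<in>vecs E. (\<lambda>n. nrm E (s n - l)) \<longlonglongrightarrow> 0" by blast
  qed
  then show ?thesis using ple by blast
qed

lemma (in banach_space) banach_closed_subspace:
  assumes G: "subspace G" "G \<subseteq> vecs E"
    and cl: "\<And>s l. (\<And>n::nat. s n \<in> G) \<Longrightarrow> l \<in> vecs E \<Longrightarrow> (\<lambda>n. nrm E (s n - l)) \<longlonglongrightarrow> 0 \<Longrightarrow> l \<in> G"
  shows "banach_space (E\<lparr>vecs := G\<rparr>)"
proof (rule banach_spaceI)
  fix s :: "nat \<Rightarrow> 'v"
  assume s: "\<And>n. s n \<in> vecs (E\<lparr>vecs := G\<rparr>)"
    and C: "\<And>e. e > 0 \<Longrightarrow> \<exists>N. \<forall>m\<ge>N. \<forall>n\<ge>N. nrm (E\<lparr>vecs := G\<rparr>) (s m - s n) < e"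
  obtain l where l: "l \<in> vecs E" "(\<lambda>n. nrm E (s n - l)) \<longlonglongrightarrow> 0"
    by (rule nrm_Cauchy_convergent[of s]) (use s C G(2) in auto)
  with cl[of s l] s show "\<exists>l\<in>vecs (E\<lparr>vecs := G\<rparr>). (\<lambda>n. nrm (E\<lparr>vecs := G\<rparr>) (s n - l)) \<longlonglongrightarrow> 0"
    by auto
next
  fix x y assume "x \<in> vecs (E\<lparr>vecs := G\<rparr>)" "y \<in> vecs (E\<lparr>vecs := G\<rparr>)"
  then show "nrm (E\<lparr>vecs := G\<rparr>) (x + y) \<le> nrm (E\<lparr>vecs := G\<rparr>) x + nrm (E\<lparr>vecs := G\<rparr>) y"
    using G(2) nrm_triangle[of x y] by auto
qed (use G nrm_nonneg nrm_eq_0 nrm_scl vector_space_axioms in auto)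

text \<open>Sokal's gliding hump argument.\<close>

theorem (in banach_space) uniform_boundedness:
  fixes \<P> :: "('v \<Rightarrow> real) set"
  assumes add: "\<And>p x y. p \<in> \<P> \<Longrightarrow> x \<in> vecs E \<Longrightarrow> y \<in> vecs E \<Longrightarrow> p (x + y) \<le> p x + p y"
    and scl: "\<And>p c x. p \<in> \<P> \<Longrightarrow> x \<in> vecs E \<Longrightarrow> p (scl E c x) = norm c * p x"
    and cont: "\<And>p. p \<in> \<P> \<Longrightarrow> \<exists>C. \<forall>x\<in>vecs E. p x \<le> C * nrm E x"
    and ptw: "\<And>x. x \<in> vecs E \<Longrightarrow> \<exists>B. \<forall>p\<in>\<P>. p x \<le> B"
  shows "\<exists>C. \<forall>p\<in>\<P>. \<forall>x\<in>vecs E. p x \<le> C * nrm E x"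
proof (rule ccontr)
  assume not: "\<not> ?thesis"
  define N :: "('v \<Rightarrow> real) \<Rightarrow> real" where "N p = (SUP x\<in>{x\<in>vecs E. nrm E x \<le> 1}. p x)" for p
  have pneg: "p (- x) = p x" if "p \<in> \<P>" "x \<in> vecs E" for p x
    using scl[OF that, of "-1"] by simp
  have p0: "p 0 = 0" if "p \<in> \<P>" for p using scl[OF that, of 0 0] by simp
  have bdd: "bdd_above (p ` {x\<in>vecs E. nrm E x \<le> 1})" if p: "p \<in> \<P>" for p
  proof -
    obtain C where C: "\<And>x. x \<in> vecs E \<Longrightarrow> p x \<le> C * nrm E x" using cont[OF p] by blast
    have "p x \<le> \<bar>C\<bar>" if "x \<in> vecs E" "nrm E x \<le> 1" for x
    proof -
      have "C * nrm E x \<le> \<bar>C\<bar> * 1"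
        using that nrm_nonneg by (intro mult_mono) auto
      then show ?thesis using C[OF that(1)] by simp
    qed
    then show ?thesis by (intro bdd_aboveI2[of _ _ "\<bar>C\<bar>"]) auto
  qed
  have N_upper: "p x \<le> N p * nrm E x" if p: "p \<in> \<P>" and x: "x \<in> vecs E" for p x
  proof (cases "x = 0")
    case False
    then have n: "nrm E x > 0" using nrm_eq_0[OF x] nrm_nonneg[OF x] by simp
    let ?y = "scl E (of_real (1 / nrm E x)) x"
    have "nrm E ?y \<le> 1" using n x by (simp add: nrm_scl norm_divide)
    then have "p ?y \<le> N p"
      unfolding N_def using x by (intro cSUP_upper bdd[OF p]) auto
    moreover have "p ?y * nrm E x = p x"
      using n scl[OF p x, of "of_real (1 / nrm E x)"] by (simp add: norm_divide)
    ultimately show ?thesis using n mult_right_mono[of "p ?y" "N p" "nrm E x"] by simp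
  qed (use p0[OF p] in simp)
  have "\<exists>p\<in>\<P>. N p > 4 ^ n" for n :: nat
  proof -
    obtain p x where p: "p \<in> \<P>" "x \<in> vecs E" "p x > 4 ^ n * nrm E x"
      using not by (meson not_less)
    then have "4 ^ n * nrm E x < N p * nrm E x" using N_upper[OF p(1,2)] by simp
    then show ?thesis using p(1) nrm_nonneg[OF p(2)] by (metis mult_less_cancel_right not_less)
  qed
  then obtain p where p: "\<And>n. p n \<in> \<P>" "\<And>n. N (p n) > 4 ^ n" by metis
  have Npos: "N (p n) > 0" for n using p(2)[of n] by (smt (verit) zero_less_power)
  have "\<exists>u\<in>vecs E. nrm E u \<le> 1 \<and> p n u > 5/6 * N (p n)" for n
  proof (rule ccontr)
    assume "\<not> ?thesis"
    then have le: "p n u \<le> 5/6 * N (p n)" if "u \<in> {x \<in> vecs E. nrm E x \<le> 1}" for u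
      using that by (auto simp: not_less)
    have "0 \<in> {x \<in> vecs E. nrm E x \<le> 1}" by simp
    then have "{x \<in> vecs E. nrm E x \<le> 1} \<noteq> {}" by blast
    then have "(SUP x\<in>{x\<in>vecs E. nrm E x \<le> 1}. p n x) \<le> 5/6 * N (p n)"
      by (rule cSUP_least[OF _ le])
    then have "N (p n) \<le> 5/6 * N (p n)" by (simp only: N_def[of "p n"])
    then show False using Npos[of n] by simp
  qed
  then obtain u where u: "\<And>n. u n \<in> vecs E" "\<And>n. nrm E (u n) \<le> 1" "\<And>n. p n (u n) > 5/6 * N (p n)"
    by metis
  \<comment> \<open>Steps of length \<open>r n\<close> leave a tail of at most
    \<open>r n / 2\<close> after step \<open>n\<close>. The values \<open>4 ^ n\<close> and
    \<open>5/6\<close> are chosen against this: \<open>5/6 - 1/2\<close> is positive and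
    \<open>4/3 > 1\<close>.\<close>
  define r :: "nat \<Rightarrow> real" where "r n = (1/3) ^ n" for n
  have rpos: "r n > 0" for n by (simp add: r_def)
  \<comment> \<open>From \<open>2 v = (x + v) + (v - x)\<close> and evenness of \<open>p n\<close>,
    one of \<open>x + v\<close> and \<open>x - v\<close> has seminorm at least \<open>p n v\<close>;
    \<open>c\<close> is the sign that works.\<close>
  have hump: "\<exists>c. norm c \<le> 1 \<and> p n (x + scl E (c * of_real (r n)) (u n)) \<ge> r n * p n (u n)" if x: "x \<in> vecs E" for n x
  proof -
    let ?v = "scl E (of_real (r n)) (u n)"
    have v: "?v \<in> vecs E" using u by simp
    have "scl E (1 + 1) ?v = (x + ?v) + (?v - x)"
      unfolding scale_left_distrib scale_one by simp
    then have "p n (scl E 2 ?v) \<le> p n (x + ?v) + p n (?v - x)"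
      using add[OF p(1)[of n], of "x + ?v" "?v - x"] x v by (simp only: one_add_one) simp
    then have "2 * p n ?v \<le> p n (x + ?v) + p n (?v - x)"
      using scl[OF p(1)[of n] v, of 2] by (simp only: norm_numeral)
    also have "p n (?v - x) = p n (x - ?v)" using pneg[OF p(1)[of n], of "x - ?v"] x v by simp
    finally have "p n (x + ?v) \<ge> p n ?v \<or> p n (x - ?v) \<ge> p n ?v" by linarith
    moreover have "p n ?v = r n * p n (u n)" using scl[OF p(1) u(1)] rpos[of n] by simp
    ultimately show ?thesis
      by (auto intro: exI[of _ 1] exI[of _ "-1"])
  qed
  then have "\<forall>n x. \<exists>c. x \<in> vecs E \<longrightarrow> norm c \<le> 1 \<and> p n (x + scl E (c * of_real (r n)) (u n)) \<ge> r n * p n (u n)"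
    by blast
  then obtain c where c: "\<And>n x. x \<in> vecs E \<Longrightarrow> norm (c n x) \<le> 1"
    "\<And>n x. x \<in> vecs E \<Longrightarrow> p n (x + scl E (c n x * of_real (r n)) (u n)) \<ge> r n * p n (u n)"
    unfolding choice_iff by blast
  define x where "x = rec_nat 0 (\<lambda>n x. x + scl E (c n x * of_real (r n)) (u n))"
  have xS: "x (Suc n) = x n + scl E (c n (x n) * of_real (r n)) (u n)" for n by (simp add: x_def)
  have xv: "x n \<in> vecs E" for n by (induction n) (simp add: x_def, simp add: xS u)
  have step: "nrm E (x (Suc n) - x n) \<le> r n" for n
  proof -
    have "norm (c n (x n)) * r n * nrm E (u n) \<le> 1 * r n * 1"
      using c(1)[OF xv] u(2) rpos[of n] nrm_nonneg[OF u(1)] by (intro mult_mono) auto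
    then show ?thesis using u(1) rpos[of n] by (simp add: xS nrm_scl norm_mult)
  qed
  have tail: "nrm E (x (Suc n + k) - x (Suc n)) \<le> r n / 2 - r (n + k) / 2" for n k
  proof (induction k)
    case (Suc k)
    have "nrm E (x (Suc n + Suc k) - x (Suc n)) \<le> nrm E (x (Suc (Suc n + k)) - x (Suc n + k)) + nrm E (x (Suc n + k) - x (Suc n))"
      using nrm_diff_via[OF xv xv xv] by simp
    also have "\<dots> \<le> r (Suc n + k) + (r n / 2 - r (n + k) / 2)"
      using Suc step by (intro add_mono) auto
    also have "\<dots> = r n / 2 - r (n + Suc k) / 2" by (simp add: r_def field_simps)
    finally show ?case .
  qed simp
  have tail': "nrm E (x m - x (Suc n)) \<le> r n / 2" if "m \<ge> Suc n" for m n
    using tail[of n "m - Suc n"] that rpos[of "n + (m - Suc n)"] by simp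
  have r0: "r \<longlonglongrightarrow> 0" unfolding r_def by (intro LIMSEQ_power_zero) auto
  obtain l where l: "l \<in> vecs E" "(\<lambda>n. nrm E (x n - l)) \<longlonglongrightarrow> 0"
  proof (rule nrm_Cauchy_convergent[of x])
    fix e :: real assume "e > 0"
    then obtain n where n: "r n < e" using order_tendstoD(2)[OF r0] by (auto simp: eventually_sequentially)
    have "nrm E (x m - x m') < e" if "m \<ge> Suc n" "m' \<ge> Suc n" for m m'
      using nrm_diff_via[of "x m" "x (Suc n)" "x m'"] tail'[OF that(1)] tail'[OF that(2)] n
        nrm_minus_commute[of "x (Suc n)" "x m'"] xv by simp
    then show "\<exists>N. \<forall>m\<ge>N. \<forall>n\<ge>N. nrm E (x m - x n) < e" by blast
  qed (use xv in auto)
  have close: "nrm E (l - x (Suc n)) \<le> r n / 2" for n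
  proof (rule tendsto_upperbound)
    have "(\<lambda>m. nrm E ((x m - x (Suc n)) - (l - x (Suc n)))) \<longlonglongrightarrow> 0" using l(2) by simp
    then show "(\<lambda>m. nrm E (x m - x (Suc n))) \<longlonglongrightarrow> nrm E (l - x (Suc n))"
      by (intro nrm_tendsto_nrm) (use l xv in auto)
    show "\<forall>\<^sub>F m in sequentially. nrm E (x m - x (Suc n)) \<le> r n / 2"
      using tail' unfolding eventually_sequentially by blast
  qed simp
  have big: "p n l \<ge> (4/3) ^ n / 3" for n
  proof -
    have "r n * (5/6 * N (p n)) \<le> r n * p n (u n)" using u(3)[of n] rpos[of n] by simp
    also have "\<dots> \<le> p n (x (Suc n))" using c(2)[OF xv] by (simp add: xS)
    also have "\<dots> \<le> p n l + p n (x (Suc n) - l)"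
      using add[OF p(1), of l "x (Suc n) - l"] l(1) xv by simp
    also have "p n (x (Suc n) - l) \<le> N (p n) * nrm E (x (Suc n) - l)"
      using l(1) xv by (intro N_upper p) auto
    also have "\<dots> \<le> N (p n) * (r n / 2)"
      using close[of n] nrm_minus_commute[OF l(1) xv] Npos[of n] by simp
    finally have "r n * N (p n) / 3 \<le> p n l" by (simp add: algebra_simps)
    moreover have "r n * 4 ^ n \<le> r n * N (p n)" using p(2)[of n] rpos[of n] by simp
    ultimately show ?thesis by (simp add: r_def power_divide)
  qed
  obtain B where B: "\<And>n. p n l \<le> B" using ptw[OF l(1)] p(1) by blast
  obtain n where "3 * B < (4/3 :: real) ^ n" using real_arch_pow[of "4/3" "3 * B"] by auto
  then show False using big[of n] B[of n] by simp
qed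

section \<open>Weakly unconditionally Cauchy series\<close>

lemma wuC_vecs: "wuC E x \<Longrightarrow> x n \<in> vecs E"
  unfolding wuC_def by auto

lemma wuC_summable: "wuC E x \<Longrightarrow> \<phi> \<in> dual E \<Longrightarrow> summable (\<lambda>n. norm (\<phi> (x n)))"
  unfolding wuC_def by auto

context banach_space
begin

text \<open>Uniform boundedness on the dual: the seminorms
  \<open>\<Sum>i<N. norm (\<phi> (x i))\<close> are bounded at each \<open>\<phi>\<close> by the
  definition of w.u.C. The dual is built here as a function space \<open>D\<close> with the supremum
  over the unit ball as norm.\<close>

lemma wuC_dual_bound:
  assumes x: "wuC E x"
  obtains C where "\<And>\<phi> N. \<phi> \<in> dual E \<Longrightarrow> (\<And>y. y \<in> vecs E \<Longrightarrow> norm (\<phi> y) \<le> nrm E y) \<Longrightarrow>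
      (\<Sum>i<N. norm (\<phi> (x i))) \<le> C"
proof -
  \<comment> \<open>Members of \<open>dual E\<close> are arbitrary off \<open>vecs E\<close>. Those
    in \<open>V\<close> vanish there, so that only the zero function has norm \<open>0\<close>;
    given functionals are cut off accordingly at the end.\<close>
  define V where "V = {\<phi>::'v \<Rightarrow> 'k. (\<forall>x\<in>vecs E. \<forall>y\<in>vecs E. \<phi> (x + y) = \<phi> x + \<phi> y) \<and>
      (\<forall>c. \<forall>x\<in>vecs E. \<phi> (scl E c x) = c * \<phi> x) \<and> (\<forall>x. x \<notin> vecs E \<longrightarrow> \<phi> x = 0)}"
  define J where "J = {x\<in>vecs E. nrm E x \<le> 1}"
  have "0 \<in> J" by (simp add: J_def)
  then have J_ne: "J \<noteq> {}" by blast
  define p :: "'v \<Rightarrow> ('v \<Rightarrow> 'k) \<Rightarrow> real" where "p j f = (\<Sum>a\<in>{j}. norm (f a))" for j f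
  define D :: "('k, 'v \<Rightarrow> 'k) nspace" where
    "D = \<lparr>vecs = {f \<in> V. bdd_above ((\<lambda>j. p j f) ` J)}, scl = (\<lambda>c f a. c * f a),
      nrm = (\<lambda>f. SUP j\<in>J. p j f)\<rparr>"
  have unit: "norm (f a) \<le> nrm E a * norm (f (scl E (of_real (1 / nrm E a)) a)) \<and>
      scl E (of_real (1 / nrm E a)) a \<in> J" if "f \<in> V" "a \<in> vecs E" for f a
  proof (cases "a = 0")
    case True
    have "f (scl E 0 0) = 0 * f 0" using that(1) vecs_0 unfolding V_def by blast
    then show ?thesis using True by (simp add: J_def)
  next
    case False
    then have n: "nrm E a > 0" using nrm_eq_0[OF that(2)] nrm_nonneg[OF that(2)] by simp
    have "nrm E (scl E (of_real (1 / nrm E a)) a) = 1"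
      using n that(2) by (simp add: nrm_scl norm_divide)
    moreover have "f (scl E (of_real (1 / nrm E a)) a) = of_real (1 / nrm E a) * f a"
      using that unfolding V_def by blast
    ultimately show ?thesis using n that(2) by (simp add: J_def norm_mult norm_divide)
  qed
  have "banach_space D \<and> (\<forall>f\<in>vecs D. \<forall>j\<in>J. p j f \<le> nrm D f)"
    unfolding D_def p_def
  proof (rule banach_function_space)
    show "J \<noteq> {}" by (rule J_ne)
    show "(\<lambda>_. 0) \<in> V" by (simp add: V_def)
    show "\<And>f g. f \<in> V \<Longrightarrow> g \<in> V \<Longrightarrow> (\<lambda>a. f a + g a) \<in> V" by (simp add: V_def algebra_simps)
    show "\<And>c f. f \<in> V \<Longrightarrow> (\<lambda>a. c * f a) \<in> V" by (simp add: V_def algebra_simps)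
    show "l \<in> V" if s: "\<And>n::nat. s n \<in> V" and l: "\<And>a. (\<lambda>n. s n a) \<longlonglongrightarrow> l a" for s l
      unfolding V_def
    proof (intro CollectI conjI ballI allI impI)
      fix x y assume "x \<in> vecs E" "y \<in> vecs E"
      then have "s n (x + y) = s n x + s n y" for n using s[of n] unfolding V_def by blast
      then show "l (x + y) = l x + l y"
        using LIMSEQ_unique[OF l[of "x + y"], of "l x + l y"] tendsto_add[OF l[of x] l[of y]] by simp
    next
      fix c x assume "x \<in> vecs E"
      then have "s n (scl E c x) = c * s n x" for n using s[of n] unfolding V_def by blast
      then show "l (scl E c x) = c * l x"
        using LIMSEQ_unique[OF l[of "scl E c x"], of "c * l x"] tendsto_mult_left[OF l[of x], of c] by simp
    next
      fix x assume "x \<notin> vecs E"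
      then have "s n x = 0" for n using s[of n] unfolding V_def by blast
      then show "l x = 0" using LIMSEQ_unique[OF l[of x], of 0] by simp
    qed
    show "\<exists>c\<ge>0. \<exists>j\<in>J. \<forall>f\<in>V. norm (f a) \<le> c * (\<Sum>a\<in>{j}. norm (f a))" for a
    proof (cases "a \<in> vecs E")
      case True
      then have "scl E (of_real (1 / nrm E a)) a \<in> J" using unit[of "\<lambda>_. 0" a] by (simp add: V_def)
      then show ?thesis using unit True nrm_nonneg[OF True] by fastforce
    next
      case False
      then show ?thesis using J_ne unfolding V_def by force
    qed
  qed
  then have D: "banach_space D" "\<And>f j. f \<in> vecs D \<Longrightarrow> j \<in> J \<Longrightarrow> p j f \<le> nrm D f"
    by blast+
  interpret D: banach_space D by (rule D(1))
  have vD: "\<phi> \<in> V" if "\<phi> \<in> vecs D" for \<phi> using that by (simp add: D_def)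
  have bound: "norm (\<phi> a) \<le> nrm E a * nrm D \<phi>" if "\<phi> \<in> vecs D" "a \<in> vecs E" for \<phi> a
  proof -
    have "norm (\<phi> (scl E (of_real (1 / nrm E a)) a)) \<le> nrm D \<phi>"
      using D(2)[OF that(1), of "scl E (of_real (1 / nrm E a)) a"] unit[OF vD[OF that(1)] that(2)]
      by (simp add: p_def)
    then show ?thesis
      using unit[OF vD[OF that(1)] that(2)] mult_left_mono[OF _ nrm_nonneg[OF that(2)]] order_trans by blast
  qed
  have dualD: "\<phi> \<in> dual E" if "\<phi> \<in> vecs D" for \<phi>
    using vD[OF that] bound[OF that] unfolding V_def
    by (intro dualI[where C = "nrm D \<phi>"]) (auto simp: mult.commute)
  let ?P = "(\<lambda>N (\<phi>::'v \<Rightarrow> 'k). \<Sum>i<N. norm (\<phi> (x i))) ` (UNIV :: nat set)"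
  have xv: "x n \<in> vecs E" for n by (rule wuC_vecs[OF x])
  have "\<exists>C. \<forall>p\<in>?P. \<forall>\<phi>\<in>vecs D. p \<phi> \<le> C * nrm D \<phi>"
  proof (rule D.uniform_boundedness)
    fix q and \<phi> \<phi>' :: "'v \<Rightarrow> 'k" assume "q \<in> ?P"
    then obtain N where q: "q = (\<lambda>\<phi>::'v \<Rightarrow> 'k. \<Sum>i<N. norm (\<phi> (x i)))" by auto
    show "q (\<phi> + \<phi>') \<le> q \<phi> + q \<phi>'"
      unfolding q sum.distrib[symmetric] by (intro sum_mono) (simp add: norm_triangle_ineq)
    show "q (scl D c \<phi>) = norm c * q \<phi>" for c
      by (simp add: q D_def norm_mult sum_distrib_left)
    have "q \<phi> \<le> (\<Sum>i<N. nrm E (x i)) * nrm D \<phi>" if "\<phi> \<in> vecs D" for \<phi>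
      unfolding q sum_distrib_right by (intro sum_mono bound that xv)
    then show "\<exists>C. \<forall>\<phi>\<in>vecs D. q \<phi> \<le> C * nrm D \<phi>" by blast
  next
    fix \<phi> assume "\<phi> \<in> vecs D"
    then have s: "summable (\<lambda>i. norm (\<phi> (x i)))" using wuC_summable[OF x] dualD by blast
    show "\<exists>B. \<forall>q\<in>?P. q \<phi> \<le> B"
      using sum_le_suminf[OF s] by (intro exI[of _ "\<Sum>i. norm (\<phi> (x i))"]) auto
  qed
  then obtain C where C: "\<And>N \<phi>. \<phi> \<in> vecs D \<Longrightarrow> (\<Sum>i<N. norm (\<phi> (x i))) \<le> C * nrm D \<phi>" by auto
  show ?thesis
  proof (rule that)
    fix \<phi> N assume \<phi>: "\<phi> \<in> dual E" "\<And>y. y \<in> vecs E \<Longrightarrow> norm (\<phi> y) \<le> nrm E y"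
    define \<phi>' where "\<phi>' y = (if y \<in> vecs E then \<phi> y else 0)" for y
    have "\<phi>' \<in> V" unfolding V_def \<phi>'_def using \<phi>(1) by (simp add: dual_add dual_scl)
    moreover have p1: "p j \<phi>' \<le> 1" if "j \<in> J" for j
      using that \<phi>(2)[of j] by (auto simp: p_def \<phi>'_def J_def)
    ultimately have v: "\<phi>' \<in> vecs D" using bdd_aboveI2[of J "\<lambda>j. p j \<phi>'" 1] by (simp add: D_def)
    have "nrm D \<phi>' \<le> 1" using p1 J_ne by (auto simp: D_def intro: cSUP_least)
    then have "C * nrm D \<phi>' \<le> \<bar>C\<bar> * 1" using D.nrm_nonneg[OF v] by (intro mult_mono) auto
    then show "(\<Sum>i<N. norm (\<phi> (x i))) \<le> \<bar>C\<bar>"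
      using C[OF v, of N] xv by (simp add: \<phi>'_def)
  qed
qed

text \<open>A norming functional of the weighted sum reduces the claim to the bound for
  \<open>\<Sum>i<N. norm (\<phi> (x i))\<close>, where the weights disappear.\<close>

lemma wuC_bounded_multipliers:
  assumes x: "wuC E x"
  obtains C where "C \<ge> 0" "\<And>c N. (\<And>i. norm (c i) \<le> 1) \<Longrightarrow> nrm E (\<Sum>i<N. scl E (c i) (x i)) \<le> C"
proof -
  obtain C where C: "\<And>\<phi> N. \<phi> \<in> dual E \<Longrightarrow> (\<And>y. y \<in> vecs E \<Longrightarrow> norm (\<phi> y) \<le> nrm E y) \<Longrightarrow>
      (\<Sum>i<N. norm (\<phi> (x i))) \<le> C"
    using wuC_dual_bound[OF x] by metis
  have xv: "x n \<in> vecs E" for n by (rule wuC_vecs[OF x])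
  have *: "nrm E (\<Sum>i<N. scl E (c i) (x i)) \<le> C" if c: "\<And>i. norm (c i) \<le> 1" for c N
  proof -
    let ?s = "\<Sum>i<N. scl E (c i) (x i)"
    have s: "?s \<in> vecs E" by (intro vecs_sum vecs_scl xv)
    obtain \<psi> where \<psi>: "\<psi> \<in> dual E" "\<And>x. x \<in> vecs E \<Longrightarrow> norm (\<psi> x) \<le> nrm E x" "\<psi> ?s = of_real (nrm E ?s)"
      using norming_functional[OF s] by blast
    have "nrm E ?s = norm (\<psi> ?s)" using \<psi>(3) nrm_nonneg[OF s] by simp
    also have "\<psi> ?s = (\<Sum>i<N. c i * \<psi> (x i))"
      using \<psi>(1) xv by (simp add: dual_sum dual_scl)
    also have "norm \<dots> \<le> (\<Sum>i<N. norm (c i * \<psi> (x i)))" by (rule norm_sum)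
    also have "\<dots> \<le> (\<Sum>i<N. norm (\<psi> (x i)))"
      using c by (intro sum_mono) (simp add: norm_mult mult_left_le_one_le)
    also have "\<dots> \<le> C" by (rule C[OF \<psi>(1,2)])
    finally show ?thesis .
  qed
  have "0 \<le> C" using *[of "\<lambda>_. 0" 0] by simp
  then show ?thesis using that * by blast
qed

lemma wuC_add:
  assumes "wuC E x" "wuC E y" shows "wuC E (\<lambda>n. x n + y n)"
  unfolding wuC_def
proof (intro conjI ballI)
  have v: "x n \<in> vecs E" "y n \<in> vecs E" for n using assms by (auto intro: wuC_vecs)
  then show "range (\<lambda>n. x n + y n) \<subseteq> vecs E" by auto
  fix \<phi> assume p: "\<phi> \<in> dual E"
  have "summable (\<lambda>n. norm (\<phi> (x n)) + norm (\<phi> (y n)))"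
    by (intro summable_add wuC_summable[OF _ p] assms)
  then show "summable (\<lambda>n. norm (\<phi> (x n + y n)))"
    by (rule summable_comparison_test') (simp add: dual_add[OF p v(1) v(2)] norm_triangle_ineq)
qed

lemma wuC_reindex:
  assumes "wuC E x" "inj r" shows "wuC E (\<lambda>n. x (r n))"
  unfolding wuC_def
proof (intro conjI ballI)
  show "range (\<lambda>n. x (r n)) \<subseteq> vecs E" using wuC_vecs[OF assms(1)] by auto
  fix \<phi> assume p: "\<phi> \<in> dual E"
  show "summable (\<lambda>n. norm (\<phi> (x (r n))))"
    using summable_reindex[OF wuC_summable[OF assms(1) p] assms(2)] by (simp add: o_def)
qed

text \<open>Partial sums of a w.u.C. series with an arbitrary starting vector. Constant sequences
  are included, so fixed and moving arguments of a multilinear map are treated alike.\<close>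

definition wuC_sums :: "(nat \<Rightarrow> 'v) \<Rightarrow> bool" where
  "wuC_sums t \<longleftrightarrow> t 0 \<in> vecs E \<and> wuC E (\<lambda>n. t (Suc n) - t n)"

lemma wuC_sums_vecs: assumes t: "wuC_sums t" shows "t n \<in> vecs E"
proof (induction n)
  case (Suc n)
  have "t (Suc n) - t n \<in> vecs E" using t wuC_vecs unfolding wuC_sums_def by blast
  then show ?case using Suc vecs_add[of "t (Suc n) - t n" "t n"] by simp
qed (use t in \<open>simp add: wuC_sums_def\<close>)

lemma wuC_zero: "wuC E (\<lambda>_. 0)"
  unfolding wuC_def by (auto simp: dual_0)

lemma wuC_sums_const: "x \<in> vecs E \<Longrightarrow> wuC_sums (\<lambda>_. x)"
  unfolding wuC_sums_def by (simp add: wuC_zero)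

lemma wuC_sums_add: "wuC_sums s \<Longrightarrow> wuC_sums t \<Longrightarrow> wuC_sums (\<lambda>n. s n + t n)"
  unfolding wuC_sums_def using wuC_add[of "\<lambda>n. s (Suc n) - s n" "\<lambda>n. t (Suc n) - t n"]
  by (simp add: algebra_simps)

lemma wuC_sums_sum:
  "(\<And>i. i \<in> S \<Longrightarrow> wuC_sums (t i)) \<Longrightarrow> wuC_sums (\<lambda>n. \<Sum>i\<in>S. t i n)"
  by (induction S rule: infinite_finite_induct) (auto intro: wuC_sums_add wuC_sums_const)

lemma wuC_partial_sums: assumes "wuC E x" shows "wuC_sums (\<lambda>n. \<Sum>i\<le>n. x i)"
  unfolding wuC_sums_def using wuC_vecs[OF assms] wuC_reindex[OF assms, of Suc] by simp

text \<open>Each new difference telescopes over an interval of old indices; the intervals are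
  disjoint, so the old sum of absolute values bounds the new one. \<open>r\<close> may stand still,
  which produces zero terms.\<close>

lemma wuC_sums_mono:
  assumes t: "wuC_sums t" and r: "mono r" shows "wuC_sums (\<lambda>n. t (r n))"
  unfolding wuC_sums_def wuC_def
proof (intro conjI ballI)
  have v: "t n \<in> vecs E" for n by (rule wuC_sums_vecs[OF t])
  then show "t (r 0) \<in> vecs E" "range (\<lambda>n. t (r (Suc n)) - t (r n)) \<subseteq> vecs E" by auto
  fix \<phi> assume p: "\<phi> \<in> dual E"
  have s: "summable (\<lambda>n. norm (\<phi> (t (Suc n) - t n)))"
    using t p unfolding wuC_sums_def wuC_def by blast
  have tel: "norm (\<phi> (t b - t a)) \<le> (\<Sum>i\<in>{a..<b}. norm (\<phi> (t (Suc i) - t i)))" if "a \<le> b" for a b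
  proof -
    have "\<phi> (t b - t a) = (\<Sum>i\<in>{a..<b}. \<phi> (t (Suc i) - t i))"
      using sum_Suc_diff'[OF that, of t] dual_sum[OF p, of "{a..<b}" "\<lambda>i. t (Suc i) - t i"] v by simp
    then show ?thesis by (simp add: norm_sum)
  qed
  show "summable (\<lambda>n. norm (\<phi> (t (r (Suc n)) - t (r n))))"
  proof (rule summableI_nonneg_bounded)
    fix N
    have "(\<Sum>n<N. norm (\<phi> (t (r (Suc n)) - t (r n)))) \<le> (\<Sum>i\<in>{r 0..<r N}. norm (\<phi> (t (Suc i) - t i)))"
    proof (induction N)
      case (Suc N)
      have "r 0 \<le> r N" "r N \<le> r (Suc N)" using r by (auto simp: mono_def)
      then have "(\<Sum>i\<in>{r 0..<r (Suc N)}. norm (\<phi> (t (Suc i) - t i)))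
          = (\<Sum>i\<in>{r 0..<r N}. norm (\<phi> (t (Suc i) - t i))) + (\<Sum>i\<in>{r N..<r (Suc N)}. norm (\<phi> (t (Suc i) - t i)))"
        by (simp add: sum.atLeastLessThan_concat)
      then show ?case using Suc tel[OF \<open>r N \<le> r (Suc N)\<close>] by simp
    qed simp
    also have "\<dots> \<le> (\<Sum>i. norm (\<phi> (t (Suc i) - t i)))"
      by (intro sum_le_suminf s) auto
    finally show "(\<Sum>n<N. norm (\<phi> (t (r (Suc n)) - t (r n)))) \<le> (\<Sum>i. norm (\<phi> (t (Suc i) - t i)))" .
  qed auto
qed

text \<open>Blocks and the gaps between them become consecutive intervals of one nondecreasing index
  sequence, the form in which \<open>wuC_sums_mono\<close> can be applied.\<close>

lemma interleave_blocks:
  fixes p q :: "nat \<Rightarrow> nat"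
  assumes "\<And>j. p j \<le> q j" "\<And>j. q j \<le> p (Suc j)"
  obtains l :: "nat \<Rightarrow> nat" where "mono l" "\<And>j. l (2 * j) = p j" "\<And>j. l (Suc (2 * j)) = q j"
proof -
  define l where "l n = (if even n then p (n div 2) else q (n div 2))" for n
  have "l n \<le> l (Suc n)" for n
    using assms by (cases "even n") (auto simp: l_def elim!: evenE oddE)
  then have "mono l" by (simp add: mono_iff_le_Suc)
  then show ?thesis using that[of l] by (simp add: l_def)
qed

lemma wuC_sums_blocks:
  fixes p q :: "nat \<Rightarrow> nat"
  assumes t: "wuC_sums t" and "\<And>j. p j \<le> q j" "\<And>j. q j \<le> p (Suc j)"
  shows "wuC E (\<lambda>j. t (q j) - t (p j))"
proof -
  obtain l where l: "mono l" "\<And>j. l (2 * j) = p j" "\<And>j. l (Suc (2 * j)) = q j"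
    using interleave_blocks[of p q] assms by blast
  have "wuC E (\<lambda>n. t (l (Suc n)) - t (l n))"
    using wuC_sums_mono[OF t l(1)] unfolding wuC_sums_def by blast
  from wuC_reindex[OF this, of "\<lambda>j. 2 * j"] show ?thesis
    by (simp add: l inj_def)
qed

lemma wuC_sums_bounded:
  assumes t: "wuC_sums t" obtains C where "\<And>n. nrm E (t n) \<le> C"
proof -
  have d: "wuC E (\<lambda>n. t (Suc n) - t n)" using t unfolding wuC_sums_def by blast
  obtain C where C: "\<And>c N. (\<And>i. norm (c i) \<le> 1) \<Longrightarrow> nrm E (\<Sum>i<N. scl E (c i) (t (Suc i) - t i)) \<le> C"
    using wuC_bounded_multipliers[OF d] by metis
  have v: "t n \<in> vecs E" for n by (rule wuC_sums_vecs[OF t])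
  have "nrm E (t n) \<le> C + nrm E (t 0)" for n
  proof -
    have "t n = (\<Sum>i<n. scl E 1 (t (Suc i) - t i)) + t 0"
      using sum_Suc_diff'[of 0 n t] by (simp add: lessThan_atLeast0)
    moreover have "(\<Sum>i<n. scl E 1 (t (Suc i) - t i)) \<in> vecs E" by (intro vecs_sum vecs_scl vecs_diff v)
    ultimately show ?thesis
      using nrm_triangle[OF _ v[of 0]] C[of "\<lambda>_. 1" n] by fastforce
  qed
  then show ?thesis using that by blast
qed

lemma unconditionally_converging_wuC_sums:
  assumes P: "unconditionally_converging E F P" and t: "wuC_sums t"
  obtains l where "limitin (norm_top F) (\<lambda>n. P (t n)) l sequentially"
proof -
  \<comment> \<open>The start \<open>t 0\<close> becomes the term with index \<open>0\<close>, so
    that the sums over \<open>i \<le> n\<close> are exactly \<open>t n\<close>.\<close>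
  define x where "x n = (case n of 0 \<Rightarrow> t 0 | Suc n \<Rightarrow> t (Suc n) - t n)" for n
  have s: "(\<Sum>i\<le>n. x i) = t n" for n by (induction n) (auto simp: x_def)
  have "wuC E x"
    unfolding wuC_def
  proof (intro conjI ballI)
    show "range x \<subseteq> vecs E" using wuC_sums_vecs[OF t] by (auto simp: x_def split: nat.splits)
    fix \<phi> assume "\<phi> \<in> dual E"
    then have "summable (\<lambda>n. norm (\<phi> (x (Suc n))))" using t unfolding wuC_sums_def wuC_def x_def by simp
    then show "summable (\<lambda>n. norm (\<phi> (x n)))" by (subst (asm) summable_Suc_iff)
  qed
  then show ?thesis using P that unfolding unconditionally_converging_def s[symmetric] by blast
qed

end

section \<open>The weak topology\<close>

lemma inf_principal_eq_bot: "inf F (principal S) = bot \<longleftrightarrow> eventually (\<lambda>y. y \<notin> S) F"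
  unfolding trivial_limit_def eventually_inf_principal by (rule arg_cong2[where f = eventually]) auto

text \<open>For \<open>x\<close> in \<open>vecs E\<close> this is the neighbourhood filter of
  \<open>weak_top E\<close>; as a filter it can be compared with ultrafilters by
  \<open>\<le>\<close>.\<close>

definition weak_nhds :: "('k::rc_field, 'v::ab_group_add) nspace \<Rightarrow> 'v \<Rightarrow> 'v filter" where
  "weak_nhds E x = inf (INF \<phi>\<in>dual E. filtercomap \<phi> (nhds (\<phi> x))) (principal (vecs E))"

lemma le_weak_nhds_iff:
  "U \<le> weak_nhds E x \<longleftrightarrow> (\<forall>\<phi>\<in>dual E. (\<phi> \<longlongrightarrow> \<phi> x) U) \<and> eventually (\<lambda>y. y \<in> vecs E) U"
  by (simp add: weak_nhds_def le_INF_iff le_principal filterlim_def filtermap_le_iff_le_filtercomap)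

lemma filtermap_le_weak_nhds_iff:
  "filtermap f U \<le> weak_nhds E x \<longleftrightarrow> (\<forall>\<phi>\<in>dual E. ((\<lambda>y. \<phi> (f y)) \<longlongrightarrow> \<phi> x) U) \<and> eventually (\<lambda>y. f y \<in> vecs E) U"
  by (simp add: le_weak_nhds_iff filterlim_filtermap eventually_filtermap)

lemma weak_nhds_tendsto: "\<phi> \<in> dual E \<Longrightarrow> (\<phi> \<longlongrightarrow> \<phi> x) (weak_nhds E x)"
  using le_weak_nhds_iff[of "weak_nhds E x"] by blast

lemma weak_nhds_vecs: "eventually (\<lambda>y. y \<in> vecs E) (weak_nhds E x)"
  using le_weak_nhds_iff[of "weak_nhds E x"] by blast

lemma eventually_weak_nhds:
  assumes "eventually P (weak_nhds E x)"
  obtains \<Phi> d where "finite \<Phi>" "\<Phi> \<subseteq> dual E" "d > 0"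
    "\<And>y. y \<in> vecs E \<Longrightarrow> (\<And>\<phi>. \<phi> \<in> \<Phi> \<Longrightarrow> norm (\<phi> y - \<phi> x) < d) \<Longrightarrow> P y"
proof -
  have "eventually (\<lambda>y. y \<in> vecs E \<longrightarrow> P y) (INF \<phi>\<in>dual E. filtercomap \<phi> (nhds (\<phi> x)))"
    using assms by (simp add: weak_nhds_def eventually_inf_principal)
  then obtain \<Phi> where \<Phi>: "\<Phi> \<subseteq> dual E" "finite \<Phi>"
      "eventually (\<lambda>y. y \<in> vecs E \<longrightarrow> P y) (INF \<phi>\<in>\<Phi>. filtercomap \<phi> (nhds (\<phi> x)))"
    unfolding eventually_INF[of _ _ "dual E"] by blast
  then obtain Q where Q: "\<forall>\<phi>\<in>\<Phi>. eventually (Q \<phi>) (filtercomap \<phi> (nhds (\<phi> x)))"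
      "\<forall>y. (\<forall>\<phi>\<in>\<Phi>. Q \<phi> y) \<longrightarrow> (y \<in> vecs E \<longrightarrow> P y)"
    unfolding eventually_INF_finite[OF \<Phi>(2)] by blast
  have "\<forall>\<phi>\<in>\<Phi>. \<exists>d>0. \<forall>y. norm (\<phi> y - \<phi> x) < d \<longrightarrow> Q \<phi> y"
    using Q(1) unfolding eventually_filtercomap eventually_nhds_metric dist_norm by blast
  then obtain D where D: "\<And>\<phi>. \<phi> \<in> \<Phi> \<Longrightarrow> D \<phi> > 0" "\<And>\<phi> y. \<phi> \<in> \<Phi> \<Longrightarrow> norm (\<phi> y - \<phi> x) < D \<phi> \<Longrightarrow> Q \<phi> y"
    by metis
  \<comment> \<open>The entry \<open>1\<close> keeps the minimum meaningful when
    \<open>\<Phi>\<close> is empty.\<close>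
  define d where "d = Min (insert 1 (D ` \<Phi>))"
  have "d > 0" using \<Phi>(2) D(1) unfolding d_def by (subst Min_gr_iff) auto
  moreover have "d \<le> D \<phi>" if "\<phi> \<in> \<Phi>" for \<phi> using that \<Phi>(2) unfolding d_def by (intro Min_le) auto
  ultimately show ?thesis
    using that[of \<Phi> d] \<Phi> D(2) Q(2) by (meson less_le_trans)
qed

lemma eventually_weak_nhdsI:
  assumes "finite \<Phi>" "\<Phi> \<subseteq> dual E" "d > 0"
    "\<And>y. y \<in> vecs E \<Longrightarrow> (\<And>\<phi>. \<phi> \<in> \<Phi> \<Longrightarrow> norm (\<phi> y - \<phi> x) < d) \<Longrightarrow> P y"
  shows "eventually P (weak_nhds E x)"
proof -
  have "\<forall>\<phi>\<in>\<Phi>. eventually (\<lambda>y. norm (\<phi> y - \<phi> x) < d) (weak_nhds E x)"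
    using assms(2,3) weak_nhds_tendsto tendstoD unfolding dist_norm[symmetric] by blast
  then have "eventually (\<lambda>y. \<forall>\<phi>\<in>\<Phi>. norm (\<phi> y - \<phi> x) < d) (weak_nhds E x)"
    by (rule eventually_ball_finite[OF assms(1)])
  then show ?thesis using weak_nhds_vecs[of E x]
    by eventually_elim (use assms(4) in blast)
qed

lemma openin_weak_top_basis:
  "\<phi> \<in> dual E \<Longrightarrow> open V \<Longrightarrow> openin (weak_top E) {y \<in> vecs E. \<phi> y \<in> V}"
  unfolding weak_top_def by (rule topology_generated_by_Basis) blast

lemma openin_weak_top_vecs: "openin (weak_top E) (vecs E)"
  using openin_topspace[of "weak_top E"] by (simp add: topspace_weak_top)

lemma eventually_weak_nhds_openin:
  assumes "eventually P (weak_nhds E x)" "x \<in> vecs E"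
  obtains W where "openin (weak_top E) W" "x \<in> W" "\<And>y. y \<in> W \<Longrightarrow> P y"
proof -
  obtain \<Phi> d where \<Phi>: "finite \<Phi>" "\<Phi> \<subseteq> dual E" "d > 0"
    "\<And>y. y \<in> vecs E \<Longrightarrow> (\<And>\<phi>. \<phi> \<in> \<Phi> \<Longrightarrow> norm (\<phi> y - \<phi> x) < d) \<Longrightarrow> P y"
    using eventually_weak_nhds[OF assms(1)] by blast
  define W where "W = vecs E \<inter> (\<Inter>\<phi>\<in>\<Phi>. {y \<in> vecs E. \<phi> y \<in> ball (\<phi> x) d})"
  have "openin (weak_top E) W"
  proof (cases "\<Phi> = {}")
    case True then show ?thesis by (simp add: W_def openin_weak_top_vecs)
  next
    case False
    then show ?thesis
      unfolding W_def using \<Phi>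
      by (intro openin_Int openin_weak_top_vecs openin_INT2 openin_weak_top_basis) auto
  qed
  moreover have "x \<in> W" using assms(2) \<Phi>(3) by (simp add: W_def)
  moreover have "P y" if "y \<in> W" for y
    using that \<Phi>(4)[of y] by (auto simp: W_def dist_norm norm_minus_commute)
  ultimately show ?thesis using that by blast
qed

lemma openin_weak_top_eventually:
  assumes "openin (weak_top E) W" "x \<in> W"
  shows "eventually (\<lambda>y. y \<in> W) (weak_nhds E x)"
proof -
  have "generate_topology_on {{x \<in> vecs E. \<phi> x \<in> U} |\<phi> U. \<phi> \<in> dual E \<and> open U} W"
    using assms(1) unfolding weak_top_def openin_topology_generated_by_iff .
  then show ?thesis using assms(2)
  proof (induction W arbitrary: x)
    case (Int a b)
    then show ?case by (auto intro: eventually_conj)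
  next
    case (UN K)
    then obtain k where "k \<in> K" "x \<in> k" by blast
    with UN show ?case by (auto intro: eventually_mono[OF UN.IH])
  next
    case (Basis s)
    then obtain \<phi> U where *: "\<phi> \<in> dual E" "open U" "s = {x \<in> vecs E. \<phi> x \<in> U}" by blast
    have "eventually (\<lambda>y. \<phi> y \<in> U) (weak_nhds E x)"
      using weak_nhds_tendsto[OF *(1), of x] *(2,3) Basis.prems by (auto dest: topological_tendstoD)
    then show ?case using weak_nhds_vecs[of E x] by eventually_elim (simp add: *(3))
  qed simp
qed

lemma closure_of_weak_top:
  "z \<in> weak_top E closure_of S \<longleftrightarrow> z \<in> vecs E \<and> inf (weak_nhds E z) (principal S) \<noteq> bot"
proof -
  have "inf (weak_nhds E z) (principal S) = bot \<longleftrightarrow> eventually (\<lambda>y. y \<notin> S) (weak_nhds E z)"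
    by (simp add: inf_principal_eq_bot)
  moreover have "(\<forall>T. z \<in> T \<and> openin (weak_top E) T \<longrightarrow> (\<exists>y. y \<in> S \<and> y \<in> T)) \<longleftrightarrow>
      \<not> eventually (\<lambda>y. y \<notin> S) (weak_nhds E z)" if z: "z \<in> vecs E"
  proof
    assume L: "\<forall>T. z \<in> T \<and> openin (weak_top E) T \<longrightarrow> (\<exists>y. y \<in> S \<and> y \<in> T)"
    show "\<not> eventually (\<lambda>y. y \<notin> S) (weak_nhds E z)"
    proof
      assume "eventually (\<lambda>y. y \<notin> S) (weak_nhds E z)"
      from eventually_weak_nhds_openin[OF this z] obtain W
        where W: "openin (weak_top E) W" "z \<in> W" "\<And>y. y \<in> W \<Longrightarrow> y \<notin> S" by metis
      then obtain y where "y \<in> S" "y \<in> W" using L by metis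
      with W(3) show False by metis
    qed
  next
    assume R: "\<not> eventually (\<lambda>y. y \<notin> S) (weak_nhds E z)"
    show "\<forall>T. z \<in> T \<and> openin (weak_top E) T \<longrightarrow> (\<exists>y. y \<in> S \<and> y \<in> T)"
    proof (intro allI impI)
      fix T assume "z \<in> T \<and> openin (weak_top E) T"
      then have "eventually (\<lambda>y. y \<in> T) (weak_nhds E z)" using openin_weak_top_eventually by blast
      then show "\<exists>y. y \<in> S \<and> y \<in> T"
        using R by (metis (mono_tags, lifting) eventually_mono)
    qed
  qed
  ultimately show ?thesis unfolding in_closure_of topspace_weak_top by blast
qed

text \<open>Ultrafilters on \<open>S\<close> suffice for compactness of its closure, because the
  weak topology is regular. If finitely many halved neighbourhoods \<open>V c\<close> covered
  \<open>S\<close>, the sets \<open>C c\<close> would cover the closure. Otherwise some ultrafilter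
  on \<open>S\<close> avoids every \<open>V c\<close>, yet it converges to a point of the
  closure.\<close>

lemma compactin_weak_closure_iff:
  assumes S: "S \<subseteq> vecs F"
  shows "compactin (weak_top F) (weak_top F closure_of S) \<longleftrightarrow>
    (\<forall>U. ultra U \<and> U \<le> principal S \<longrightarrow> (\<exists>l\<in>vecs F. U \<le> weak_nhds F l))" (is "?L \<longleftrightarrow> ?R")
proof
  assume L: ?L
  show ?R
  proof (intro allI impI)
    fix U assume U: "ultra U \<and> U \<le> principal S"
    let ?K = "weak_top F closure_of S"
    let ?W = "{W. openin (weak_top F) W \<and> \<not> eventually (\<lambda>y. y \<in> W) U}"
    have SK: "S \<subseteq> ?K" using S by (simp add: closure_of_subset topspace_weak_top)
    show "\<exists>l\<in>vecs F. U \<le> weak_nhds F l"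
    proof (rule ccontr)
      assume n: "\<not> ?thesis"
      have "?K \<subseteq> \<Union>?W"
      proof
        fix l assume "l \<in> ?K"
        then have l: "l \<in> vecs F" by (simp add: closure_of_weak_top)
        then obtain P where P: "eventually P (weak_nhds F l)" "\<not> eventually P U"
          using n by (auto simp: le_filter_def)
        obtain W where W: "openin (weak_top F) W" "l \<in> W" "\<And>y. y \<in> W \<Longrightarrow> P y"
          using eventually_weak_nhds_openin[OF P(1) l] by blast
        then have "W \<in> ?W" using P(2) eventually_mono[of "\<lambda>y. y \<in> W" U P] by blast
        then show "l \<in> \<Union>?W" using W(2) by blast
      qed
      then obtain \<F> where \<F>: "finite \<F>" "\<F> \<subseteq> ?W" "?K \<subseteq> \<Union>\<F>"
        using L[unfolded compactin_def, THEN conjunct2, rule_format, of ?W] by blast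
      have "\<forall>W\<in>\<F>. eventually (\<lambda>y. y \<notin> W) U" using \<F>(2) U unfolding ultra_def by blast
      then have "eventually (\<lambda>y. \<forall>W\<in>\<F>. y \<notin> W) U" by (rule eventually_ball_finite[OF \<F>(1)])
      moreover have "eventually (\<lambda>y. y \<in> S) U" using U by (simp add: le_principal)
      ultimately have "eventually (\<lambda>y. False) U" by eventually_elim (use SK \<F>(3) in blast)
      then show False using U by (simp add: ultra_def)
    qed
  qed
next
  assume R: ?R
  let ?K = "weak_top F closure_of S"
  show ?L
    unfolding compactin_def
  proof (intro conjI allI impI)
    show "?K \<subseteq> topspace (weak_top F)" by (rule closure_of_subset_topspace)
    fix \<C> assume C: "Ball \<C> (openin (weak_top F)) \<and> ?K \<subseteq> \<Union>\<C>"
    have "\<exists>C \<Phi> d. C \<in> \<C> \<and> finite \<Phi> \<and> \<Phi> \<subseteq> dual F \<and> d > 0 \<and>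
        (\<forall>y\<in>vecs F. (\<forall>\<phi>\<in>\<Phi>. norm (\<phi> y - \<phi> c) < d) \<longrightarrow> y \<in> C)" if cK: "c \<in> ?K" for c
    proof -
      obtain C where "C \<in> \<C>" "c \<in> C" using C cK by blast
      then have "eventually (\<lambda>y. y \<in> C) (weak_nhds F c)" using C openin_weak_top_eventually by blast
      from eventually_weak_nhds[OF this] show ?thesis using \<open>C \<in> \<C>\<close> by metis
    qed
    then have "\<forall>c. \<exists>C \<Phi> d. c \<in> ?K \<longrightarrow> C \<in> \<C> \<and> finite \<Phi> \<and> \<Phi> \<subseteq> dual F \<and> d > 0 \<and>
        (\<forall>y\<in>vecs F. (\<forall>\<phi>\<in>\<Phi>. norm (\<phi> y - \<phi> c) < d) \<longrightarrow> y \<in> C)"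
      by blast
    then obtain C \<Phi> d where "\<forall>c. c \<in> ?K \<longrightarrow> C c \<in> \<C> \<and> finite (\<Phi> c) \<and> \<Phi> c \<subseteq> dual F \<and> d c > (0::real) \<and>
        (\<forall>y\<in>vecs F. (\<forall>\<phi>\<in>\<Phi> c. norm (\<phi> y - \<phi> c) < d c) \<longrightarrow> y \<in> C c)"
      unfolding choice_iff by blast
    then have c: "\<And>c. c \<in> ?K \<Longrightarrow> C c \<in> \<C>" "\<And>c. c \<in> ?K \<Longrightarrow> finite (\<Phi> c)"
      "\<And>c. c \<in> ?K \<Longrightarrow> \<Phi> c \<subseteq> dual F" "\<And>c. c \<in> ?K \<Longrightarrow> d c > (0::real)"
      "\<And>c y. c \<in> ?K \<Longrightarrow> y \<in> vecs F \<Longrightarrow> (\<And>\<phi>. \<phi> \<in> \<Phi> c \<Longrightarrow> norm (\<phi> y - \<phi> c) < d c) \<Longrightarrow> y \<in> C c"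
      by blast+
    define V where "V c = {y. \<forall>\<phi>\<in>\<Phi> c. norm (\<phi> y - \<phi> c) < d c / 2}" for c
    show "\<exists>\<F>. finite \<F> \<and> \<F> \<subseteq> \<C> \<and> ?K \<subseteq> \<Union>\<F>"
    proof (rule ccontr)
      assume no: "\<not> ?thesis"
      have notcov: "\<not> S \<subseteq> (\<Union>c\<in>X. V c)" if X: "finite X" "X \<subseteq> ?K" for X
      proof
        assume cov: "S \<subseteq> (\<Union>c\<in>X. V c)"
        have "?K \<subseteq> \<Union>(C ` X)"
        proof
          fix z assume z: "z \<in> ?K"
          show "z \<in> \<Union>(C ` X)"
          proof (rule ccontr)
            assume nz: "z \<notin> \<Union>(C ` X)"
            have "\<forall>c\<in>X. eventually (\<lambda>y. y \<notin> V c) (weak_nhds F z)"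
            proof
              fix c assume cX: "c \<in> X"
              then have cK: "c \<in> ?K" using X by blast
              \<comment> \<open>A point outside \<open>C c\<close> keeps the full distance
                \<open>d c\<close> from \<open>c\<close> in some functional, hence points weakly
                near it stay farther than \<open>d c / 2\<close>.\<close>
              obtain \<phi> where \<phi>: "\<phi> \<in> \<Phi> c" "norm (\<phi> z - \<phi> c) \<ge> d c"
                using c(5)[OF cK, of z] nz cX z by (force simp: closure_of_weak_top not_less)
              have "((\<lambda>y. norm (\<phi> y - \<phi> c)) \<longlongrightarrow> norm (\<phi> z - \<phi> c)) (weak_nhds F z)"
                using \<phi>(1) c(3)[OF cK] by (intro tendsto_intros weak_nhds_tendsto) auto
              then have "eventually (\<lambda>y. norm (\<phi> y - \<phi> c) > d c / 2) (weak_nhds F z)"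
                using \<phi>(2) c(4)[OF cK] by (intro order_tendstoD(1)) auto
              then show "eventually (\<lambda>y. y \<notin> V c) (weak_nhds F z)"
                by eventually_elim (use \<phi>(1) in \<open>force simp: V_def\<close>)
            qed
            then have "eventually (\<lambda>y. \<forall>c\<in>X. y \<notin> V c) (weak_nhds F z)"
              by (rule eventually_ball_finite[OF X(1)])
            then have "eventually (\<lambda>y. False) (inf (weak_nhds F z) (principal S))"
              unfolding eventually_inf_principal by eventually_elim (use cov in blast)
            then show False using z by (simp add: closure_of_weak_top)
          qed
        qed
        then have "finite (C ` X) \<and> C ` X \<subseteq> \<C> \<and> ?K \<subseteq> \<Union>(C ` X)" using X c(1) by blast
        then show False using no by metis
      qed
      let ?G = "inf (INF c\<in>?K. principal (- V c)) (principal S)"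
      have "?G \<noteq> bot"
      proof
        assume "?G = bot"
        then have "eventually (\<lambda>y. y \<notin> S) (INF c\<in>?K. principal (- V c))"
          by (simp add: inf_principal_eq_bot)
        then obtain X where X: "X \<subseteq> ?K" "finite X" "eventually (\<lambda>y. y \<notin> S) (INF c\<in>X. principal (- V c))"
          unfolding eventually_INF[of _ _ ?K] by blast
        then have "eventually (\<lambda>y. y \<notin> S) (principal (\<Inter>c\<in>X. - V c))"
          by (simp add: INF_principal_finite)
        then show False using notcov[OF X(2,1)] by (auto simp: eventually_principal)
      qed
      then obtain U where U: "U \<le> ?G" "ultra U" using ultra_exists by blast
      then have US: "U \<le> principal S" by simp
      then obtain l where l: "l \<in> vecs F" "U \<le> weak_nhds F l" using R U(2) by blast
      have "U \<le> inf (weak_nhds F l) (principal S)" using l(2) US by simp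
      then have lK: "l \<in> ?K" using l(1) U(2) unfolding closure_of_weak_top ultra_def by (metis bot.extremum_uniqueI)
      have "U \<le> principal (- V l)" using U(1) lK by (meson INF_lower inf.boundedE order_trans)
      then have "eventually (\<lambda>y. y \<notin> V l) U" by (simp add: le_principal)
      moreover have "eventually (\<lambda>y. y \<in> V l) (weak_nhds F l)"
        by (rule eventually_weak_nhdsI[OF c(2,3)[OF lK], of "d l / 2"]) (use c(4)[OF lK] in \<open>auto simp: V_def\<close>)
      then have "eventually (\<lambda>y. y \<in> V l) U" using l(2) by (simp add: le_filter_def)
      ultimately have "eventually (\<lambda>y. False) U" by eventually_elim simp
      then show False using U(2) by (simp add: ultra_def)
    qed
  qed
qed

abbreviation unit_ball :: "('k, 'v) nspace \<Rightarrow> 'v set" where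
  "unit_ball E \<equiv> {x \<in> vecs E. nrm E x \<le> 1}"

text \<open>The test is moved from the image to the ball. An ultrafilter on the image lifts to an
  ultrafilter on the ball; the image of the lift is finer than the given ultrafilter and so equal to
  it.\<close>

lemma weakly_compact_iff:
  assumes P: "\<And>x. x \<in> vecs E \<Longrightarrow> P x \<in> vecs F"
  shows "weakly_compact E F P \<longleftrightarrow> (\<forall>U. ultra U \<and> U \<le> principal (unit_ball E) \<longrightarrow>
     (\<exists>l\<in>vecs F. \<forall>\<psi>\<in>dual F. ((\<lambda>x. \<psi> (P x)) \<longlongrightarrow> \<psi> l) U))" (is "_ \<longleftrightarrow> ?R")
proof -
  have S: "P ` unit_ball E \<subseteq> vecs F" using P by auto
  have conv: "(\<forall>\<psi>\<in>dual F. ((\<lambda>x. \<psi> (P x)) \<longlongrightarrow> \<psi> l) U) \<longleftrightarrow> filtermap P U \<le> weak_nhds F l"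
    if "U \<le> principal (unit_ball E)" for U l
  proof -
    have "eventually (\<lambda>y. P y \<in> vecs F) U"
      using that P unfolding le_principal by (auto elim: eventually_mono)
    then show ?thesis by (simp add: filtermap_le_weak_nhds_iff)
  qed
  have "(\<forall>U. ultra U \<and> U \<le> principal (P ` unit_ball E) \<longrightarrow> (\<exists>l\<in>vecs F. U \<le> weak_nhds F l)) \<longleftrightarrow> ?R"
  proof (intro iffI allI impI)
    fix U assume L: "\<forall>U. ultra U \<and> U \<le> principal (P ` unit_ball E) \<longrightarrow> (\<exists>l\<in>vecs F. U \<le> weak_nhds F l)"
      and U: "ultra U \<and> U \<le> principal (unit_ball E)"
    have "filtermap P U \<le> principal (P ` unit_ball E)"
      using U unfolding le_principal eventually_filtermap by (auto elim: eventually_mono)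
    then obtain l where "l \<in> vecs F" "filtermap P U \<le> weak_nhds F l"
      using L[rule_format, of "filtermap P U"] ultra_filtermap[of U P] U by metis
    then show "\<exists>l\<in>vecs F. \<forall>\<psi>\<in>dual F. ((\<lambda>x. \<psi> (P x)) \<longlongrightarrow> \<psi> l) U"
      using U conv[of U l] by metis
  next
    fix U assume R: ?R and U: "ultra U \<and> U \<le> principal (P ` unit_ball E)"
    let ?G = "inf (filtercomap P U) (principal (unit_ball E))"
    have "?G \<noteq> bot"
    proof
      assume "?G = bot"
      then have "eventually (\<lambda>x. x \<notin> unit_ball E) (filtercomap P U)"
        by (simp add: inf_principal_eq_bot)
      then obtain Q where Q: "eventually Q U" "\<And>x. Q (P x) \<Longrightarrow> x \<notin> unit_ball E"
        unfolding eventually_filtercomap by blast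
      have "eventually (\<lambda>y. y \<in> P ` unit_ball E) U" using U by (simp add: le_principal)
      with Q(1) have "eventually (\<lambda>y. False) U" by eventually_elim (use Q(2) in blast)
      then show False using U by (simp add: ultra_def)
    qed
    then obtain V where V: "V \<le> ?G" "ultra V" using ultra_exists by blast
    then have VB: "V \<le> principal (unit_ball E)" by simp
    then obtain l where "l \<in> vecs F" "\<forall>\<psi>\<in>dual F. ((\<lambda>x. \<psi> (P x)) \<longlongrightarrow> \<psi> l) V"
      using R[rule_format, of V] V(2) by metis
    then have l: "l \<in> vecs F" "filtermap P V \<le> weak_nhds F l" using conv[OF VB] by metis+
    have VU: "filtermap P V \<le> U" using V(1) by (simp add: filtermap_le_iff_le_filtercomap)
    have "U \<le> filtermap P V"
    proof (rule filter_leI)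
      fix Q assume Q: "eventually Q (filtermap P V)"
      show "eventually Q U"
      proof (rule ccontr)
        assume "\<not> eventually Q U"
        then have "eventually (\<lambda>y. \<not> Q y) (filtermap P V)" using U VU unfolding ultra_def by (meson le_filter_def)
        with Q have "eventually (\<lambda>y. False) (filtermap P V)" by eventually_elim simp
        then show False using ultra_filtermap[OF V(2), of P] by (simp add: ultra_def)
      qed
    qed
    then show "\<exists>l\<in>vecs F. U \<le> weak_nhds F l" using l order_trans by blast
  qed
  then show ?thesis unfolding weakly_compact_def compactin_weak_closure_iff[OF S] .
qed

text \<open>Balls replace arbitrary bounded sets and filters replace subspace topologies;
  \<open>polys_wb_scalar_iff\<close> shows the equivalence for scalar polynomials.\<close>

definition weakly_cont_on_bounded ::
    "('k::rc_field, 'v::ab_group_add) nspace \<Rightarrow> ('v \<Rightarrow> 'k) \<Rightarrow> bool" where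
  "weakly_cont_on_bounded E f \<longleftrightarrow> (\<forall>R. \<forall>x\<in>vecs E. nrm E x \<le> R \<longrightarrow>
     (f \<longlongrightarrow> f x) (inf (weak_nhds E x) (principal {y. nrm E y \<le> R})))"

lemma continuous_map_weak_iff:
  assumes B: "B \<subseteq> vecs E"
  shows "continuous_map (subtopology (weak_top E) B) euclidean (f :: 'v::ab_group_add \<Rightarrow> 'k::rc_field) \<longleftrightarrow>
    (\<forall>x\<in>B. (f \<longlongrightarrow> f x) (inf (weak_nhds E x) (principal B)))" (is "?L \<longleftrightarrow> ?R")
proof
  assume L: ?L
  show ?R
  proof (intro ballI topological_tendstoI)
    fix x U assume x: "x \<in> B" "open U" "f x \<in> U"
    have "openin (subtopology (weak_top E) B) {y \<in> topspace (subtopology (weak_top E) B). f y \<in> U}"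
      using L x(2) by (auto simp: continuous_map_def)
    then obtain T where T: "openin (weak_top E) T" "{y \<in> topspace (subtopology (weak_top E) B). f y \<in> U} = T \<inter> B"
      unfolding openin_subtopology by blast
    have "x \<in> T" using T(2) x B by (auto simp: topspace_weak_top)
    then have "eventually (\<lambda>y. y \<in> T) (weak_nhds E x)" by (rule openin_weak_top_eventually[OF T(1)])
    then show "eventually (\<lambda>y. f y \<in> U) (inf (weak_nhds E x) (principal B))"
      unfolding eventually_inf_principal by eventually_elim (use T(2) in blast)
  qed
next
  assume R: ?R
  show ?L
    unfolding continuous_map_def
  proof (intro conjI allI impI)
    fix U :: "'k set" assume "openin euclidean U"
    then have U: "open U" by simp
    let ?T = "\<Union>{W. openin (weak_top E) W \<and> (\<forall>y\<in>W \<inter> B. f y \<in> U)}"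
    have "{x \<in> topspace (subtopology (weak_top E) B). f x \<in> U} = ?T \<inter> B"
    proof (intro equalityI subsetI)
      fix x assume "x \<in> {x \<in> topspace (subtopology (weak_top E) B). f x \<in> U}"
      then have x: "x \<in> vecs E" "x \<in> B" "f x \<in> U" by (auto simp: topspace_weak_top)
      have "eventually (\<lambda>y. y \<in> B \<longrightarrow> f y \<in> U) (weak_nhds E x)"
        using topological_tendstoD[OF R[rule_format, OF x(2)] U x(3)] by (simp add: eventually_inf_principal)
      from eventually_weak_nhds_openin[OF this x(1)] obtain W
        where "openin (weak_top E) W" "x \<in> W" "\<And>y. y \<in> W \<Longrightarrow> y \<in> B \<longrightarrow> f y \<in> U" by metis
      then show "x \<in> ?T \<inter> B" using x(2) by blast
    qed (use B in \<open>auto simp: topspace_weak_top\<close>)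
    moreover have "openin (weak_top E) ?T" by (intro openin_Union) blast
    ultimately show "openin (subtopology (weak_top E) B) {x \<in> topspace (subtopology (weak_top E) B). f x \<in> U}"
      unfolding openin_subtopology by blast
  qed simp
qed

lemma (in banach_space) mbounded_iff:
  "Metric_space.mbounded (vecs E) (ndist E) B \<longleftrightarrow> B \<subseteq> vecs E \<and> (\<exists>R. \<forall>x\<in>B. nrm E x \<le> R)"
proof -
  interpret M: Metric_space "vecs E" "ndist E" by (rule Metric_space_ndist)
  show ?thesis
  proof
    assume "M.mbounded B"
    then obtain c R where "B \<subseteq> M.mcball c R" unfolding M.mbounded_def by blast
    then have *: "x \<in> vecs E \<and> c \<in> vecs E \<and> nrm E (c - x) \<le> R" if "x \<in> B" for x
      using that by (auto simp: ndist_def subset_iff)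
    have "nrm E x \<le> R + nrm E c" if "x \<in> B" for x
      using *[OF that] nrm_reverse_triangle[of c x] by linarith
    then show "B \<subseteq> vecs E \<and> (\<exists>R. \<forall>x\<in>B. nrm E x \<le> R)" using * by blast
  next
    assume "B \<subseteq> vecs E \<and> (\<exists>R. \<forall>x\<in>B. nrm E x \<le> R)"
    then obtain R where R: "B \<subseteq> vecs E" "\<forall>x\<in>B. nrm E x \<le> R" by blast
    then have "B \<subseteq> M.mcball 0 R" using nrm_minus by (auto simp: ndist_def)
    then show "M.mbounded B" unfolding M.mbounded_def by blast
  qed
qed

lemma (in banach_space) polys_wb_scalar_iff:
  "P \<in> polys_wb k E scalar_space \<longleftrightarrow> P \<in> polys k E scalar_space \<and> weakly_cont_on_bounded E P"
proof -
  have "(\<forall>B. Metric_space.mbounded (vecs E) (ndist E) B \<longrightarrow>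
       continuous_map (subtopology (weak_top E) B) euclidean P) \<longleftrightarrow> weakly_cont_on_bounded E P" (is "?L \<longleftrightarrow> ?R")
  proof
    assume L: ?L
    show ?R
      unfolding weakly_cont_on_bounded_def
    proof (intro allI ballI impI)
      fix R x assume x: "x \<in> vecs E" "nrm E x \<le> R"
      let ?B = "{y \<in> vecs E. nrm E y \<le> R}"
      have "(P \<longlongrightarrow> P x) (inf (weak_nhds E x) (principal ?B))"
        using L x continuous_map_weak_iff[of ?B E P] mbounded_iff[of ?B] by auto
      moreover have "inf (weak_nhds E x) (principal {y. nrm E y \<le> R}) \<le> inf (weak_nhds E x) (principal ?B)"
        using weak_nhds_vecs[of E x] by (auto simp: le_principal eventually_inf_principal elim: eventually_mono)
      ultimately show "(P \<longlongrightarrow> P x) (inf (weak_nhds E x) (principal {y. nrm E y \<le> R}))"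
        using tendsto_mono by blast
    qed
  next
    assume R: ?R
    show ?L
    proof (intro allI impI)
      fix B assume "Metric_space.mbounded (vecs E) (ndist E) B"
      then obtain r where B: "B \<subseteq> vecs E" "\<And>x. x \<in> B \<Longrightarrow> nrm E x \<le> r" unfolding mbounded_iff by blast
      have "(P \<longlongrightarrow> P x) (inf (weak_nhds E x) (principal B))" if "x \<in> B" for x
      proof (rule tendsto_mono)
        show "(P \<longlongrightarrow> P x) (inf (weak_nhds E x) (principal {y. nrm E y \<le> r}))"
          using R that B unfolding weakly_cont_on_bounded_def by blast
        show "inf (weak_nhds E x) (principal B) \<le> inf (weak_nhds E x) (principal {y. nrm E y \<le> r})"
          using B(2) by (intro inf_mono order_refl) auto
      qed
      then show "continuous_map (subtopology (weak_top E) B) euclidean P"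
        using continuous_map_weak_iff[OF B(1)] by blast
    qed
  qed
  then show ?thesis unfolding polys_wb_def norm_top_scalar_space by simp
qed

section \<open>Bounded multilinear maps, polynomials and polarization\<close>

section \<open>Multilinear maps and polynomials\<close>

text \<open>Multilinear maps in the slots of a finite set \<open>I\<close>, so that fixing some of the
  arguments gives a multilinear map in the remaining slots without renumbering.\<close>

definition bounded_multilinear ::
    "nat set \<Rightarrow> ('k::rc_field, 'v::ab_group_add) nspace \<Rightarrow> ('k, 'w::ab_group_add) nspace
      \<Rightarrow> ((nat \<Rightarrow> 'v) \<Rightarrow> 'w) \<Rightarrow> bool"
  where
  "bounded_multilinear I E F A \<longleftrightarrow>
     (\<forall>x. (\<forall>i\<in>I. x i \<in> vecs E) \<longrightarrow> A x \<in> vecs F) \<and>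
     (\<forall>x y. (\<forall>i\<in>I. x i = y i) \<longrightarrow> A x = A y) \<and>
     (\<forall>x i u v. i \<in> I \<longrightarrow> (\<forall>j\<in>I - {i}. x j \<in> vecs E) \<longrightarrow> u \<in> vecs E \<longrightarrow> v \<in> vecs E \<longrightarrow>
        A (x(i := u + v)) = A (x(i := u)) + A (x(i := v))) \<and>
     (\<forall>x i c u. i \<in> I \<longrightarrow> (\<forall>j\<in>I - {i}. x j \<in> vecs E) \<longrightarrow> u \<in> vecs E \<longrightarrow>
        A (x(i := scl E c u)) = scl F c (A (x(i := u)))) \<and>
     (\<exists>M\<ge>0. \<forall>x. (\<forall>i\<in>I. x i \<in> vecs E) \<longrightarrow> nrm F (A x) \<le> M * (\<Prod>i\<in>I. nrm E (x i)))"

locale multilinear = E: banach_space E + F: banach_space F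
  for E :: "('k::rc_field, 'v::ab_group_add) nspace" and F :: "('k, 'w::ab_group_add) nspace" +
  fixes I :: "nat set" and A :: "(nat \<Rightarrow> 'v) \<Rightarrow> 'w"
  assumes finite_slots: "finite I" and bml: "bounded_multilinear I E F A"
begin

lemma vecs_app: "(\<And>i. i \<in> I \<Longrightarrow> x i \<in> vecs E) \<Longrightarrow> A x \<in> vecs F"
  using bml unfolding bounded_multilinear_def by blast

lemma cong: "(\<And>i. i \<in> I \<Longrightarrow> x i = y i) \<Longrightarrow> A x = A y"
  using bml unfolding bounded_multilinear_def by blast

lemma add: "i \<in> I \<Longrightarrow> (\<And>j. j \<in> I \<Longrightarrow> j \<noteq> i \<Longrightarrow> x j \<in> vecs E) \<Longrightarrow> u \<in> vecs E \<Longrightarrow> v \<in> vecs E \<Longrightarrow>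
    A (x(i := u + v)) = A (x(i := u)) + A (x(i := v))"
  using bml[unfolded bounded_multilinear_def, THEN conjunct2, THEN conjunct2, THEN conjunct1, rule_format, of i x u v]
  by blast

lemma scl: "i \<in> I \<Longrightarrow> (\<And>j. j \<in> I \<Longrightarrow> j \<noteq> i \<Longrightarrow> x j \<in> vecs E) \<Longrightarrow> u \<in> vecs E \<Longrightarrow>
    A (x(i := scl E c u)) = scl F c (A (x(i := u)))"
  using bml[unfolded bounded_multilinear_def, THEN conjunct2, THEN conjunct2, THEN conjunct2, THEN conjunct1, rule_format, of i x u c]
  by blast

lemma bound: obtains M where "M \<ge> 0"
    "\<And>x. (\<And>i. i \<in> I \<Longrightarrow> x i \<in> vecs E) \<Longrightarrow> nrm F (A x) \<le> M * (\<Prod>i\<in>I. nrm E (x i))"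
proof -
  obtain M where "M \<ge> 0" "\<forall>x. (\<forall>i\<in>I. x i \<in> vecs E) \<longrightarrow> nrm F (A x) \<le> M * (\<Prod>i\<in>I. nrm E (x i))"
    using bml unfolding bounded_multilinear_def by blast
  then show ?thesis using that[of M] by blast
qed

text \<open>A Lipschitz constant on balls that is the same for every slot. Since
  \<open>R \<ge> 1\<close>, the exponent may be rounded up to \<open>card I\<close>.\<close>

lemma bound_slot: obtains M where "M \<ge> 0"
    "\<And>x R i u. R \<ge> 1 \<Longrightarrow> i \<in> I \<Longrightarrow> (\<And>j. j \<in> I \<Longrightarrow> j \<noteq> i \<Longrightarrow> x j \<in> vecs E \<and> nrm E (x j) \<le> R) \<Longrightarrow> u \<in> vecs E \<Longrightarrow>
       nrm F (A (x(i := u))) \<le> M * R ^ card I * nrm E u"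
proof -
  obtain M where M: "M \<ge> 0" "\<And>x. (\<And>i. i \<in> I \<Longrightarrow> x i \<in> vecs E) \<Longrightarrow> nrm F (A x) \<le> M * (\<Prod>i\<in>I. nrm E (x i))"
    using bound by blast
  have "nrm F (A (x(i := u))) \<le> M * R ^ card I * nrm E u" if R: "R \<ge> 1" and i: "i \<in> I"
    and x: "\<And>j. j \<in> I \<Longrightarrow> j \<noteq> i \<Longrightarrow> x j \<in> vecs E \<and> nrm E (x j) \<le> R" and u: "u \<in> vecs E" for x R i u
  proof -
    have "(\<Prod>j\<in>I. nrm E ((x(i := u)) j)) = nrm E u * (\<Prod>j\<in>I - {i}. nrm E (x j))"
      using i finite_slots by (subst prod.remove[of I i]) auto
    also have "(\<Prod>j\<in>I - {i}. nrm E (x j)) \<le> (\<Prod>j\<in>I - {i}. R)"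
      using x by (intro prod_mono) (auto simp: E.nrm_nonneg)
    also have "\<dots> = R ^ (card I - 1)" using i by simp
    also have "\<dots> \<le> R ^ card I" using R by (intro power_increasing) auto
    finally have "(\<Prod>j\<in>I. nrm E ((x(i := u)) j)) \<le> nrm E u * R ^ card I"
      using E.nrm_nonneg[OF u] by (simp add: mult_left_mono)
    moreover have "nrm F (A (x(i := u))) \<le> M * (\<Prod>j\<in>I. nrm E ((x(i := u)) j))"
      using x u by (intro M(2)) auto
    ultimately show ?thesis using mult_left_mono[OF _ M(1)] by (fastforce simp: mult_ac)
  qed
  then show ?thesis using that M(1) by blast
qed

lemma zero: "i \<in> I \<Longrightarrow> (\<And>j. j \<in> I \<Longrightarrow> j \<noteq> i \<Longrightarrow> x j \<in> vecs E) \<Longrightarrow> A (x(i := 0)) = 0"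
  using scl[of i x 0 0] by simp

lemma diff: "i \<in> I \<Longrightarrow> (\<And>j. j \<in> I \<Longrightarrow> j \<noteq> i \<Longrightarrow> x j \<in> vecs E) \<Longrightarrow> u \<in> vecs E \<Longrightarrow> v \<in> vecs E \<Longrightarrow>
    A (x(i := u - v)) = A (x(i := u)) - A (x(i := v))"
  using add[of i x "u - v" v] by simp

lemma sum: "i \<in> I \<Longrightarrow> (\<And>j. j \<in> I \<Longrightarrow> j \<noteq> i \<Longrightarrow> x j \<in> vecs E) \<Longrightarrow> (\<And>n. n \<in> S \<Longrightarrow> f n \<in> vecs E) \<Longrightarrow>
    A (x(i := (\<Sum>n\<in>S. f n))) = (\<Sum>n\<in>S. A (x(i := f n)))"
proof (induction S rule: infinite_finite_induct)
  case (insert a S)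
  then have "A (x(i := f a + (\<Sum>n\<in>S. f n))) = A (x(i := f a)) + A (x(i := (\<Sum>n\<in>S. f n)))"
    by (intro add E.vecs_sum) auto
  moreover have "A (x(i := (\<Sum>n\<in>S. f n))) = (\<Sum>n\<in>S. A (x(i := f n)))"
    using insert by blast
  ultimately show ?case unfolding sum.insert[OF insert.hyps] by (simp only:)
qed (auto intro!: zero simp del: fun_upd_apply)

lemma slot_bounded_op:
  assumes i: "i \<in> I" and x: "\<And>j. j \<in> I \<Longrightarrow> j \<noteq> i \<Longrightarrow> x j \<in> vecs E"
  shows "(\<lambda>u. A (x(i := u))) \<in> bounded_ops E F"
proof -
  obtain M where M: "M \<ge> 0" "\<And>x R i u. R \<ge> 1 \<Longrightarrow> i \<in> I \<Longrightarrow> (\<And>j. j \<in> I \<Longrightarrow> j \<noteq> i \<Longrightarrow> x j \<in> vecs E \<and> nrm E (x j) \<le> R) \<Longrightarrow> u \<in> vecs E \<Longrightarrow>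
       nrm F (A (x(i := u))) \<le> M * R ^ card I * nrm E u"
    using bound_slot by blast
  define R where "R = 1 + (\<Sum>j\<in>I - {i}. nrm E (x j))"
  have s0: "(\<Sum>j\<in>I - {i}. nrm E (x j)) \<ge> 0" using x by (intro sum_nonneg) (auto simp: E.nrm_nonneg)
  have "nrm E (x j) \<le> R" if "j \<in> I" "j \<noteq> i" for j
    using member_le_sum[of j "I - {i}" "\<lambda>j. nrm E (x j)"] that x finite_slots by (force simp: R_def E.nrm_nonneg)
  then have "nrm F (A (x(i := u))) \<le> M * R ^ card I * nrm E u" if "u \<in> vecs E" for u
    using M(2)[of R i x u] i x that s0 by (simp add: R_def)
  then show ?thesis
    by (rule bounded_opsI[rotated 3]) (use i x in \<open>auto intro!: vecs_app add scl\<close>)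
qed

text \<open>\<open>y\<close> is exchanged for \<open>x\<close> one slot at a time. During the
  exchange the other slots hold a mixture of both, so \<open>c i\<close> has to bound the difference
  against every mixture \<open>z\<close>.\<close>

lemma telescope:
  assumes x: "\<And>i. i \<in> I \<Longrightarrow> x i \<in> vecs E" and y: "\<And>i. i \<in> I \<Longrightarrow> y i \<in> vecs E"
    and c: "\<And>i z. i \<in> I \<Longrightarrow> (\<And>j. j \<in> I \<Longrightarrow> z j = x j \<or> z j = y j) \<Longrightarrow> nrm F (A (z(i := x i - y i))) \<le> c i"
  shows "nrm F (A x - A y) \<le> (\<Sum>i\<in>I. c i)"
proof -
  have "nrm F (A (\<lambda>i. if i \<in> J then x i else y i) - A y) \<le> (\<Sum>i\<in>J. c i)" if "J \<subseteq> I" for J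
    using finite_subset[OF that finite_slots] that
  proof (induction J rule: finite_induct)
    case empty
    then show ?case using F.nrm_0 by simp
  next
    case (insert s J)
    let ?z = "\<lambda>i. if i \<in> J then x i else y i"
    have z: "?z j \<in> vecs E" if "j \<in> I" for j using that x y by simp
    have e: "(\<lambda>i. if i \<in> insert s J then x i else y i) = ?z(s := x s)" "?z = ?z(s := y s)"
      using insert by auto
    have "A (?z(s := x s - y s)) = A (?z(s := x s)) - A (?z(s := y s))"
      using insert.prems z x y by (intro diff) auto
    then have d: "A (?z(s := x s - y s)) = A (?z(s := x s)) - A ?z"
      using e(2) by (metis (no_types, lifting))
    have Az: "A ?z \<in> vecs F" "A (?z(s := x s)) \<in> vecs F" "A y \<in> vecs F"
      using z x y insert.prems by (auto intro!: vecs_app)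
    have "nrm F (A (?z(s := x s)) - A y) \<le> nrm F (A (?z(s := x s)) - A ?z) + nrm F (A ?z - A y)"
      by (rule F.nrm_diff_via[OF Az(2,1,3)])
    also have "\<dots> \<le> c s + (\<Sum>i\<in>J. c i)"
      using insert d c[of s ?z] by (intro add_mono) auto
    finally show ?case using insert.hyps unfolding e(1) by simp
  qed
  from this[of I] show ?thesis using cong[of "\<lambda>i. if i \<in> I then x i else y i" x] by simp
qed

lemma tendsto_diag:
  assumes x: "\<And>n::'n. x n \<in> vecs E" and l: "l \<in> vecs E" and t: "((\<lambda>n. nrm E (x n - l)) \<longlongrightarrow> 0) U"
  shows "((\<lambda>n. nrm F (A (\<lambda>_. x n) - A (\<lambda>_. l))) \<longlongrightarrow> 0) U"
proof -
  obtain M where M: "M \<ge> 0" "\<And>x R i u. R \<ge> 1 \<Longrightarrow> i \<in> I \<Longrightarrow> (\<And>j. j \<in> I \<Longrightarrow> j \<noteq> i \<Longrightarrow> x j \<in> vecs E \<and> nrm E (x j) \<le> R) \<Longrightarrow> u \<in> vecs E \<Longrightarrow>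
       nrm F (A (x(i := u))) \<le> M * R ^ card I * nrm E u"
    using bound_slot by blast
  define R where "R = nrm E l + 1"
  have R: "R \<ge> 1" using E.nrm_nonneg[OF l] by (simp add: R_def)
  have "eventually (\<lambda>n. nrm E (x n - l) < 1) U" using t by (rule order_tendstoD) simp
  then have "eventually (\<lambda>n. norm (nrm F (A (\<lambda>_. x n) - A (\<lambda>_. l))) \<le> (\<Sum>i\<in>I. M * R ^ card I * nrm E (x n - l))) U"
  proof eventually_elim
    case (elim n)
    have xR: "nrm E (x n) \<le> R"
      using E.nrm_reverse_triangle[OF x[of n] l] elim by (simp add: R_def)
    have "nrm F (A (\<lambda>_. x n) - A (\<lambda>_. l)) \<le> (\<Sum>i\<in>I. M * R ^ card I * nrm E (x n - l))"
    proof (rule telescope)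
      fix i z assume "i \<in> I" and z: "\<And>j. j \<in> I \<Longrightarrow> z j = x n \<or> z j = l"
      then show "nrm F (A (z(i := x n - l))) \<le> M * R ^ card I * nrm E (x n - l)"
        using z xR x l R by (intro M(2)) (fastforce simp: R_def)+
    qed (use x l in auto)
    then show ?case using F.nrm_nonneg x l by (simp add: vecs_app)
  qed
  moreover have "((\<lambda>n. \<Sum>i\<in>I. M * R ^ card I * nrm E (x n - l)) \<longlongrightarrow> (\<Sum>i\<in>I. M * R ^ card I * 0)) U"
    by (intro tendsto_intros t)
  ultimately show ?thesis by (auto intro: Lim_null_comparison)
qed

lemma fix_slots:
  assumes J: "J \<subseteq> I" and a: "\<And>i. i \<in> I - J \<Longrightarrow> a i \<in> vecs E"
  shows "multilinear E F J (\<lambda>x. A (\<lambda>i. if i \<in> J then x i else a i))"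
proof unfold_locales
  show fJ: "finite J" using J finite_slots finite_subset by blast
  obtain M where M: "M \<ge> 0" "\<And>x. (\<And>i. i \<in> I \<Longrightarrow> x i \<in> vecs E) \<Longrightarrow> nrm F (A x) \<le> M * (\<Prod>i\<in>I. nrm E (x i))"
    using bound by blast
  have upd: "(\<lambda>i. if i \<in> J then (x(j := u)) i else a i) = (\<lambda>i. if i \<in> J then x i else a i)(j := u)"
    if "j \<in> J" for x j and u :: 'v using that by auto
  show "bounded_multilinear J E F (\<lambda>x. A (\<lambda>i. if i \<in> J then x i else a i))"
    unfolding bounded_multilinear_def
  proof (intro conjI allI impI)
    fix x assume "\<forall>i\<in>J. x i \<in> vecs E"
    then show "A (\<lambda>i. if i \<in> J then x i else a i) \<in> vecs F" using a by (intro vecs_app) auto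
  next
    fix x y assume "\<forall>i\<in>J. x i = (y i :: 'v)"
    then show "A (\<lambda>i. if i \<in> J then x i else a i) = A (\<lambda>i. if i \<in> J then y i else a i)"
      by (intro cong) auto
  next
    fix x i u v assume *: "i \<in> J" "\<forall>j\<in>J - {i}. x j \<in> vecs E" "u \<in> vecs E" "v \<in> vecs E"
    then show "A (\<lambda>j. if j \<in> J then (x(i := u + v)) j else a j)
        = A (\<lambda>j. if j \<in> J then (x(i := u)) j else a j) + A (\<lambda>j. if j \<in> J then (x(i := v)) j else a j)"
      unfolding upd[OF *(1)] using a J by (intro add) auto
  next
    fix x i c u assume *: "i \<in> J" "\<forall>j\<in>J - {i}. x j \<in> vecs E" "u \<in> vecs E"
    then show "A (\<lambda>j. if j \<in> J then (x(i := scl E c u)) j else a j)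
        = scl F c (A (\<lambda>j. if j \<in> J then (x(i := u)) j else a j))"
      unfolding upd[OF *(1)] using a J by (intro scl) auto
  next
    let ?M = "M * (\<Prod>i\<in>I - J. nrm E (a i))"
    have "?M \<ge> 0" using M(1) a by (intro mult_nonneg_nonneg prod_nonneg) (auto simp: E.nrm_nonneg)
    moreover have "nrm F (A (\<lambda>i. if i \<in> J then x i else a i)) \<le> ?M * (\<Prod>i\<in>J. nrm E (x i))"
      if x: "\<forall>i\<in>J. x i \<in> vecs E" for x
    proof -
      have "(\<Prod>i\<in>I. nrm E (if i \<in> J then x i else a i)) = (\<Prod>i\<in>I - J. nrm E (a i)) * (\<Prod>i\<in>J. nrm E (x i))"
        by (subst prod.subset_diff[OF J finite_slots]) simp
      then show ?thesis using M(2)[of "\<lambda>i. if i \<in> J then x i else a i"] x a by (auto simp: mult.assoc)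
    qed
    ultimately show "\<exists>M\<ge>0. \<forall>x. (\<forall>i\<in>J. x i \<in> vecs E) \<longrightarrow>
        nrm F (A (\<lambda>i. if i \<in> J then x i else a i)) \<le> M * (\<Prod>i\<in>J. nrm E (x i))" by blast
  qed
qed

lemma precompose:
  assumes T: "\<And>i. i \<in> I \<Longrightarrow> T i \<in> bounded_ops E E"
  shows "multilinear E F I (\<lambda>x. A (\<lambda>i. T i (x i)))"
proof unfold_locales
  show "finite I" by (rule finite_slots)
  obtain M where M: "M \<ge> 0" "\<And>x. (\<And>i. i \<in> I \<Longrightarrow> x i \<in> vecs E) \<Longrightarrow> nrm F (A x) \<le> M * (\<Prod>i\<in>I. nrm E (x i))"
    using bound by blast
  have "\<forall>i\<in>I. \<exists>C\<ge>0. \<forall>x\<in>vecs E. nrm E (T i x) \<le> C * nrm E x"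
    using bounded_ops_bound[OF E.banach_space_axioms T] by metis
  then obtain C where C: "\<And>i. i \<in> I \<Longrightarrow> C i \<ge> 0" "\<And>i x. i \<in> I \<Longrightarrow> x \<in> vecs E \<Longrightarrow> nrm E (T i x) \<le> C i * nrm E x"
    by metis
  have upd: "(\<lambda>i. T i ((x(j := u)) i)) = (\<lambda>i. T i (x i))(j := T j u)" for x j u by auto
  show "bounded_multilinear I E F (\<lambda>x. A (\<lambda>i. T i (x i)))"
    unfolding bounded_multilinear_def upd
  proof (intro conjI allI impI)
    fix x assume "\<forall>i\<in>I. x i \<in> vecs E"
    then show "A (\<lambda>i. T i (x i)) \<in> vecs F" using bounded_ops_vecs[OF T] by (intro vecs_app) auto
  next
    fix x y assume "\<forall>i\<in>I. x i = (y i :: 'v)"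
    then show "A (\<lambda>i. T i (x i)) = A (\<lambda>i. T i (y i))" by (intro cong) auto
  next
    fix x i u v assume *: "i \<in> I" "\<forall>j\<in>I - {i}. x j \<in> vecs E" "u \<in> vecs E" "v \<in> vecs E"
    then show "A ((\<lambda>i. T i (x i))(i := T i (u + v))) = A ((\<lambda>i. T i (x i))(i := T i u)) + A ((\<lambda>i. T i (x i))(i := T i v))"
      unfolding bounded_ops_add[OF T[OF *(1)] *(3,4)] using bounded_ops_vecs[OF T] by (intro add) auto
  next
    fix x i c u assume *: "i \<in> I" "\<forall>j\<in>I - {i}. x j \<in> vecs E" "u \<in> vecs E"
    then show "A ((\<lambda>i. T i (x i))(i := T i (scl E c u))) = scl F c (A ((\<lambda>i. T i (x i))(i := T i u)))"
      unfolding bounded_ops_scl[OF T[OF *(1)] *(3)] using bounded_ops_vecs[OF T] by (intro scl) auto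
  next
    let ?M = "M * (\<Prod>i\<in>I. C i)"
    have "?M \<ge> 0" using M(1) C(1) by (intro mult_nonneg_nonneg prod_nonneg) auto
    moreover have "nrm F (A (\<lambda>i. T i (x i))) \<le> ?M * (\<Prod>i\<in>I. nrm E (x i))" if x: "\<forall>i\<in>I. x i \<in> vecs E" for x
    proof -
      have "(\<Prod>i\<in>I. nrm E (T i (x i))) \<le> (\<Prod>i\<in>I. C i * nrm E (x i))"
        using x C bounded_ops_vecs[OF T] by (intro prod_mono) (auto simp: E.nrm_nonneg)
      then have "M * (\<Prod>i\<in>I. nrm E (T i (x i))) \<le> ?M * (\<Prod>i\<in>I. nrm E (x i))"
        using M(1) by (simp add: prod.distrib mult_left_mono mult.assoc)
      moreover have "nrm F (A (\<lambda>i. T i (x i))) \<le> M * (\<Prod>i\<in>I. nrm E (T i (x i)))"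
        using x bounded_ops_vecs[OF T] by (intro M(2)) auto
      ultimately show ?thesis by linarith
    qed
    ultimately show "\<exists>M\<ge>0. \<forall>x. (\<forall>i\<in>I. x i \<in> vecs E) \<longrightarrow>
        nrm F (A (\<lambda>i. T i (x i))) \<le> M * (\<Prod>i\<in>I. nrm E (x i))" by blast
  qed
qed

lemma postcompose:
  assumes G: "banach_space G" and T: "T \<in> bounded_ops F G"
  shows "multilinear E G I (\<lambda>x. T (A x))"
proof -
  interpret G: banach_space G by fact
  obtain M where M: "M \<ge> 0" "\<And>x. (\<And>i. i \<in> I \<Longrightarrow> x i \<in> vecs E) \<Longrightarrow> nrm F (A x) \<le> M * (\<Prod>i\<in>I. nrm E (x i))"
    using bound by blast
  obtain C where C: "C \<ge> 0" "\<And>y. y \<in> vecs F \<Longrightarrow> nrm G (T y) \<le> C * nrm F y"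
    using bounded_ops_bound[OF F.banach_space_axioms T] by blast
  have upd: "j \<in> I - {i} \<Longrightarrow> (\<forall>j\<in>I - {i}. x j \<in> vecs E) \<Longrightarrow> x j \<in> vecs E" for x i j by blast
  have vu: "A (x(i := u)) \<in> vecs F" if "\<forall>j\<in>I - {i}. x j \<in> vecs E" "u \<in> vecs E" for x i u
    using that by (intro vecs_app) auto
  show ?thesis
  proof unfold_locales
    show "finite I" by (rule finite_slots)
    show "bounded_multilinear I E G (\<lambda>x. T (A x))"
      unfolding bounded_multilinear_def
    proof (intro conjI allI impI)
      fix x assume "\<forall>i\<in>I. x i \<in> vecs E"
      then show "T (A x) \<in> vecs G" using bounded_ops_vecs[OF T] vecs_app by blast
    next
      fix x y assume "\<forall>i\<in>I. x i = (y i :: 'v)"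
      then show "T (A x) = T (A y)" using cong[of x y] by simp
    next
      fix x i u v assume *: "i \<in> I" "\<forall>j\<in>I - {i}. x j \<in> vecs E" "u \<in> vecs E" "v \<in> vecs E"
      then have "A (x(i := u + v)) = A (x(i := u)) + A (x(i := v))" by (intro add) auto
      then show "T (A (x(i := u + v))) = T (A (x(i := u))) + T (A (x(i := v)))"
        using bounded_ops_add[OF T vu vu] * by metis
    next
      fix x i c u assume *: "i \<in> I" "\<forall>j\<in>I - {i}. x j \<in> vecs E" "u \<in> vecs E"
      then have "A (x(i := scl E c u)) = scl F c (A (x(i := u)))" by (intro scl) auto
      then show "T (A (x(i := scl E c u))) = scl G c (T (A (x(i := u))))"
        using bounded_ops_scl[OF T vu] * by metis
    next
      have "nrm G (T (A x)) \<le> C * M * (\<Prod>i\<in>I. nrm E (x i))" if x: "\<forall>i\<in>I. x i \<in> vecs E" for x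
        using C(2)[of "A x"] mult_left_mono[OF M(2)[of x] C(1)] vecs_app[of x] x by (auto simp: mult.assoc)
      then show "\<exists>M\<ge>0. \<forall>x. (\<forall>i\<in>I. x i \<in> vecs E) \<longrightarrow> nrm G (T (A x)) \<le> M * (\<Prod>i\<in>I. nrm E (x i))"
        using C(1) M(1) by (intro exI[of _ "C * M"]) auto
    qed
  qed
qed

end

text \<open>Stated outside the locale \<open>multilinear\<close>, whose axioms contain the very
  bound that \<open>polys_multilinear\<close> derives with its help.\<close>

lemma multilinear_scaling:
  fixes F :: "('k::rc_field, 'w::ab_group_add) nspace" and E :: "('k, 'v::ab_group_add) nspace"
  assumes E: "banach_space E" and F: "banach_space F" and I: "finite I"
    and scl: "\<And>x i c u. i \<in> I \<Longrightarrow> (\<And>j. j \<in> I \<Longrightarrow> x j \<in> vecs E) \<Longrightarrow> u \<in> vecs E \<Longrightarrow>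
      A (x(i := scl E c u)) = scl F c (A (x(i := u)))"
    and cong: "\<And>x y. (\<And>i. i \<in> I \<Longrightarrow> x i = y i) \<Longrightarrow> A x = A y"
    and x: "\<And>i. i \<in> I \<Longrightarrow> x i \<in> vecs E"
  shows "A (\<lambda>i. scl E (c i) (x i)) = scl F (\<Prod>i\<in>I. c i) (A x)"
proof -
  interpret E: banach_space E by fact
  interpret F: banach_space F by fact
  have "A (\<lambda>i. if i \<in> J then scl E (c i) (x i) else x i) = scl F (\<Prod>i\<in>J. c i) (A x)" if "J \<subseteq> I" for J
    using finite_subset[OF that I] that
  proof (induction J rule: finite_induct)
    case (insert s J)
    let ?z = "\<lambda>i. if i \<in> J then scl E (c i) (x i) else x i"
    have "(\<lambda>i. if i \<in> insert s J then scl E (c i) (x i) else x i) = ?z(s := scl E (c s) (x s))" "?z(s := x s) = ?z"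
      using insert by auto
    then show ?case using scl[of s ?z "x s" "c s"] x insert by (simp add: mult.commute)
  qed simp
  from this[of I] show ?thesis using cong[of "\<lambda>i. scl E (c i) (x i)" "\<lambda>i. if i \<in> I then scl E (c i) (x i) else x i"] by simp
qed

text \<open>Continuity at the origin gives a radius \<open>d\<close> such that \<open>A\<close> has
  norm below \<open>1\<close> on arguments shorter than \<open>d\<close>. Scaling all arguments to
  length \<open>d / 2\<close> yields the constant \<open>(2 / d) ^ k\<close>; an argument
  \<open>0\<close> cannot be scaled and makes both sides vanish.\<close>

lemma polys_multilinear:
  fixes E :: "('k::rc_field, 'v::ab_group_add) nspace" and F :: "('k, 'w::ab_group_add) nspace"
  assumes E: "banach_space E" and F: "banach_space F" and k: "k \<ge> 1" and P: "P \<in> polys k E F"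
  obtains A where "multilinear E F {..<k} A" "\<And>x. x \<in> vecs E \<Longrightarrow> P x = A (\<lambda>_. x)"
proof -
  interpret E: banach_space E by fact
  interpret F: banach_space F by fact
  interpret ME: Metric_space "vecs E" "ndist E" by (rule E.Metric_space_ndist)
  interpret MF: Metric_space "vecs F" "ndist F" by (rule F.Metric_space_ndist)
  let ?I = "{..<k}"
  obtain A0 where A0: "multilinear_map k E F A0"
    and cont: "continuous_map (product_topology (\<lambda>_. norm_top E) ?I) (norm_top F) A0"
    and PA: "\<And>x. x \<in> vecs E \<Longrightarrow> P x = A0 (\<lambda>i\<in>?I. x)"
    using P unfolding polys_def by blast
  define A where "A x = A0 (restrict x ?I)" for x
  \<comment> \<open>The old entry \<open>x i\<close> may lie outside \<open>vecs E\<close>; writing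
    \<open>0\<close> there first produces a point of the product, where the hypotheses on
    \<open>A0\<close> apply.\<close>
  have upd: "restrict (x(i := u)) ?I = (restrict (x(i := 0)) ?I)(i := u)" if "i < k" for x i and u :: 'v
    using that by (auto simp: restrict_def fun_eq_iff)
  have cong: "A x = A y" if "\<And>i. i \<in> ?I \<Longrightarrow> x i = y i" for x y
    using that unfolding A_def by (metis restrict_ext)
  have inP: "restrict (x(i := 0)) ?I \<in> ?I \<rightarrow>\<^sub>E vecs E" if "\<forall>j\<in>?I - {i}. x j \<in> vecs E" for x i
    using that by auto
  have inV: "A x \<in> vecs F" if "\<forall>i\<in>?I. x i \<in> vecs E" for x
    using A0 that unfolding A_def multilinear_map_def by (auto simp: Pi_iff)
  have add: "A (x(i := u + v)) = A (x(i := u)) + A (x(i := v))"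
    if "i \<in> ?I" "\<forall>j\<in>?I - {i}. x j \<in> vecs E" "u \<in> vecs E" "v \<in> vecs E" for x i u v
  proof -
    have i: "i < k" using that by simp
    show ?thesis
      unfolding A_def upd[OF i, of x "u + v"] upd[OF i, of x u] upd[OF i, of x v]
      using A0 inP[OF that(2)] i that(3,4) unfolding multilinear_map_def by blast
  qed
  have scl: "A (x(i := scl E c u)) = scl F c (A (x(i := u)))"
    if "i \<in> ?I" "\<forall>j\<in>?I - {i}. x j \<in> vecs E" "u \<in> vecs E" for x i c u
  proof -
    have i: "i < k" using that by simp
    show ?thesis
      unfolding A_def upd[OF i, of x "scl E c u"] upd[OF i, of x u]
      using A0 inP[OF that(2)] i that(3) unfolding multilinear_map_def by blast
  qed
  have zero: "A x = 0" if x: "\<forall>j\<in>?I. x j \<in> vecs E" and i: "i \<in> ?I" "x i = 0" for x i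
  proof -
    have "x = x(i := scl E 0 0)" using i by auto
    then show ?thesis using scl[of i x 0 0] x i by (metis DiffD1 E.vecs_0 F.scale_zero_left)
  qed
  have mb: "norm_top F = MF.mtopology" "norm_top E = ME.mtopology" by (simp_all add: norm_top_def)
  let ?W = "MF.mball 0 1" and ?z = "\<lambda>i\<in>?I. 0 :: 'v"
  let ?S = "{x \<in> topspace (product_topology (\<lambda>_. norm_top E) ?I). A0 x \<in> ?W}"
  have op: "openin (product_topology (\<lambda>_. norm_top E) ?I) ?S"
    using cont MF.openin_mball[of 0 1] unfolding continuous_map_def mb by blast
  have "A0 ?z = 0"
    using zero[of "\<lambda>_. 0" 0] k by (simp add: A_def)
  then have "A0 ?z \<in> ?W" by (simp only: MF.in_mball) simp
  moreover have "?z \<in> topspace (product_topology (\<lambda>_. norm_top E) ?I)"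
    unfolding topspace_product_topology by (rule restrict_PiE_iff[THEN iffD2]) (simp add: E.topspace_norm_top)
  ultimately have zS: "?z \<in> ?S" by blast
  obtain U where U': "\<forall>i\<in>?I. openin (norm_top E) (U i)" "?z \<in> Pi\<^sub>E ?I U" "Pi\<^sub>E ?I U \<subseteq> ?S"
    using op[unfolded openin_product_topology_alt, THEN bspec, OF zS] by (elim exE conjE)
  have U: "openin (norm_top E) (U i)" "0 \<in> U i" if "i \<in> ?I" for i
    using U'(1) that PiE_mem[OF U'(2) that] by simp_all
  have "\<exists>r>0. ME.mball 0 r \<subseteq> U i" if "i \<in> ?I" for i
    using U[OF that] unfolding mb ME.openin_mtopology by metis
  then obtain r where r: "\<And>i. i \<in> ?I \<Longrightarrow> r i > 0" "\<And>i. i \<in> ?I \<Longrightarrow> ME.mball 0 (r i) \<subseteq> U i"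
    by metis
  define d where "d = Min (r ` ?I)"
  have "0 \<in> ?I" using k by simp
  then have "r ` ?I \<noteq> {}" by blast
  then have d: "d > 0" "\<And>i. i \<in> ?I \<Longrightarrow> d \<le> r i"
    unfolding d_def using r(1) by (auto simp: Min_gr_iff)
  have small: "nrm F (A x) < 1" if x: "\<forall>i\<in>?I. x i \<in> vecs E \<and> nrm E (x i) < d" for x
  proof -
    have "restrict x ?I \<in> Pi\<^sub>E ?I U"
    proof (intro restrict_PiE_iff[THEN iffD2] ballI)
      fix i assume i: "i \<in> ?I"
      have "x i \<in> ME.mball 0 (r i)" using x[rule_format, OF i] d(2)[OF i] E.nrm_minus[of "x i"] by (simp add: ndist_def)
      then show "x i \<in> U i" using r(2)[OF i] by blast
    qed
    then have "A x \<in> ?W" using U'(3) unfolding A_def by blast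
    then show ?thesis using F.nrm_minus[of "A x"] by (auto simp: ndist_def)
  qed
  have bound: "nrm F (A x) \<le> (2 / d) ^ k * (\<Prod>i\<in>?I. nrm E (x i))" if x: "\<forall>i\<in>?I. x i \<in> vecs E" for x
  proof (cases "\<exists>i\<in>?I. x i = 0")
    case True
    then obtain i where "i \<in> ?I" "x i = 0" by blast
    then have "A x = 0" using zero[OF x] by blast
    then show ?thesis using d x by (auto intro!: mult_nonneg_nonneg prod_nonneg simp: E.nrm_nonneg)
  next
    case False
    then have pos: "nrm E (x i) > 0" if "i \<in> ?I" for i
      using E.nrm_eq_0[of "x i"] E.nrm_nonneg[of "x i"] x that by force
    define c :: "nat \<Rightarrow> 'k" where "c i = of_real (d / (2 * nrm E (x i)))" for i
    have nc: "norm (c i) = d / (2 * nrm E (x i))" if "i \<in> ?I" for i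
      using pos[OF that] d(1) unfolding c_def norm_of_real by simp
    have "nrm F (A (\<lambda>i. scl E (c i) (x i))) < 1"
    proof (rule small, intro ballI conjI)
      fix i assume i: "i \<in> ?I"
      show "scl E (c i) (x i) \<in> vecs E" using x i by simp
      show "nrm E (scl E (c i) (x i)) < d" using x i nc[OF i] pos[OF i] d(1) by (simp add: E.nrm_scl)
    qed
    moreover have "A (\<lambda>i. scl E (c i) (x i)) = scl F (\<Prod>i\<in>?I. c i) (A x)"
    proof (rule multilinear_scaling[OF E F])
      show "A (x(i := scl E c u)) = scl F c (A (x(i := u)))"
        if "i \<in> ?I" "\<And>j. j \<in> ?I \<Longrightarrow> x j \<in> vecs E" "u \<in> vecs E" for x i c u
        by (rule scl[OF that(1) _ that(3)]) (use that(2) in blast)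
      show "A x = A y" if "\<And>i. i \<in> ?I \<Longrightarrow> x i = y i" for x y by (rule cong[OF that])
      show "x i \<in> vecs E" if "i \<in> ?I" for i using x that by blast
    qed simp
    ultimately have "norm (\<Prod>i\<in>?I. c i) * nrm F (A x) < 1"
      using F.nrm_scl[OF inV[OF x]] by simp
    also have "norm (\<Prod>i\<in>?I. c i) = (\<Prod>i\<in>?I. d / (2 * nrm E (x i)))"
      unfolding prod_norm[symmetric] by (intro prod.cong nc) auto
    also have "\<dots> = (d / 2) ^ k / (\<Prod>i\<in>?I. nrm E (x i))"
      by (simp add: prod_dividef prod.distrib power_divide)
    finally have "(d / 2) ^ k * nrm F (A x) < (\<Prod>i\<in>?I. nrm E (x i))"
      using prod_pos[of ?I "\<lambda>i. nrm E (x i)"] pos by (simp add: field_simps)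
    then show ?thesis using d(1) by (simp add: field_simps power_divide)
  qed
  have "multilinear E F ?I A"
  proof unfold_locales
    show "bounded_multilinear ?I E F A"
      unfolding bounded_multilinear_def
    proof (intro conjI allI impI)
      show "A x \<in> vecs F" if "\<forall>i\<in>?I. x i \<in> vecs E" for x by (rule inV[OF that])
      show "A x = A y" if "\<forall>i\<in>?I. x i = y i" for x y by (rule cong) (rule that[rule_format])
      show "A (x(i := u + v)) = A (x(i := u)) + A (x(i := v))"
        if "i \<in> ?I" "\<forall>j\<in>?I - {i}. x j \<in> vecs E" "u \<in> vecs E" "v \<in> vecs E" for x i u v
        by (rule add[OF that])
      show "A (x(i := scl E c u)) = scl F c (A (x(i := u)))"
        if "i \<in> ?I" "\<forall>j\<in>?I - {i}. x j \<in> vecs E" "u \<in> vecs E" for x i c u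
        by (rule scl[OF that])
      have "0 \<le> (2 / d) ^ k" using d(1) by simp
      then show "\<exists>M\<ge>0. \<forall>x. (\<forall>i\<in>?I. x i \<in> vecs E) \<longrightarrow> nrm F (A x) \<le> M * (\<Prod>i\<in>?I. nrm E (x i))"
        using bound by meson
    qed
  qed simp
  moreover have "P x = A (\<lambda>_. x)" if "x \<in> vecs E" for x using PA[OF that] by (simp add: A_def)
  ultimately show ?thesis using that by blast
qed

text \<open>The slotwise Lipschitz estimate on a ball gives continuity for the product
  topology.\<close>

lemma (in multilinear) polysI:
  assumes I: "I = {..<k}" and P: "\<And>x. x \<in> vecs E \<Longrightarrow> P x = A (\<lambda>_. x)"
  shows "P \<in> polys k E F"
proof -
  interpret ME: Metric_space "vecs E" "ndist E" by (rule E.Metric_space_ndist)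
  interpret MF: Metric_space "vecs F" "ndist F" by (rule F.Metric_space_ndist)
  have "multilinear_map k E F A"
    unfolding multilinear_map_def
  proof (intro conjI ballI allI impI)
    show "A \<in> ({..<k} \<rightarrow>\<^sub>E vecs E) \<rightarrow> vecs F" using I by (auto intro!: vecs_app)
    fix x i u assume *: "x \<in> {..<k} \<rightarrow>\<^sub>E vecs E" "i < k" "u \<in> vecs E"
    show "A (x(i := u + v)) = A (x(i := u)) + A (x(i := v))" if "v \<in> vecs E" for v
      using * that I by (intro add) auto
    show "A (x(i := scl E c u)) = scl F c (A (x(i := u)))" for c
      using * I by (intro scl) auto
  qed
  moreover have "P x = A (\<lambda>i\<in>{..<k}. x)" if "x \<in> vecs E" for x
    unfolding P[OF that] by (rule cong) (simp add: I)
  moreover have "continuous_map (product_topology (\<lambda>_. norm_top E) {..<k}) MF.mtopology A"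
    unfolding MF.continuous_map_to_metric
  proof (intro ballI allI impI)
    fix x and e :: real
    assume "x \<in> topspace (product_topology (\<lambda>_. norm_top E) {..<k})" and e: "e > 0"
    then have x: "x i \<in> vecs E" if "i < k" for i using that by (auto simp: E.topspace_norm_top)
    have xe: "x \<in> extensional {..<k}"
      using \<open>x \<in> topspace _\<close> by (auto simp: PiE_def)
    obtain M where M: "M \<ge> 0" "\<And>x R i u. R \<ge> 1 \<Longrightarrow> i \<in> I \<Longrightarrow> (\<And>j. j \<in> I \<Longrightarrow> j \<noteq> i \<Longrightarrow> x j \<in> vecs E \<and> nrm E (x j) \<le> R) \<Longrightarrow> u \<in> vecs E \<Longrightarrow>
       nrm F (A (x(i := u))) \<le> M * R ^ card I * nrm E u"
      using bound_slot by blast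
    define R where "R = 1 + (\<Sum>i<k. nrm E (x i))"
    have nn: "nrm E (x i) \<ge> 0" if "i < k" for i using x[OF that] by (rule E.nrm_nonneg)
    have R: "R \<ge> 1" unfolding R_def using sum_nonneg[of "{..<k}" "\<lambda>i. nrm E (x i)"] nn by simp
    have xR: "nrm E (x i) + 1 \<le> R" if "i < k" for i
      unfolding R_def using member_le_sum[of i "{..<k}" "\<lambda>i. nrm E (x i)"] nn that by auto
    define L where "L = real k * (M * R ^ k)"
    have L: "L \<ge> 0" using M(1) R by (simp add: L_def)
    \<comment> \<open>\<open>d \<le> 1\<close> keeps \<open>y\<close> inside the ball of radius
      \<open>R\<close>, which has a margin of \<open>1\<close>; the other bound gives
      \<open>L * d < e\<close> even if \<open>L = 0\<close>.\<close>
    define d where "d = min 1 (e / (L + 1))"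
    have d: "d > 0" "d \<le> 1" "L * d < e"
    proof -
      have "d \<le> e / (L + 1)" by (simp add: d_def)
      then have "(L + 1) * d \<le> e" using L by (simp add: pos_le_divide_eq mult.commute)
      moreover show "d > 0" unfolding d_def using e L by simp
      ultimately show "L * d < e" by (simp add: algebra_simps)
      show "d \<le> 1" by (simp add: d_def)
    qed
    let ?U = "Pi\<^sub>E {..<k} (\<lambda>i. ME.mball (x i) d)"
    have "openin (product_topology (\<lambda>_. norm_top E) {..<k}) ?U"
      unfolding openin_PiE_gen norm_top_def by auto
    moreover have "x \<in> ?U" using x d(1) xe by (auto simp: PiE_iff)
    moreover have "A y \<in> MF.mball (A x) e" if y: "y \<in> ?U" for y
    proof -
      have y': "y i \<in> vecs E" "nrm E (x i - y i) < d" if "i < k" for i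
        using PiE_mem[OF y, of i] x[OF that] that by (auto simp: ndist_def)
      have yR: "nrm E (y i) \<le> R" if "i < k" for i
        using E.nrm_reverse_triangle[of "x i" "y i"] x[OF that] y'[OF that] xR[OF that] d(2) by linarith
      have "nrm F (A x - A y) \<le> (\<Sum>i\<in>I. M * R ^ card I * nrm E (x i - y i))"
      proof (rule telescope)
        fix i z assume "i \<in> I" and z: "\<And>j. j \<in> I \<Longrightarrow> z j = x j \<or> z j = y j"
        have "z j \<in> vecs E \<and> nrm E (z j) \<le> R" if "j \<in> I" for j
          using z[OF that] that x y' yR xR I by force
        then show "nrm F (A (z(i := x i - y i))) \<le> M * R ^ card I * nrm E (x i - y i)"
          using \<open>i \<in> I\<close> x y' I R by (intro M(2)) auto
      qed (use x y' I in auto)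
      also have "\<dots> \<le> (\<Sum>i\<in>I. M * R ^ card I * d)"
        using M(1) R y'(2) I by (intro sum_mono mult_left_mono) (auto intro: less_imp_le)
      also have "\<dots> = L * d" by (simp add: L_def I)
      finally show ?thesis
        using d(3) x y' I by (auto simp: ndist_def intro!: vecs_app)
    qed
    ultimately show "\<exists>U. openin (product_topology (\<lambda>_. norm_top E) {..<k}) U \<and> x \<in> U \<and> (\<forall>y\<in>U. A y \<in> MF.mball (A x) e)"
      by blast
  qed
  ultimately show ?thesis unfolding polys_def norm_top_def[of F] by blast
qed

section \<open>Polarization\<close>

lemma (in multilinear) expand_sums:
  assumes "finite K" "K \<subseteq> I" and "\<And>i n. i \<in> K \<Longrightarrow> n \<in> J \<Longrightarrow> y i n \<in> vecs E"
    and "\<And>i. i \<in> I \<Longrightarrow> x i \<in> vecs E"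
  shows "A (\<lambda>i. if i \<in> K then (\<Sum>n\<in>J. y i n) else x i) =
    (\<Sum>f\<in>Pi\<^sub>E K (\<lambda>_. J). A (\<lambda>i. if i \<in> K then y i (f i) else x i))"
  using assms
proof (induction K arbitrary: x rule: finite_induct)
  case (insert s K)
  let ?z = "\<lambda>x i. if i \<in> K then (\<Sum>n\<in>J. y i n) else x i"
  have s: "s \<in> I" using insert by blast
  have zv: "?z x j \<in> vecs E" if "j \<in> I" for j using that insert.prems by (auto intro: E.vecs_sum)
  have "(\<lambda>i. if i \<in> insert s K then (\<Sum>n\<in>J. y i n) else x i) = (?z x)(s := (\<Sum>n\<in>J. y s n))" by auto
  then have "A (\<lambda>i. if i \<in> insert s K then (\<Sum>n\<in>J. y i n) else x i) = (\<Sum>n\<in>J. A ((?z x)(s := y s n)))"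
    using sum[OF s, of "?z x" J "y s"] zv insert.prems by simp
  also have "\<dots> = (\<Sum>n\<in>J. A (?z (x(s := y s n))))"
    using insert.hyps by (intro sum.cong refl arg_cong[where f = A]) auto
  also have "\<dots> = (\<Sum>n\<in>J. \<Sum>f\<in>Pi\<^sub>E K (\<lambda>_. J). A (\<lambda>i. if i \<in> K then y i (f i) else (x(s := y s n)) i))"
    using insert.prems by (intro sum.cong refl insert.IH) auto
  also have "\<dots> = (\<Sum>n\<in>J. \<Sum>f\<in>Pi\<^sub>E K (\<lambda>_. J). A (\<lambda>i. if i \<in> insert s K then y i ((f(s := n)) i) else x i))"
    using insert.hyps by (intro sum.cong refl arg_cong[where f = A]) auto
  also have "\<dots> = (\<Sum>(n, f)\<in>J \<times> Pi\<^sub>E K (\<lambda>_. J). A (\<lambda>i. if i \<in> insert s K then y i ((f(s := n)) i) else x i))"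
    by (simp only: sum.cartesian_product)
  also have "\<dots> = (\<Sum>f\<in>Pi\<^sub>E (insert s K) (\<lambda>_. J). A (\<lambda>i. if i \<in> insert s K then y i (f i) else x i))"
    unfolding PiE_insert_eq
    by (subst sum.reindex[OF inj_combinator[OF insert.hyps(2)]]) (simp add: o_def case_prod_unfold)
  finally show ?case .
qed simp

text \<open>Expansion of the product of the factors \<open>1 - 1\<close> over \<open>I - T\<close>.
  In the polarization formula it singles out the maps onto \<open>I\<close>.\<close>

lemma alternating_superset_sum:
  assumes I: "finite I" and T: "T \<subseteq> I"
  shows "(\<Sum>J\<in>{J \<in> Pow I. T \<subseteq> J}. (- 1) ^ card (I - J)) = (if T = I then 1 else (0 :: 'a::comm_ring_1))"
proof -
  have "(\<Sum>J\<in>{J \<in> Pow I. T \<subseteq> J}. (- 1) ^ card (I - J)) = (\<Sum>X\<in>Pow (I - T). (- 1 :: 'a) ^ card X)"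
    by (rule sum.reindex_bij_witness[of _ "\<lambda>X. I - X" "\<lambda>J. I - J"]) (use T in auto)
  also have "\<dots> = (\<Prod>x\<in>I - T. 1 - 1)"
    using prod_diff_conv_sum[of "I - T" "\<lambda>_. 1::'a" "\<lambda>_. 1"] I by simp
  also have "\<dots> = (if T = I then 1 else 0)"
  proof (cases "T = I")
    case False
    then have "card (I - T) \<noteq> 0" using T I by auto
    then show ?thesis using False by (simp add: power_0_left)
  qed simp
  finally show ?thesis .
qed

lemma (in multilinear) permute:
  assumes f: "inj_on f I" "f ` I = I"
  shows "multilinear E F I (\<lambda>x. A (\<lambda>i. x (f i)))"
proof unfold_locales
  show "finite I" by (rule finite_slots)
  obtain M where M: "M \<ge> 0" "\<And>x. (\<And>i. i \<in> I \<Longrightarrow> x i \<in> vecs E) \<Longrightarrow> nrm F (A x) \<le> M * (\<Prod>i\<in>I. nrm E (x i))"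
    using bound by blast
  have fI: "f i \<in> I" if "i \<in> I" for i using f(2) that by blast
  have upd: "A (\<lambda>i. (x(f j := u)) (f i)) = A ((\<lambda>i. x (f i))(j := u))" if "j \<in> I" for x j u
    using that f(1) by (intro cong) (auto dest: inj_onD)
  have other: "x (f j) \<in> vecs E" if "\<forall>j\<in>I - {f i}. x j \<in> vecs E" "i \<in> I" "j \<in> I" "j \<noteq> i" for x i j
    using that f(1) fI by (metis DiffI inj_onD singletonD)
  show "bounded_multilinear I E F (\<lambda>x. A (\<lambda>i. x (f i)))"
    unfolding bounded_multilinear_def
  proof (intro conjI allI impI)
    fix x assume "\<forall>i\<in>I. x i \<in> vecs E"
    then show "A (\<lambda>i. x (f i)) \<in> vecs F" using fI by (intro vecs_app) auto
  next
    fix x y assume "\<forall>i\<in>I. x i = (y i :: 'v)"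
    then show "A (\<lambda>i. x (f i)) = A (\<lambda>i. y (f i))" using fI by (intro cong) auto
  next
    fix x i' u v assume *: "i' \<in> I" "\<forall>j\<in>I - {i'}. x j \<in> vecs E" "u \<in> vecs E" "v \<in> vecs E"
    then obtain i where i: "i \<in> I" "i' = f i" using f(2) by blast
    show "A (\<lambda>i. (x(i' := u + v)) (f i)) = A (\<lambda>i. (x(i' := u)) (f i)) + A (\<lambda>i. (x(i' := v)) (f i))"
      unfolding i(2) upd[OF i(1)] using * i other by (intro add) auto
  next
    fix x i' c u assume *: "i' \<in> I" "\<forall>j\<in>I - {i'}. x j \<in> vecs E" "u \<in> vecs E"
    then obtain i where i: "i \<in> I" "i' = f i" using f(2) by blast
    show "A (\<lambda>i. (x(i' := scl E c u)) (f i)) = scl F c (A (\<lambda>i. (x(i' := u)) (f i)))"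
      unfolding i(2) upd[OF i(1)] using * i other by (intro scl) auto
  next
    have "nrm F (A (\<lambda>i. x (f i))) \<le> M * (\<Prod>i\<in>I. nrm E (x i))" if "\<forall>i\<in>I. x i \<in> vecs E" for x
      using M(2)[of "\<lambda>i. x (f i)"] that fI prod.reindex[OF f(1), of "\<lambda>i. nrm E (x i)"] f(2) by (simp add: o_def)
    then show "\<exists>M\<ge>0. \<forall>x. (\<forall>i\<in>I. x i \<in> vecs E) \<longrightarrow> nrm F (A (\<lambda>i. x (f i))) \<le> M * (\<Prod>i\<in>I. nrm E (x i))"
      using M(1) by blast
  qed
qed

lemma multilinear_sum:
  fixes E :: "('k::rc_field, 'v::ab_group_add) nspace" and F :: "('k, 'w::ab_group_add) nspace"
  assumes E: "banach_space E" and F: "banach_space F" and I: "finite I"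
    and A: "\<And>q. q \<in> Q \<Longrightarrow> multilinear E F I (A q)"
  shows "multilinear E F I (\<lambda>x. \<Sum>q\<in>Q. A q x)"
proof -
  interpret E: banach_space E by fact
  interpret F: banach_space F by fact
  have "\<forall>q\<in>Q. \<exists>M\<ge>0. \<forall>x. (\<forall>i\<in>I. x i \<in> vecs E) \<longrightarrow> nrm F (A q x) \<le> M * (\<Prod>i\<in>I. nrm E (x i))"
  proof
    fix q assume "q \<in> Q"
    then interpret q: multilinear E F I "A q" by (rule A)
    show "\<exists>M\<ge>0. \<forall>x. (\<forall>i\<in>I. x i \<in> vecs E) \<longrightarrow> nrm F (A q x) \<le> M * (\<Prod>i\<in>I. nrm E (x i))"
    proof (rule q.bound)
      fix M assume "M \<ge> 0" "\<And>x. (\<And>i. i \<in> I \<Longrightarrow> x i \<in> vecs E) \<Longrightarrow> nrm F (A q x) \<le> M * (\<Prod>i\<in>I. nrm E (x i))"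
      then show ?thesis by (intro exI[of _ M]) simp
    qed
  qed
  then obtain M where M': "\<forall>q\<in>Q. M q \<ge> 0 \<and> (\<forall>x. (\<forall>i\<in>I. x i \<in> vecs E) \<longrightarrow> nrm F (A q x) \<le> M q * (\<Prod>i\<in>I. nrm E (x i)))"
    by (elim bchoice[THEN exE])
  have M: "M q \<ge> 0" "(\<forall>i\<in>I. x i \<in> vecs E) \<Longrightarrow> nrm F (A q x) \<le> M q * (\<Prod>i\<in>I. nrm E (x i))" if "q \<in> Q" for q x
    using M' that by simp_all
  have v: "A q x \<in> vecs F" if "q \<in> Q" "\<forall>i\<in>I. x i \<in> vecs E" for q x
    using multilinear.vecs_app[OF A[OF that(1)]] that(2) by blast
  show ?thesis
  proof unfold_locales
    show "finite I" by fact
    show "bounded_multilinear I E F (\<lambda>x. \<Sum>q\<in>Q. A q x)"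
      unfolding bounded_multilinear_def
    proof (intro conjI allI impI)
      fix x assume "\<forall>i\<in>I. x i \<in> vecs E"
      then show "(\<Sum>q\<in>Q. A q x) \<in> vecs F" using v by (intro F.vecs_sum) auto
    next
      fix x y assume "\<forall>i\<in>I. x i = (y i :: 'v)"
      then show "(\<Sum>q\<in>Q. A q x) = (\<Sum>q\<in>Q. A q y)"
        by (intro sum.cong refl multilinear.cong[OF A]) auto
    next
      fix x i u v assume *: "i \<in> I" "\<forall>j\<in>I - {i}. x j \<in> vecs E" "u \<in> vecs E" "v \<in> vecs E"
      show "(\<Sum>q\<in>Q. A q (x(i := u + v))) = (\<Sum>q\<in>Q. A q (x(i := u))) + (\<Sum>q\<in>Q. A q (x(i := v)))"
        unfolding sum.distrib[symmetric] by (intro sum.cong refl multilinear.add[OF A]) (use * in auto)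
    next
      fix x i c u assume *: "i \<in> I" "\<forall>j\<in>I - {i}. x j \<in> vecs E" "u \<in> vecs E"
      show "(\<Sum>q\<in>Q. A q (x(i := scl E c u))) = scl F c (\<Sum>q\<in>Q. A q (x(i := u)))"
        unfolding F.scale_sum_right by (intro sum.cong refl multilinear.scl[OF A]) (use * in auto)
    next
      have "nrm F (\<Sum>q\<in>Q. A q x) \<le> (\<Sum>q\<in>Q. M q) * (\<Prod>i\<in>I. nrm E (x i))" if x: "\<forall>i\<in>I. x i \<in> vecs E" for x
      proof -
        have "nrm F (\<Sum>q\<in>Q. A q x) \<le> (\<Sum>q\<in>Q. nrm F (A q x))" using v x by (intro F.nrm_sum) auto
        also have "\<dots> \<le> (\<Sum>q\<in>Q. M q * (\<Prod>i\<in>I. nrm E (x i)))" using M(2) x by (intro sum_mono) auto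
        finally show ?thesis by (simp add: sum_distrib_right)
      qed
      then show "\<exists>M\<ge>0. \<forall>x. (\<forall>i\<in>I. x i \<in> vecs E) \<longrightarrow> nrm F (\<Sum>q\<in>Q. A q x) \<le> M * (\<Prod>i\<in>I. nrm E (x i))"
        using M(1) by (intro exI[of _ "\<Sum>q\<in>Q. M q"]) (auto intro: sum_nonneg)
    qed
  qed
qed

lemma (in banach_space) scl_bounded_op: "scl E c \<in> bounded_ops E E"
  by (rule bounded_opsI[where C = "norm c"]) (simp_all add: scale_right_distrib nrm_scl mult.commute)

text \<open>\<open>S\<close> is the symmetrization of \<open>A\<close>. Expanding \<open>A\<close>
  at the sums over \<open>J\<close> gives one term for each map \<open>f\<close> from
  \<open>I\<close> to \<open>J\<close>; in the signed sum over \<open>J\<close> only maps onto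
  \<open>I\<close> survive, that is, permutations. Division by their number is possible in
  characteristic \<open>0\<close>.\<close>

lemma (in multilinear) polarization:
  obtains S and c :: "nat set \<Rightarrow> 'k" where "multilinear E F I S" "\<And>x. x \<in> vecs E \<Longrightarrow> S (\<lambda>_. x) = A (\<lambda>_. x)"
    "\<And>x. (\<And>i. i \<in> I \<Longrightarrow> x i \<in> vecs E) \<Longrightarrow>
      S x = (\<Sum>J\<in>Pow I. scl F (c J) (A (\<lambda>_. \<Sum>i\<in>J. x i)))"
proof -
  \<comment> \<open>The permutations of \<open>I\<close>; being extensional, they form a finite
    set.\<close>
  define G where "G = {f \<in> Pi\<^sub>E I (\<lambda>_. I). f ` I = I}"
  have fin: "finite (Pi\<^sub>E I (\<lambda>_. I))" using finite_slots by (intro finite_PiE) auto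
  then have finG: "finite G" by (simp add: G_def)
  have "(\<lambda>i\<in>I. i) \<in> G" by (auto simp: G_def)
  then have "card G > 0" using finG card_gt_0_iff by blast
  then have N: "(of_nat (card G) :: 'k) \<noteq> 0" by simp
  define S where "S x = scl F (1 / of_nat (card G)) (\<Sum>f\<in>G. A (\<lambda>i. x (f i)))" for x
  have mG: "multilinear E F I (\<lambda>x. \<Sum>f\<in>G. A (\<lambda>i. x (f i)))"
  proof (rule multilinear_sum[OF E.banach_space_axioms F.banach_space_axioms finite_slots])
    fix f assume "f \<in> G"
    then have "f ` I = I" "inj_on f I" using finite_slots by (auto simp: G_def intro: eq_card_imp_inj_on)
    then show "multilinear E F I (\<lambda>x. A (\<lambda>i. x (f i)))" by (intro permute) auto
  qed
  have mS: "multilinear E F I S"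
    unfolding S_def by (rule multilinear.postcompose[OF mG F.banach_space_axioms F.scl_bounded_op])
  have diag: "S (\<lambda>_. x) = A (\<lambda>_. x)" for x
  proof -
    have "(\<Sum>f\<in>G. A (\<lambda>_. x)) = scl F (of_nat (card G)) (A (\<lambda>_. x))"
      using F.scale_sum_left[of "\<lambda>_. 1" G "A (\<lambda>_. x)"] by simp
    then show ?thesis using N by (simp add: S_def)
  qed
  define c :: "nat set \<Rightarrow> 'k" where "c J = 1 / of_nat (card G) * (- 1) ^ card (I - J)" for J
  have "S x = (\<Sum>J\<in>Pow I. scl F (c J) (A (\<lambda>_. \<Sum>i\<in>J. x i)))" if x: "\<And>i. i \<in> I \<Longrightarrow> x i \<in> vecs E" for x
  proof -
    have ex: "A (\<lambda>_. \<Sum>i\<in>J. x i) = (\<Sum>f\<in>Pi\<^sub>E I (\<lambda>_. I). if f ` I \<subseteq> J then A (\<lambda>i. x (f i)) else 0)" if J: "J \<subseteq> I" for J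
    proof -
      have "A (\<lambda>_. \<Sum>i\<in>J. x i) = A (\<lambda>i. if i \<in> I then \<Sum>n\<in>J. x n else 0)" by (intro cong) simp
      also have "\<dots> = (\<Sum>f\<in>Pi\<^sub>E I (\<lambda>_. J). A (\<lambda>i. if i \<in> I then x (f i) else 0))"
        by (rule expand_sums) (use finite_slots x J in auto)
      also have "\<dots> = (\<Sum>f\<in>Pi\<^sub>E I (\<lambda>_. J). A (\<lambda>i. x (f i)))"
        by (intro sum.cong refl cong) auto
      also have "Pi\<^sub>E I (\<lambda>_. J) = {f \<in> Pi\<^sub>E I (\<lambda>_. I). f ` I \<subseteq> J}"
        unfolding PiE_def Pi_def using J by (intro set_eqI) (simp add: image_subset_iff, blast)
      also have "(\<Sum>f\<in>{f \<in> Pi\<^sub>E I (\<lambda>_. I). f ` I \<subseteq> J}. A (\<lambda>i. x (f i))) =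
          (\<Sum>f\<in>Pi\<^sub>E I (\<lambda>_. I). if f ` I \<subseteq> J then A (\<lambda>i. x (f i)) else 0)"
        by (rule sum.inter_filter[OF fin])
      finally show ?thesis .
    qed
    have "(\<Sum>J\<in>Pow I. scl F ((- 1) ^ card (I - J)) (A (\<lambda>_. \<Sum>i\<in>J. x i))) =
       (\<Sum>J\<in>Pow I. \<Sum>f\<in>Pi\<^sub>E I (\<lambda>_. I). if f ` I \<subseteq> J then scl F ((- 1) ^ card (I - J)) (A (\<lambda>i. x (f i))) else 0)"
      by (intro sum.cong refl) (simp add: ex F.scale_sum_right if_distrib cong: if_cong)
    also have "\<dots> = (\<Sum>f\<in>Pi\<^sub>E I (\<lambda>_. I). \<Sum>J\<in>Pow I. if f ` I \<subseteq> J then scl F ((- 1) ^ card (I - J)) (A (\<lambda>i. x (f i))) else 0)"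
      by (rule sum.swap)
    also have "\<dots> = (\<Sum>f\<in>Pi\<^sub>E I (\<lambda>_. I). scl F (\<Sum>J\<in>{J \<in> Pow I. f ` I \<subseteq> J}. (- 1) ^ card (I - J)) (A (\<lambda>i. x (f i))))"
      unfolding F.scale_sum_left using finite_slots by (intro sum.cong refl sum.inter_filter[symmetric]) simp
    also have "\<dots> = (\<Sum>f\<in>Pi\<^sub>E I (\<lambda>_. I). if f ` I = I then A (\<lambda>i. x (f i)) else 0)"
    proof (intro sum.cong refl)
      fix f assume "f \<in> Pi\<^sub>E I (\<lambda>_. I)"
      then have "f ` I \<subseteq> I" by auto
      then show "scl F (\<Sum>J\<in>{J \<in> Pow I. f ` I \<subseteq> J}. (- 1) ^ card (I - J)) (A (\<lambda>i. x (f i))) =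
          (if f ` I = I then A (\<lambda>i. x (f i)) else 0)"
        by (subst alternating_superset_sum[OF finite_slots]) auto
    qed
    also have "\<dots> = (\<Sum>f\<in>G. A (\<lambda>i. x (f i)))"
      unfolding G_def by (rule sum.inter_filter[OF fin, symmetric])
    finally show ?thesis
      unfolding S_def c_def F.scale_scale[symmetric] F.scale_sum_right[symmetric] by simp
  qed
  then show ?thesis using that mS diag by blast
qed

section \<open>Tools on series: multilinear forms on w.u.C. series, the Schur property, concrete
  sequence spaces\<close>

section \<open>Scalar multilinear forms on weakly unconditionally Cauchy series\<close>

text \<open>Averaging over the signs removes the terms off the diagonal.\<close>

lemma sign_average:
  fixes g :: "nat \<Rightarrow> nat \<Rightarrow> 'k::rc_field"
  assumes "\<And>\<epsilon> :: nat \<Rightarrow> 'k. (\<And>n. \<epsilon> n = 1 \<or> \<epsilon> n = - 1) \<Longrightarrow>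
    norm (a + (\<Sum>n<N. \<Sum>m<N. \<epsilon> n * \<epsilon> m * g n m)) \<le> C"
  shows "norm (a + (\<Sum>n<N. g n n)) \<le> C"
  using assms
proof (induction N arbitrary: a)
  case 0
  from 0[of "\<lambda>_. 1"] show ?case by simp
next
  case (Suc N)
  have "norm (a + g N N + (\<Sum>n<N. \<Sum>m<N. \<epsilon> n * \<epsilon> m * g n m)) \<le> C"
    if e: "\<And>n. \<epsilon> n = 1 \<or> \<epsilon> n = - 1" for \<epsilon> :: "nat \<Rightarrow> 'k"
  proof -
    define S where "S = (\<Sum>n<N. \<Sum>m<N. \<epsilon> n * \<epsilon> m * g n m)"
    define X where "X = (\<Sum>n<N. \<epsilon> n * g n N) + (\<Sum>m<N. \<epsilon> m * g N m)"
    \<comment> \<open>The sign of index \<open>N\<close> enters the mixed terms \<open>X\<close>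
      linearly but \<open>g N N\<close> as its square, so the average over both signs keeps
      \<open>g N N\<close> and kills \<open>X\<close>.\<close>
    have "norm ((a + g N N + S) + s * X) \<le> C" if s: "s = 1 \<or> s = - 1" for s
    proof -
      let ?e = "\<epsilon>(N := s)"
      have ss: "s * s = 1" using s by auto
      have "(\<Sum>n<Suc N. \<Sum>m<Suc N. ?e n * ?e m * g n m) = S + (\<Sum>n<N. \<epsilon> n * s * g n N) + ((\<Sum>m<N. s * \<epsilon> m * g N m) + s * s * g N N)"
        by (simp add: S_def sum.distrib)
      also have "\<dots> = S + s * X + g N N"
        using ss by (simp add: X_def sum_distrib_left distrib_left mult_ac)
      finally show ?thesis using Suc.prems[of ?e] e s by (simp add: algebra_simps)
    qed
    from this[of 1] this[of "-1"] have "norm ((a + g N N + S) + X) \<le> C" "norm ((a + g N N + S) - X) \<le> C"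
      by simp_all
    then have "norm (((a + g N N + S) + X) + ((a + g N N + S) - X)) \<le> C + C"
      by (rule order_trans[OF norm_triangle_ineq add_mono])
    also have "((a + g N N + S) + X) + ((a + g N N + S) - X) = 2 * (a + g N N + S)" by simp
    finally show ?thesis unfolding S_def norm_mult by simp
  qed
  then have "norm (a + g N N + (\<Sum>n<N. g n n)) \<le> C" by (rule Suc.IH)
  then show ?case by (simp add: algebra_simps)
qed

text \<open>Induction over the slots in \<open>W\<close>. With one slot the sum can be pulled
  inside. For a further slot, \<open>sign_average\<close> replaces the diagonal sum by double sums
  with signs, in which that slot holds one fixed vector, a signed sum bounded by \<open>C\<close>.
  No combinatorial factor arises.\<close>

lemma multilinear_diagonal_sum:
  fixes E :: "('k::rc_field, 'v::ab_group_add) nspace" and v :: "nat \<Rightarrow> nat \<Rightarrow> 'v"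
  assumes B: "multilinear E scalar_space I B"
    and M: "M \<ge> 0" "\<And>x. (\<And>i. i \<in> I \<Longrightarrow> x i \<in> vecs E) \<Longrightarrow> norm (B x) \<le> M * (\<Prod>i\<in>I. nrm E (x i))"
    and W: "W \<subseteq> I" "W \<noteq> {}" and v: "\<And>s n. s \<in> W \<Longrightarrow> v s n \<in> vecs E"
    and C: "\<And>s c. s \<in> W \<Longrightarrow> (\<And>n. norm (c n) \<le> 1) \<Longrightarrow> nrm E (\<Sum>n<N. scl E (c n) (v s n)) \<le> C s"
    and x: "\<And>i. i \<in> I - W \<Longrightarrow> x i \<in> vecs E"
  shows "(\<Sum>n<N. norm (B (\<lambda>i. if i \<in> W then v i n else x i))) \<le> M * (\<Prod>i\<in>W. C i) * (\<Prod>i\<in>I - W. nrm E (x i))"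
proof -
  interpret B: multilinear E scalar_space I B by (rule B)
  have C0: "C s \<ge> 0" if "s \<in> W" for s using C[OF that, of "\<lambda>_. 0"] by simp
  have sv: "(\<Sum>n<N. scl E (c n) (v s n)) \<in> vecs E" if "s \<in> W" for s and c :: "nat \<Rightarrow> 'k"
    using v[OF that] by (intro B.E.vecs_sum B.E.vecs_scl)
  have split: "(\<Prod>i\<in>I. nrm E ((x(s := u)) i)) = nrm E u * (\<Prod>i\<in>I - {s}. nrm E (x i))" if "s \<in> I" for s x u
    using that B.finite_slots by (subst prod.remove[of I s]) auto
  \<comment> \<open>The multipliers \<open>\<theta>\<close> let the induction absorb the signs
    \<open>\<epsilon> n\<close>; at the end they turn the terms into absolute values.\<close>
  have *: "norm (\<Sum>n<N. \<theta> n * B (\<lambda>i. if i \<in> V then v i n else x i)) \<le> M * (\<Prod>i\<in>V. C i) * (\<Prod>i\<in>I - V. nrm E (x i))"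
    if "finite V" "V \<noteq> {}" "V \<subseteq> W" "\<And>n. norm (\<theta> n) \<le> 1" "\<And>i. i \<in> I - V \<Longrightarrow> x i \<in> vecs E" for V x and \<theta> :: "nat \<Rightarrow> 'k"
    using that
  proof (induction V arbitrary: x \<theta> rule: finite_ne_induct)
    case (singleton s)
    then have s: "s \<in> I" "s \<in> W" using W by auto
    have xo: "x j \<in> vecs E" if "j \<in> I" "j \<noteq> s" for j using singleton.prems that by auto
    have "(\<Sum>n<N. \<theta> n * B (\<lambda>i. if i \<in> {s} then v i n else x i)) = (\<Sum>n<N. B (x(s := scl E (\<theta> n) (v s n))))"
    proof (intro sum.cong refl)
      fix n
      have "(\<lambda>i. if i \<in> {s} then v i n else x i) = x(s := v s n)" by auto
      then show "\<theta> n * B (\<lambda>i. if i \<in> {s} then v i n else x i) = B (x(s := scl E (\<theta> n) (v s n)))"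
        using B.scl[OF s(1) xo v[OF s(2)]] by simp
    qed
    also have "\<dots> = B (x(s := (\<Sum>n<N. scl E (\<theta> n) (v s n))))"
      by (rule B.sum[OF s(1) xo, symmetric]) (use v[OF s(2)] in auto)
    finally have "norm (\<Sum>n<N. \<theta> n * B (\<lambda>i. if i \<in> {s} then v i n else x i))
        \<le> M * (nrm E (\<Sum>n<N. scl E (\<theta> n) (v s n)) * (\<Prod>i\<in>I - {s}. nrm E (x i)))"
      using M(2)[of "x(s := (\<Sum>n<N. scl E (\<theta> n) (v s n)))"] split[OF s(1)] xo sv[OF s(2)] by simp
    also have "\<dots> \<le> M * (C s * (\<Prod>i\<in>I - {s}. nrm E (x i)))"
      using C[OF s(2) singleton.prems(2)] xo
      by (intro mult_left_mono mult_right_mono M(1) prod_nonneg) (auto simp: B.E.nrm_nonneg)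
    finally show ?case by simp
  next
    case (insert s V)
    then have s: "s \<in> I" "s \<in> W" and VW: "V \<subseteq> W" using W by auto
    have VI: "V \<subseteq> I" using VW W by blast
    define z where "z u n = (\<lambda>i. if i \<in> V then v i n else (x(s := u)) i)" for u n
    have zu: "z u n = (z 0 n)(s := u)" for u n using insert.hyps by (auto simp: z_def)
    have z0: "z 0 n j \<in> vecs E" if "j \<in> I" "j \<noteq> s" for n j
      using that insert.prems(3)[of j] v[of j n] VW by (auto simp: z_def)
    have e: "(\<lambda>i. if i \<in> insert s V then v i n else x i) = z (v s n) n" for n by (auto simp: z_def)
    have "norm (0 + (\<Sum>n<N. \<theta> n * B (z (v s n) n))) \<le> M * (\<Prod>i\<in>insert s V. C i) * (\<Prod>i\<in>I - insert s V. nrm E (x i))"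
    proof (rule sign_average[where g = "\<lambda>n m. \<theta> n * B (z (v s m) n)"])
      fix \<epsilon> :: "nat \<Rightarrow> 'k" assume \<epsilon>: "\<And>n. \<epsilon> n = 1 \<or> \<epsilon> n = - 1"
      have n\<epsilon>: "norm (\<epsilon> n) \<le> 1" for n using \<epsilon>[of n] by auto
      let ?S = "\<Sum>m<N. scl E (\<epsilon> m) (v s m)"
      have lin: "B (z ?S n) = (\<Sum>m<N. \<epsilon> m * B (z (v s m) n))" for n
      proof -
        have "B ((z 0 n)(s := ?S)) = (\<Sum>m<N. B ((z 0 n)(s := scl E (\<epsilon> m) (v s m))))"
          by (rule B.sum[OF s(1) z0]) (use v[OF s(2)] in auto)
        also have "\<dots> = (\<Sum>m<N. \<epsilon> m * B ((z 0 n)(s := v s m)))"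
          using B.scl[OF s(1) z0 v[OF s(2)]] by simp
        finally show ?thesis unfolding zu[symmetric] .
      qed
      have "(\<Sum>n<N. \<Sum>m<N. \<epsilon> n * \<epsilon> m * (\<theta> n * B (z (v s m) n))) = (\<Sum>n<N. (\<epsilon> n * \<theta> n) * B (z ?S n))"
        unfolding lin sum_distrib_left by (intro sum.cong refl) (simp add: mult_ac)
      also have "norm \<dots> \<le> M * (\<Prod>i\<in>V. C i) * (\<Prod>i\<in>I - V. nrm E ((x(s := ?S)) i))"
        unfolding z_def
      proof (rule insert.IH[OF VW])
        show "norm (\<epsilon> n * \<theta> n) \<le> 1" for n
          using n\<epsilon>[of n] insert.prems(2)[of n] by (simp add: norm_mult mult_le_one)
        show "(x(s := ?S)) i \<in> vecs E" if "i \<in> I - V" for i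
          using that insert.prems(3)[of i] sv[OF s(2)] by auto
      qed
      also have "(\<Prod>i\<in>I - V. nrm E ((x(s := ?S)) i)) = nrm E ?S * (\<Prod>i\<in>I - insert s V. nrm E (x i))"
      proof -
        have "I - V - {s} = I - insert s V" by blast
        then show ?thesis using s(1) insert.hyps B.finite_slots by (subst prod.remove[of "I - V" s]) auto
      qed
      also have "M * (\<Prod>i\<in>V. C i) * (nrm E ?S * (\<Prod>i\<in>I - insert s V. nrm E (x i)))
          \<le> M * (\<Prod>i\<in>V. C i) * (C s * (\<Prod>i\<in>I - insert s V. nrm E (x i)))"
        using C[OF s(2) n\<epsilon>] C0 VW M(1) insert.prems(3)
        by (intro mult_left_mono mult_right_mono prod_nonneg mult_nonneg_nonneg) (auto simp: B.E.nrm_nonneg)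
      also have "\<dots> = M * (\<Prod>i\<in>insert s V. C i) * (\<Prod>i\<in>I - insert s V. nrm E (x i))"
        using insert.hyps by simp
      finally show "norm (0 + (\<Sum>n<N. \<Sum>m<N. \<epsilon> n * \<epsilon> m * (\<theta> n * B (z (v s m) n))))
          \<le> M * (\<Prod>i\<in>insert s V. C i) * (\<Prod>i\<in>I - insert s V. nrm E (x i))" by simp
    qed
    then show ?case unfolding e by simp
  qed
  let ?b = "\<lambda>n. B (\<lambda>i. if i \<in> W then v i n else x i)"
  have "(\<Sum>n<N. rsgn (?b n) * ?b n) = of_real (\<Sum>n<N. norm (?b n))" by (simp add: rsgn_mult)
  then have "norm (\<Sum>n<N. rsgn (?b n) * ?b n) = (\<Sum>n<N. norm (?b n))"
    by (simp only: norm_of_real abs_of_nonneg[OF sum_nonneg[OF norm_ge_zero]])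
  then show ?thesis
    using *[of W "\<lambda>n. rsgn (?b n)" x] W x B.finite_slots finite_subset norm_rsgn by fastforce
qed

text \<open>Slots in \<open>W\<close> hold terms of w.u.C. series, slots in \<open>K\<close> hold
  partial sums, the others are constant. Without partial sums, the values of \<open>B\<close> are
  absolutely summable by \<open>multilinear_diagonal_sum\<close>. The induction removes a slot
  \<open>r\<close> from \<open>K\<close> in two ways: by freezing it, and by replacing its partial
  sums by block differences, which moves \<open>r\<close> to \<open>W\<close>.\<close>

lemma multilinear_wuC_null:
  fixes E :: "('k::rc_field, 'v::ab_group_add) nspace" and y :: "nat \<Rightarrow> nat \<Rightarrow> 'v"
  assumes B: "multilinear E scalar_space I B"
    and "K \<subseteq> I" "W \<subseteq> I" "W \<noteq> {}" "K \<inter> W = {}"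
    and "\<And>i. i \<in> W \<Longrightarrow> wuC E (\<lambda>n. y n i)"
    and "\<And>i. i \<in> K \<Longrightarrow> banach_space.wuC_sums E (\<lambda>n. y n i)"
    and "\<And>i. i \<in> I - K - W \<Longrightarrow> \<exists>a\<in>vecs E. \<forall>n. y n i = a"
  shows "(\<lambda>n. B (y n)) \<longlonglongrightarrow> 0"
proof -
  interpret B: multilinear E scalar_space I B by (rule B)
  obtain M where M: "M \<ge> 0" "\<And>x. (\<And>i. i \<in> I \<Longrightarrow> x i \<in> vecs E) \<Longrightarrow> norm (B x) \<le> M * (\<Prod>i\<in>I. nrm E (x i))"
    using B.bound by auto
  have "finite K" using assms(2) B.finite_slots finite_subset by blast
  then show ?thesis using assms(2-)
  proof (induction K arbitrary: W y rule: finite_induct)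
    case empty
    have "\<forall>s. \<exists>C. s \<in> W \<longrightarrow> (\<forall>c N. (\<forall>i. norm (c i) \<le> 1) \<longrightarrow> nrm E (\<Sum>n<N. scl E (c n) (y n s)) \<le> C)"
      using empty.prems(5) B.E.wuC_bounded_multipliers by metis
    then obtain C where C: "\<And>s c N. s \<in> W \<Longrightarrow> (\<And>n. norm (c n) \<le> 1) \<Longrightarrow> nrm E (\<Sum>n<N. scl E (c n) (y n s)) \<le> C s"
      unfolding choice_iff by blast
    have eq: "B (y n) = B (\<lambda>i. if i \<in> W then y n i else y 0 i)" for n
    proof (rule B.cong)
      fix i assume "i \<in> I"
      then show "y n i = (if i \<in> W then y n i else y 0 i)"
        using empty.prems(7)[of i] by (cases "i \<in> W") auto
    qed
    have y0: "y 0 i \<in> vecs E" if "i \<in> I - W" for i using empty.prems(7)[of i] that by auto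
    have "(\<Sum>n<N. norm (B (y n))) \<le> M * (\<Prod>i\<in>W. C i) * (\<Prod>i\<in>I - W. nrm E (y 0 i))" for N
      unfolding eq
      by (rule multilinear_diagonal_sum[OF B M, where v = "\<lambda>s n. y n s"])
        (use empty.prems(2,3) C y0 wuC_vecs[OF empty.prems(5)] in auto)
    then have "summable (\<lambda>n. norm (B (y n)))" by (intro summableI_nonneg_bounded) auto
    then show ?case using summable_LIMSEQ_zero tendsto_norm_zero_iff by blast
  next
    case (insert r K)
    have r: "r \<in> I" "r \<notin> W" using insert.prems by auto
    have ys: "B.E.wuC_sums (\<lambda>n. y n i)" if "i \<in> insert r K" for i using insert.prems(6)[OF that] .
    have yv: "y n i \<in> vecs E" if "i \<in> I" for n i
      using that insert.prems(5)[of i, THEN wuC_vecs] ys[THEN B.E.wuC_sums_vecs] insert.prems(7)[of i] by (metis DiffI insert_iff)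
    have fixed: "(\<lambda>n. B ((y n)(r := y q r))) \<longlonglongrightarrow> 0" for q
    proof (rule insert.IH)
      show "wuC E (\<lambda>n. ((y n)(r := y q r)) i)" if "i \<in> W" for i using insert.prems(5)[OF that] that r by (cases "i = r") auto
      show "B.E.wuC_sums (\<lambda>n. ((y n)(r := y q r)) i)" if "i \<in> K" for i using ys[of i] that insert.hyps by (cases "i = r") auto
      show "\<exists>a\<in>vecs E. \<forall>n. ((y n)(r := y q r)) i = a" if "i \<in> I - K - W" for i
        using that insert.prems(7)[of i] yv[OF r(1)] by (cases "i = r") auto
    qed (use insert.prems(1-4) in auto)
    show ?case
    proof (rule ccontr)
      assume "\<not> ?case"
      then obtain e where e: "e > 0" "\<And>N. \<exists>n\<ge>N. norm (B (y n)) \<ge> e"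
        unfolding LIMSEQ_iff by (auto simp: not_less)
      \<comment> \<open>With slot \<open>r\<close> frozen at index \<open>q\<close> the values tend
        to \<open>0\<close>, while the unfrozen values return above \<open>e\<close>. Subtracting
        the two leaves at least \<open>e/2\<close> on the difference
        \<open>y n r - y q r\<close>.\<close>
      have "\<exists>n>q. norm (B (y n)) \<ge> e \<and> norm (B ((y n)(r := y q r))) < e/2" for q
      proof -
        obtain N where N: "\<And>n. n \<ge> N \<Longrightarrow> norm (B ((y n)(r := y q r))) < e/2"
          using fixed[of q] e(1) unfolding LIMSEQ_iff by (metis diff_zero half_gt_zero)
        obtain n where "n \<ge> max N (Suc q)" "norm (B (y n)) \<ge> e" using e(2) by blast
        then show ?thesis using N[of n] by (intro exI[of _ n]) auto
      qed
      then obtain f where f: "\<And>q. q < f q" "\<And>q. norm (B (y (f q))) \<ge> e"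
        "\<And>q. norm (B ((y (f q))(r := y q r))) < e/2" by metis
      define m where "m = rec_nat 0 (\<lambda>_ q. f q)"
      have mS: "m (Suc j) = f (m j)" for j by (simp add: m_def)
      have sm: "strict_mono m" unfolding strict_mono_Suc_iff mS using f(1) by blast
      then have sm': "strict_mono (\<lambda>j. m (Suc j))" by (simp add: strict_mono_Suc_iff)
      define y' where "y' j = (y (m (Suc j)))(r := y (m (Suc j)) r - y (m j) r)" for j
      have "(\<lambda>j. B (y' j)) \<longlonglongrightarrow> 0"
      proof (rule insert.IH)
        show "wuC E (\<lambda>n. y' n i)" if "i \<in> insert r W" for i
        proof (cases "i = r")
          case True
          have "B.E.wuC_sums (\<lambda>j. y (m j) r)"
            by (rule B.E.wuC_sums_mono[OF ys strict_mono_mono[OF sm]]) simp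
          then show ?thesis using True by (simp add: y'_def B.E.wuC_sums_def)
        next
          case False
          then have "wuC E (\<lambda>n. y n i)" using that insert.prems(5) by blast
          then show ?thesis using B.E.wuC_reindex[of "\<lambda>n. y n i" "\<lambda>j. m (Suc j)"] False strict_mono_imp_inj_on[OF sm'] by (simp add: y'_def)
        qed
        show "B.E.wuC_sums (\<lambda>n. y' n i)" if "i \<in> K" for i
          using B.E.wuC_sums_mono[OF ys strict_mono_mono[OF sm'], of i] that insert.hyps
          by (cases "i = r") (auto simp: y'_def)
        show "\<exists>a\<in>vecs E. \<forall>n. y' n i = a" if "i \<in> I - K - insert r W" for i
          using that insert.prems(7)[of i] by (auto simp: y'_def)
      qed (use insert.prems(1-4) insert.hyps in auto)
      moreover have "norm (B (y' j)) \<ge> e/2" for j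
      proof -
        have "B (y' j) = B ((y (m (Suc j)))(r := y (m (Suc j)) r)) - B ((y (m (Suc j)))(r := y (m j) r))"
          unfolding y'_def by (rule B.diff[OF r(1)]) (use yv r(1) in auto)
        then have eq: "B (y' j) = B (y (f (m j))) - B ((y (f (m j)))(r := y (m j) r))" by (simp add: mS)
        show ?thesis unfolding eq using f(2,3)[of "m j"] norm_triangle_ineq2[of "B (y (f (m j)))" "B ((y (f (m j)))(r := y (m j) r))"]
          by linarith
      qed
      ultimately show False using e(1) unfolding LIMSEQ_iff
        by (metis diff_zero half_gt_zero le_refl not_less)
    qed
  qed
qed

text \<open>Along bad blocks the right ends replace the left ends one slot at a time. Each
  replacement has a w.u.C. block difference in one slot and partial sums in the others, so it tends
  to \<open>0\<close> by \<open>multilinear_wuC_null\<close>.\<close>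

lemma multilinear_wuC_sums_Cauchy:
  fixes E :: "('k::rc_field, 'v::ab_group_add) nspace" and y :: "nat \<Rightarrow> nat \<Rightarrow> 'v"
  assumes B: "multilinear E scalar_space I B"
    and y: "\<And>i. i \<in> I \<Longrightarrow> banach_space.wuC_sums E (\<lambda>n. y n i)"
  shows "\<forall>e>0. \<exists>N. \<forall>m\<ge>N. \<forall>n\<ge>N. norm (B (y m) - B (y n)) < e"
proof (rule ccontr)
  assume not: "\<not> ?thesis"
  interpret B: multilinear E scalar_space I B by (rule B)
  obtain e p q where e: "e > 0" "\<And>j. p j < q j" "\<And>j. q j \<le> p (Suc j)"
      "\<And>j. norm (B (y (p j)) - B (y (q j))) \<ge> e"
    using not by (rule not_Cauchy_blocks[of "\<lambda>m n. norm (B (y m) - B (y n))", rotated 2]) (auto simp: norm_minus_commute)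
  have pq: "p j \<le> q j" for j using e(2)[of j] by simp
  note mono = mono_blocks[of p q, OF pq e(3)]
  have yv: "y n i \<in> vecs E" if "i \<in> I" for n i by (rule B.E.wuC_sums_vecs[OF y[OF that]])
  let ?z = "\<lambda>J j i. if i \<in> J then y (q j) i else y (p j) i"
  have "(\<lambda>j. B (?z J j) - B (y (p j))) \<longlonglongrightarrow> 0" if "J \<subseteq> I" for J
    using finite_subset[OF that B.finite_slots] that
  proof (induction J rule: finite_induct)
    case (insert s J)
    let ?w = "\<lambda>j. (?z J j)(s := y (q j) s - y (p j) s)"
    have "(\<lambda>j. B (?w j)) \<longlonglongrightarrow> 0"
    proof (rule multilinear_wuC_null[OF B, of "I - {s}" "{s}"])
      show "wuC E (\<lambda>n. ?w n i)" if "i \<in> {s}" for i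
        using B.E.wuC_sums_blocks[of "\<lambda>n. y n s" p q, OF y pq e(3)] that insert.prems by simp
      show "B.E.wuC_sums (\<lambda>n. ?w n i)" if "i \<in> I - {s}" for i
        using that B.E.wuC_sums_mono[OF y mono(1), of i] B.E.wuC_sums_mono[OF y mono(2), of i]
        by (cases "i \<in> J") auto
    qed (use insert.prems in auto)
    moreover have "B (?w j) = B (?z (insert s J) j) - B (?z J j)" for j
    proof -
      have "(?z J j)(s := y (q j) s) = ?z (insert s J) j" "(?z J j)(s := y (p j) s) = ?z J j"
        using insert.hyps by auto
      then show ?thesis
        using B.diff[of s "?z J j" "y (q j) s" "y (p j) s"] yv insert.prems by auto
    qed
    ultimately have "(\<lambda>j. (B (?z (insert s J) j) - B (?z J j)) + (B (?z J j) - B (y (p j)))) \<longlonglongrightarrow> 0 + 0"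
      using insert by (intro tendsto_add) auto
    then show ?case by simp
  qed simp
  from this[of I] have "(\<lambda>j. B (y (q j)) - B (y (p j))) \<longlonglongrightarrow> 0"
    using B.cong[of "?z I _" "y (q _)"] by simp
  then show False using e(1,4) unfolding LIMSEQ_iff
    by (metis diff_zero le_refl not_less norm_minus_commute)
qed

section \<open>The Schur property\<close>

lemma rc_summable_norm:
  fixes f :: "nat \<Rightarrow> 'k::rc_field"
  assumes "summable (\<lambda>i. norm (f i))"
  shows "summable f" "norm (\<Sum>i. f i) \<le> (\<Sum>i. norm (f i))"
proof -
  have "\<exists>l. (\<lambda>n. \<Sum>i<n. f i) \<longlonglongrightarrow> l"
  proof (rule rc_Cauchy_convergent)
    fix e :: real assume "e > 0"
    then obtain N where N: "\<And>m n. m \<ge> N \<Longrightarrow> norm (\<Sum>i\<in>{m..<n}. norm (f i)) < e"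
      using assms unfolding summable_Cauchy by blast
    have *: "norm ((\<Sum>i<n. f i) - (\<Sum>i<m. f i)) < e" if "N \<le> m" "m \<le> n" for m n
    proof -
      have "(\<Sum>i<n. f i) = (\<Sum>i<m. f i) + (\<Sum>i\<in>{m..<n}. f i)"
        using sum.atLeastLessThan_concat[of 0 m n f] that(2) by (simp add: lessThan_atLeast0)
      then have "norm ((\<Sum>i<n. f i) - (\<Sum>i<m. f i)) \<le> (\<Sum>i\<in>{m..<n}. norm (f i))"
        by (simp add: norm_sum)
      then show ?thesis using N[OF that(1), of n] by simp
    qed
    have "norm ((\<Sum>i<m. f i) - (\<Sum>i<n. f i)) < e" if "N \<le> m" "N \<le> n" for m n
      using *[of m n] *[of n m] that by (cases "m \<le> n") (auto simp: norm_minus_commute)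
    then show "\<exists>N. \<forall>m\<ge>N. \<forall>n\<ge>N. norm ((\<Sum>i<m. f i) - (\<Sum>i<n. f i)) < e" by blast
  qed
  then show s: "summable f" unfolding summable_def sums_def by blast
  show "norm (\<Sum>i. f i) \<le> (\<Sum>i. norm (f i))"
  proof (rule tendsto_upperbound)
    show "(\<lambda>n. norm (\<Sum>i<n. f i)) \<longlonglongrightarrow> norm (\<Sum>i. f i)"
      by (intro tendsto_norm summable_LIMSEQ s)
    have "norm (\<Sum>i<n. f i) \<le> (\<Sum>i. norm (f i))" for n
      using norm_sum[of f "{..<n}"] sum_le_suminf[OF assms, of "{..<n}"] by simp
    then show "\<forall>\<^sub>F n in sequentially. norm (\<Sum>i<n. f i) \<le> (\<Sum>i. norm (f i))" by simp
  qed simp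
qed

text \<open>Gliding hump. Coordinates tend to \<open>0\<close>, so members of norm at least
  \<open>e\<close> can be chosen with less than \<open>e/8\<close> of their mass before their block
  and less than \<open>e/8\<close> after it. One bounded sequence \<open>c\<close> carries the right
  signs on all the disjoint blocks and contradicts weak convergence.\<close>

lemma schur:
  fixes y :: "nat \<Rightarrow> nat \<Rightarrow> 'k::rc_field"
  assumes sm: "\<And>p. summable (\<lambda>i. norm (y p i))"
    and weak: "\<And>c. (\<And>i. norm (c i) \<le> 1) \<Longrightarrow> (\<lambda>p. \<Sum>i. c i * y p i) \<longlonglongrightarrow> 0"
  shows "(\<lambda>p. \<Sum>i. norm (y p i)) \<longlonglongrightarrow> 0"
proof (rule ccontr)
  let ?n = "\<lambda>p. \<Sum>i. norm (y p i)"
  assume "\<not> ?thesis"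
  then obtain e where e: "e > 0" "\<And>N. \<exists>p\<ge>N. norm (?n p) \<ge> e"
    unfolding LIMSEQ_iff by (auto simp: not_less)
  have n0: "?n p \<ge> 0" for p by (intro suminf_nonneg sm) auto
  have coord: "(\<lambda>p. y p i) \<longlonglongrightarrow> 0" for i
  proof -
    have "(\<Sum>j. (if j = i then 1 else 0) * y p j) = y p i" for p
    proof -
      have "(\<lambda>j. (if j = i then 1 else 0) * y p j) = (\<lambda>j. if j = i then y p j else 0)" by auto
      then show ?thesis using sums_unique[OF sums_single[of i "\<lambda>j. y p j"]] by simp
    qed
    then show ?thesis using weak[of "\<lambda>j. if j = i then 1 else 0"] by simp
  qed
  have "\<exists>p\<ge>N. ?n p \<ge> e \<and> (\<Sum>i<N. norm (y p i)) < e/8" for N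
  proof -
    have "(\<lambda>p. \<Sum>i<N. norm (y p i)) \<longlonglongrightarrow> (\<Sum>i<N. norm (0::'k))" by (intro tendsto_intros coord)
    then have "(\<lambda>p. \<Sum>i<N. norm (y p i)) \<longlonglongrightarrow> 0" by simp
    then obtain P where P: "\<And>p. p \<ge> P \<Longrightarrow> (\<Sum>i<N. norm (y p i)) < e/8"
      using order_tendstoD(2)[of _ 0 sequentially "e/8"] e(1) unfolding eventually_sequentially by auto
    obtain p where "p \<ge> max N P" "norm (?n p) \<ge> e" using e(2) by blast
    then show ?thesis using P[of p] n0[of p] by (intro exI[of _ p]) auto
  qed
  then obtain pick where pick: "\<And>N. pick N \<ge> N" "\<And>N. ?n (pick N) \<ge> e" "\<And>N. (\<Sum>i<N. norm (y (pick N) i)) < e/8"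
    by metis
  have "\<exists>N'>N. ?n p - (\<Sum>i<N'. norm (y p i)) < e/8" for p N
  proof -
    have "(\<lambda>N'. ?n p - (\<Sum>i<N'. norm (y p i))) \<longlonglongrightarrow> ?n p - ?n p"
      by (intro tendsto_intros summable_LIMSEQ sm)
    then have "eventually (\<lambda>N'. ?n p - (\<Sum>i<N'. norm (y p i)) < e/8) sequentially"
      by (rule order_tendstoD) (use e in simp)
    then have "eventually (\<lambda>N'. ?n p - (\<Sum>i<N'. norm (y p i)) < e/8 \<and> N' > N) sequentially"
      using eventually_gt_at_top[of N] by eventually_elim simp
    then show ?thesis using eventually_happens' sequentially_bot by blast
  qed
  then have "\<forall>p N. \<exists>N'. N' > N \<and> ?n p - (\<Sum>i<N'. norm (y p i)) < e/8" by simp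
  then obtain cut where cut: "\<And>p N. cut p N > N" "\<And>p N. ?n p - (\<Sum>i<cut p N. norm (y p i)) < e/8"
    unfolding choice_iff by blast
  define b where "b = rec_nat 0 (\<lambda>_ N. cut (pick N) N)"
  have b0: "b 0 = 0" and bS: "b (Suc j) = cut (pick (b j)) (b j)" for j by (simp_all add: b_def)
  have bm: "strict_mono b" unfolding strict_mono_Suc_iff bS using cut(1) by blast
  have bj: "j \<le> b j" for j using strict_mono_imp_increasing[OF bm] .
  \<comment> \<open>The number of the block containing \<open>i\<close>; the blocks start at
    \<open>b 0 = 0\<close> and leave no gaps.\<close>
  define J where "J i = (LEAST j. i < b (Suc j))" for i
  have J: "J i = j" if "b j \<le> i" "i < b (Suc j)" for i j
    unfolding J_def
  proof (rule Least_equality)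
    show "i < b (Suc j)" by (rule that(2))
    fix j' assume "i < b (Suc j')"
    then have "b j < b (Suc j')" using that(1) by simp
    then show "j \<le> j'" using strict_mono_less[OF bm] by simp
  qed
  define c where "c i = rsgn (y (pick (b (J i))) i)" for i
  have big: "norm (\<Sum>i. c i * y (pick (b j)) i) > e/2" for j
  proof -
    let ?y = "y (pick (b j))" and ?I = "{b j..<b (Suc j)}"
    \<comment> \<open>On the block \<open>c i\<close> has the exact sign and the error is
      \<open>0\<close>; elsewhere it is at most twice the coordinate. The total error stays below
      \<open>2 (e/8 + e/8) = e/2\<close>.\<close>
    let ?g = "\<lambda>i. 2 * norm (?y i) - (if i \<in> ?I then 2 * norm (?y i) else 0)"
    have g: "?g sums (2 * ?n (pick (b j)) - (\<Sum>i\<in>?I. 2 * norm (?y i)))"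
      by (intro sums_diff sums_mult summable_sums sm sums_If_finite_set) simp
    have mid: "(\<Sum>i<b j. norm (?y i)) + (\<Sum>i\<in>?I. norm (?y i)) = (\<Sum>i<b (Suc j). norm (?y i))"
      using sum.atLeastLessThan_concat[of 0 "b j" "b (Suc j)" "\<lambda>i. norm (?y i)"] strict_mono_less_eq[OF bm, of j "Suc j"]
      by (simp add: lessThan_atLeast0)
    have small: "2 * ?n (pick (b j)) - (\<Sum>i\<in>?I. 2 * norm (?y i)) < e/2"
      using mid pick(3)[of "b j"] cut(2)[of "pick (b j)" "b j"] unfolding bS[symmetric] sum_distrib_left[symmetric] by linarith
    have h: "norm (c i * ?y i - of_real (norm (?y i))) \<le> ?g i" for i
    proof (cases "i \<in> ?I")
      case True
      then have "J i = j" by (intro J) auto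
      then show ?thesis using True by (simp add: c_def rsgn_mult)
    next
      case False
      have "norm (c i * ?y i - of_real (norm (?y i))) \<le> norm (c i * ?y i) + norm (?y i)"
        by (rule order_trans[OF norm_triangle_ineq4]) simp
      also have "norm (c i * ?y i) \<le> 1 * norm (?y i)"
        unfolding norm_mult c_def by (intro mult_right_mono norm_rsgn) auto
      finally show ?thesis unfolding if_not_P[OF False] by simp
    qed
    have "summable (\<lambda>i. norm (c i * ?y i))"
      by (rule summable_comparison_test'[OF sm[of "pick (b j)"]])
        (simp add: c_def norm_mult mult_left_le_one_le norm_rsgn)
    then have sc: "summable (\<lambda>i. c i * ?y i)" by (rule rc_summable_norm)
    have "(\<lambda>i. c i * ?y i - of_real (norm (?y i))) sums ((\<Sum>i. c i * ?y i) - of_real (?n (pick (b j))))"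
      by (intro sums_diff summable_sums sc sums_of_real sm)
    then have "norm ((\<Sum>i. c i * ?y i) - of_real (?n (pick (b j)))) = norm (\<Sum>i. c i * ?y i - of_real (norm (?y i)))"
      by (simp add: sums_iff)
    also have "\<dots> \<le> (\<Sum>i. norm (c i * ?y i - of_real (norm (?y i))))"
      by (rule rc_summable_norm) (rule summable_comparison_test'[OF sums_summable[OF g]], use h in simp)
    also have "\<dots> \<le> (\<Sum>i. ?g i)"
      by (intro suminf_le h sums_summable[OF g] summable_comparison_test'[OF sums_summable[OF g]]) (use h in simp)
    also have "\<dots> < e/2" using small sums_unique[OF g] by simp
    finally have "norm ((\<Sum>i. c i * ?y i) - of_real (?n (pick (b j)))) < e/2" .
    moreover have "norm (of_real (?n (pick (b j))) :: 'k) \<ge> e" using pick(2)[of "b j"] by simp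
    ultimately show ?thesis
      using norm_triangle_ineq2[of "of_real (?n (pick (b j)))" "\<Sum>i. c i * ?y i"]
        norm_minus_commute[of "of_real (?n (pick (b j)))" "\<Sum>i. c i * ?y i"] by linarith
  qed
  have "(\<lambda>p. \<Sum>i. c i * y p i) \<longlonglongrightarrow> 0" by (rule weak) (simp add: c_def norm_rsgn)
  then obtain P where P: "\<And>p. p \<ge> P \<Longrightarrow> norm (\<Sum>i. c i * y p i) < e/2"
    using e(1) unfolding LIMSEQ_iff by (metis diff_zero half_gt_zero)
  have "pick (b P) \<ge> P" using pick(1)[of "b P"] bj[of P] by simp
  then show False using P[of "pick (b P)"] big[of P] by simp
qed

section \<open>The spaces of null sequences and of summable sequences\<close>

text \<open>The space \<open>\<ell>\<^sub>1\<close> with coordinates labelled by the range of an injection \<open>\<iota>\<close>, so that it can be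
  carried by the type \<open>('e \<Rightarrow> 'k) \<Rightarrow> 'k\<close>, the only one available for target spaces in assertion (b).\<close>

definition l1_space :: "(nat \<Rightarrow> 'i) \<Rightarrow> ('k::rc_field, 'i \<Rightarrow> 'k) nspace" where
  "l1_space \<iota> = \<lparr>vecs = {f \<in> {f. \<forall>a. a \<notin> range \<iota> \<longrightarrow> f a = 0}.
       bdd_above ((\<lambda>N. \<Sum>a\<in>\<iota> ` {..<N}. norm (f a)) ` UNIV)},
     scl = (\<lambda>c f a. c * f a), nrm = (\<lambda>f. SUP N\<in>UNIV. \<Sum>a\<in>\<iota> ` {..<N}. norm (f a))\<rparr>"

lemma scl_l1 [simp]: "scl (l1_space \<iota>) = (\<lambda>c f a. c * f a)"
  by (simp add: l1_space_def)

lemma l1_partial: "inj \<iota> \<Longrightarrow> (\<Sum>a\<in>\<iota> ` {..<N}. norm (f a)) = (\<Sum>n<N. norm (f (\<iota> n)))"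
  by (subst sum.reindex) (auto simp: o_def intro: inj_on_subset)

lemma l1_vecs_iff:
  assumes "inj \<iota>"
  shows "f \<in> vecs (l1_space \<iota>) \<longleftrightarrow> (\<forall>a. a \<notin> range \<iota> \<longrightarrow> f a = 0) \<and> summable (\<lambda>n. norm (f (\<iota> n)))"
proof -
  have "bdd_above (range (\<lambda>N. \<Sum>n<N. norm (f (\<iota> n)))) \<longleftrightarrow> summable (\<lambda>n. norm (f (\<iota> n)))"
  proof
    assume "bdd_above (range (\<lambda>N. \<Sum>n<N. norm (f (\<iota> n))))"
    then obtain C where "\<And>N. (\<Sum>n<N. norm (f (\<iota> n))) \<le> C" by (auto simp: bdd_above_def)
    then show "summable (\<lambda>n. norm (f (\<iota> n)))" by (intro summableI_nonneg_bounded) auto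
  next
    assume s: "summable (\<lambda>n. norm (f (\<iota> n)))"
    show "bdd_above (range (\<lambda>N. \<Sum>n<N. norm (f (\<iota> n))))"
      by (rule bdd_aboveI2[of _ _ "\<Sum>n. norm (f (\<iota> n))"]) (auto intro!: sum_le_suminf s)
  qed
  then show ?thesis by (simp add: l1_space_def l1_partial[OF assms])
qed

lemma l1_nrm:
  assumes "inj \<iota>" and f: "f \<in> vecs (l1_space \<iota>)"
  shows "nrm (l1_space \<iota>) f = (\<Sum>n. norm (f (\<iota> n)))"
proof -
  have s: "summable (\<lambda>n. norm (f (\<iota> n)))" using f l1_vecs_iff[OF assms(1)] by blast
  have bdd: "bdd_above (range (\<lambda>N. \<Sum>n<N. norm (f (\<iota> n))))"
    by (rule bdd_aboveI2[of _ _ "\<Sum>n. norm (f (\<iota> n))"]) (auto intro!: sum_le_suminf s)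
  have "(SUP N. \<Sum>n<N. norm (f (\<iota> n))) = (\<Sum>n. norm (f (\<iota> n)))"
  proof (rule antisym)
    show "(SUP N. \<Sum>n<N. norm (f (\<iota> n))) \<le> (\<Sum>n. norm (f (\<iota> n)))"
      by (rule cSUP_least) (auto intro!: sum_le_suminf s)
    show "(\<Sum>n. norm (f (\<iota> n))) \<le> (SUP N. \<Sum>n<N. norm (f (\<iota> n)))"
      by (rule suminf_le_const[OF s cSUP_upper[OF UNIV_I bdd]])
  qed
  then show ?thesis by (simp add: l1_space_def l1_partial[OF assms(1)])
qed

lemma banach_l1:
  assumes "inj \<iota>" shows "banach_space (l1_space \<iota> :: ('k::rc_field, 'i \<Rightarrow> 'k) nspace)"
proof -
  have "banach_space (l1_space \<iota> :: ('k, 'i \<Rightarrow> 'k) nspace) \<and>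
    (\<forall>f\<in>vecs (l1_space \<iota> :: ('k, 'i \<Rightarrow> 'k) nspace). \<forall>j\<in>UNIV. (\<Sum>a\<in>\<iota> ` {..<j}. norm (f a)) \<le> nrm (l1_space \<iota>) f)"
    unfolding l1_space_def
  proof (rule banach_function_space)
    fix s :: "nat \<Rightarrow> 'i \<Rightarrow> 'k" and l
    assume s: "\<And>n. s n \<in> {f. \<forall>a. a \<notin> range \<iota> \<longrightarrow> f a = 0}" and l: "\<And>a. (\<lambda>n. s n a) \<longlonglongrightarrow> l a"
    have "l a = 0" if "a \<notin> range \<iota>" for a
      using LIMSEQ_unique[OF l[of a], of 0] s that by simp
    then show "l \<in> {f. \<forall>a. a \<notin> range \<iota> \<longrightarrow> f a = 0}" by simp
  next
    fix a
    show "\<exists>c\<ge>0. \<exists>j\<in>UNIV. \<forall>f\<in>{f. \<forall>a. a \<notin> range \<iota> \<longrightarrow> f a = 0}. norm (f a :: 'k) \<le> c * (\<Sum>a\<in>\<iota> ` {..<j}. norm (f a))"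
    proof (cases "a \<in> range \<iota>")
      case True
      then obtain n where "a = \<iota> n" by blast
      then have "norm (f a) \<le> 1 * (\<Sum>a\<in>\<iota> ` {..<Suc n}. norm (f a))" for f :: "'i \<Rightarrow> 'k"
        using member_le_sum[of a "\<iota> ` {..<Suc n}" "\<lambda>a. norm (f a)"] by simp
      then show ?thesis by (intro exI[of _ 1] conjI bexI[of _ "Suc n"] ballI) auto
    qed (auto intro!: exI[of _ 0])
  qed auto
  then show ?thesis by blast
qed

lemma l1_functional:
  fixes c :: "nat \<Rightarrow> 'k::rc_field" and \<iota> :: "nat \<Rightarrow> 'i"
  assumes \<iota>: "inj \<iota>" and c: "\<And>n. norm (c n) \<le> 1"
  shows "(\<lambda>f. \<Sum>n. c n * f (\<iota> n)) \<in> dual (l1_space \<iota>)"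
proof -
  have s: "summable (\<lambda>n. norm (c n * f (\<iota> n)))" if "f \<in> vecs (l1_space \<iota>)" for f :: "'i \<Rightarrow> 'k"
  proof (rule summable_comparison_test')
    show "summable (\<lambda>n. norm (f (\<iota> n)))" using that l1_vecs_iff[OF \<iota>] by blast
    show "norm (norm (c n * f (\<iota> n))) \<le> norm (f (\<iota> n))" for n
      using c[of n] by (simp add: norm_mult mult_left_le_one_le)
  qed
  note s' = rc_summable_norm(1)[OF s]
  show ?thesis
  proof (rule dualI[where C = 1])
    fix f :: "'i \<Rightarrow> 'k" assume f: "f \<in> vecs (l1_space \<iota>)"
    show "(\<Sum>n. c n * (f + g) (\<iota> n)) = (\<Sum>n. c n * f (\<iota> n)) + (\<Sum>n. c n * g (\<iota> n))" if "g \<in> vecs (l1_space \<iota>)" for g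
      using suminf_add[OF s'[OF f] s'[OF that]] by (simp add: distrib_left)
    show "(\<Sum>n. c n * scl (l1_space \<iota>) a f (\<iota> n)) = a * (\<Sum>n. c n * f (\<iota> n))" for a
      using suminf_mult[OF s'[OF f], of a] by (simp add: mult_ac)
    have "norm (\<Sum>n. c n * f (\<iota> n)) \<le> (\<Sum>n. norm (c n * f (\<iota> n)))" by (rule rc_summable_norm(2)[OF s[OF f]])
    also have "\<dots> \<le> (\<Sum>n. norm (f (\<iota> n)))"
    proof (rule suminf_le[OF _ s[OF f]])
      show "norm (c n * f (\<iota> n)) \<le> norm (f (\<iota> n))" for n
        using c[of n] by (simp add: norm_mult mult_left_le_one_le)
      show "summable (\<lambda>n. norm (f (\<iota> n)))" using f l1_vecs_iff[OF \<iota>] by blast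
    qed
    finally show "norm (\<Sum>n. c n * f (\<iota> n)) \<le> 1 * nrm (l1_space \<iota>) f" by (simp add: l1_nrm[OF \<iota> f])
  qed
qed

definition c0_space :: "('k::rc_field, nat \<Rightarrow> 'k) nspace" where
  "c0_space = \<lparr>vecs = {f. f \<longlonglongrightarrow> 0}, scl = (\<lambda>c f a. c * f a), nrm = (\<lambda>f. SUP n. norm (f n))\<rparr>"

lemma c0_simps [simp]:
  "f \<in> vecs c0_space \<longleftrightarrow> f \<longlonglongrightarrow> 0" "scl c0_space = (\<lambda>c f a. c * f a)"
  by (simp_all add: c0_space_def)

lemma null_seq_bdd: "f \<longlonglongrightarrow> (0 :: 'k::rc_field) \<Longrightarrow> bdd_above (range (\<lambda>n. norm (f n)))"
proof -
  assume f: "f \<longlonglongrightarrow> 0"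
  obtain K where K: "\<forall>n. norm (f n) \<le> K"
    using convergent_imp_Bseq[OF convergentI[OF f]] unfolding Bseq_def by (elim exE conjE)
  show ?thesis by (rule bdd_aboveI2[of _ _ K]) (simp add: K)
qed

lemma c0_coord_le: "f \<longlonglongrightarrow> 0 \<Longrightarrow> norm (f n) \<le> nrm c0_space f"
  unfolding c0_space_def using cSUP_upper[OF UNIV_I null_seq_bdd, of f n] by simp

lemma c0_nrm_le: "(\<And>n. norm (f n) \<le> C) \<Longrightarrow> nrm c0_space f \<le> C"
  unfolding c0_space_def by (auto intro: cSUP_least)

text \<open>A closed subspace of the bounded sequences, which \<open>banach_function_space\<close>
  supplies with single coordinates as seminorms.\<close>

lemma banach_c0: "banach_space (c0_space :: ('k::rc_field, nat \<Rightarrow> 'k) nspace)"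
proof -
  let ?L = "\<lparr>vecs = {f \<in> UNIV. bdd_above ((\<lambda>j. \<Sum>a\<in>{j}. norm (f a)) ` UNIV)}, scl = (\<lambda>c f a. c * f a),
      nrm = (\<lambda>f. SUP j\<in>UNIV. \<Sum>a\<in>{j}. norm (f a))\<rparr> :: ('k, nat \<Rightarrow> 'k) nspace"
  have "banach_space ?L \<and> (\<forall>f\<in>vecs ?L. \<forall>j\<in>UNIV. (\<Sum>a\<in>{j}. norm (f a)) \<le> nrm ?L f)"
  proof (rule banach_function_space)
    show "\<exists>c\<ge>0. \<exists>j\<in>UNIV. \<forall>f\<in>UNIV. norm (f a :: 'k) \<le> c * (\<Sum>a\<in>{j}. norm (f a))" for a :: nat
      by (intro exI[of _ 1] conjI bexI[of _ a]) auto
  qed auto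
  then have L: "banach_space ?L" and coord: "\<And>f j. f \<in> vecs ?L \<Longrightarrow> norm (f j) \<le> nrm ?L f" by auto
  interpret L: banach_space ?L by (rule L)
  have "banach_space (?L\<lparr>vecs := {f. f \<longlonglongrightarrow> 0}\<rparr>)"
  proof (rule L.banach_closed_subspace)
    show "module.subspace (scl ?L) {f. f \<longlonglongrightarrow> 0}"
    proof (rule L.subspaceI)
      fix x y assume "x \<in> {f. f \<longlonglongrightarrow> (0::'k)}" "y \<in> {f. f \<longlonglongrightarrow> (0::'k)}"
      then show "x + y \<in> {f. f \<longlonglongrightarrow> 0}" using tendsto_add[of x 0 sequentially y 0] by (simp add: plus_fun_def)
    next
      fix c and x assume "x \<in> {f. f \<longlonglongrightarrow> (0::'k)}"
      then show "scl ?L c x \<in> {f. f \<longlonglongrightarrow> 0}" using tendsto_mult_left[of x 0 sequentially c] by simp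
    qed (simp add: zero_fun_def)
    show sub: "{f. f \<longlonglongrightarrow> 0} \<subseteq> vecs ?L" using null_seq_bdd by auto
    fix s :: "nat \<Rightarrow> nat \<Rightarrow> 'k" and l
    assume s: "\<And>n. s n \<in> {f. f \<longlonglongrightarrow> 0}" and l: "l \<in> vecs ?L" and c: "(\<lambda>n. nrm ?L (s n - l)) \<longlonglongrightarrow> 0"
    show "l \<in> {f. f \<longlonglongrightarrow> 0}"
    proof (intro CollectI LIMSEQ_I)
      fix r :: real assume r: "r > 0"
      obtain n where n: "nrm ?L (s n - l) < r/2"
        using order_tendstoD(2)[OF c, of "r/2"] r unfolding eventually_sequentially by auto
      have "s n \<longlonglongrightarrow> 0" using s by blast
      then obtain N where N: "\<And>j. j \<ge> N \<Longrightarrow> norm (s n j - 0) < r/2" using LIMSEQ_D[of "s n" 0 "r/2"] r by auto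
      have sl: "s n - l \<in> vecs ?L" by (rule L.vecs_diff[OF subsetD[OF sub s] l])
      have "norm (l j - 0) < r" if "j \<ge> N" for j
        using coord[OF sl, of j] n N[OF that] norm_triangle_ineq4[of "s n j" "s n j - l j"] by simp
      then show "\<exists>no. \<forall>j\<ge>no. norm (l j - 0) < r" by blast
    qed
  qed
  moreover have "?L\<lparr>vecs := {f. f \<longlonglongrightarrow> 0}\<rparr> = c0_space" by (simp add: c0_space_def)
  ultimately show ?thesis by simp
qed

lemma c0_coordinate_functional: "(\<lambda>f. f n) \<in> dual c0_space"
  by (rule dualI[where C = 1]) (use c0_coord_le in auto)

section \<open>From (a) to (b)\<close>

section \<open>Changing the type of the target space\<close>

text \<open>A functional on the range of \<open>T\<close> is determined by its composition with \<open>T\<close>, so the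
  bipolar of the range embeds into the functions on the type of functionals of \<open>E\<close>.\<close>

lemma property_V_any_type:
  fixes E :: "('k::rc_field, 'e::ab_group_add) nspace"
  assumes E: "banach_space E" and V: "property_V TYPE(('e \<Rightarrow> 'k) \<Rightarrow> 'k) E"
  shows "property_V TYPE('f::ab_group_add) E"
  unfolding property_V_def
proof (intro allI impI ballI)
  fix F :: "('k, 'f) nspace" and T
  assume F: "banach_space F" and T: "T \<in> bounded_ops E F" and uc: "unconditionally_converging E F T"
  interpret E: banach_space E by fact
  interpret F: banach_space F by fact
  have Tv: "T x \<in> vecs F" if "x \<in> vecs E" for x by (rule bounded_ops_vecs[OF T that])
  define G where "G = {y \<in> vecs F. \<forall>\<psi>\<in>dual F. (\<forall>x\<in>vecs E. \<psi> (T x) = 0) \<longrightarrow> \<psi> y = 0}"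
  define key where "key \<psi> = (\<lambda>x. if x \<in> vecs E then \<psi> (T x) else 0)" for \<psi> :: "'f \<Rightarrow> 'k"
  \<comment> \<open>Functionals with the same label \<open>key \<psi>\<close> agree on
    \<open>G\<close>, so the representative picked by \<open>SOME\<close> is immaterial there; this
    is \<open>Jkey\<close>.\<close>
  define J where "J y = (\<lambda>\<phi>. if \<exists>\<psi>\<in>dual F. key \<psi> = \<phi> then (SOME \<psi>. \<psi> \<in> dual F \<and> key \<psi> = \<phi>) y else 0)" for y
  have GF: "y \<in> vecs F" if "y \<in> G" for y using that by (simp add: G_def)
  have TG: "T x \<in> G" if "x \<in> vecs E" for x using that Tv by (simp add: G_def)
  have some: "(SOME \<psi>. \<psi> \<in> dual F \<and> key \<psi> = \<phi>) \<in> dual F \<and> key (SOME \<psi>. \<psi> \<in> dual F \<and> key \<psi> = \<phi>) = \<phi>"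
    if "\<exists>\<psi>\<in>dual F. key \<psi> = \<phi>" for \<phi>
    using someI_ex[of "\<lambda>\<psi>. \<psi> \<in> dual F \<and> key \<psi> = \<phi>"] that by blast
  have Gadd: "y + z \<in> G" if "y \<in> G" "z \<in> G" for y z
    using that by (auto simp: G_def dual_add)
  have Gscl: "scl F c y \<in> G" if "y \<in> G" for c y
    using that by (auto simp: G_def dual_scl)
  have Gdiff: "y - z \<in> G" if "y \<in> G" "z \<in> G" for y z
    using Gadd[OF that(1) Gscl[OF that(2), of "-1"]] by simp
  have Jadd: "J (y + z) = (\<lambda>\<phi>. J y \<phi> + J z \<phi>)" if "y \<in> G" "z \<in> G" for y z
    unfolding J_def using some dual_add[OF _ GF[OF that(1)] GF[OF that(2)]] by auto
  have Jscl: "J (scl F c y) = (\<lambda>\<phi>. c * J y \<phi>)" if "y \<in> G" for c y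
    unfolding J_def using some dual_scl[OF _ GF[OF that]] by auto
  have Jkey: "J y (key \<psi>) = \<psi> y" if y: "y \<in> G" and \<psi>: "\<psi> \<in> dual F" for y \<psi>
  proof -
    define \<psi>' where "\<psi>' = (SOME \<psi>'. \<psi>' \<in> dual F \<and> key \<psi>' = key \<psi>)"
    have ex: "\<exists>\<psi>'\<in>dual F. key \<psi>' = key \<psi>" using \<psi> by blast
    from some[OF this] have \<psi>': "\<psi>' \<in> dual F" "key \<psi>' = key \<psi>" unfolding \<psi>'_def by blast+
    have d: "(\<lambda>y. \<psi>' y + (- 1) * \<psi> y) \<in> dual F" by (intro F.dual_add_fun F.dual_scl_fun \<psi> \<psi>')
    have v: "\<psi>' (T x) + (- 1) * \<psi> (T x) = 0" if "x \<in> vecs E" for x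
      using fun_cong[OF \<psi>'(2), of x] that by (simp add: key_def)
    have "\<forall>\<psi>\<in>dual F. (\<forall>x\<in>vecs E. \<psi> (T x) = 0) \<longrightarrow> \<psi> y = 0" using y by (simp add: G_def)
    from this[rule_format, OF d v] have "\<psi>' y = \<psi> y" by simp
    moreover have "J y (key \<psi>) = \<psi>' y" unfolding J_def \<psi>'_def by (rule if_P[OF ex])
    ultimately show ?thesis by simp
  qed
  have Jinj: "inj_on J G"
  proof (rule inj_onI)
    fix y z assume yz: "y \<in> G" "z \<in> G" "J y = J z"
    have "\<psi> y = \<psi> z" if "\<psi> \<in> dual F" for \<psi>
      using Jkey[OF yz(1) that] Jkey[OF yz(2) that] yz(3) by simp
    then show "y = z" by (rule F.dual_separates[OF GF[OF yz(1)] GF[OF yz(2)]])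
  qed
  define inv where "inv = the_inv_into G J"
  have inv: "inv (J y) = y" if "y \<in> G" for y unfolding inv_def by (rule the_inv_into_f_f[OF Jinj that])
  define F' :: "('k, ('e \<Rightarrow> 'k) \<Rightarrow> 'k) nspace" where
    \<comment> \<open>The norm is carried over through the inverse of \<open>J\<close>, which makes
      \<open>J\<close> an isometry of \<open>G\<close>; completeness then comes from that of
      \<open>F\<close>, as \<open>G\<close> is closed.\<close>
    "F' = \<lparr>vecs = J ` G, scl = (\<lambda>c f a. c * f a), nrm = (\<lambda>f. nrm F (inv f))\<rparr>"
  have F' [simp]: "vecs F' = J ` G" "scl F' = (\<lambda>c f a. c * f a)" "nrm F' f = nrm F (inv f)" for f
    by (simp_all add: F'_def)
  have Jadd': "J y + J z = J (y + z)" if "y \<in> G" "z \<in> G" for y z using Jadd[OF that] by (simp add: plus_fun_def)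
  have Jscl': "scl F' c (J y) = J (scl F c y)" if "y \<in> G" for c y using Jscl[OF that] by simp
  have Jdiff: "J y - J z = J (y - z)" if "y \<in> G" "z \<in> G" for y z
    using Jadd'[OF Gdiff[OF that] that(2)] by (metis add_diff_cancel_right' diff_add_cancel)
  have Gclosed: "l \<in> G" if s: "\<And>n::nat. s n \<in> G" and l: "l \<in> vecs F" "(\<lambda>n. nrm F (s n - l)) \<longlonglongrightarrow> 0" for s l
    unfolding G_def
  proof (intro CollectI conjI ballI impI l(1))
    fix \<psi> assume \<psi>: "\<psi> \<in> dual F" "\<forall>x\<in>vecs E. \<psi> (T x) = 0"
    have "(\<lambda>n. \<psi> (s n)) \<longlonglongrightarrow> \<psi> l"
      by (rule F.dual_tendsto[OF \<psi>(1) _ l]) (simp add: GF s)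
    moreover have "\<psi> (s n) = 0" for n using s[of n] \<psi> unfolding G_def by blast
    ultimately show "\<psi> l = 0" using LIMSEQ_unique[of "\<lambda>n. \<psi> (s n)" "\<psi> l" 0] by simp
  qed
  have G0: "0 \<in> G" using F.dual_0 by (auto simp: G_def)
  have BF': "banach_space F'"
  proof (rule banach_spaceI)
    show "vector_space (scl F')" unfolding F' by (rule vector_space_fun)
    then interpret vector_space "scl F'" .
    show "module.subspace (scl F') (vecs F')"
    proof (rule subspaceI)
      have "J 0 = 0" using Jscl[OF G0, of 0] by (simp add: zero_fun_def)
      then show "0 \<in> vecs F'" using G0 by (metis F'(1) imageI)
      show "x + y \<in> vecs F'" if "x \<in> vecs F'" "y \<in> vecs F'" for x y
        using that Jadd' Gadd by auto
      show "scl F' c x \<in> vecs F'" if x: "x \<in> vecs F'" for c x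
      proof -
        obtain y where "y \<in> G" "x = J y" using x by auto
        then show ?thesis using Jscl'[of y c] Gscl[of y c] by (metis F'(1) imageI)
      qed
    qed
    show "0 \<le> nrm F' x" if "x \<in> vecs F'" for x using that inv GF F.nrm_nonneg by auto
    show "x = 0" if x: "x \<in> vecs F'" "nrm F' x = 0" for x
    proof -
      obtain y where y: "y \<in> G" "x = J y" using x by auto
      then have "y = 0" using x(2) inv F.nrm_eq_0[OF GF[OF y(1)]] by simp
      then show ?thesis using y(2) Jscl[OF G0, of 0] by (simp add: zero_fun_def)
    qed
    show "nrm F' (scl F' c x) = norm c * nrm F' x" if x: "x \<in> vecs F'" for c x
    proof -
      obtain y where y: "y \<in> G" "x = J y" using x by auto
      show ?thesis unfolding y(2) Jscl'[OF y(1)] F'(3) inv[OF y(1)] inv[OF Gscl[OF y(1)]]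
        by (rule F.nrm_scl[OF GF[OF y(1)]])
    qed
    show "nrm F' (x + x') \<le> nrm F' x + nrm F' x'" if x: "x \<in> vecs F'" "x' \<in> vecs F'" for x x'
    proof -
      obtain y z where y: "y \<in> G" "x = J y" "z \<in> G" "x' = J z" using x by auto
      show ?thesis unfolding y(2,4) Jadd'[OF y(1,3)] F'(3) inv[OF y(1)] inv[OF y(3)] inv[OF Gadd[OF y(1,3)]]
        by (rule F.nrm_triangle[OF GF[OF y(1)] GF[OF y(3)]])
    qed
    show "\<exists>l\<in>vecs F'. (\<lambda>n. nrm F' (s n - l)) \<longlonglongrightarrow> 0"
      if s: "\<And>n::nat. s n \<in> vecs F'"
        and C: "\<And>e. e > 0 \<Longrightarrow> \<exists>N. \<forall>m\<ge>N. \<forall>n\<ge>N. nrm F' (s m - s n) < e" for s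
    proof -
      have "\<exists>y. y \<in> G \<and> s n = J y" for n using s[of n] by auto
      then obtain y where y: "\<And>n. y n \<in> G" "\<And>n. s n = J (y n)" by metis
      have d: "nrm F' (s m - J z) = nrm F (y m - z)" if "z \<in> G" for m z
        unfolding y(2) Jdiff[OF y(1) that] F'(3) inv[OF Gdiff[OF y(1) that]] ..
      have e: "nrm F' (s m - s n) = nrm F (y m - y n)" for m n using d[OF y(1), of m n] y(2)[of n] by (simp only:)
      obtain l where l: "l \<in> vecs F" "(\<lambda>n. nrm F (y n - l)) \<longlonglongrightarrow> 0"
      proof (rule F.nrm_Cauchy_convergent[of y])
        show "y n \<in> vecs F" for n by (rule GF[OF y(1)])
        show "\<exists>N. \<forall>m\<ge>N. \<forall>n\<ge>N. nrm F (y m - y n) < e" if "e > 0" for e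
          using C[OF that] unfolding e .
      qed
      have lG: "l \<in> G" by (rule Gclosed[OF y(1) l])
      have "(\<lambda>n. nrm F' (s n - J l)) \<longlonglongrightarrow> 0" unfolding d[OF lG] by (rule l(2))
      then show ?thesis using lG by auto
    qed
  qed
  obtain C where C: "C \<ge> 0" "\<And>x. x \<in> vecs E \<Longrightarrow> nrm F (T x) \<le> C * nrm E x"
    using bounded_ops_bound[OF E T] by blast
  have T': "(\<lambda>x. J (T x)) \<in> bounded_ops E F'"
  proof (rule bounded_opsI[where C = C])
    show "J (T x) \<in> vecs F'" if "x \<in> vecs E" for x using TG[OF that] by simp
    show "J (T (x + y)) = J (T x) + J (T y)" if "x \<in> vecs E" "y \<in> vecs E" for x y
      unfolding bounded_ops_add[OF T that] by (rule Jadd'[OF TG[OF that(1)] TG[OF that(2)], symmetric])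
    show "J (T (scl E c x)) = scl F' c (J (T x))" if "x \<in> vecs E" for c x
      unfolding bounded_ops_scl[OF T that] by (rule Jscl'[OF TG[OF that], symmetric])
    show "nrm F' (J (T x)) \<le> C * nrm E x" if "x \<in> vecs E" for x
      unfolding F'(3) inv[OF TG[OF that]] by (rule C(2)[OF that])
  qed
  have "unconditionally_converging E F' (\<lambda>x. J (T x))"
    unfolding unconditionally_converging_def
  proof (intro allI impI)
    fix x assume x: "wuC E x"
    have sv: "(\<Sum>i\<le>n. x i) \<in> vecs E" for n using wuC_vecs[OF x] by (intro E.vecs_sum)
    obtain l where "limitin (norm_top F) (\<lambda>n. T (\<Sum>i\<le>n. x i)) l sequentially"
      using uc x unfolding unconditionally_converging_def by blast
    then have l: "l \<in> vecs F" "(\<lambda>n. nrm F (T (\<Sum>i\<le>n. x i) - l)) \<longlonglongrightarrow> 0"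
      unfolding F.limitin_norm_top by blast+
    have lG: "l \<in> G" by (rule Gclosed[OF TG[OF sv] l])
    have "limitin (norm_top F') (\<lambda>n. J (T (\<Sum>i\<le>n. x i))) (J l) sequentially"
      unfolding banach_space.limitin_norm_top[OF BF'] Jdiff[OF TG[OF sv] lG] F'(3) inv[OF Gdiff[OF TG[OF sv] lG]]
      using lG TG[OF sv] l(2) by simp
    then show "\<exists>l. limitin (norm_top F') (\<lambda>n. J (T (\<Sum>i\<le>n. x i))) l sequentially" by blast
  qed
  then have wc: "weakly_compact E F' (\<lambda>x. J (T x))"
    using V BF' T' unfolding property_V_def by blast
  have T'v: "J (T x) \<in> vecs F'" if "x \<in> vecs E" for x by (rule bounded_ops_vecs[OF T' that])
  show "weakly_compact E F T"
  proof (rule iffD2[OF weakly_compact_iff], erule Tv, intro allI impI)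
    fix U assume U: "ultra U \<and> U \<le> principal (unit_ball E)"
    then obtain l' where l': "l' \<in> vecs F'" "\<forall>\<psi>\<in>dual F'. ((\<lambda>x. \<psi> (J (T x))) \<longlongrightarrow> \<psi> l') U"
      using iffD1[OF weakly_compact_iff[of E "\<lambda>x. J (T x)" F', OF T'v] wc] by blast
    then obtain l where l: "l \<in> G" "l' = J l" by auto
    have "((\<lambda>x. \<psi> (T x)) \<longlongrightarrow> \<psi> l) U" if \<psi>: "\<psi> \<in> dual F" for \<psi>
    proof -
      obtain D where D: "D \<ge> 0" "\<And>y. y \<in> vecs F \<Longrightarrow> norm (\<psi> y) \<le> D * nrm F y" using F.dual_bound[OF \<psi>] by blast
      have "(\<lambda>f. \<psi> (inv f)) \<in> dual F'"
      proof (rule dualI[where C = D])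
        fix x assume "x \<in> vecs F'"
        then obtain y where y: "y \<in> G" "x = J y" by auto
        show "\<psi> (inv (scl F' c x)) = c * \<psi> (inv x)" for c
          unfolding y(2) Jscl'[OF y(1)] inv[OF y(1)] inv[OF Gscl[OF y(1)]] by (rule dual_scl[OF \<psi> GF[OF y(1)]])
        show "norm (\<psi> (inv x)) \<le> D * nrm F' x"
          unfolding y(2) F'(3) inv[OF y(1)] by (rule D(2)[OF GF[OF y(1)]])
        fix x' assume "x' \<in> vecs F'"
        then obtain z where z: "z \<in> G" "x' = J z" by auto
        show "\<psi> (inv (x + x')) = \<psi> (inv x) + \<psi> (inv x')"
          unfolding y(2) z(2) Jadd'[OF y(1) z(1)] inv[OF y(1)] inv[OF z(1)] inv[OF Gadd[OF y(1) z(1)]]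
          by (rule dual_add[OF \<psi> GF[OF y(1)] GF[OF z(1)]])
      qed
      from l'(2)[THEN bspec, OF this] have "((\<lambda>x. \<psi> (inv (J (T x)))) \<longlongrightarrow> \<psi> (inv l')) U" .
      moreover have "eventually (\<lambda>x. \<psi> (inv (J (T x))) = \<psi> (T x)) U"
        using U unfolding le_principal by (auto elim!: eventually_mono simp: inv TG)
      ultimately show ?thesis unfolding l(2) inv[OF l(1)] by (rule Lim_transform_eventually)
    qed
    then show "\<exists>l\<in>vecs F. \<forall>\<psi>\<in>dual F. ((\<lambda>x. \<psi> (T x)) \<longlongrightarrow> \<psi> l) U" using GF[OF l(1)] by blast
  qed
qed

lemma property_V_weak_limit:
  fixes E :: "('k::rc_field, 'e::ab_group_add) nspace" and F :: "('k, 'f::ab_group_add) nspace"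
  assumes "banach_space E" "property_V TYPE(('e \<Rightarrow> 'k) \<Rightarrow> 'k) E" "banach_space F"
    "T \<in> bounded_ops E F" "unconditionally_converging E F T" "ultra U" "U \<le> principal (unit_ball E)"
  shows "\<exists>l\<in>vecs F. \<forall>\<psi>\<in>dual F. ((\<lambda>x. \<psi> (T x)) \<longlongrightarrow> \<psi> l) U"
proof -
  have "weakly_compact E F T"
    using property_V_any_type[OF assms(1,2), where 'f = 'f] assms(3-5) unfolding property_V_def by blast
  then show ?thesis
    using weakly_compact_iff[of E T F, OF bounded_ops_vecs[OF assms(4)]] assms(6,7) by simp
qed

section \<open>Iterated weak limits\<close>

text \<open>Along an ultrafilter on the unit ball, which plays the role of a point of the bidual, the
  slots of an unconditionally converging multilinear map are replaced by limits one after the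
  other.\<close>

definition wuC_Cauchy ::
    "nat set \<Rightarrow> ('k::rc_field, 'v::ab_group_add) nspace \<Rightarrow> ('k, 'w::ab_group_add) nspace
      \<Rightarrow> ((nat \<Rightarrow> 'v) \<Rightarrow> 'w) \<Rightarrow> bool"
  where
  "wuC_Cauchy I E F A \<longleftrightarrow> (\<forall>t. (\<forall>i\<in>I. banach_space.wuC_sums E (\<lambda>n. t n i)) \<longrightarrow>
     (\<forall>e>0. \<exists>N. \<forall>m\<ge>N. \<forall>n\<ge>N. nrm F (A (t m) - A (t n)) < e))"

lemma wuC_CauchyD:
  assumes "wuC_Cauchy I E F A" "\<And>i. i \<in> I \<Longrightarrow> banach_space.wuC_sums E (\<lambda>n. t n i)" "e > 0"
  shows "\<exists>N. \<forall>m\<ge>N. \<forall>n\<ge>N. nrm F (A (t m) - A (t n)) < e"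
  using assms(1)[unfolded wuC_Cauchy_def, rule_format, of t e] assms(2,3) by blast

text \<open>With the other slots fixed, slot \<open>s\<close> is an unconditionally converging
  operator, so property (V) yields the limit. For its Cauchy property, suppose that
  \<open>A1\<close> moves by at least \<open>e\<close> over infinitely many blocks, and let
  \<open>\<psi> j\<close> norm these differences. The numbers \<open>S x j\<close> tend to
  \<open>0\<close> for fixed \<open>x\<close>, so \<open>S\<close> maps into
  \<open>c0_space\<close>. It converges unconditionally, hence its weak limit along \<open>U\<close>
  is a null sequence as well. But the coordinates of this limit are the norms of the differences of
  \<open>A1\<close>.\<close>

lemma slot_weak_limit:
  fixes E :: "('k::rc_field, 'e::ab_group_add) nspace" and F :: "('k, 'f::ab_group_add) nspace"
  assumes V: "property_V TYPE(('e \<Rightarrow> 'k) \<Rightarrow> 'k) E"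
    and A: "multilinear E F (insert s I) A" and s: "s \<notin> I"
    and CV: "wuC_Cauchy (insert s I) E F A"
    and U: "ultra U" "U \<le> principal (unit_ball E)"
  obtains A1 where "multilinear E F I A1" "wuC_Cauchy I E F A1"
    "\<And>x \<psi>. (\<And>i. i \<in> I \<Longrightarrow> x i \<in> vecs E) \<Longrightarrow> \<psi> \<in> dual F \<Longrightarrow>
       ((\<lambda>u. \<psi> (A (x(s := u)))) \<longlongrightarrow> \<psi> (A1 x)) U"
proof -
  interpret A: multilinear E F "insert s I" A by (rule A)
  have E: "banach_space E" and F: "banach_space F" by unfold_locales
  have sI: "s \<in> insert s I" by simp
  have finI: "finite I" using A.finite_slots by simp
  have Ub: "U \<noteq> bot" by (rule ultra_not_bot[OF U(1)])
  have Uball: "eventually (\<lambda>u. u \<in> vecs E \<and> nrm E u \<le> 1) U" using U(2) by (simp add: le_principal)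
  define lim where "lim x l \<longleftrightarrow> l \<in> vecs F \<and> (\<forall>\<psi>\<in>dual F. ((\<lambda>u. \<psi> (A (x(s := u)))) \<longlongrightarrow> \<psi> l) U)" for x l
  define A1 where "A1 x = (SOME l. lim x l)" for x
  define slots where "slots x \<longleftrightarrow> (\<forall>i\<in>I. x i \<in> vecs E)" for x
  have A1: "lim x (A1 x)" if slx: "slots x" for x
  proof -
    have x: "x i \<in> vecs E" if "i \<in> I" for i using slx that by (simp add: slots_def)
    have op: "(\<lambda>u. A (x(s := u))) \<in> bounded_ops E F"
      by (rule A.slot_bounded_op[OF sI]) (use x in auto)
    have "unconditionally_converging E F (\<lambda>u. A (x(s := u)))"
      unfolding unconditionally_converging_def
    proof (intro allI impI)
      fix w assume w: "wuC E w"
      define t where "t n = x(s := (\<Sum>i\<le>n. w i))" for n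
      have tp: "A.E.wuC_sums (\<lambda>n. t n i)" if "i \<in> insert s I" for i
        using that x A.E.wuC_partial_sums[OF w] A.E.wuC_sums_const[of "x i"] by (cases "i = s") (auto simp: t_def)
      have tv: "A (t n) \<in> vecs F" for n
        by (rule A.vecs_app) (rule A.E.wuC_sums_vecs[OF tp])
      obtain l where "l \<in> vecs F" "(\<lambda>n. nrm F (A (t n) - l)) \<longlonglongrightarrow> 0"
      proof (rule A.F.nrm_Cauchy_convergent[of "\<lambda>n. A (t n)"])
        show "\<exists>N. \<forall>m\<ge>N. \<forall>n\<ge>N. nrm F (A (t m) - A (t n)) < e" if e: "e > 0" for e
          by (rule wuC_CauchyD[OF CV tp e])
      qed (rule tv)
      then have "limitin (norm_top F) (\<lambda>n. A (t n)) l sequentially"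
        unfolding A.F.limitin_norm_top using tv by simp
      then show "\<exists>l. limitin (norm_top F) (\<lambda>n. A (x(s := \<Sum>i\<le>n. w i))) l sequentially"
        unfolding t_def by blast
    qed
    from property_V_weak_limit[OF E V F op this U] have "\<exists>l. lim x l" unfolding lim_def by blast
    then show ?thesis unfolding A1_def by (rule someI_ex)
  qed
  have A1v: "A1 x \<in> vecs F" if "slots x" for x using A1[OF that] unfolding lim_def by blast
  have A1l: "((\<lambda>u. \<psi> (A (x(s := u)))) \<longlongrightarrow> \<psi> (A1 x)) U" if "slots x" "\<psi> \<in> dual F" for x \<psi>
    using A1[OF that(1)] that(2) unfolding lim_def by blast
  have Av: "A (x(s := u)) \<in> vecs F" if "slots x" "u \<in> vecs E" for x u
    by (rule A.vecs_app) (use that in \<open>auto simp: slots_def\<close>)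
  \<comment> \<open>Functionals separate points, so the value picked by \<open>SOME\<close> is the
    only weak limit; additivity and homogeneity of \<open>A1\<close> follow from this
    uniqueness.\<close>
  have A1_eq: "A1 x = y" if x: "slots x" and y: "y \<in> vecs F"
    and l: "\<And>\<psi>. \<psi> \<in> dual F \<Longrightarrow> ((\<lambda>u. \<psi> (A (x(s := u)))) \<longlongrightarrow> \<psi> y) U" for x y
    by (rule A.F.dual_separates[OF A1v[OF x] y]) (rule tendsto_unique[OF Ub A1l[OF x] l])
  obtain M where M: "M \<ge> 0" "\<And>x. (\<And>i. i \<in> insert s I \<Longrightarrow> x i \<in> vecs E) \<Longrightarrow> nrm F (A x) \<le> M * (\<Prod>i\<in>insert s I. nrm E (x i))"
    using A.bound by blast
  have m1: "multilinear E F I A1"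
  proof unfold_locales
    show "finite I" by (rule finI)
    show "bounded_multilinear I E F A1"
      unfolding bounded_multilinear_def
    proof (intro conjI allI impI)
      show "A1 x \<in> vecs F" if "\<forall>i\<in>I. x i \<in> vecs E" for x by (rule A1v) (use that in \<open>simp add: slots_def\<close>)
      show "A1 x = A1 y" if xy: "\<forall>i\<in>I. x i = y i" for x y
      proof -
        have "A (x(s := u)) = A (y(s := u))" for u by (rule A.cong) (use xy in auto)
        then have "lim x = lim y" unfolding lim_def by simp
        then show ?thesis by (simp add: A1_def)
      qed
      fix x i u assume i: "i \<in> I" and x: "\<forall>j\<in>I - {i}. x j \<in> vecs E" and u: "u \<in> vecs E"
      have ineq: "i \<noteq> s" using i s by blast
      have xi: "slots (x(i := w))" if "w \<in> vecs E" for w using x that by (simp add: slots_def)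
      have comm: "(x(i := w))(s := a) = (x(s := a))(i := w)" for w a using ineq by (rule fun_upd_twist)
      have evx: "eventually (\<lambda>a. \<forall>j. j \<in> insert s I \<longrightarrow> j \<noteq> i \<longrightarrow> (x(s := a)) j \<in> vecs E) U"
        using Uball by eventually_elim (use x in auto)
      show "A1 (x(i := u + v)) = A1 (x(i := u)) + A1 (x(i := v))" if v: "v \<in> vecs E" for v
      proof (rule A1_eq)
        show "slots (x(i := u + v))" by (rule xi[OF A.E.vecs_add[OF u v]])
        show "A1 (x(i := u)) + A1 (x(i := v)) \<in> vecs F"
          by (intro A.F.vecs_add A1v xi u v)
        fix \<psi> assume \<psi>: "\<psi> \<in> dual F"
        have "((\<lambda>a. \<psi> (A ((x(i := u))(s := a))) + \<psi> (A ((x(i := v))(s := a)))) \<longlongrightarrow> \<psi> (A1 (x(i := u))) + \<psi> (A1 (x(i := v)))) U"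
          by (intro tendsto_add A1l xi u v \<psi>)
        moreover have "eventually (\<lambda>a. \<psi> (A ((x(i := u))(s := a))) + \<psi> (A ((x(i := v))(s := a))) = \<psi> (A ((x(i := u + v))(s := a)))) U"
          using evx Uball
        proof eventually_elim
          case (elim a)
          have "A ((x(s := a))(i := u + v)) = A ((x(s := a))(i := u)) + A ((x(s := a))(i := v))"
            by (rule A.add) (use i u v elim(1) in auto)
          then have "A ((x(i := u + v))(s := a)) = A ((x(i := u))(s := a)) + A ((x(i := v))(s := a))"
            unfolding comm .
          then show ?case
            using dual_add[OF \<psi> Av[OF xi[OF u]] Av[OF xi[OF v]], of a a] elim(2) by (simp only:)
        qed
        ultimately show "((\<lambda>a. \<psi> (A ((x(i := u + v))(s := a)))) \<longlongrightarrow> \<psi> (A1 (x(i := u)) + A1 (x(i := v)))) U"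
          unfolding dual_add[OF \<psi> A1v[OF xi[OF u]] A1v[OF xi[OF v]]] by (rule Lim_transform_eventually)
      qed
      show "A1 (x(i := scl E c u)) = scl F c (A1 (x(i := u)))" for c
      proof (rule A1_eq)
        show "slots (x(i := scl E c u))" by (rule xi[OF A.E.vecs_scl[OF u]])
        show "scl F c (A1 (x(i := u))) \<in> vecs F" by (intro A.F.vecs_scl A1v xi u)
        fix \<psi> assume \<psi>: "\<psi> \<in> dual F"
        have "((\<lambda>a. c * \<psi> (A ((x(i := u))(s := a)))) \<longlongrightarrow> c * \<psi> (A1 (x(i := u)))) U"
          by (intro tendsto_mult_left A1l xi u \<psi>)
        moreover have "eventually (\<lambda>a. c * \<psi> (A ((x(i := u))(s := a))) = \<psi> (A ((x(i := scl E c u))(s := a)))) U"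
          using evx Uball
        proof eventually_elim
          case (elim a)
          have "A ((x(s := a))(i := scl E c u)) = scl F c (A ((x(s := a))(i := u)))"
            by (rule A.scl) (use i u elim(1) in auto)
          then have "A ((x(i := scl E c u))(s := a)) = scl F c (A ((x(i := u))(s := a)))" unfolding comm .
          then show ?case using dual_scl[OF \<psi> Av[OF xi[OF u]], of a c] elim(2) by (simp only:)
        qed
        ultimately show "((\<lambda>a. \<psi> (A ((x(i := scl E c u))(s := a)))) \<longlongrightarrow> \<psi> (scl F c (A1 (x(i := u))))) U"
          unfolding dual_scl[OF \<psi> A1v[OF xi[OF u]]] by (rule Lim_transform_eventually)
      qed
    next
      have "nrm F (A1 x) \<le> M * (\<Prod>i\<in>I. nrm E (x i))" if x: "slots x" for x
      proof -
        have xI: "x i \<in> vecs E" if "i \<in> I" for i using x that by (simp add: slots_def)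
        obtain \<psi> where \<psi>: "\<psi> \<in> dual F" "\<And>y. y \<in> vecs F \<Longrightarrow> norm (\<psi> y) \<le> nrm F y" "\<psi> (A1 x) = of_real (nrm F (A1 x))"
          using A.F.norming_functional_ex[OF A1v[OF x]] by blast
        have "norm (\<psi> (A1 x)) \<le> M * (\<Prod>i\<in>I. nrm E (x i))"
        proof (rule tendsto_upperbound)
          show "((\<lambda>u. norm (\<psi> (A (x(s := u))))) \<longlongrightarrow> norm (\<psi> (A1 x))) U"
            by (intro tendsto_norm A1l x \<psi>(1))
          show "eventually (\<lambda>u. norm (\<psi> (A (x(s := u)))) \<le> M * (\<Prod>i\<in>I. nrm E (x i))) U"
            using Uball
          proof eventually_elim
            case (elim u)
            have p0: "(\<Prod>i\<in>I. nrm E (x i)) \<ge> 0" using xI by (intro prod_nonneg) (auto simp: A.E.nrm_nonneg)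
            have "norm (\<psi> (A (x(s := u)))) \<le> nrm F (A (x(s := u)))" by (rule \<psi>(2)[OF Av[OF x]]) (use elim in auto)
            also have "\<dots> \<le> M * (\<Prod>i\<in>insert s I. nrm E ((x(s := u)) i))" by (rule M(2)) (use xI elim in auto)
            also have "(\<Prod>i\<in>insert s I. nrm E ((x(s := u)) i)) = nrm E u * (\<Prod>i\<in>I. nrm E (x i))"
              using s finI by (subst prod.insert) (auto intro!: prod.cong)
            also have "M * (nrm E u * (\<Prod>i\<in>I. nrm E (x i))) \<le> M * (1 * (\<Prod>i\<in>I. nrm E (x i)))"
              using elim p0 by (intro mult_left_mono mult_right_mono M(1)) auto
            finally show ?case by (simp add: fun_upd_def)
          qed
        qed (rule Ub)
        then show ?thesis using \<psi>(3) A.F.nrm_nonneg[OF A1v[OF x]] by simp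
      qed
      then show "\<exists>M\<ge>0. \<forall>x. (\<forall>i\<in>I. x i \<in> vecs E) \<longrightarrow> nrm F (A1 x) \<le> M * (\<Prod>i\<in>I. nrm E (x i))"
        using M(1) by (intro exI[of _ M]) (simp add: slots_def)
    qed
  qed
  obtain K where K: "K \<ge> 0" "\<And>x R i u. R \<ge> 1 \<Longrightarrow> i \<in> insert s I \<Longrightarrow>
      (\<And>j. j \<in> insert s I \<Longrightarrow> j \<noteq> i \<Longrightarrow> x j \<in> vecs E \<and> nrm E (x j) \<le> R) \<Longrightarrow> u \<in> vecs E \<Longrightarrow>
       nrm F (A (x(i := u))) \<le> K * R ^ card (insert s I) * nrm E u"
    using A.bound_slot by blast
  have CV1: "wuC_Cauchy I E F A1"
    unfolding wuC_Cauchy_def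
  proof (intro allI impI)
    fix t and \<epsilon> :: real
    assume t: "\<forall>i\<in>I. A.E.wuC_sums (\<lambda>n. t n i)" and eps: "\<epsilon> > 0"
    have tvi: "t n i \<in> vecs E" if "i \<in> I" for n i
      by (rule A.E.wuC_sums_vecs[of "\<lambda>n. t n i"]) (use t that in blast)
    have tv: "slots (t n)" for n using tvi by (simp add: slots_def)
    have A1tv: "A1 (t n) \<in> vecs F" for n by (rule A1v[OF tv])
    have Atv: "A ((t n)(s := u)) \<in> vecs F" if "u \<in> vecs E" for n u by (rule Av[OF tv that])
    have "\<forall>e>0. \<exists>N. \<forall>m\<ge>N. \<forall>n\<ge>N. nrm F (A1 (t m) - A1 (t n)) < e"
    proof (rule ccontr)
      assume "\<not> ?thesis"
      then obtain e p q where e: "e > 0" "\<And>j. p j < q j" "\<And>j. q j \<le> p (Suc j)"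
          "\<And>j. nrm F (A1 (t (p j)) - A1 (t (q j))) \<ge> e"
        by (rule not_Cauchy_blocks[of "\<lambda>m n. nrm F (A1 (t m) - A1 (t n))", rotated 2])
          (auto simp: A.F.nrm_minus_commute A1tv)
      have pq: "p j \<le> q j" for j using e(2)[of j] by simp
      have pj: "j \<le> p j" for j
      proof (induction j)
        case (Suc j) then show ?case using e(2)[of j] e(3)[of j] by linarith
      qed simp
      have yv: "A1 (t (p j)) - A1 (t (q j)) \<in> vecs F" for j by (intro A.F.vecs_diff A1tv)
      have "\<forall>j. \<exists>\<psi>. \<psi> \<in> dual F \<and> (\<forall>y\<in>vecs F. norm (\<psi> y) \<le> nrm F y) \<and>
          \<psi> (A1 (t (p j)) - A1 (t (q j))) = of_real (nrm F (A1 (t (p j)) - A1 (t (q j))))"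
        by (intro allI A.F.norming_functional_ex yv)
      then obtain \<psi> where \<psi>: "\<And>j. \<psi> j \<in> dual F" "\<And>j y. y \<in> vecs F \<Longrightarrow> norm (\<psi> j y) \<le> nrm F y"
          "\<And>j. \<psi> j (A1 (t (p j)) - A1 (t (q j))) = of_real (nrm F (A1 (t (p j)) - A1 (t (q j))))"
        unfolding choice_iff by blast
      define S where "S x j = \<psi> j (A ((t (p j))(s := x)) - A ((t (q j))(s := x)))" for x j
      have Sle: "norm (S x j) \<le> nrm F (A ((t (p j))(s := x)) - A ((t (q j))(s := x)))" if "x \<in> vecs E" for x j
        unfolding S_def by (intro \<psi>(2) A.F.vecs_diff Atv that)
      have ups: "A.E.wuC_sums (\<lambda>n. ((t (\<nu> n))(s := \<sigma> n)) i)"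
        if "mono \<nu>" "A.E.wuC_sums \<sigma>" "i \<in> insert s I" for \<nu> \<sigma> i
        using that A.E.wuC_sums_mono[OF t[rule_format] that(1), of i] by (cases "i = s") auto
      \<comment> \<open>The constant \<open>x\<close> in slot \<open>s\<close> and the sums
        \<open>t\<close> in the others are all \<open>wuC_sums\<close>, so \<open>A\<close> is
        Cauchy along them.\<close>
      have S0: "S x \<longlonglongrightarrow> 0" if x: "x \<in> vecs E" for x
      proof (rule LIMSEQ_I)
        fix r :: real assume r: "r > 0"
        have "\<exists>N. \<forall>m\<ge>N. \<forall>n\<ge>N. nrm F (A ((t m)(s := x)) - A ((t n)(s := x))) < r"
        proof (rule wuC_CauchyD[OF CV _ r])
          show "A.E.wuC_sums (\<lambda>n. ((t n)(s := x)) i)" if "i \<in> insert s I" for i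
            using ups[of "\<lambda>n. n" "\<lambda>_. x" i] A.E.wuC_sums_const[OF x] that by (simp add: mono_def)
        qed
        then obtain N where N: "\<forall>m\<ge>N. \<forall>n\<ge>N. nrm F (A ((t m)(s := x)) - A ((t n)(s := x))) < r" by blast
        have "norm (S x j - 0) < r" if "j \<ge> N" for j
          using Sle[OF x, of j] N[rule_format, of "p j" "q j"] pj[of j] pq[of j] that by simp
        then show "\<exists>no. \<forall>n\<ge>no. norm (S x n - 0) < r" by blast
      qed
      have "\<forall>i. \<exists>C. i \<in> I \<longrightarrow> (\<forall>n. nrm E (t n i) \<le> C)"
        using A.E.wuC_sums_bounded[OF t[rule_format]] by metis
      then obtain C where C: "\<And>i n. i \<in> I \<Longrightarrow> nrm E (t n i) \<le> C i" unfolding choice_iff by blast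
      define R where "R = 1 + (\<Sum>i\<in>I. \<bar>C i\<bar>)"
      have R: "R \<ge> 1" by (simp add: R_def sum_nonneg)
      have tR: "nrm E (t n i) \<le> R" if "i \<in> I" for n i
        using C[OF that, of n] member_le_sum[of i I "\<lambda>i. \<bar>C i\<bar>"] that finI by (simp add: R_def)
      define D where "D = K * R ^ card (insert s I)"
      have AD: "nrm F (A ((t n)(s := x))) \<le> D * nrm E x" if "x \<in> vecs E" for n x
        unfolding D_def by (rule K(2)[OF R sI]) (use tvi tR that in auto)
      have Sop: "S \<in> bounded_ops E c0_space"
      proof (rule bounded_opsI[where C = "2 * D"])
        fix x assume x: "x \<in> vecs E"
        show "S x \<in> vecs c0_space" using S0[OF x] by simp
        show "nrm c0_space (S x) \<le> 2 * D * nrm E x"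
        proof (rule c0_nrm_le)
          fix j
          have "norm (S x j) \<le> nrm F (A ((t (p j))(s := x))) + nrm F (A ((t (q j))(s := x)))"
            using Sle[OF x, of j] A.F.nrm_diff_triangle[OF Atv[OF x] Atv[OF x], of "p j" "q j"] by linarith
          then show "norm (S x j) \<le> 2 * D * nrm E x" using AD[OF x, of "p j"] AD[OF x, of "q j"] by simp
        qed
        have lin: "A ((t n)(s := x + y)) = A ((t n)(s := x)) + A ((t n)(s := y))" if "y \<in> vecs E" for n y
          by (rule A.add) (use x that tvi in auto)
        show "S (x + y) = S x + S y" if y: "y \<in> vecs E" for y
        proof
          fix j
          have "S (x + y) j = \<psi> j ((A ((t (p j))(s := x)) - A ((t (q j))(s := x))) + (A ((t (p j))(s := y)) - A ((t (q j))(s := y))))"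
            unfolding S_def lin[OF y] by (simp add: algebra_simps)
          also have "\<dots> = S x j + S y j" unfolding S_def
            by (intro dual_add[OF \<psi>(1)] A.F.vecs_diff Atv x y)
          finally show "S (x + y) j = (S x + S y) j" by simp
        qed
        have sc: "A ((t n)(s := scl E c x)) = scl F c (A ((t n)(s := x)))" for n c
          by (rule A.scl) (use x tvi in auto)
        show "S (scl E c x) = scl c0_space c (S x)" for c
        proof
          fix j
          have "S (scl E c x) j = \<psi> j (scl F c (A ((t (p j))(s := x)) - A ((t (q j))(s := x))))"
            unfolding S_def sc A.F.scale_right_diff_distrib ..
          also have "\<dots> = c * S x j" unfolding S_def
            by (intro dual_scl[OF \<psi>(1)] A.F.vecs_diff Atv x)
          finally show "S (scl E c x) j = scl c0_space c (S x) j" by simp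
        qed
      qed
      interpret c0: banach_space "c0_space :: ('k, nat \<Rightarrow> 'k) nspace" by (rule banach_c0)
      have "unconditionally_converging E c0_space S"
        unfolding unconditionally_converging_def
      proof (intro allI impI)
        fix w assume w: "wuC E w"
        define \<sigma> where "\<sigma> n = (\<Sum>i\<le>n. w i)" for n
        have \<sigma>: "A.E.wuC_sums \<sigma>" unfolding \<sigma>_def by (rule A.E.wuC_partial_sums[OF w])
        have \<sigma>v: "\<sigma> n \<in> vecs E" for n by (rule A.E.wuC_sums_vecs[OF \<sigma>])
        have S\<sigma>: "S (\<sigma> n) \<in> vecs c0_space" for n by (rule bounded_ops_vecs[OF Sop \<sigma>v])
        have Sdiff: "S (\<sigma> m) j - S (\<sigma> n) j =
            \<psi> j (A ((t (p j))(s := \<sigma> m)) - A ((t (p j))(s := \<sigma> n))) - \<psi> j (A ((t (q j))(s := \<sigma> m)) - A ((t (q j))(s := \<sigma> n)))" for m n j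
          unfolding S_def by (simp add: A.F.dual_diff[OF \<psi>(1)] Atv \<sigma>v)
        have "\<forall>e>0. \<exists>N. \<forall>m\<ge>N. \<forall>n\<ge>N. nrm c0_space (S (\<sigma> m) - S (\<sigma> n)) < e"
        proof (rule ccontr)
          assume na: "\<not> ?thesis"
          have z: "nrm c0_space (S (\<sigma> n) - S (\<sigma> n)) = 0" for n by simp
          obtain e' P Q where "e' > 0 \<and> (\<forall>a. P a < Q a) \<and> (\<forall>a. Q a \<le> P (Suc a)) \<and>
              (\<forall>a. nrm c0_space (S (\<sigma> (P a)) - S (\<sigma> (Q a))) \<ge> e')"
            using not_Cauchy_blocks_ex[of "\<lambda>m n. nrm c0_space (S (\<sigma> m) - S (\<sigma> n))",
                  OF c0.nrm_minus_commute[OF S\<sigma> S\<sigma>] z na] by (elim exE)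
          then have e': "e' > 0" "P a < Q a" "Q a \<le> P (Suc a)"
              "nrm c0_space (S (\<sigma> (P a)) - S (\<sigma> (Q a))) \<ge> e'" for a
            by simp_all
          \<comment> \<open>A coordinate of \<open>S\<close> involves two members of
            \<open>t\<close>. Were all these differences at most \<open>e'/5\<close>, the norm of
            \<open>S\<close> would move by at most \<open>2 e'/5\<close>.\<close>
          have "\<exists>n. nrm F (A ((t n)(s := \<sigma> (P a))) - A ((t n)(s := \<sigma> (Q a)))) > e'/5" for a
          proof (rule ccontr)
            assume n: "\<nexists>n. nrm F (A ((t n)(s := \<sigma> (P a))) - A ((t n)(s := \<sigma> (Q a)))) > e'/5"
            have "norm (\<psi> j (A ((t n)(s := \<sigma> (P a))) - A ((t n)(s := \<sigma> (Q a))))) \<le> e'/5" for j n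
              using \<psi>(2)[OF A.F.vecs_diff[OF Atv[OF \<sigma>v] Atv[OF \<sigma>v]], of j n "P a" n "Q a"] n
              by (meson dual_order.trans not_less)
            then have "norm (S (\<sigma> (P a)) j - S (\<sigma> (Q a)) j) \<le> e'/5 + e'/5" for j
              unfolding Sdiff by (intro order_trans[OF norm_triangle_ineq4] add_mono)
            then have "nrm c0_space (S (\<sigma> (P a)) - S (\<sigma> (Q a))) \<le> e'/5 + e'/5"
              by (intro c0_nrm_le) simp
            then show False using e'(1) e'(4)[of a] by simp
          qed
          then obtain n where n: "\<And>a. nrm F (A ((t (n a))(s := \<sigma> (P a))) - A ((t (n a))(s := \<sigma> (Q a)))) > e'/5"
            by metis
          \<comment> \<open>Nothing controls the indices \<open>n a\<close>, but \<open>t\<close>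
            stays a sequence of \<open>wuC_sums\<close> only under nondecreasing reindexing.\<close>
          obtain r :: "nat \<Rightarrow> nat" where r: "strict_mono r" "mono (n \<circ> r)" by (rule nat_seq_incseq_subseq)
          have PQ: "P a \<le> Q a" for a using e'(2)[of a] by simp
          have "mono P" by (rule mono_blocks(1)[of P Q, OF PQ e'(3)])
          then have QP: "Q (r j) \<le> P (r (Suc j))" for j
            using e'(3)[of "r j"] strict_monoD[OF r(1), of j "Suc j"] monoD[of P "Suc (r j)" "r (Suc j)"] by simp
          obtain l :: "nat \<Rightarrow> nat" where l: "mono l" "\<And>j. l (2 * j) = P (r j)" "\<And>j. l (Suc (2 * j)) = Q (r j)"
            using A.E.interleave_blocks[of "\<lambda>j. P (r j)" "\<lambda>j. Q (r j)", OF PQ QP] by blast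
          \<comment> \<open>Halving keeps the member of \<open>t\<close> fixed over each pair
            \<open>2 j\<close>, \<open>Suc (2 j)\<close>, while slot \<open>s\<close> passes from
            one end of the block to the other.\<close>
          define \<nu> where "\<nu> i = n (r (i div 2))" for i
          have \<nu>: "mono \<nu>"
            using r(2) unfolding mono_def \<nu>_def o_def by (auto intro: div_le_mono)
          have "\<exists>N. \<forall>m\<ge>N. \<forall>n\<ge>N. nrm F (A ((t (\<nu> m))(s := \<sigma> (l m))) - A ((t (\<nu> n))(s := \<sigma> (l n)))) < e'/5"
          proof (rule wuC_CauchyD[OF CV])
            show "A.E.wuC_sums (\<lambda>n. ((t (\<nu> n))(s := \<sigma> (l n))) i)" if "i \<in> insert s I" for i
              by (rule ups[OF \<nu> A.E.wuC_sums_mono[OF \<sigma> l(1)] that])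
            show "e'/5 > 0" using e'(1) by simp
          qed
          then obtain N where N: "\<forall>m\<ge>N. \<forall>n\<ge>N. nrm F (A ((t (\<nu> m))(s := \<sigma> (l m))) - A ((t (\<nu> n))(s := \<sigma> (l n)))) < e'/5"
            by blast
          have "\<nu> (2 * N) = n (r N)" "\<nu> (Suc (2 * N)) = n (r N)" by (simp_all add: \<nu>_def)
          then show False using N[rule_format, of "2 * N" "Suc (2 * N)"] n[of "r N"] l(2,3)[of N] by simp
        qed
        then obtain L where "L \<in> vecs c0_space" "(\<lambda>n. nrm c0_space (S (\<sigma> n) - L)) \<longlonglongrightarrow> 0"
          using c0.nrm_Cauchy_convergent[of "\<lambda>n. S (\<sigma> n)"] S\<sigma> by metis
        then have "limitin (norm_top c0_space) (\<lambda>n. S (\<sigma> n)) L sequentially"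
          unfolding c0.limitin_norm_top using S\<sigma> by simp
        then show "\<exists>l. limitin (norm_top c0_space) (\<lambda>n. S (\<Sum>i\<le>n. w i)) l sequentially"
          unfolding \<sigma>_def by blast
      qed
      from property_V_weak_limit[OF E V banach_c0 Sop this U] obtain g :: "nat \<Rightarrow> 'k"
        where g: "g \<in> vecs c0_space" "\<forall>\<phi>\<in>dual c0_space. ((\<lambda>x. \<phi> (S x)) \<longlongrightarrow> \<phi> g) U" by blast
      have gj: "g j = of_real (nrm F (A1 (t (p j)) - A1 (t (q j))))" for j
      proof (rule tendsto_unique[OF Ub])
        show "((\<lambda>x. S x j) \<longlongrightarrow> g j) U"
          using g(2)[THEN bspec, OF c0_coordinate_functional[of j]] .
        have "((\<lambda>x. \<psi> j (A ((t (p j))(s := x))) - \<psi> j (A ((t (q j))(s := x)))) \<longlongrightarrow> \<psi> j (A1 (t (p j))) - \<psi> j (A1 (t (q j)))) U"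
          by (intro tendsto_diff A1l tv \<psi>(1))
        moreover have "eventually (\<lambda>x. \<psi> j (A ((t (p j))(s := x))) - \<psi> j (A ((t (q j))(s := x))) = S x j) U"
          using Uball by eventually_elim (simp add: S_def A.F.dual_diff[OF \<psi>(1)] Atv)
        ultimately have "((\<lambda>x. S x j) \<longlongrightarrow> \<psi> j (A1 (t (p j))) - \<psi> j (A1 (t (q j)))) U"
          by (rule Lim_transform_eventually)
        then show "((\<lambda>x. S x j) \<longlongrightarrow> of_real (nrm F (A1 (t (p j)) - A1 (t (q j))))) U"
          unfolding \<psi>(3)[symmetric] A.F.dual_diff[OF \<psi>(1) A1tv A1tv] .
      qed
      have "g \<longlonglongrightarrow> 0" using g(1) by simp
      then obtain N where "norm (g N - 0) < e" using LIMSEQ_D[of g 0 e] e(1) by blast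
      moreover have "norm (g N) \<ge> e" using e(4)[of N] by (simp add: gj)
      ultimately show False by simp
    qed
    then show "\<exists>N. \<forall>m\<ge>N. \<forall>n\<ge>N. nrm F (A1 (t m) - A1 (t n)) < \<epsilon>" using eps by blast
  qed
  show ?thesis by (rule that[OF m1 CV1], rule A1l) (simp_all add: slots_def)
qed

text \<open>The points in the slots vary independently over \<open>V\<close>; this is what allows an
  iterated limit to be compared with the limit on the diagonal.\<close>

definition jointly_Cauchy :: "'v filter \<Rightarrow> nat set \<Rightarrow> ((nat \<Rightarrow> 'v) \<Rightarrow> 'k::rc_field) \<Rightarrow> bool" where
  "jointly_Cauchy U I B \<longleftrightarrow> (\<forall>e>0. \<exists>V. eventually V U \<and>
     (\<forall>x y. (\<forall>i\<in>I. V (x i) \<and> V (y i)) \<longrightarrow> norm (B x - B y) < e))"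

text \<open>\<open>L\<close> comes from iterating \<open>slot_weak_limit\<close> and is chosen
  before \<open>\<psi>\<close>, while joint Cauchyness is asked of each \<open>\<psi>\<close>
  separately. It passes to \<open>A1\<close> because the estimate \<open>e/2\<close> survives the
  limit in slot \<open>s\<close>, and it shows that on the diagonal the entry of slot
  \<open>s\<close> may be replaced by its limit.\<close>

lemma diagonal_weak_limit:
  fixes E :: "('k::rc_field, 'e::ab_group_add) nspace" and F :: "('k, 'f::ab_group_add) nspace"
  assumes V: "property_V TYPE(('e \<Rightarrow> 'k) \<Rightarrow> 'k) E"
    and U: "ultra U" "U \<le> principal (unit_ball E)" and "finite I"
    and "multilinear E F I A" "wuC_Cauchy I E F A"
  shows "\<exists>L\<in>vecs F. \<forall>\<psi>\<in>dual F. jointly_Cauchy U I (\<lambda>x. \<psi> (A x)) \<longrightarrow> ((\<lambda>x. \<psi> (A (\<lambda>_. x))) \<longlongrightarrow> \<psi> L) U"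
  using assms(4-)
proof (induction I arbitrary: A rule: finite_induct)
  case empty
  interpret A: multilinear E F "{}" A by (rule empty.prems(1))
  have c: "A (\<lambda>_. x) = A (\<lambda>_. 0)" for x by (rule A.cong) simp
  have "((\<lambda>x. \<psi> (A (\<lambda>_. x))) \<longlongrightarrow> \<psi> (A (\<lambda>_. 0))) U" for \<psi> :: "'f \<Rightarrow> 'k"
    by (intro tendsto_eventually always_eventually allI arg_cong[where f = \<psi>] c)
  moreover have "A (\<lambda>_. 0) \<in> vecs F" by (rule A.vecs_app) simp
  ultimately show ?case by blast
next
  case (insert s I)
  interpret A: multilinear E F "insert s I" A by (rule insert.prems(1))
  have Ub: "U \<noteq> bot" by (rule ultra_not_bot[OF U(1)])
  have Uball: "eventually (\<lambda>u. u \<in> unit_ball E) U" using U(2) by (simp add: le_principal)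
  obtain A1 where A1: "multilinear E F I A1" "wuC_Cauchy I E F A1"
    "\<And>x \<psi>. (\<And>i. i \<in> I \<Longrightarrow> x i \<in> vecs E) \<Longrightarrow> \<psi> \<in> dual F \<Longrightarrow>
       ((\<lambda>u. \<psi> (A (x(s := u)))) \<longlongrightarrow> \<psi> (A1 x)) U"
    by (rule slot_weak_limit[OF V insert.prems(1) insert.hyps(2) insert.prems(2) U]) blast
  obtain L where L: "L \<in> vecs F"
      "\<forall>\<psi>\<in>dual F. jointly_Cauchy U I (\<lambda>x. \<psi> (A1 x)) \<longrightarrow> ((\<lambda>x. \<psi> (A1 (\<lambda>_. x))) \<longlongrightarrow> \<psi> L) U"
    using insert.IH[OF A1(1,2)] by blast
  have "((\<lambda>x. \<psi> (A (\<lambda>_. x))) \<longlongrightarrow> \<psi> L) U"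
    if \<psi>: "\<psi> \<in> dual F" and J: "jointly_Cauchy U (insert s I) (\<lambda>x. \<psi> (A x))" for \<psi>
  proof -
    have cl: "\<exists>V. eventually V U \<and> (\<forall>x. V x \<longrightarrow> x \<in> unit_ball E) \<and>
        (\<forall>x y. (\<forall>i\<in>insert s I. V (x i) \<and> V (y i)) \<longrightarrow> norm (\<psi> (A x) - \<psi> (A y)) < e)" if e: "e > 0" for e
    proof -
      obtain V where V: "eventually V U" "\<forall>x y. (\<forall>i\<in>insert s I. V (x i) \<and> V (y i)) \<longrightarrow> norm (\<psi> (A x) - \<psi> (A y)) < e"
        using J e unfolding jointly_Cauchy_def by blast
      have "eventually (\<lambda>x. V x \<and> x \<in> unit_ball E) U" using V(1) Uball by eventually_elim simp
      then show ?thesis using V(2) by (intro exI[of _ "\<lambda>x. V x \<and> x \<in> unit_ball E"]) simp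
    qed
    have "jointly_Cauchy U I (\<lambda>x. \<psi> (A1 x))"
      unfolding jointly_Cauchy_def
    proof (intro allI impI)
      fix e :: real assume "e > 0"
      then obtain V where V: "eventually V U" "\<forall>x. V x \<longrightarrow> x \<in> unit_ball E"
          "\<forall>x y. (\<forall>i\<in>insert s I. V (x i) \<and> V (y i)) \<longrightarrow> norm (\<psi> (A x) - \<psi> (A y)) < e/2"
        using cl[of "e/2"] by auto
      have "norm (\<psi> (A1 x) - \<psi> (A1 y)) < e" if xy: "\<forall>i\<in>I. V (x i) \<and> V (y i)" for x y
      proof -
        have v: "x i \<in> vecs E" "y i \<in> vecs E" if "i \<in> I" for i using xy V(2) that by auto
        have "norm (\<psi> (A1 x) - \<psi> (A1 y)) \<le> e/2"
        proof (rule tendsto_upperbound)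
          show "((\<lambda>u. norm (\<psi> (A (x(s := u))) - \<psi> (A (y(s := u))))) \<longlongrightarrow> norm (\<psi> (A1 x) - \<psi> (A1 y))) U"
            by (intro tendsto_intros A1(3) v \<psi>)
          show "eventually (\<lambda>u. norm (\<psi> (A (x(s := u))) - \<psi> (A (y(s := u)))) \<le> e/2) U"
            using V(1)
          proof eventually_elim
            case (elim u)
            have "\<forall>i\<in>insert s I. V ((x(s := u)) i) \<and> V ((y(s := u)) i)" using xy elim by auto
            then show ?case using V(3) by (meson less_imp_le)
          qed
        qed (rule Ub)
        then show ?thesis using \<open>e > 0\<close> by simp
      qed
      then show "\<exists>V. eventually V U \<and> (\<forall>x y. (\<forall>i\<in>I. V (x i) \<and> V (y i)) \<longrightarrow> norm (\<psi> (A1 x) - \<psi> (A1 y)) < e)"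
        using V(1) by blast
    qed
    then have lim1: "((\<lambda>x. \<psi> (A1 (\<lambda>_. x))) \<longlongrightarrow> \<psi> L) U" using L(2) \<psi> by blast
    have "((\<lambda>x. \<psi> (A (\<lambda>_. x)) - \<psi> (A1 (\<lambda>_. x))) \<longlongrightarrow> 0) U"
    proof (rule tendstoI)
      fix e :: real assume "e > 0"
      then obtain V where V: "eventually V U" "\<forall>x. V x \<longrightarrow> x \<in> unit_ball E"
          "\<forall>x y. (\<forall>i\<in>insert s I. V (x i) \<and> V (y i)) \<longrightarrow> norm (\<psi> (A x) - \<psi> (A y)) < e/2"
        using cl[of "e/2"] by auto
      show "eventually (\<lambda>x. dist (\<psi> (A (\<lambda>_. x)) - \<psi> (A1 (\<lambda>_. x))) 0 < e) U"
        using V(1)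
      proof eventually_elim
        case (elim x)
        have xv: "x \<in> vecs E" using elim V(2) by blast
        have "norm (\<psi> (A (\<lambda>_. x)) - \<psi> (A1 (\<lambda>_. x))) \<le> e/2"
        proof (rule tendsto_upperbound)
          show "((\<lambda>u. norm (\<psi> (A (\<lambda>_. x)) - \<psi> (A ((\<lambda>_. x)(s := u))))) \<longlongrightarrow> norm (\<psi> (A (\<lambda>_. x)) - \<psi> (A1 (\<lambda>_. x)))) U"
            by (intro tendsto_intros A1(3)[of "\<lambda>_. x"] xv \<psi>)
          show "eventually (\<lambda>u. norm (\<psi> (A (\<lambda>_. x)) - \<psi> (A ((\<lambda>_. x)(s := u)))) \<le> e/2) U"
            using V(1)
          proof eventually_elim
            case (elim u)
            have "\<forall>i\<in>insert s I. V ((\<lambda>_. x) i) \<and> V (((\<lambda>_. x)(s := u)) i)" using elim \<open>V x\<close> by auto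
            from V(3)[THEN spec[of _ "\<lambda>_. x"], THEN spec[of _ "(\<lambda>_. x)(s := u)"], THEN mp, OF this]
            show ?case by (rule less_imp_le)
          qed
        qed (rule Ub)
        then show ?case using \<open>e > 0\<close> by (simp add: dist_norm)
      qed
    qed
    from tendsto_add[OF this lim1] show ?thesis by simp
  qed
  then show ?case using L(1) by blast
qed

section \<open>Weakly continuous polynomials along an ultrafilter\<close>

text \<open>Every functional converges along \<open>U\<close>, so differences of points from a
  suitable member of \<open>U\<close> are weakly small, although the points themselves need not
  converge weakly in \<open>E\<close>.\<close>

lemma weakly_cont_differences:
  fixes E :: "('k::rc_field, 'e::ab_group_add) nspace"
  assumes E: "banach_space E" and U: "ultra U" "U \<le> principal (unit_ball E)"
    and Q: "weakly_cont_on_bounded E Q" and p: "p \<in> vecs E" and J: "finite J" and e: "e > 0"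
  shows "\<exists>V. eventually V U \<and> (\<forall>x y. (\<forall>i\<in>J. V (x i) \<and> V (y i)) \<longrightarrow>
      norm (Q (p + (\<Sum>i\<in>J. x i - y i)) - Q p) < (e::real))"
proof -
  interpret E: banach_space E by fact
  have Uball: "eventually (\<lambda>u. u \<in> unit_ball E) U" using U(2) by (simp add: le_principal)
  \<comment> \<open>A difference of two points of the unit ball has norm at most
    \<open>2\<close>.\<close>
  define R where "R = nrm E p + 2 * card J"
  have "(Q \<longlongrightarrow> Q p) (inf (weak_nhds E p) (principal {y. nrm E y \<le> R}))"
    using Q p unfolding weakly_cont_on_bounded_def by (simp add: R_def)
  from tendstoD[OF this e] have "eventually (\<lambda>y. nrm E y \<le> R \<longrightarrow> norm (Q y - Q p) < e) (weak_nhds E p)"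
    by (simp add: eventually_inf_principal dist_norm)
  then obtain \<Phi> d where \<Phi>: "finite \<Phi>" "\<Phi> \<subseteq> dual E" "d > 0"
    "\<And>y. y \<in> vecs E \<Longrightarrow> (\<And>\<phi>. \<phi> \<in> \<Phi> \<Longrightarrow> norm (\<phi> y - \<phi> p) < d) \<Longrightarrow> nrm E y \<le> R \<longrightarrow> norm (Q y - Q p) < e"
    using eventually_weak_nhds by blast
  have "\<exists>l. (\<phi> \<longlongrightarrow> l) U" if \<phi>: "\<phi> \<in> \<Phi>" for \<phi>
  proof -
    obtain C where C: "C \<ge> 0" "\<And>x. x \<in> vecs E \<Longrightarrow> norm (\<phi> x) \<le> C * nrm E x"
      using E.dual_bound \<phi> \<Phi>(2) by blast
    have "eventually (\<lambda>x. norm (\<phi> x) \<le> C) U"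
      using Uball
    proof eventually_elim
      case (elim x)
      then show ?case using C(2)[of x] mult_left_le[of "nrm E x" C] C(1) by simp
    qed
    then show ?thesis using ultra_bounded_tendsto[OF U(1)] by blast
  qed
  then obtain l where l: "\<And>\<phi>. \<phi> \<in> \<Phi> \<Longrightarrow> (\<phi> \<longlongrightarrow> l \<phi>) U" by metis
  \<comment> \<open>There are \<open>card J\<close> differences, each with an error of at most
    \<open>2 d'\<close>; adding \<open>1\<close> makes the bound strict and covers an empty
    \<open>J\<close>.\<close>
  define d' where "d' = d / (2 * (real (card J) + 1))"
  have d': "d' > 0" "2 * card J * d' < d" using \<Phi>(3) by (simp_all add: d'_def field_simps)
  let ?V = "\<lambda>x. x \<in> unit_ball E \<and> (\<forall>\<phi>\<in>\<Phi>. norm (\<phi> x - l \<phi>) < d')"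
  have "eventually (\<lambda>x. \<forall>\<phi>\<in>\<Phi>. norm (\<phi> x - l \<phi>) < d') U"
  proof (rule eventually_ball_finite[OF \<Phi>(1)], intro ballI)
    fix \<phi> assume "\<phi> \<in> \<Phi>"
    from tendstoD[OF l[OF this] d'(1)] show "eventually (\<lambda>x. norm (\<phi> x - l \<phi>) < d') U"
      unfolding dist_norm .
  qed
  with Uball have ev: "eventually ?V U" by eventually_elim simp
  have "norm (Q (p + (\<Sum>i\<in>J. x i - y i)) - Q p) < e" if xy: "\<forall>i\<in>J. ?V (x i) \<and> ?V (y i)" for x y
  proof -
    have v: "x i \<in> vecs E" "y i \<in> vecs E" "nrm E (x i) \<le> 1" "nrm E (y i) \<le> 1" if "i \<in> J" for i
      using xy that by auto
    have sv: "(\<Sum>i\<in>J. x i - y i) \<in> vecs E" using v by (intro E.vecs_sum E.vecs_diff)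
    have "nrm E (\<Sum>i\<in>J. x i - y i) \<le> (\<Sum>i\<in>J. nrm E (x i - y i))" using v by (intro E.nrm_sum E.vecs_diff)
    also have "\<dots> \<le> (\<Sum>i\<in>J. 2)"
    proof (rule sum_mono)
      fix i assume "i \<in> J"
      then show "nrm E (x i - y i) \<le> 2" using E.nrm_diff_triangle[of "x i" "y i"] v[of i] by simp
    qed
    finally have "nrm E (p + (\<Sum>i\<in>J. x i - y i)) \<le> R"
      using E.nrm_triangle[OF p sv] by (simp add: R_def)
    moreover have "norm (\<phi> (p + (\<Sum>i\<in>J. x i - y i)) - \<phi> p) < d" if \<phi>: "\<phi> \<in> \<Phi>" for \<phi>
    proof -
      have \<phi>E: "\<phi> \<in> dual E" using \<phi> \<Phi>(2) by blast
      have "\<phi> (p + (\<Sum>i\<in>J. x i - y i)) - \<phi> p = \<phi> (\<Sum>i\<in>J. x i - y i)"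
        using dual_add[OF \<phi>E p sv] by simp
      also have "\<dots> = (\<Sum>i\<in>J. \<phi> (x i - y i))"
        by (rule E.dual_sum[OF \<phi>E]) (use v in \<open>simp add: E.vecs_diff\<close>)
      also have "\<dots> = (\<Sum>i\<in>J. (\<phi> (x i) - l \<phi>) - (\<phi> (y i) - l \<phi>))"
        using v by (intro sum.cong refl) (simp add: E.dual_diff[OF \<phi>E])
      also have "norm \<dots> \<le> (\<Sum>i\<in>J. 2 * d')"
      proof (rule order_trans[OF norm_sum sum_mono])
        fix i assume i: "i \<in> J"
        have "norm (\<phi> (x i) - l \<phi>) < d'" "norm (\<phi> (y i) - l \<phi>) < d'" using xy i \<phi> by auto
        then show "norm ((\<phi> (x i) - l \<phi>) - (\<phi> (y i) - l \<phi>)) \<le> 2 * d'"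
          using norm_triangle_ineq4[of "\<phi> (x i) - l \<phi>" "\<phi> (y i) - l \<phi>"] by linarith
      qed
      also have "\<dots> = 2 * card J * d'" by simp
      finally show ?thesis using d'(2) by simp
    qed
    ultimately show ?thesis using \<Phi>(4)[of "p + (\<Sum>i\<in>J. x i - y i)"] p sv by simp
  qed
  then show ?thesis using ev by blast
qed

text \<open>Weak continuity controls \<open>Q\<close> near one fixed point only, so \<open>B\<close>
  is first estimated with differences in some slots and fixed vectors in the others. Slots with
  variable entries are then reduced to these two kinds, and a telescoping sum over the slots
  concludes.\<close>

lemma jointly_Cauchy_of_weakly_cont:
  fixes E :: "('k::rc_field, 'e::ab_group_add) nspace"
  assumes B: "multilinear E scalar_space I B"
    and U: "ultra U" "U \<le> principal (unit_ball E)"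
    and Q: "weakly_cont_on_bounded E Q"
    and BQ: "\<And>x. (\<forall>i\<in>I. x i \<in> vecs E) \<Longrightarrow> B x = (\<Sum>J\<in>Pow I. c J * Q (\<Sum>i\<in>J. x i))"
  shows "jointly_Cauchy U I B"
proof -
  interpret B: multilinear E scalar_space I B by (rule B)
  have E: "banach_space E" by unfold_locales
  have Uball: "eventually (\<lambda>u. u \<in> unit_ball E) U" using U(2) by (simp add: le_principal)
  have Ub: "U \<noteq> bot" by (rule ultra_not_bot[OF U(1)])
  have Z: "\<exists>V. eventually V U \<and> (\<forall>x. V x \<longrightarrow> x \<in> unit_ball E) \<and>
      (\<forall>x y. (\<forall>i\<in>K. V (x i) \<and> V (y i)) \<longrightarrow> norm (B (\<lambda>i. if i \<in> K then x i - y i else a i)) < e)"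
    if K: "K \<subseteq> I" "K \<noteq> {}" and a: "\<forall>i\<in>I. a i \<in> vecs E" and e: "e > 0" for K a and e :: real
  proof -
    \<comment> \<open>The point of comparison, with all differences replaced by \<open>0\<close>.
      There \<open>B\<close> vanishes because \<open>K\<close> is nonempty, and each value of
      \<open>Q\<close> in the polarization formula has changed by less than
      \<open>\<delta>\<close>.\<close>
    define a' where "a' i = (if i \<in> K then 0 else a i)" for i
    have a'v: "\<forall>i\<in>I. a' i \<in> vecs E" using a by (simp add: a'_def)
    define D where "D = (\<Sum>J\<in>Pow I. norm (c J)) + 1"
    define \<delta> where "\<delta> = e / (2 * D)"
    have "(\<Sum>J\<in>Pow I. norm (c J)) \<ge> 0" by (simp add: sum_nonneg)
    then have D: "D > 0" unfolding D_def by linarith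
    have \<delta>: "\<delta> > 0" using e D by (simp add: \<delta>_def)
    have "\<forall>J\<in>Pow I. \<exists>V. eventually V U \<and> (\<forall>x y. (\<forall>i\<in>J \<inter> K. V (x i) \<and> V (y i)) \<longrightarrow>
      norm (Q ((\<Sum>i\<in>J. a' i) + (\<Sum>i\<in>J \<inter> K. x i - y i)) - Q (\<Sum>i\<in>J. a' i)) < \<delta>)"
    proof
      fix J assume J: "J \<in> Pow I"
      then have "finite (J \<inter> K)" using B.finite_slots finite_subset by blast
      moreover have "(\<Sum>i\<in>J. a' i) \<in> vecs E" using J a'v by (intro B.E.vecs_sum) auto
      ultimately show "\<exists>V. eventually V U \<and> (\<forall>x y. (\<forall>i\<in>J \<inter> K. V (x i) \<and> V (y i)) \<longrightarrow>
        norm (Q ((\<Sum>i\<in>J. a' i) + (\<Sum>i\<in>J \<inter> K. x i - y i)) - Q (\<Sum>i\<in>J. a' i)) < \<delta>)"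
        by (intro weakly_cont_differences[OF E U Q _ _ \<delta>])
    qed
    then obtain V where V: "\<forall>J\<in>Pow I. eventually (V J) U \<and> (\<forall>x y. (\<forall>i\<in>J \<inter> K. V J (x i) \<and> V J (y i)) \<longrightarrow>
      norm (Q ((\<Sum>i\<in>J. a' i) + (\<Sum>i\<in>J \<inter> K. x i - y i)) - Q (\<Sum>i\<in>J. a' i)) < \<delta>)"
      by (elim bchoice[THEN exE])
    have "eventually (\<lambda>x. \<forall>J\<in>Pow I. V J x) U"
      by (rule eventually_ball_finite) (use V B.finite_slots in auto)
    with Uball have ev: "eventually (\<lambda>x. x \<in> unit_ball E \<and> (\<forall>J\<in>Pow I. V J x)) U" by eventually_elim simp
    have "norm (B (\<lambda>i. if i \<in> K then x i - y i else a i)) < e"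
      if xy: "\<forall>i\<in>K. (x i \<in> unit_ball E \<and> (\<forall>J\<in>Pow I. V J (x i))) \<and> (y i \<in> unit_ball E \<and> (\<forall>J\<in>Pow I. V J (y i)))" for x y
    proof -
      let ?z = "\<lambda>i. if i \<in> K then x i - y i else a i"
      have zv: "\<forall>i\<in>I. ?z i \<in> vecs E" using xy a by auto
      obtain k where k: "k \<in> K" using K(2) by blast
      have "a' = a'(k := 0)" using k by (auto simp: a'_def)
      then have "B a' = 0" using B.zero[of k a'] k K(1) a'v by (metis subsetD)
      then have "B ?z = (\<Sum>J\<in>Pow I. c J * Q (\<Sum>i\<in>J. ?z i)) - (\<Sum>J\<in>Pow I. c J * Q (\<Sum>i\<in>J. a' i))"
        using BQ[OF zv] BQ[OF a'v] by simp
      also have "\<dots> = (\<Sum>J\<in>Pow I. c J * (Q (\<Sum>i\<in>J. ?z i) - Q (\<Sum>i\<in>J. a' i)))"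
        by (simp add: sum_subtractf right_diff_distrib)
      also have "norm \<dots> \<le> (\<Sum>J\<in>Pow I. norm (c J) * \<delta>)"
      proof (rule order_trans[OF norm_sum sum_mono])
        fix J assume J: "J \<in> Pow I"
        then have fJ: "finite J" using B.finite_slots finite_subset by blast
        have "(\<Sum>i\<in>J. ?z i) = (\<Sum>i\<in>J. a' i + (if i \<in> K then x i - y i else 0))"
          by (intro sum.cong refl) (simp add: a'_def)
        also have "\<dots> = (\<Sum>i\<in>J. a' i) + (\<Sum>i\<in>J \<inter> K. x i - y i)"
          unfolding sum.distrib sum.inter_restrict[OF fJ] ..
        finally have "norm (Q (\<Sum>i\<in>J. ?z i) - Q (\<Sum>i\<in>J. a' i)) < \<delta>"
          using V[THEN bspec, OF J] xy J by (metis (no_types, lifting) IntD2)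
        then show "norm (c J * (Q (\<Sum>i\<in>J. ?z i) - Q (\<Sum>i\<in>J. a' i))) \<le> norm (c J) * \<delta>"
          unfolding norm_mult by (intro mult_left_mono) auto
      qed
      also have "\<dots> = (\<Sum>J\<in>Pow I. norm (c J)) * \<delta>" by (simp add: sum_distrib_right)
      also have "\<dots> \<le> D * \<delta>" using \<delta> by (simp add: D_def)
      also have "\<dots> = e/2" unfolding \<delta>_def using D by simp
      finally show ?thesis using e by simp
    qed
    then show ?thesis using ev by (intro exI[of _ "\<lambda>x. x \<in> unit_ball E \<and> (\<forall>J\<in>Pow I. V J x)"]) simp
  qed
  have mixed: "\<exists>V. eventually V U \<and> (\<forall>x. V x \<longrightarrow> x \<in> unit_ball E) \<and>
      (\<forall>x y. (\<forall>i\<in>I. V (x i) \<and> V (y i)) \<longrightarrow>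
        norm (B (\<lambda>i. if i \<in> K1 then x i else if i \<in> K2 then x i - y i else a i)) < e)"
    if "finite K1" "K1 \<subseteq> I" "K2 \<subseteq> I" "K2 \<noteq> {}" "K1 \<inter> K2 = {}" "\<forall>i\<in>I. a i \<in> vecs E" "e > 0" for K1 K2 a and e :: real
    using that
  proof (induction K1 arbitrary: K2 a e rule: finite_induct)
    case empty
    obtain V where V: "eventually V U" "\<forall>x. V x \<longrightarrow> x \<in> unit_ball E"
        "\<forall>x y. (\<forall>i\<in>K2. V (x i) \<and> V (y i)) \<longrightarrow> norm (B (\<lambda>i. if i \<in> K2 then x i - y i else a i)) < e"
      using Z[OF empty.prems(2,3,5,6)] by (elim exE conjE)
    have "norm (B (\<lambda>i. if i \<in> {} then x i else if i \<in> K2 then x i - y i else a i)) < e"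
      if xy: "\<forall>i\<in>I. V (x i) \<and> V (y i)" for x y
    proof -
      have "\<forall>i\<in>K2. V (x i) \<and> V (y i)"
        using xy empty.prems(2) by (intro ballI) (drule subsetD, assumption, erule bspec)
      from V(3)[THEN spec, THEN spec, THEN mp, OF this] show ?thesis by simp
    qed
    then show ?case using V(1,2) by (intro exI[of _ V] conjI allI impI) simp_all
  next
    case (insert r K1)
    have r: "r \<in> I" "r \<notin> K2" using insert.prems by auto
    obtain V1 where V1: "eventually V1 U" "\<forall>x. V1 x \<longrightarrow> x \<in> unit_ball E" "\<forall>x y. (\<forall>i\<in>I. V1 (x i) \<and> V1 (y i)) \<longrightarrow>
        norm (B (\<lambda>i. if i \<in> K1 then x i else if i \<in> insert r K2 then x i - y i else a i)) < e/2"
      using insert.IH[of "insert r K2" a "e/2"] insert.prems insert.hyps by auto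
    \<comment> \<open>A fixed \<open>v\<close> splits the variable entry \<open>x r\<close> into the
      difference \<open>x r - v\<close> and the constant \<open>v\<close>. The set \<open>V2\<close>
      is chosen afterwards and may depend on \<open>v\<close>.\<close>
    obtain v where v: "V1 v" using eventually_happens'[OF Ub V1(1)] by blast
    have vv: "v \<in> vecs E" using v V1(2) by auto
    obtain V2 where V2: "eventually V2 U" "\<forall>x y. (\<forall>i\<in>I. V2 (x i) \<and> V2 (y i)) \<longrightarrow>
        norm (B (\<lambda>i. if i \<in> K1 then x i else if i \<in> K2 then x i - y i else (a(r := v)) i)) < e/2"
    proof -
      have "K1 \<subseteq> I" "K1 \<inter> K2 = {}" "\<forall>i\<in>I. (a(r := v)) i \<in> vecs E" "e/2 > 0"
        using insert.prems vv by auto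
      from insert.IH[OF this(1) insert.prems(2,3) this(2-4)] show thesis by (elim exE conjE) (rule that)
    qed
    have ev: "eventually (\<lambda>x. V1 x \<and> V2 x) U" using V1(1) V2(1) by eventually_elim simp
    have "norm (B (\<lambda>i. if i \<in> insert r K1 then x i else if i \<in> K2 then x i - y i else a i)) < e"
      if xy: "\<forall>i\<in>I. (V1 (x i) \<and> V2 (x i)) \<and> V1 (y i) \<and> V2 (y i)" for x y
    proof -
      define z where "z i = (if i \<in> K1 then x i else if i \<in> K2 then x i - y i else a i)" for i
      have xv: "x i \<in> vecs E" "y i \<in> vecs E" if "i \<in> I" for i using xy that V1(2) by auto
      have zv: "z i \<in> vecs E" if "i \<in> I" for i using xv[OF that] insert.prems(5) that by (auto simp: z_def)
      have e0: "(\<lambda>i. if i \<in> insert r K1 then x i else if i \<in> K2 then x i - y i else a i) = z(r := (x r - v) + v)"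
        by (auto simp: z_def)
      have e1: "z(r := x r - v) = (\<lambda>i. if i \<in> K1 then x i else if i \<in> insert r K2 then x i - (y(r := v)) i else a i)"
        using r insert.hyps by (auto simp: z_def)
      have e2: "z(r := v) = (\<lambda>i. if i \<in> K1 then x i else if i \<in> K2 then x i - y i else (a(r := v)) i)"
        using r insert.hyps by (auto simp: z_def)
      have "B (z(r := (x r - v) + v)) = B (z(r := x r - v)) + B (z(r := v))"
        by (rule B.add[OF r(1)]) (use zv xv[OF r(1)] vv in auto)
      moreover have "norm (B (z(r := x r - v))) < e/2"
        unfolding e1 by (rule V1(3)[rule_format]) (use xy v in auto)
      moreover have "norm (B (z(r := v))) < e/2"
        unfolding e2 by (rule V2(2)[rule_format]) (use xy in auto)
      ultimately show ?thesis unfolding e0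
        using norm_triangle_ineq[of "B (z(r := x r - v))" "B (z(r := v))"] by simp
    qed
    then show ?case using ev V1(2) by (intro exI[of _ "\<lambda>x. V1 x \<and> V2 x"]) simp
  qed
  show ?thesis
    unfolding jointly_Cauchy_def
  proof (intro allI impI)
    fix e :: real assume e: "e > 0"
    define \<delta> where "\<delta> = e / (real (card I) + 1)"
    have \<delta>: "\<delta> > 0" "card I * \<delta> < e" using e by (simp_all add: \<delta>_def field_simps)
    have "\<forall>s\<in>I. \<exists>V. eventually V U \<and> (\<forall>x. V x \<longrightarrow> x \<in> unit_ball E) \<and> (\<forall>x y. (\<forall>i\<in>I. V (x i) \<and> V (y i)) \<longrightarrow>
        norm (B (\<lambda>i. if i \<in> I - {s} then x i else if i \<in> {s} then x i - y i else 0)) < \<delta>)"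
      by (intro ballI mixed) (use B.finite_slots \<delta> in auto)
    then obtain V where V: "\<forall>s\<in>I. eventually (V s) U \<and> (\<forall>x. V s x \<longrightarrow> x \<in> unit_ball E) \<and> (\<forall>x y. (\<forall>i\<in>I. V s (x i) \<and> V s (y i)) \<longrightarrow>
        norm (B (\<lambda>i. if i \<in> I - {s} then x i else if i \<in> {s} then x i - y i else 0)) < \<delta>)"
      by (elim bchoice[THEN exE])
    have "eventually (\<lambda>x. \<forall>s\<in>I. V s x) U"
      by (rule eventually_ball_finite) (use V B.finite_slots in auto)
    moreover have "norm (B x - B y) < e" if xy: "\<forall>i\<in>I. (\<forall>s\<in>I. V s (x i)) \<and> (\<forall>s\<in>I. V s (y i))" for x y
    proof -
      have v: "x i \<in> vecs E" "y i \<in> vecs E" if "i \<in> I" for i using xy V that by blast+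
      have "nrm scalar_space (B x - B y) \<le> (\<Sum>i\<in>I. \<delta>)"
      proof (rule B.telescope)
        fix s z assume s: "s \<in> I" and z: "\<And>j. j \<in> I \<Longrightarrow> z j = x j \<or> z j = y j"
        have "B (z(s := x s - y s)) = B (\<lambda>i. if i \<in> I - {s} then (z(s := x s)) i else if i \<in> {s} then (z(s := x s)) i - (z(s := y s)) i else 0)"
          by (rule B.cong) auto
        also have "norm \<dots> < \<delta>"
        proof (rule V[THEN bspec, OF s, THEN conjunct2, THEN conjunct2, rule_format])
          fix i assume i: "i \<in> I"
          have "V s (z i)" using z[OF i] xy i s by auto
          then show "V s ((z(s := x s)) i) \<and> V s ((z(s := y s)) i)" using xy s by auto
        qed
        finally show "nrm scalar_space (B (z(s := x s - y s))) \<le> \<delta>" by simp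
      qed (use v in auto)
      then show ?thesis using \<delta>(2) by simp
    qed
    ultimately show "\<exists>V. eventually V U \<and> (\<forall>x y. (\<forall>i\<in>I. V (x i) \<and> V (y i)) \<longrightarrow> norm (B x - B y) < e)"
      by (intro exI[of _ "\<lambda>x. \<forall>s\<in>I. V s x"]) simp
  qed
qed

text \<open>\<open>P\<close> determines \<open>A\<close> only up to symmetrization, so both Cauchy
  properties are shown for the symmetric form \<open>S\<close>, whose values are combinations of
  values of \<open>P\<close>. Sums of \<open>wuC_sums\<close> over \<open>J\<close> are again
  \<open>wuC_sums\<close>, where \<open>P\<close> converges; and each
  \<open>\<psi> \<circ> P\<close> is a scalar polynomial of degree \<open>k\<close>, to which the
  equality with \<open>polys_wb\<close> applies.\<close>

theorem property_V_imp_uc_polys_weakly_compact: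
  fixes E :: "('k::rc_field, 'e::ab_group_add) nspace"
  assumes E: "banach_space E" and k: "k \<ge> 1" and V: "property_V TYPE(('e \<Rightarrow> 'k) \<Rightarrow> 'k) E"
    and wb: "polys k E scalar_space = polys_wb k E scalar_space"
  shows "uc_polys_weakly_compact TYPE('f::ab_group_add) k E"
  unfolding uc_polys_weakly_compact_def
proof (intro allI impI ballI)
  fix F :: "('k, 'f) nspace" and P
  assume F: "banach_space F" and P: "P \<in> polys k E F" and uc: "unconditionally_converging E F P"
  interpret E: banach_space E by fact
  interpret F: banach_space F by fact
  obtain A where A: "multilinear E F {..<k} A" "\<And>x. x \<in> vecs E \<Longrightarrow> P x = A (\<lambda>_. x)"
    using polys_multilinear[OF E F k P] by blast
  interpret A: multilinear E F "{..<k}" A by (rule A(1))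
  obtain S c where S: "multilinear E F {..<k} S" "\<And>x. x \<in> vecs E \<Longrightarrow> S (\<lambda>_. x) = A (\<lambda>_. x)"
    "\<And>x. (\<And>i. i \<in> {..<k} \<Longrightarrow> x i \<in> vecs E) \<Longrightarrow> S x = (\<Sum>J\<in>Pow {..<k}. scl F (c J) (A (\<lambda>_. \<Sum>i\<in>J. x i)))"
    using A.polarization by blast
  interpret S: multilinear E F "{..<k}" S by (rule S(1))
  have Pv: "P x \<in> vecs F" if "x \<in> vecs E" for x unfolding A(2)[OF that] by (rule A.vecs_app) (rule that)
  have sumv: "(\<Sum>i\<in>J. x i) \<in> vecs E" if "J \<in> Pow {..<k}" "\<forall>i\<in>{..<k}. x i \<in> vecs E" for J x
    using that by (intro E.vecs_sum) auto
  have SP: "S x = (\<Sum>J\<in>Pow {..<k}. scl F (c J) (P (\<Sum>i\<in>J. x i)))" if x: "\<forall>i\<in>{..<k}. x i \<in> vecs E" for x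
  proof -
    have "S x = (\<Sum>J\<in>Pow {..<k}. scl F (c J) (A (\<lambda>_. \<Sum>i\<in>J. x i)))" by (rule S(3)) (use x in blast)
    also have "\<dots> = (\<Sum>J\<in>Pow {..<k}. scl F (c J) (P (\<Sum>i\<in>J. x i)))"
      by (intro sum.cong refl) (simp only: A(2)[OF sumv[OF _ x]])
    finally show ?thesis .
  qed
  have "wuC_Cauchy {..<k} E F S"
    unfolding wuC_Cauchy_def
  proof (intro allI impI)
    fix t and e :: real assume t: "\<forall>i\<in>{..<k}. E.wuC_sums (\<lambda>n. t n i)" and e: "e > 0"
    have tv: "\<forall>i\<in>{..<k}. t n i \<in> vecs E" for n using t E.wuC_sums_vecs by blast
    have "\<exists>l. l \<in> vecs F \<and> (\<lambda>n. nrm F (P (\<Sum>i\<in>J. t n i) - l)) \<longlonglongrightarrow> 0" if J: "J \<in> Pow {..<k}" for J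
    proof -
      have "E.wuC_sums (\<lambda>n. \<Sum>i\<in>J. t n i)" using t J by (intro E.wuC_sums_sum) auto
      from E.unconditionally_converging_wuC_sums[OF uc this] obtain l
        where "limitin (norm_top F) (\<lambda>n. P (\<Sum>i\<in>J. t n i)) l sequentially" by blast
      then show ?thesis unfolding F.limitin_norm_top by blast
    qed
    then obtain l where l: "\<And>J. J \<in> Pow {..<k} \<Longrightarrow> l J \<in> vecs F"
        "\<And>J. J \<in> Pow {..<k} \<Longrightarrow> (\<lambda>n. nrm F (P (\<Sum>i\<in>J. t n i) - l J)) \<longlonglongrightarrow> 0" by metis
    define L where "L = (\<Sum>J\<in>Pow {..<k}. scl F (c J) (l J))"
    have Lv: "L \<in> vecs F" unfolding L_def using l(1) by (intro F.vecs_sum F.vecs_scl)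
    have Sv: "S (t n) \<in> vecs F" for n by (rule S.vecs_app) (use tv in blast)
    have "nrm F (S (t n) - L) \<le> (\<Sum>J\<in>Pow {..<k}. norm (c J) * nrm F (P (\<Sum>i\<in>J. t n i) - l J))" for n
    proof -
      have d: "P (\<Sum>i\<in>J. t n i) - l J \<in> vecs F" if "J \<in> Pow {..<k}" for J
        by (intro F.vecs_diff Pv sumv tv l(1) that)
      have "S (t n) - L = (\<Sum>J\<in>Pow {..<k}. scl F (c J) (P (\<Sum>i\<in>J. t n i) - l J))"
        unfolding SP[OF tv] L_def by (simp add: sum_subtractf F.scale_right_diff_distrib)
      also have "nrm F \<dots> \<le> (\<Sum>J\<in>Pow {..<k}. nrm F (scl F (c J) (P (\<Sum>i\<in>J. t n i) - l J)))"
        by (intro F.nrm_sum F.vecs_scl d)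
      also have "\<dots> = (\<Sum>J\<in>Pow {..<k}. norm (c J) * nrm F (P (\<Sum>i\<in>J. t n i) - l J))"
        by (intro sum.cong refl F.nrm_scl d)
      finally show ?thesis .
    qed
    moreover have "(\<lambda>n. \<Sum>J\<in>Pow {..<k}. norm (c J) * nrm F (P (\<Sum>i\<in>J. t n i) - l J)) \<longlonglongrightarrow> (\<Sum>J\<in>Pow {..<k}. norm (c J) * 0)"
      by (intro tendsto_intros l(2))
    ultimately have "(\<lambda>n. nrm F (S (t n) - L)) \<longlonglongrightarrow> 0"
      using F.nrm_nonneg[OF F.vecs_diff[OF Sv Lv]] by (intro Lim_null_comparison[of "\<lambda>n. nrm F (S (t n) - L)"]) auto
    then show "\<exists>N. \<forall>m\<ge>N. \<forall>n\<ge>N. nrm F (S (t m) - S (t n)) < e"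
      by (rule F.nrm_Cauchy_if_convergent[OF Sv Lv _ e])
  qed
  note CV = this
  show "weakly_compact E F P"
  proof (rule iffD2[OF weakly_compact_iff], erule Pv, intro allI impI)
    fix U assume U: "ultra U \<and> U \<le> principal (unit_ball E)"
    obtain L where L: "L \<in> vecs F"
        "\<forall>\<psi>\<in>dual F. jointly_Cauchy U {..<k} (\<lambda>x. \<psi> (S x)) \<longrightarrow> ((\<lambda>x. \<psi> (S (\<lambda>_. x))) \<longlongrightarrow> \<psi> L) U"
      using diagonal_weak_limit[OF V U[THEN conjunct1] U[THEN conjunct2] finite_lessThan S(1) CV] by blast
    have "((\<lambda>x. \<psi> (P x)) \<longlongrightarrow> \<psi> L) U" if \<psi>: "\<psi> \<in> dual F" for \<psi>
    proof -
      have \<psi>o: "\<psi> \<in> bounded_ops F scalar_space" using \<psi> by (simp add: dual_def)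
      have "multilinear E scalar_space {..<k} (\<lambda>x. \<psi> (A x))" by (rule A.postcompose[OF banach_scalar \<psi>o])
      then have "(\<lambda>x. \<psi> (P x)) \<in> polys k E scalar_space"
        by (rule multilinear.polysI) (auto simp: A(2))
      then have wc: "weakly_cont_on_bounded E (\<lambda>x. \<psi> (P x))" using wb E.polys_wb_scalar_iff by blast
      have "jointly_Cauchy U {..<k} (\<lambda>x. \<psi> (S x))"
      proof (rule jointly_Cauchy_of_weakly_cont[OF _ _ _ wc])
        show "multilinear E scalar_space {..<k} (\<lambda>x. \<psi> (S x))" by (rule S.postcompose[OF banach_scalar \<psi>o])
        show "ultra U" "U \<le> principal (unit_ball E)" using U by auto
        fix x :: "nat \<Rightarrow> 'e" assume x: "\<forall>i\<in>{..<k}. x i \<in> vecs E"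
        have "\<psi> (S x) = (\<Sum>J\<in>Pow {..<k}. \<psi> (scl F (c J) (P (\<Sum>i\<in>J. x i))))"
          unfolding SP[OF x] by (intro F.dual_sum[OF \<psi>] F.vecs_scl Pv sumv x)
        also have "\<dots> = (\<Sum>J\<in>Pow {..<k}. c J * \<psi> (P (\<Sum>i\<in>J. x i)))"
          by (intro sum.cong refl dual_scl[OF \<psi>] Pv sumv x)
        finally show "\<psi> (S x) = (\<Sum>J\<in>Pow {..<k}. c J * \<psi> (P (\<Sum>i\<in>J. x i)))" .
      qed
      then have "((\<lambda>x. \<psi> (S (\<lambda>_. x))) \<longlongrightarrow> \<psi> L) U" using L(2) \<psi> by blast
      moreover have "eventually (\<lambda>x. \<psi> (S (\<lambda>_. x)) = \<psi> (P x)) U"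
        using U unfolding le_principal by (auto elim!: eventually_mono simp: S(2) A(2))
      ultimately show ?thesis by (rule Lim_transform_eventually)
    qed
    then show "\<exists>l\<in>vecs F. \<forall>\<psi>\<in>dual F. ((\<lambda>x. \<psi> (P x)) \<longlongrightarrow> \<psi> l) U" using L(1) by blast
  qed
qed

section \<open>From (b) to (a)\<close>

section \<open>Polynomials into the space of summable sequences\<close>

text \<open>Composed with the functional of a bounded sequence, \<open>A\<close> becomes a scalar
  form, which is Cauchy on partial sums. Differences over blocks are therefore weakly null, and norm
  null by the Schur property.\<close>

lemma multilinear_l1_unconditionally_converging:
  fixes E :: "('k::rc_field, 'e::ab_group_add) nspace" and \<iota> :: "nat \<Rightarrow> 'i"
  assumes \<iota>: "inj \<iota>" and A: "multilinear E (l1_space \<iota>) I A"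
  shows "unconditionally_converging E (l1_space \<iota>) (\<lambda>x. A (\<lambda>_. x))"
  unfolding unconditionally_converging_def
proof (intro allI impI)
  let ?L = "l1_space \<iota> :: ('k, 'i \<Rightarrow> 'k) nspace"
  interpret A: multilinear E ?L I A by (rule A)
  fix w assume w: "wuC E w"
  define t where "t n = (\<Sum>i\<le>n. w i)" for n
  have t: "A.E.wuC_sums t" unfolding t_def by (rule A.E.wuC_partial_sums[OF w])
  have tv: "t n \<in> vecs E" for n by (rule A.E.wuC_sums_vecs[OF t])
  define P where "P n = A (\<lambda>_. t n)" for n
  have Pv: "P n \<in> vecs ?L" for n unfolding P_def by (rule A.vecs_app) (rule tv)
  have dv: "P m - P n \<in> vecs ?L" for m n by (intro A.F.vecs_diff Pv)
  have "\<forall>e>0. \<exists>N. \<forall>m\<ge>N. \<forall>n\<ge>N. nrm ?L (P m - P n) < e"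
  proof (rule ccontr)
    assume na: "\<not> ?thesis"
    have z: "nrm ?L (P n - P n) = 0" for n by simp
    obtain e p q where "e > 0 \<and> (\<forall>j. p j < q j) \<and> (\<forall>j. q j \<le> p (Suc j)) \<and>
        (\<forall>j. nrm ?L (P (p j) - P (q j)) \<ge> e)"
      using not_Cauchy_blocks_ex[of "\<lambda>m n. nrm ?L (P m - P n)", OF A.F.nrm_minus_commute[OF Pv Pv] z na]
      by (elim exE)
    then have e: "e > 0" "p j < q j" "q j \<le> p (Suc j)" "nrm ?L (P (p j) - P (q j)) \<ge> e" for j
      by simp_all
    have pj: "j \<le> p j" for j
    proof (induction j)
      case (Suc j) then show ?case using e(2)[of j] e(3)[of j] by linarith
    qed simp
    define y where "y j i = (P (p j) - P (q j)) (\<iota> i)" for j i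
    have "(\<lambda>j. \<Sum>i. norm (y j i)) \<longlonglongrightarrow> 0"
    proof (rule schur)
      show "summable (\<lambda>i. norm (y j i))" for j
        using dv[of "p j" "q j"] unfolding l1_vecs_iff[OF \<iota>] y_def by blast
      fix c :: "nat \<Rightarrow> 'k" assume c: "\<And>i. norm (c i) \<le> 1"
      define \<psi> where "\<psi> f = (\<Sum>n. c n * f (\<iota> n))" for f :: "'i \<Rightarrow> 'k"
      have \<psi>: "\<psi> \<in> dual ?L" unfolding \<psi>_def by (rule l1_functional[OF \<iota> c])
      have "multilinear E scalar_space I (\<lambda>x. \<psi> (A x))"
        by (rule A.postcompose[OF banach_scalar]) (use \<psi> in \<open>simp add: dual_def\<close>)
      from multilinear_wuC_sums_Cauchy[OF this, of "\<lambda>n _. t n"] t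
      have C: "\<forall>e>0. \<exists>N. \<forall>m\<ge>N. \<forall>n\<ge>N. norm (\<psi> (P m) - \<psi> (P n)) < e" unfolding P_def by simp
      have "(\<lambda>j. \<psi> (P (p j) - P (q j))) \<longlonglongrightarrow> 0"
      proof (rule LIMSEQ_I)
        fix r :: real assume "r > 0"
        then obtain N where N: "\<forall>m\<ge>N. \<forall>n\<ge>N. norm (\<psi> (P m) - \<psi> (P n)) < r" using C by blast
        have "norm (\<psi> (P (p j) - P (q j)) - 0) < r" if "j \<ge> N" for j
          using N[rule_format, of "p j" "q j"] pj[of j] e(2)[of j] that
          by (simp add: A.F.dual_diff[OF \<psi> Pv Pv])
        then show "\<exists>no. \<forall>n\<ge>no. norm (\<psi> (P (p n) - P (q n)) - 0) < r" by blast
      qed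
      then show "(\<lambda>p. \<Sum>i. c i * y p i) \<longlonglongrightarrow> 0" unfolding \<psi>_def y_def .
    qed
    moreover have "(\<Sum>i. norm (y j i)) = nrm ?L (P (p j) - P (q j))" for j
      unfolding y_def by (rule l1_nrm[OF \<iota> dv, symmetric])
    ultimately have "(\<lambda>j. nrm ?L (P (p j) - P (q j))) \<longlonglongrightarrow> 0" by simp
    then have "eventually (\<lambda>j. nrm ?L (P (p j) - P (q j)) < e) sequentially"
      by (rule order_tendstoD) (rule e(1))
    then show False using e(4) by (auto simp: eventually_sequentially not_less[symmetric])
  qed
  then obtain l where "l \<in> vecs ?L" "(\<lambda>n. nrm ?L (P n - l)) \<longlonglongrightarrow> 0"
    using A.F.nrm_Cauchy_convergent[of P] Pv by metis
  then have "limitin (norm_top ?L) P l sequentially" unfolding A.F.limitin_norm_top using Pv by simp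
  then show "\<exists>l. limitin (norm_top ?L) (\<lambda>n. A (\<lambda>_. \<Sum>i\<le>n. w i)) l sequentially"
    unfolding P_def t_def by blast
qed

lemma l1_coordinate_functional:
  assumes \<iota>: "inj \<iota>"
  shows "(\<lambda>f. f (\<iota> i)) \<in> dual (l1_space \<iota> :: ('k::rc_field, 'i \<Rightarrow> 'k) nspace)"
proof (rule dualI[where C = 1])
  fix f :: "'i \<Rightarrow> 'k" assume f: "f \<in> vecs (l1_space \<iota>)"
  then have s: "summable (\<lambda>n. norm (f (\<iota> n)))" unfolding l1_vecs_iff[OF \<iota>] by blast
  have "norm (f (\<iota> i)) \<le> (\<Sum>n. norm (f (\<iota> n)))" using sum_le_suminf[OF s, of "{i}"] by simp
  then show "norm (f (\<iota> i)) \<le> 1 * nrm (l1_space \<iota>) f" unfolding l1_nrm[OF \<iota> f] by simp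
  show "(f + g) (\<iota> i) = f (\<iota> i) + g (\<iota> i)" for g :: "'i \<Rightarrow> 'k" by simp
  show "scl (l1_space \<iota>) c f (\<iota> i) = c * f (\<iota> i)" for c by simp
qed

text \<open>Points that violate the claim would have images with a subsequence converging weakly,
  hence in norm, to some \<open>l\<close>, whose coordinates tend to \<open>0\<close>. Weak
  compactness is available through ultrafilters only, so the subsequence is first made to converge
  in each coordinate; limits along further subsequences then have the coordinates of
  \<open>l\<close>.\<close>

lemma l1_weakly_compact_coordinates:
  fixes E :: "('k::rc_field, 'e::ab_group_add) nspace" and \<iota> :: "nat \<Rightarrow> 'i"
  assumes \<iota>: "inj \<iota>" and Pv: "\<And>x. x \<in> vecs E \<Longrightarrow> P x \<in> vecs (l1_space \<iota>)"
    and wc: "weakly_compact E (l1_space \<iota> :: ('k, 'i \<Rightarrow> 'k) nspace) P" and e: "e > 0"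
  shows "\<exists>N. \<forall>n\<ge>N. \<forall>x\<in>unit_ball E. norm (P x (\<iota> n)) < e"
proof (rule ccontr)
  let ?L = "l1_space \<iota> :: ('k, 'i \<Rightarrow> 'k) nspace"
  interpret L: banach_space ?L by (rule banach_l1[OF \<iota>])
  assume "\<not> ?thesis"
  then have "\<forall>N. \<exists>n x. n \<ge> N \<and> x \<in> unit_ball E \<and> norm (P x (\<iota> n)) \<ge> e"
    by (simp add: not_less)
  then obtain n x where nx: "\<forall>N. n N \<ge> N \<and> x N \<in> unit_ball E \<and> norm (P (x N) (\<iota> (n N))) \<ge> e"
    unfolding choice_iff by blast
  define y where "y N = P (x N)" for N
  have yv: "y N \<in> vecs ?L" for N unfolding y_def using nx by (intro Pv) blast
  obtain U where U: "U \<le> sequentially" "ultra U" using ultra_exists[OF sequentially_bot] by blast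
  have Ub: "U \<noteq> bot" by (rule ultra_not_bot[OF U(2)])
  have lim: "\<exists>l\<in>vecs ?L. \<forall>\<psi>\<in>dual ?L. ((\<lambda>j. \<psi> (y (r j))) \<longlongrightarrow> \<psi> l) U" for r :: "nat \<Rightarrow> nat"
  proof -
    have "filtermap (\<lambda>j. x (r j)) U \<le> principal (unit_ball E)"
      unfolding le_principal eventually_filtermap using nx by (intro always_eventually) blast
    then obtain l where "l \<in> vecs ?L" "\<forall>\<psi>\<in>dual ?L. ((\<lambda>x. \<psi> (P x)) \<longlongrightarrow> \<psi> l) (filtermap (\<lambda>j. x (r j)) U)"
      using iffD1[OF weakly_compact_iff wc, rule_format, OF Pv, of "filtermap (\<lambda>j. x (r j)) U"]
        ultra_filtermap[OF U(2), of "\<lambda>j. x (r j)"] by blast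
    then show ?thesis unfolding filterlim_filtermap y_def by blast
  qed
  obtain l where l: "l \<in> vecs ?L" "\<forall>\<psi>\<in>dual ?L. ((\<lambda>j. \<psi> (y j)) \<longlongrightarrow> \<psi> l) U" using lim[of "\<lambda>j. j"] by blast
  have "\<exists>N>M. \<forall>i\<in>{..j}. norm (y N (\<iota> i) - l (\<iota> i)) < inverse (real (Suc j))" for M j
  proof -
    have "eventually (\<lambda>N. \<forall>i\<in>{..j}. norm (y N (\<iota> i) - l (\<iota> i)) < inverse (real (Suc j))) U"
    proof (rule eventually_ball_finite)
      show "\<forall>i\<in>{..j}. eventually (\<lambda>N. norm (y N (\<iota> i) - l (\<iota> i)) < inverse (real (Suc j))) U"
      proof
        fix i
        have "((\<lambda>N. y N (\<iota> i)) \<longlongrightarrow> l (\<iota> i)) U"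
          using l(2)[THEN bspec, OF l1_coordinate_functional[OF \<iota>, of i]] .
        from tendstoD[OF this, of "inverse (real (Suc j))"]
        show "eventually (\<lambda>N. norm (y N (\<iota> i) - l (\<iota> i)) < inverse (real (Suc j))) U"
          by (simp add: dist_norm)
      qed
    qed simp
    moreover have "eventually (\<lambda>N. N > M) U"
      using U(1) eventually_gt_at_top[of M] by (rule filter_leD)
    ultimately have "eventually (\<lambda>N. N > M \<and> (\<forall>i\<in>{..j}. norm (y N (\<iota> i) - l (\<iota> i)) < inverse (real (Suc j)))) U"
      by eventually_elim simp
    then show ?thesis using eventually_happens'[OF Ub] by blast
  qed
  then have "\<forall>j M. \<exists>N. N > M \<and> (\<forall>i\<in>{..j}. norm (y N (\<iota> i) - l (\<iota> i)) < inverse (real (Suc j)))" by blast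
  \<comment> \<open>The ultrafilter supplies an index beyond \<open>M\<close> that matches
    \<open>l\<close> in the coordinates up to \<open>j\<close>; iterating in \<open>M\<close> while
    \<open>j\<close> grows yields the subsequence \<open>r\<close>.\<close>
  then obtain f where f: "\<forall>j M. f j M > M \<and> (\<forall>i\<in>{..j}. norm (y (f j M) (\<iota> i) - l (\<iota> i)) < inverse (real (Suc j)))"
    unfolding choice_iff by blast
  define r where "r = rec_nat (f 0 0) (\<lambda>j M. f (Suc j) M)"
  have r0: "r 0 = f 0 0" and rS: "r (Suc j) = f (Suc j) (r j)" for j by (simp_all add: r_def)
  have rmono: "strict_mono r" unfolding strict_mono_Suc_iff rS using f by blast
  have rj: "j \<le> r j" for j by (rule strict_mono_imp_increasing[OF rmono])
  have close: "norm (y (r j) (\<iota> i) - l (\<iota> i)) < inverse (real (Suc j))" if "i \<le> j" for i j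
  proof (cases j)
    case 0
    then show ?thesis
      using f[THEN spec[of _ 0], THEN spec[of _ 0], THEN conjunct2, THEN bspec, of i] that by (simp add: r0)
  next
    case (Suc m)
    have "norm (y (f j (r m)) (\<iota> i) - l (\<iota> i)) < inverse (real (Suc j))"
      using f[THEN spec[of _ j], THEN spec[of _ "r m"], THEN conjunct2, THEN bspec, of i] that by simp
    then show ?thesis unfolding Suc rS .
  qed
  have coord: "(\<lambda>j. y (r j) (\<iota> i)) \<longlonglongrightarrow> l (\<iota> i)" for i
  proof -
    have "(\<lambda>j. y (r j) (\<iota> i) - l (\<iota> i)) \<longlonglongrightarrow> 0"
    proof (rule Lim_null_comparison[OF _ LIMSEQ_inverse_real_of_nat])
      show "eventually (\<lambda>j. norm (y (r j) (\<iota> i) - l (\<iota> i)) \<le> inverse (real (Suc j))) sequentially"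
        unfolding eventually_sequentially using close less_imp_le by blast
    qed
    then show ?thesis by (simp add: LIM_zero_iff)
  qed
  define z where "z j i = (y (r j) - l) (\<iota> i)" for j i
  have zv: "y (r j) - l \<in> vecs ?L" for j by (intro L.vecs_diff yv l(1))
  have zs: "summable (\<lambda>i. norm (z j i))" for j
    using zv[of j] unfolding l1_vecs_iff[OF \<iota>] z_def by blast
  have "(\<lambda>j. \<Sum>i. norm (z j i)) \<longlonglongrightarrow> 0"
  proof (rule schur[OF zs])
    fix c :: "nat \<Rightarrow> 'k" assume c: "\<And>i. norm (c i) \<le> 1"
    define \<psi> where "\<psi> f = (\<Sum>n. c n * f (\<iota> n))" for f :: "'i \<Rightarrow> 'k"
    have \<psi>: "\<psi> \<in> dual ?L" unfolding \<psi>_def by (rule l1_functional[OF \<iota> c])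
    have "(\<lambda>j. \<psi> (y (r j)) - \<psi> l) \<longlonglongrightarrow> 0"
    proof (rule ccontr)
      assume "\<not> ?thesis"
      then obtain e' where e': "e' > 0" "\<And>N. \<exists>j\<ge>N. norm (\<psi> (y (r j)) - \<psi> l) \<ge> e'"
        unfolding LIMSEQ_iff by (auto simp: not_less)
      then obtain s :: "nat \<Rightarrow> nat" where s: "strict_mono s" "\<And>j. norm (\<psi> (y (r (s j))) - \<psi> l) \<ge> e'"
        using extract_strict_mono[of "\<lambda>j. norm (\<psi> (y (r j)) - \<psi> l) \<ge> e'"] by blast
      obtain l' where l': "l' \<in> vecs ?L" "\<forall>\<psi>\<in>dual ?L. ((\<lambda>j. \<psi> (y (r (s j)))) \<longlongrightarrow> \<psi> l') U"
        using lim[of "\<lambda>j. r (s j)"] by blast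
      have "l' (\<iota> i) = l (\<iota> i)" for i
      proof (rule tendsto_unique[OF Ub])
        show "((\<lambda>j. y (r (s j)) (\<iota> i)) \<longlongrightarrow> l' (\<iota> i)) U"
          using l'(2)[THEN bspec, OF l1_coordinate_functional[OF \<iota>, of i]] .
        show "((\<lambda>j. y (r (s j)) (\<iota> i)) \<longlongrightarrow> l (\<iota> i)) U"
          using tendsto_mono[OF U(1) LIMSEQ_subseq_LIMSEQ[OF coord[of i] s(1)]] by (simp add: o_def)
      qed
      then have "\<psi> l' = \<psi> l" by (simp add: \<psi>_def)
      then have "((\<lambda>j. \<psi> (y (r (s j)))) \<longlongrightarrow> \<psi> l) U" using l'(2)[THEN bspec, OF \<psi>] by simp
      from tendstoD[OF this e'(1)] have "eventually (\<lambda>j. norm (\<psi> (y (r (s j))) - \<psi> l) < e') U"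
        by (simp add: dist_norm)
      from eventually_happens'[OF Ub this] show False using s(2) by (auto simp: not_less[symmetric])
    qed
    then have "(\<lambda>j. \<psi> (y (r j) - l)) \<longlonglongrightarrow> 0" by (simp add: L.dual_diff[OF \<psi> yv l(1)])
    then show "(\<lambda>j. \<Sum>i. c i * z j i) \<longlonglongrightarrow> 0" unfolding \<psi>_def z_def .
  qed
  from order_tendstoD(2)[OF this, of "e/2"] obtain N1 where N1: "\<And>j. j \<ge> N1 \<Longrightarrow> (\<Sum>i. norm (z j i)) < e/2"
    using e by (auto simp: eventually_sequentially)
  have "summable (\<lambda>m. norm (l (\<iota> m)))" using l(1) unfolding l1_vecs_iff[OF \<iota>] by blast
  from order_tendstoD(2)[OF summable_LIMSEQ_zero[OF this], of "e/2"]
  obtain N2 where N2: "\<And>m. m \<ge> N2 \<Longrightarrow> norm (l (\<iota> m)) < e/2"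
    using e by (auto simp: eventually_sequentially)
  \<comment> \<open>The coordinate \<open>?m\<close> recedes with the index, since
    \<open>n N \<ge> N\<close>. So it is small in \<open>l\<close> by \<open>N2\<close> and small in
    the difference by \<open>N1\<close>, but not in their sum.\<close>
  let ?j = "max N1 N2" and ?m = "n (r (max N1 N2))"
  have "?m \<ge> ?j" using nx[rule_format, of "r ?j"] rj[of ?j] by linarith
  then have "norm (l (\<iota> ?m)) < e/2" by (intro N2) simp
  moreover have "norm (z ?j ?m) < e/2"
    using sum_le_suminf[OF zs[of ?j], of "{?m}"] N1[of ?j] by simp
  moreover have "norm (y (r ?j) (\<iota> ?m)) \<ge> e" unfolding y_def using nx by blast
  ultimately show False using norm_triangle_ineq[of "z ?j ?m" "l (\<iota> ?m)"] by (simp add: z_def)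
qed

section \<open>Operators of finite rank\<close>

text \<open>Induction on the size of the spanning set, which need not be independent. A functional
  with \<open>\<psi> b = 1\<close> gives the projection \<open>R\<close> that kills
  \<open>b\<close>; the component along \<open>b\<close> contributes one summand, and
  \<open>R \<circ> T\<close> has its range in the span of fewer vectors.\<close>

lemma (in banach_space) finite_rank_span_representation:
  assumes "finite B" "B \<subseteq> vecs E" "T \<in> bounded_ops E E" "T ` vecs E \<subseteq> span B"
  shows "\<exists>(d::nat) f g. (\<forall>i<d. f i \<in> dual E \<and> g i \<in> vecs E) \<and> (\<forall>x\<in>vecs E. T x = (\<Sum>i<d. scl E (f i x) (g i)))"
  using assms
proof (induction "card B" arbitrary: B T rule: less_induct)
  case less
  note E = banach_space_axioms
  show ?case
  proof (cases "B - {0} = {}")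
    case True
    have "span B = {0}" using span_delete_0[of B] unfolding True by simp
    then have "\<forall>x\<in>vecs E. T x = 0" using less.prems(4) by blast
    then show ?thesis by (intro exI[of _ "0::nat"]) simp
  next
    case False
    then obtain b where b: "b \<in> B" "b \<noteq> 0" by blast
    have bv: "b \<in> vecs E" using b less.prems(2) by blast
    have nb: "nrm E b > 0" using nrm_eq_0[OF bv] nrm_nonneg[OF bv] b(2) by simp
    obtain \<psi>0 where \<psi>0: "\<psi>0 \<in> dual E" "\<psi>0 b = of_real (nrm E b)" using norming_functional_ex[OF bv] by blast
    define \<psi> where "\<psi> x = of_real (1 / nrm E b) * \<psi>0 x" for x
    have \<psi>: "\<psi> \<in> dual E" unfolding \<psi>_def by (rule dual_scl_fun[OF \<psi>0(1)])
    have \<psi>b: "\<psi> b = 1" using nb by (simp add: \<psi>_def \<psi>0(2))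
    obtain C where C: "C \<ge> 0" "\<And>x. x \<in> vecs E \<Longrightarrow> norm (\<psi> x) \<le> C * nrm E x" using dual_bound[OF \<psi>] by blast
    define R where "R v = v - scl E (\<psi> v) b" for v
    have Rv: "R v \<in> vecs E" if "v \<in> vecs E" for v unfolding R_def using that bv by simp
    have Radd: "R (u + v) = R u + R v" if "u \<in> vecs E" "v \<in> vecs E" for u v
      unfolding R_def dual_add[OF \<psi> that] by (simp add: scale_left_distrib algebra_simps)
    have Rscl: "R (scl E c v) = scl E c (R v)" if "v \<in> vecs E" for c v
      unfolding R_def dual_scl[OF \<psi> that] by (simp add: scale_right_diff_distrib)
    have Rop: "R \<in> bounded_ops E E"
    proof (rule bounded_opsI[where C = "1 + C * nrm E b"])
      fix x assume x: "x \<in> vecs E"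
      have "nrm E (R x) \<le> nrm E x + norm (\<psi> x) * nrm E b"
        unfolding R_def using nrm_diff_triangle[OF x vecs_scl[OF bv], of "\<psi> x"] by (simp add: nrm_scl[OF bv])
      also have "\<dots> \<le> nrm E x + C * nrm E x * nrm E b" using C(2)[OF x] nb by simp
      finally show "nrm E (R x) \<le> (1 + C * nrm E b) * nrm E x" by (simp add: algebra_simps)
    qed (use Rv Radd Rscl in auto)
    define B' where "B' = R ` (B - {b})"
    have "card B' \<le> card (B - {b})" unfolding B'_def using less.prems(1) by (intro card_image_le) simp
    then have c: "card B' < card B" using card_Diff1_less[OF less.prems(1) b(1)] by linarith
    have B'v: "finite B'" "B' \<subseteq> vecs E" using less.prems(1,2) Rv by (auto simp: B'_def)
    have span: "v \<in> vecs E \<and> R v \<in> span B'" if "v \<in> span B" for v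
      using that
    proof (rule span_induct)
      show "v \<in> vecs E \<and> R v \<in> span B'" if "v \<in> B" for v
      proof (cases "v = b")
        case True
        have "R b = 0" by (simp add: R_def \<psi>b)
        then show ?thesis using True bv span_zero by simp
      next
        case False
        then show ?thesis using that less.prems(2) by (auto simp: B'_def intro: span_base)
      qed
      show "subspace {v. v \<in> vecs E \<and> R v \<in> span B'}"
      proof (rule subspaceI)
        have "R 0 = 0" using Rscl[of 0 0] by simp
        then show "0 \<in> {v. v \<in> vecs E \<and> R v \<in> span B'}" using span_zero by simp
      qed (auto simp: Radd Rscl span_add span_scale)
    qed
    have RT: "(\<lambda>x. R (T x)) \<in> bounded_ops E E" by (rule bounded_ops_comp[OF E E less.prems(3) Rop])
    have "(\<lambda>x. R (T x)) ` vecs E \<subseteq> span B'" using less.prems(4) span by blast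
    from less.hyps[OF c B'v RT this] obtain d :: nat and f g where
      d: "\<forall>i<d. f i \<in> dual E \<and> g i \<in> vecs E" "\<forall>x\<in>vecs E. R (T x) = (\<Sum>i<d. scl E (f i x) (g i))"
      by (elim exE conjE)
    define f' where "f' i = (if i = d then (\<lambda>x. \<psi> (T x)) else f i)" for i
    define g' where "g' i = (if i = d then b else g i)" for i
    have "\<forall>i<Suc d. f' i \<in> dual E \<and> g' i \<in> vecs E"
      using d(1) bv dual_comp[OF E E less.prems(3) \<psi>] by (simp add: f'_def g'_def less_Suc_eq)
    moreover have "T x = (\<Sum>i<Suc d. scl E (f' i x) (g' i))" if x: "x \<in> vecs E" for x
    proof -
      have "T x = R (T x) + scl E (\<psi> (T x)) b" by (simp add: R_def)
      also have "R (T x) = (\<Sum>i<d. scl E (f' i x) (g' i))"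
        using d(2) x by (simp add: f'_def g'_def)
      finally show ?thesis by (simp add: f'_def g'_def)
    qed
    ultimately show ?thesis by blast
  qed
qed

lemma (in banach_space) finite_rank_representation:
  assumes "T \<in> bounded_ops E E" "finite_rank E T"
  shows "\<exists>(d::nat) f g. (\<forall>i<d. f i \<in> dual E \<and> g i \<in> vecs E) \<and> (\<forall>x\<in>vecs E. T x = (\<Sum>i<d. scl E (f i x) (g i)))"
proof -
  obtain B where "B \<subseteq> vecs E" "finite B" "T ` vecs E \<subseteq> span B" using assms(2) unfolding finite_rank_def by blast
  then show ?thesis using finite_rank_span_representation assms(1) by blast
qed

section \<open>Unconditionally convergent series of scalars\<close>

text \<open>The coordinates with respect to \<open>1\<close> and \<open>i\<close>, chosen by choice;
  they are additive because they are unique. In the real case \<open>v = 0\<close>.\<close>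

lemma rc_real_parts:
  obtains u v :: "'k::rc_field \<Rightarrow> real" where
    "\<And>x y. u (x + y) = u x + u y" "\<And>x y. v (x + y) = v x + v y"
    "\<And>x. \<bar>u x\<bar> \<le> norm x" "\<And>x. \<bar>v x\<bar> \<le> norm x" "\<And>x. norm x \<le> \<bar>u x\<bar> + \<bar>v x\<bar>"
  using real_or_complex[where 'a='k]
proof
  assume r: "\<forall>z::'k. \<exists>a. z = a *\<^sub>R 1"
  then obtain u where u: "\<And>z::'k. z = u z *\<^sub>R 1" by metis
  have uu: "u (a *\<^sub>R 1) = a" for a using u[of "a *\<^sub>R 1"] by simp
  show ?thesis
  proof (rule that[of u "\<lambda>_. 0"])
    show "u (x + y) = u x + u y" for x y
      using u[of x] u[of y] uu[of "u x + u y"] by (simp add: scaleR_left_distrib)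
    have n: "norm x = \<bar>u x\<bar>" for x :: 'k
      using arg_cong[OF u[of x], of norm] by simp
    show "\<bar>u x\<bar> \<le> norm x" "norm x \<le> \<bar>u x\<bar> + \<bar>0::real\<bar>" for x by (simp_all add: n)
  qed auto
next
  assume "\<exists>i::'k. i * i = - 1 \<and> (\<forall>z. \<exists>a b. z = a *\<^sub>R 1 + b *\<^sub>R i \<and> norm z = sqrt (a\<^sup>2 + b\<^sup>2))"
  then obtain i :: 'k where ii: "i * i = - 1"
    and rep: "\<forall>z. \<exists>a b. z = of_real a + of_real b * i \<and> norm z = sqrt (a\<^sup>2 + b\<^sup>2)"
    by (auto simp: scaleR_conv_of_real)
  have ind: "a = 0 \<and> b = 0" if "of_real a + of_real b * i = 0" for a b
  proof -
    have ii': "i * (i * z) = - z" for z using ii by (simp flip: mult.assoc)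
    have "(of_real (a\<^sup>2 + b\<^sup>2) :: 'k) = (of_real a + of_real b * i) * (of_real a - of_real b * i)"
      by (simp add: algebra_simps power2_eq_square ii')
    then have "a\<^sup>2 + b\<^sup>2 = 0" using that by (metis mult_zero_left of_real_eq_0_iff)
    then show ?thesis by (simp add: sum_power2_eq_zero_iff)
  qed
  from rep obtain u v where uv: "\<forall>z. z = of_real (u z) + of_real (v z) * i \<and> norm z = sqrt ((u z)\<^sup>2 + (v z)\<^sup>2)"
    unfolding choice_iff by blast
  have add: "u (x + y) = u x + u y \<and> v (x + y) = v x + v y" for x y
  proof -
    have "x + y = of_real (u (x + y)) + of_real (v (x + y)) * i" using uv by blast
    moreover have "x = of_real (u x) + of_real (v x) * i" "y = of_real (u y) + of_real (v y) * i" using uv by blast+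
    ultimately have "of_real (u (x + y)) + of_real (v (x + y)) * i =
        (of_real (u x) + of_real (v x) * i) + (of_real (u y) + of_real (v y) * i)" by metis
    then have "of_real (u (x + y) - (u x + u y)) + of_real (v (x + y) - (v x + v y)) * i = 0"
      by (simp add: algebra_simps)
    from ind[OF this] show ?thesis by simp
  qed
  have n: "norm z = sqrt ((u z)\<^sup>2 + (v z)\<^sup>2)" for z using uv by blast
  show ?thesis
    by (rule that[of u v]) (use add in \<open>simp_all add: n real_sqrt_ge_abs1 real_sqrt_ge_abs2 sqrt_sum_squares_le_sum_abs\<close>)
qed

text \<open>Splitting by the sign of a real coordinate turns its absolute values into a difference
  of two finite sums, each bounded by \<open>K\<close>. Two coordinates give
  \<open>4 K\<close>.\<close>

lemma bounded_finite_sums_imp_summable_norm: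
  fixes a :: "nat \<Rightarrow> 'k::rc_field"
  assumes K: "\<And>S. finite S \<Longrightarrow> norm (\<Sum>i\<in>S. a i) \<le> K"
  shows "summable (\<lambda>i. norm (a i))"
proof -
  obtain u v :: "'k \<Rightarrow> real" where uv: "\<And>x y. u (x + y) = u x + u y" "\<And>x y. v (x + y) = v x + v y"
    "\<And>x. \<bar>u x\<bar> \<le> norm x" "\<And>x. \<bar>v x\<bar> \<le> norm x" "\<And>x. norm x \<le> \<bar>u x\<bar> + \<bar>v x\<bar>"
    using rc_real_parts by blast
  have part: "(\<Sum>i<N. \<bar>w (a i)\<bar>) \<le> 2 * K"
    if add: "\<And>x y. w (x + y) = w x + w y" and le: "\<And>x. \<bar>w x\<bar> \<le> norm x" for w :: "'k \<Rightarrow> real" and N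
  proof -
    have w0: "w 0 = 0" using add[of 0 0] by simp
    have ws: "w (\<Sum>i\<in>S. a i) = (\<Sum>i\<in>S. w (a i))" for S :: "nat set"
      by (induction S rule: infinite_finite_induct) (simp_all add: w0 add)
    have S: "\<bar>\<Sum>i\<in>S. w (a i)\<bar> \<le> K" if "finite S" for S :: "nat set"
      using le[of "\<Sum>i\<in>S. a i"] K[OF that] by (simp add: ws)
    have "(\<Sum>i<N. \<bar>w (a i)\<bar>) = (\<Sum>i\<in>{i\<in>{..<N}. w (a i) \<ge> 0}. w (a i)) - (\<Sum>i\<in>{i\<in>{..<N}. \<not> w (a i) \<ge> 0}. w (a i))"
      unfolding sum.inter_filter[OF finite_lessThan] sum_subtractf[symmetric] by (intro sum.cong refl) auto
    then show ?thesis
      using S[of "{i\<in>{..<N}. w (a i) \<ge> 0}"] S[of "{i\<in>{..<N}. \<not> w (a i) \<ge> 0}"] by simp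
  qed
  have "(\<Sum>i<N. norm (a i)) \<le> 4 * K" for N
  proof -
    have "(\<Sum>i<N. norm (a i)) \<le> (\<Sum>i<N. \<bar>u (a i)\<bar> + \<bar>v (a i)\<bar>)" by (intro sum_mono uv(5))
    then show ?thesis using part[OF uv(1,3), of N] part[OF uv(2,4), of N] by (simp add: sum.distrib)
  qed
  then show ?thesis by (intro summableI_nonneg_bounded) auto
qed

text \<open>If the series is not unconditionally Cauchy, moving a block of indices with a large sum to the
  front of each of infinitely many intervals gives a divergent rearrangement.\<close>

lemma rearrangements_convergent_imp_summable_norm:
  fixes a :: "nat \<Rightarrow> 'k::rc_field"
  assumes conv: "\<And>\<pi>. bij \<pi> \<Longrightarrow> convergent (\<lambda>n. \<Sum>i<n. a (\<pi> i))"
  shows "summable (\<lambda>i. norm (a i))"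
proof -
  \<comment> \<open>The single threshold \<open>1\<close> is enough: it bounds all finite sums, and
    bounded finite sums already give absolute summability.\<close>
  have "\<exists>N. \<forall>S. finite S \<and> S \<subseteq> {N..} \<longrightarrow> norm (\<Sum>i\<in>S. a i) < 1"
  proof (rule ccontr)
    assume "\<not> ?thesis"
    then have "\<forall>N. \<exists>S. finite S \<and> S \<subseteq> {N..} \<and> norm (\<Sum>i\<in>S. a i) \<ge> 1" by (auto simp: not_less)
    then obtain S where S: "\<forall>N. finite (S N) \<and> S N \<subseteq> {N..} \<and> norm (\<Sum>i\<in>S N. a i) \<ge> 1"
      unfolding choice_iff by blast
    have ne: "S N \<noteq> {}" for N using S[rule_format, of N] by auto
    define b where "b = rec_nat 0 (\<lambda>_ N. Suc (Max (S N)))"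
    have b0: "b 0 = 0" and bS: "b (Suc j) = Suc (Max (S (b j)))" for j by (simp_all add: b_def)
    have Sb: "S (b j) \<subseteq> {b j..<b (Suc j)}" for j
      using S[rule_format, of "b j"] by (auto simp: bS less_Suc_eq_le)
    have bm: "strict_mono b"
      unfolding strict_mono_Suc_iff
    proof
      fix j
      obtain i where "i \<in> S (b j)" using ne[of "b j"] by blast
      from subsetD[OF Sb this] show "b j < b (Suc j)" by simp
    qed
    have bj: "j \<le> b j" for j by (rule strict_mono_imp_increasing[OF bm])
    define s where "s j = card (S (b j))" for j
    have sle: "b j + s j \<le> b (Suc j)" for j
    proof -
      have "s j \<le> card {b j..<b (Suc j)}" unfolding s_def by (rule card_mono[OF _ Sb]) simp
      then show ?thesis using strict_mono_less[OF bm, of j "Suc j"] by simp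
    qed
    \<comment> \<open>\<open>h\<close> permutes one interval and brings \<open>S (b j)\<close> to
      its front, so that the large sum appears between two partial sums of the rearranged
      series.\<close>
    have "\<exists>h. bij_betw h {b j..<b (Suc j)} {b j..<b (Suc j)} \<and> h ` {b j..<b j + s j} = S (b j)" for j
    proof -
      let ?I = "{b j..<b (Suc j)}" and ?F = "{b j..<b j + s j}" and ?R = "{b j + s j..<b (Suc j)}"
      have fS: "finite (S (b j))" using S by blast
      have "card ?F = card (S (b j))" by (simp add: s_def)
      then obtain h1 where h1: "bij_betw h1 ?F (S (b j))" using finite_same_card_bij[OF _ fS] by blast
      have "card ?R = card (?I - S (b j))" using Sb[of j] fS by (simp add: card_Diff_subset s_def)
      then obtain h2 where h2: "bij_betw h2 ?R (?I - S (b j))" using finite_same_card_bij[of ?R "?I - S (b j)"] by blast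
      have "bij_betw (\<lambda>i. if i \<in> ?F then h1 i else h2 i) (?F \<union> ?R) (S (b j) \<union> (?I - S (b j)))"
        by (rule bij_betw_disjoint_Un[OF h1 h2]) auto
      moreover have "?F \<union> ?R = ?I" using sle[of j] by auto
      moreover have "S (b j) \<union> (?I - S (b j)) = ?I" using Sb[of j] by blast
      moreover have "(\<lambda>i. if i \<in> ?F then h1 i else h2 i) ` ?F = S (b j)"
        using bij_betw_imp_surj_on[OF h1] by (auto simp: image_def)
      ultimately show ?thesis by (intro exI[of _ "\<lambda>i. if i \<in> ?F then h1 i else h2 i"]) simp
    qed
    then obtain h where h: "\<And>j. bij_betw (h j) {b j..<b (Suc j)} {b j..<b (Suc j)}"
      "\<And>j. h j ` {b j..<b j + s j} = S (b j)" by metis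
    define J where "J i = (LEAST j. i < b (Suc j))" for i
    have J: "J i = j" if "i \<in> {b j..<b (Suc j)}" for i j
      unfolding J_def
    proof (rule Least_equality)
      show "i < b (Suc j)" using that by simp
      fix j' assume "i < b (Suc j')"
      then have "b j < b (Suc j')" using that by simp
      then show "j \<le> j'" using strict_mono_less[OF bm] by simp
    qed
    have inJ: "i \<in> {b (J i)..<b (Suc (J i))}" for i
    proof -
      have "i < b (Suc i)" using bj[of "Suc i"] by simp
      then have 1: "i < b (Suc (J i))" unfolding J_def by (rule LeastI)
      have "b (J i) \<le> i"
      proof (cases "J i")
        case (Suc j)
        then have "\<not> i < b (Suc j)" using not_less_Least[of j "\<lambda>j. i < b (Suc j)"] unfolding J_def by simp
        then show ?thesis using Suc by simp
      qed (simp add: b0)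
      then show ?thesis using 1 by simp
    qed
    \<comment> \<open>The permutations of the intervals glued together; every interval is preserved,
      so \<open>J (\<pi> i) = J i\<close> and bijectivity is checked interval by interval.\<close>
    define \<pi> where "\<pi> i = h (J i) i" for i
    have \<pi>J: "\<pi> i \<in> {b (J i)..<b (Suc (J i))}" for i
      unfolding \<pi>_def using bij_betwE[OF h(1)] inJ by blast
    have "bij \<pi>"
      unfolding bij_def
    proof
      show "inj \<pi>"
      proof (rule injI)
        fix i i' assume eq: "\<pi> i = \<pi> i'"
        then have "J i = J i'" using J[OF \<pi>J[of i]] J[OF \<pi>J[of i']] by simp
        then show "i = i'" using eq inJ[of i] inJ[of i'] bij_betw_imp_inj_on[OF h(1)[of "J i"]]
          unfolding \<pi>_def by (metis inj_onD)
      qed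
      show "surj \<pi>"
      proof (rule surjI[of _ "\<lambda>y. the_inv_into {b (J y)..<b (Suc (J y))} (h (J y)) y"])
        fix y
        let ?x = "the_inv_into {b (J y)..<b (Suc (J y))} (h (J y)) y"
        have "?x \<in> {b (J y)..<b (Suc (J y))}"
          by (rule the_inv_into_into[OF bij_betw_imp_inj_on[OF h(1)] _ order_refl])
            (use bij_betw_imp_surj_on[OF h(1)[of "J y"]] inJ[of y] in simp)
        then have "J ?x = J y" by (rule J)
        then show "\<pi> ?x = y" unfolding \<pi>_def
          using f_the_inv_into_f_bij_betw[OF h(1), of "J y" y] inJ[of y] by simp
      qed
    qed
    from conv[OF this] have "Cauchy (\<lambda>n. \<Sum>i<n. a (\<pi> i))" by (rule convergent_Cauchy)
    then obtain M where M: "\<And>m n. m \<ge> M \<Longrightarrow> n \<ge> M \<Longrightarrow> norm ((\<Sum>i<m. a (\<pi> i)) - (\<Sum>i<n. a (\<pi> i))) < 1"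
      unfolding Cauchy_iff by (meson zero_less_one)
    have "(\<Sum>i<b M + s M. a (\<pi> i)) - (\<Sum>i<b M. a (\<pi> i)) = (\<Sum>i\<in>{b M..<b M + s M}. a (\<pi> i))"
      using sum.atLeastLessThan_concat[of 0 "b M" "b M + s M" "\<lambda>i. a (\<pi> i)"]
      by (simp add: lessThan_atLeast0 algebra_simps)
    also have "\<dots> = (\<Sum>i\<in>{b M..<b M + s M}. a (h M i))"
    proof (intro sum.cong refl)
      fix i assume "i \<in> {b M..<b M + s M}"
      then have "i \<in> {b M..<b (Suc M)}" using sle[of M] by simp
      then show "a (\<pi> i) = a (h M i)" by (simp add: \<pi>_def J)
    qed
    also have "\<dots> = (\<Sum>i\<in>h M ` {b M..<b M + s M}. a i)"
      by (subst sum.reindex) (use sle[of M] in \<open>auto intro: inj_on_subset[OF bij_betw_imp_inj_on[OF h(1)]]\<close>)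
    also have "\<dots> = (\<Sum>i\<in>S (b M). a i)" by (simp add: h(2))
    finally show False using M[of "b M + s M" "b M"] bj[of M] S[rule_format, of "b M"] by simp
  qed
  then obtain N where N: "\<forall>S. finite S \<and> S \<subseteq> {N..} \<longrightarrow> norm (\<Sum>i\<in>S. a i) < 1" by blast
  show ?thesis
  proof (rule bounded_finite_sums_imp_summable_norm)
    fix S :: "nat set" assume S: "finite S"
    have "(\<Sum>i\<in>S. a i) = (\<Sum>i\<in>S \<inter> {..<N}. a i) + (\<Sum>i\<in>S \<inter> {N..}. a i)"
      using S by (subst sum.union_disjoint[symmetric]) (auto intro!: sum.cong)
    moreover have "norm (\<Sum>i\<in>S \<inter> {..<N}. a i) \<le> (\<Sum>i<N. norm (a i))"
      by (rule order_trans[OF norm_sum sum_mono2]) auto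
    moreover have "norm (\<Sum>i\<in>S \<inter> {N..}. a i) < 1" using N S by simp
    ultimately show "norm (\<Sum>i\<in>S. a i) \<le> (\<Sum>i<N. norm (a i)) + 1"
      using norm_triangle_ineq[of "\<Sum>i\<in>S \<inter> {..<N}. a i" "\<Sum>i\<in>S \<inter> {N..}. a i"] by simp
  qed
qed

section \<open>Weak continuity on bounded sets\<close>

lemma weakly_cont_const: "weakly_cont_on_bounded E (\<lambda>_. c)"
  unfolding weakly_cont_on_bounded_def by simp

lemma weakly_cont_add:
  "weakly_cont_on_bounded E f \<Longrightarrow> weakly_cont_on_bounded E g \<Longrightarrow> weakly_cont_on_bounded E (\<lambda>x. f x + g x)"
  unfolding weakly_cont_on_bounded_def by (intro allI ballI impI tendsto_add) auto

lemma weakly_cont_mult: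
  "weakly_cont_on_bounded E f \<Longrightarrow> weakly_cont_on_bounded E g \<Longrightarrow> weakly_cont_on_bounded E (\<lambda>x. f x * g x)"
  unfolding weakly_cont_on_bounded_def by (intro allI ballI impI tendsto_mult) auto

lemma weakly_cont_sum:
  "(\<And>i. i \<in> S \<Longrightarrow> weakly_cont_on_bounded E (f i)) \<Longrightarrow> weakly_cont_on_bounded E (\<lambda>x. \<Sum>i\<in>S. f i x)"
  by (induction S rule: infinite_finite_induct) (auto intro: weakly_cont_const weakly_cont_add)

lemma weakly_cont_dual: "\<phi> \<in> dual E \<Longrightarrow> weakly_cont_on_bounded E \<phi>"
  unfolding weakly_cont_on_bounded_def
  using tendsto_mono[OF inf_le1 weak_nhds_tendsto] by blast

lemma weakly_cont_cong:
  assumes f: "weakly_cont_on_bounded E f" and eq: "\<And>x. x \<in> vecs E \<Longrightarrow> f x = g x"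
  shows "weakly_cont_on_bounded E g"
  unfolding weakly_cont_on_bounded_def
proof (intro allI ballI impI)
  fix R x assume x: "x \<in> vecs E" "nrm E x \<le> R"
  have "(f \<longlongrightarrow> f x) (inf (weak_nhds E x) (principal {y. nrm E y \<le> R}))"
    using f x unfolding weakly_cont_on_bounded_def by blast
  moreover have "eventually (\<lambda>y. f y = g y) (inf (weak_nhds E x) (principal {y. nrm E y \<le> R}))"
    unfolding eventually_inf_principal using weak_nhds_vecs[of E x] by eventually_elim (simp add: eq)
  ultimately show "(g \<longlongrightarrow> g x) (inf (weak_nhds E x) (principal {y. nrm E y \<le> R}))"
    unfolding eq[OF x(1)] by (rule Lim_transform_eventually)
qed

lemma weakly_cont_uniform_limit:
  fixes f :: "'v::ab_group_add \<Rightarrow> 'k::rc_field"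
  assumes "\<And>R e. e > (0::real) \<Longrightarrow> \<exists>g. weakly_cont_on_bounded E g \<and>
    (\<forall>x\<in>vecs E. nrm E x \<le> R \<longrightarrow> norm (f x - g x) \<le> e)"
  shows "weakly_cont_on_bounded E f"
  unfolding weakly_cont_on_bounded_def
proof (intro allI ballI impI tendstoI)
  fix R x and e :: real assume x: "x \<in> vecs E" "nrm E x \<le> R" and e: "e > 0"
  obtain g where g: "weakly_cont_on_bounded E g" "\<forall>x\<in>vecs E. nrm E x \<le> R \<longrightarrow> norm (f x - g x) \<le> e/4"
    using assms[of "e/4" R] e by auto
  have "(g \<longlongrightarrow> g x) (inf (weak_nhds E x) (principal {y. nrm E y \<le> R}))"
    using g(1) x unfolding weakly_cont_on_bounded_def by blast
  from tendstoD[OF this, of "e/4"] e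
  have "eventually (\<lambda>y. nrm E y \<le> R \<longrightarrow> norm (g y - g x) < e/4) (weak_nhds E x)"
    by (simp add: eventually_inf_principal dist_norm)
  then show "eventually (\<lambda>y. dist (f y) (f x) < e) (inf (weak_nhds E x) (principal {y. nrm E y \<le> R}))"
    unfolding eventually_inf_principal using weak_nhds_vecs[of E x]
  proof eventually_elim
    case (elim y)
    show ?case
    proof
      assume "y \<in> {y. nrm E y \<le> R}"
      then have "norm (f y - g y) \<le> e/4" "norm (g y - g x) < e/4" using elim g(2) by auto
      moreover have "norm (f x - g x) \<le> e/4" using g(2) x by blast
      moreover have "norm (f y - f x) \<le> norm (f y - g y) + norm (g y - g x) + norm (f x - g x)"
      proof -
        have eq: "f y - f x = (f y - g y) + (g y - g x) - (f x - g x)" by simp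
        show ?thesis unfolding eq
          using norm_triangle_ineq4[of "(f y - g y) + (g y - g x)" "f x - g x"]
            norm_triangle_ineq[of "f y - g y" "g y - g x"] by linarith
      qed
      ultimately show "dist (f y) (f x) < e" using e unfolding dist_norm by linarith
    qed
  qed
qed

section \<open>Constructing multilinear maps\<close>

lemma multilinear_times_functional:
  fixes E :: "('k::rc_field, 'v::ab_group_add) nspace"
  assumes B: "multilinear E scalar_space I B" and \<phi>: "\<phi> \<in> dual E" and r: "r \<notin> I"
  shows "multilinear E scalar_space (insert r I) (\<lambda>x. \<phi> (x r) * B x)"
proof -
  interpret B: multilinear E scalar_space I B by (rule B)
  obtain C where C: "C \<ge> 0" "\<And>x. x \<in> vecs E \<Longrightarrow> norm (\<phi> x) \<le> C * nrm E x" using B.E.dual_bound[OF \<phi>] by blast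
  obtain M where M: "M \<ge> 0" "\<And>x. (\<And>i. i \<in> I \<Longrightarrow> x i \<in> vecs E) \<Longrightarrow> norm (B x) \<le> M * (\<Prod>i\<in>I. nrm E (x i))"
    using B.bound by auto
  have Br: "B (x(r := u)) = B x" for x u by (rule B.cong) (use r in auto)
  show ?thesis
  proof unfold_locales
    show "finite (insert r I)" using B.finite_slots by simp
    show "bounded_multilinear (insert r I) E scalar_space (\<lambda>x. \<phi> (x r) * B x)"
      unfolding bounded_multilinear_def
    proof (intro conjI allI impI)
      show "\<phi> (x r) * B x = \<phi> (y r) * B y" if xy: "\<forall>i\<in>insert r I. x i = y i" for x y
        using B.cong[of x y] xy by simp
      fix x i u assume i: "i \<in> insert r I" and x: "\<forall>j\<in>insert r I - {i}. x j \<in> vecs E" and u: "u \<in> vecs E"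
      have Ba: "B (x(i := u + v)) = B (x(i := u)) + B (x(i := v))" if "v \<in> vecs E" "i \<noteq> r" for v
        by (rule B.add) (use i x u that in auto)
      have Bs: "B (x(i := scl E c u)) = c * B (x(i := u))" if "i \<noteq> r" for c
        using B.scl[of i x u c] i x u that by auto
      show "\<phi> ((x(i := u + v)) r) * B (x(i := u + v)) = \<phi> ((x(i := u)) r) * B (x(i := u)) + \<phi> ((x(i := v)) r) * B (x(i := v))"
        if v: "v \<in> vecs E" for v
        using Ba[OF v] by (cases "i = r") (simp_all add: Br dual_add[OF \<phi> u v] algebra_simps)
      show "\<phi> ((x(i := scl E c u)) r) * B (x(i := scl E c u)) = scl scalar_space c (\<phi> ((x(i := u)) r) * B (x(i := u)))" for c
        using Bs by (cases "i = r") (simp_all add: Br dual_scl[OF \<phi> u])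
    next
      have "norm (\<phi> (x r) * B x) \<le> C * M * (\<Prod>i\<in>insert r I. nrm E (x i))" if x: "\<forall>i\<in>insert r I. x i \<in> vecs E" for x
      proof -
        have "norm (\<phi> (x r) * B x) \<le> (C * nrm E (x r)) * (M * (\<Prod>i\<in>I. nrm E (x i)))"
          unfolding norm_mult using C x B.E.nrm_nonneg by (intro mult_mono M(2)) auto
        also have "\<dots> = C * M * (\<Prod>i\<in>insert r I. nrm E (x i))" using r B.finite_slots by simp
        finally show ?thesis .
      qed
      then show "\<exists>M\<ge>0. \<forall>x. (\<forall>i\<in>insert r I. x i \<in> vecs E) \<longrightarrow>
          nrm scalar_space (\<phi> (x r) * B x) \<le> M * (\<Prod>i\<in>insert r I. nrm E (x i))"
        using C(1) M(1) by (intro exI[of _ "C * M"]) simp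
    qed simp
  qed
qed

lemma multilinear_times_functionals:
  fixes E :: "('k::rc_field, 'v::ab_group_add) nspace"
  assumes B: "multilinear E scalar_space I B" and \<phi>: "\<phi> \<in> dual E" and K: "finite K" "K \<inter> I = {}"
  shows "multilinear E scalar_space (K \<union> I) (\<lambda>x. (\<Prod>s\<in>K. \<phi> (x s)) * B x)"
  using K
proof (induction K rule: finite_induct)
  case (insert r K)
  have "multilinear E scalar_space (insert r (K \<union> I)) (\<lambda>x. \<phi> (x r) * ((\<Prod>s\<in>K. \<phi> (x s)) * B x))"
    by (rule multilinear_times_functional[OF _ \<phi>]) (use insert in auto)
  then show ?case using insert.hyps by (simp add: mult.assoc)
qed (simp add: B)

lemma multilinear_into_l1:
  fixes E :: "('k::rc_field, 'v::ab_group_add) nspace" and \<iota> :: "nat \<Rightarrow> 'i"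
  assumes \<iota>: "inj \<iota>" and E: "banach_space E"
    and G: "\<And>j. multilinear E scalar_space I (G j)" and M: "M \<ge> 0"
    "\<And>x N. \<forall>i\<in>I. x i \<in> vecs E \<Longrightarrow> (\<Sum>j<N. norm (G j x)) \<le> M * (\<Prod>i\<in>I. nrm E (x i))"
  shows "multilinear E (l1_space \<iota>) I (\<lambda>x a. if a \<in> range \<iota> then G (inv \<iota> a) x else 0)"
proof -
  interpret E: banach_space E by (rule E)
  let ?L = "l1_space \<iota> :: ('k, 'i \<Rightarrow> 'k) nspace"
  interpret L: banach_space ?L by (rule banach_l1[OF \<iota>])
  define A where "A x = (\<lambda>a. if a \<in> range \<iota> then G (inv \<iota> a) x else 0)" for x
  have A\<iota>: "A x (\<iota> j) = G j x" for x j by (simp add: A_def inv_f_f[OF \<iota>])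
  have sm: "summable (\<lambda>j. norm (G j x))" if x: "\<forall>i\<in>I. x i \<in> vecs E" for x
    using M(2)[OF x] by (intro summableI_nonneg_bounded) auto
  have Av: "A x \<in> vecs ?L" if x: "\<forall>i\<in>I. x i \<in> vecs E" for x
    unfolding l1_vecs_iff[OF \<iota>] A\<iota> using sm[OF x] by (simp add: A_def)
  have "multilinear E ?L I A"
  proof unfold_locales
    show "finite I" by (rule multilinear.finite_slots[OF G])
    show "bounded_multilinear I E ?L A"
      unfolding bounded_multilinear_def
    proof (intro conjI allI impI)
      show "A x \<in> vecs ?L" if "\<forall>i\<in>I. x i \<in> vecs E" for x by (rule Av[OF that])
      show "A x = A y" if xy: "\<forall>i\<in>I. x i = y i" for x y
      proof -
        have "G j x = G j y" for j by (rule multilinear.cong[OF G]) (use xy in blast)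
        then show ?thesis by (auto simp: A_def)
      qed
      fix x i u assume i: "i \<in> I" and x: "\<forall>j\<in>I - {i}. x j \<in> vecs E" and u: "u \<in> vecs E"
      show "A (x(i := u + v)) = A (x(i := u)) + A (x(i := v))" if v: "v \<in> vecs E" for v
      proof -
        have "G j (x(i := u + v)) = G j (x(i := u)) + G j (x(i := v))" for j
          by (rule multilinear.add[OF G i _ u v]) (use x in blast)
        then show ?thesis by (auto simp: A_def)
      qed
      show "A (x(i := scl E c u)) = scl ?L c (A (x(i := u)))" for c
      proof -
        have "G j (x(i := scl E c u)) = scl scalar_space c (G j (x(i := u)))" for j
          by (rule multilinear.scl[OF G i _ u]) (use x in blast)
        then show ?thesis by (auto simp: A_def)
      qed
    next
      have "nrm ?L (A x) \<le> M * (\<Prod>i\<in>I. nrm E (x i))" if x: "\<forall>i\<in>I. x i \<in> vecs E" for x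
        unfolding l1_nrm[OF \<iota> Av[OF x]] A\<iota> by (rule suminf_le_const[OF sm[OF x] M(2)[OF x]])
      then show "\<exists>M\<ge>0. \<forall>x. (\<forall>i\<in>I. x i \<in> vecs E) \<longrightarrow> nrm ?L (A x) \<le> M * (\<Prod>i\<in>I. nrm E (x i))"
        using M(1) by blast
    qed
  qed
  then show ?thesis by (simp only: A_def[abs_def])
qed

section \<open>Property (V) from polynomials\<close>

lemma (in banach_space) functional_exists:
  assumes "x \<in> vecs E" "x \<noteq> 0"
  shows "\<exists>\<phi> e0. \<phi> \<in> dual E \<and> (\<forall>y\<in>vecs E. norm (\<phi> y) \<le> nrm E y) \<and> e0 \<in> vecs E \<and> \<phi> e0 = 1"
proof -
  obtain \<psi> where \<psi>: "\<psi> \<in> dual E" "\<forall>y\<in>vecs E. norm (\<psi> y) \<le> nrm E y" "\<psi> x = of_real (nrm E x)"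
    using norming_functional_ex[OF assms(1)] by blast
  have n: "nrm E x \<noteq> 0" using nrm_eq_0[OF assms(1)] assms(2) by simp
  have "\<psi> (scl E (of_real (1 / nrm E x)) x) = 1" using n by (simp add: dual_scl[OF \<psi>(1) assms(1)] \<psi>(3))
  then show ?thesis using \<psi>(1,2) vecs_scl[OF assms(1)] by blast
qed

lemma (in banach_space) wuC_functional_converges:
  assumes w: "wuC E w" and \<phi>: "\<phi> \<in> dual E"
  shows "\<exists>l. (\<lambda>n. \<phi> (\<Sum>i\<le>n. w i)) \<longlonglongrightarrow> l"
proof -
  have "summable (\<lambda>i. \<phi> (w i))" by (rule rc_summable_norm(1)[OF wuC_summable[OF w \<phi>]])
  then have "(\<lambda>n. \<Sum>i<Suc n. \<phi> (w i)) \<longlonglongrightarrow> (\<Sum>i. \<phi> (w i))"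
    using LIMSEQ_Suc[OF summable_LIMSEQ] by blast
  moreover have "\<phi> (\<Sum>i\<le>n. w i) = (\<Sum>i<Suc n. \<phi> (w i))" for n
    unfolding lessThan_Suc_atMost by (rule dual_sum[OF \<phi>]) (rule wuC_vecs[OF w])
  ultimately show ?thesis by auto
qed

text \<open>\<open>\<phi>\<close> converges along w.u.C. partial sums, so multiplying
  \<open>T\<close> by a power of \<open>\<phi>\<close> keeps it unconditionally converging. Weak
  limits of \<open>T\<close> are recovered by dividing by that power, which requires
  \<open>\<phi>\<close> to have a nonzero limit along \<open>U\<close>. The zero space has no
  suitable \<open>\<phi>\<close> and is treated separately.\<close>

lemma property_V_of_uc_polys:
  fixes E :: "('k::rc_field, 'e::ab_group_add) nspace"
  assumes E: "banach_space E" and k: "k \<ge> 1"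
    and uc: "uc_polys_weakly_compact TYPE('w::ab_group_add) k E"
  shows "property_V TYPE('w) E"
  unfolding property_V_def
proof (intro allI impI ballI)
  fix F :: "('k, 'w) nspace" and T
  assume F: "banach_space F" and T: "T \<in> bounded_ops E F" and ucT: "unconditionally_converging E F T"
  interpret E: banach_space E by fact
  interpret F: banach_space F by fact
  have Tv: "T x \<in> vecs F" if "x \<in> vecs E" for x by (rule bounded_ops_vecs[OF T that])
  show "weakly_compact E F T"
  proof (cases "\<exists>x\<in>vecs E. x \<noteq> 0")
    case False
    then have zero: "x = 0" if "x \<in> vecs E" for x using that by blast
    have T0: "T x = 0" if "x \<in> vecs E" for x
      unfolding zero[OF that] by (rule bounded_ops_0[OF E F T])
    show ?thesis
    proof (rule iffD2[OF weakly_compact_iff], erule Tv, intro allI impI)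
      fix U assume U: "ultra U \<and> U \<le> principal (unit_ball E)"
      have "((\<lambda>x. \<psi> (T x)) \<longlongrightarrow> \<psi> 0) U" for \<psi> :: "'w \<Rightarrow> 'k"
      proof (rule tendsto_eventually)
        show "eventually (\<lambda>x. \<psi> (T x) = \<psi> 0) U"
          using U[THEN conjunct2, unfolded le_principal] by eventually_elim (simp add: T0)
      qed
      then show "\<exists>l\<in>vecs F. \<forall>\<psi>\<in>dual F. ((\<lambda>x. \<psi> (T x)) \<longlongrightarrow> \<psi> l) U" using F.vecs_0 by blast
    qed
  next
    case True
    then obtain \<phi> e0 where \<phi>: "\<phi> \<in> dual E" "e0 \<in> vecs E" "\<phi> e0 = 1" using E.functional_exists by blast
    obtain C where C: "C \<ge> 0" "\<And>x. x \<in> vecs E \<Longrightarrow> nrm F (T x) \<le> C * nrm E x" using bounded_ops_bound[OF E T] by blast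
    obtain D where D: "D \<ge> 0" "\<And>x. x \<in> vecs E \<Longrightarrow> norm (\<phi> x) \<le> D * nrm E x" using E.dual_bound[OF \<phi>(1)] by blast
    let ?I = "{..<k}" and ?K = "{..<k - 1}"
    have IK: "?I = insert (k - 1) ?K" using k by (auto)
    \<comment> \<open>The last slot is reserved for \<open>T\<close>; the others carry
      \<open>\<phi>\<close>. For \<open>k = 1\<close> the product is empty and \<open>A\<close> is
      \<open>T\<close>.\<close>
    define A where "A x = scl F (\<Prod>s\<in>?K. \<phi> (x s)) (T (x (k - 1)))" for x
    have prod_upd: "(\<Prod>s\<in>?K. \<phi> ((x(i := u)) s)) = \<phi> u * (\<Prod>s\<in>?K - {i}. \<phi> (x s))" if "i \<in> ?K" for x i u
      using that by (subst prod.remove[of ?K i]) (auto intro!: prod.cong)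
    have prod_last: "(\<Prod>s\<in>?K. \<phi> ((x(k - 1 := u)) s)) = (\<Prod>s\<in>?K. \<phi> (x s))" for x u
      by (rule prod.cong) auto
    have A: "multilinear E F ?I A"
    proof unfold_locales
      show "bounded_multilinear ?I E F A"
        unfolding bounded_multilinear_def
      proof (intro conjI allI impI)
        show "A x \<in> vecs F" if "\<forall>i\<in>?I. x i \<in> vecs E" for x
          unfolding A_def using that k by (intro F.vecs_scl Tv) simp
        show "A x = A y" if "\<forall>i\<in>?I. x i = y i" for x y
        proof -
          have "(\<Prod>s\<in>?K. \<phi> (x s)) = (\<Prod>s\<in>?K. \<phi> (y s))" using that by (intro prod.cong) auto
          then show ?thesis using that k by (simp add: A_def)
        qed
        fix x i u assume i: "i \<in> ?I" and x: "\<forall>j\<in>?I - {i}. x j \<in> vecs E" and u: "u \<in> vecs E"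
        show "A (x(i := u + v)) = A (x(i := u)) + A (x(i := v))" if v: "v \<in> vecs E" for v
        proof (cases "i = k - 1")
          case True
          show ?thesis unfolding A_def True prod_last
            by (simp add: bounded_ops_add[OF T u v] F.scale_right_distrib)
        next
          case False
          then have "i \<in> ?K" using i by auto
          then show ?thesis using False unfolding A_def prod_upd[OF \<open>i \<in> ?K\<close>]
            by (simp add: dual_add[OF \<phi>(1) u v] F.scale_left_distrib distrib_right)
        qed
        show "A (x(i := scl E c u)) = scl F c (A (x(i := u)))" for c
        proof (cases "i = k - 1")
          case True
          show ?thesis unfolding A_def True prod_last
            by (simp add: bounded_ops_scl[OF T u] mult.commute)
        next
          case False
          then have "i \<in> ?K" using i by auto
          then show ?thesis using False unfolding A_def prod_upd[OF \<open>i \<in> ?K\<close>]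
            by (simp add: dual_scl[OF \<phi>(1) u] mult_ac)
        qed
      next
        have "nrm F (A x) \<le> D ^ (k - 1) * C * (\<Prod>i\<in>?I. nrm E (x i))" if x: "\<forall>i\<in>?I. x i \<in> vecs E" for x
        proof -
          have last: "x (k - 1) \<in> vecs E" using x k by simp
          have "nrm F (A x) = (\<Prod>s\<in>?K. norm (\<phi> (x s))) * nrm F (T (x (k - 1)))"
            unfolding A_def F.nrm_scl[OF Tv[OF last]] prod_norm ..
          also have "\<dots> \<le> (\<Prod>s\<in>?K. D * nrm E (x s)) * (C * nrm E (x (k - 1)))"
            using x C(2)[OF last] D by (intro mult_mono prod_mono prod_nonneg) (use F.nrm_nonneg[OF Tv[OF last]] in \<open>auto simp: E.nrm_nonneg\<close>)
          also have "\<dots> = D ^ (k - 1) * C * (\<Prod>i\<in>?I. nrm E (x i))"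
            unfolding IK by (simp add: prod.distrib mult_ac)
          finally show ?thesis .
        qed
        then show "\<exists>M\<ge>0. \<forall>x. (\<forall>i\<in>?I. x i \<in> vecs E) \<longrightarrow> nrm F (A x) \<le> M * (\<Prod>i\<in>?I. nrm E (x i))"
          using C(1) D(1) by (intro exI[of _ "D ^ (k - 1) * C"]) simp
      qed
    qed simp
    interpret A: multilinear E F ?I A by (rule A)
    define P where "P x = scl F (\<phi> x ^ (k - 1)) (T x)" for x
    have PA: "P x = A (\<lambda>_. x)" for x by (simp add: P_def A_def)
    have P: "P \<in> polys k E F" by (rule A.polysI[OF refl]) (rule PA)
    have Pv: "P x \<in> vecs F" if "x \<in> vecs E" for x unfolding P_def by (intro F.vecs_scl Tv that)
    have "unconditionally_converging E F P"
      unfolding unconditionally_converging_def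
    proof (intro allI impI)
      fix w assume w: "wuC E w"
      define t where "t n = (\<Sum>i\<le>n. w i)" for n
      have tv: "t n \<in> vecs E" for n unfolding t_def by (intro E.vecs_sum wuC_vecs[OF w])
      obtain c where c: "(\<lambda>n. \<phi> (t n)) \<longlonglongrightarrow> c" using E.wuC_functional_converges[OF w \<phi>(1)] unfolding t_def by blast
      obtain l where "limitin (norm_top F) (\<lambda>n. T (t n)) l sequentially"
        using ucT w unfolding unconditionally_converging_def t_def by blast
      then have l: "l \<in> vecs F" "(\<lambda>n. nrm F (T (t n) - l)) \<longlonglongrightarrow> 0" unfolding F.limitin_norm_top by blast+
      let ?a = "\<lambda>n. \<phi> (t n) ^ (k - 1)"
      have a: "?a \<longlonglongrightarrow> c ^ (k - 1)" by (intro tendsto_power c)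
      have "(\<lambda>n. norm (?a n) * nrm F (T (t n) - l) + norm (?a n - c ^ (k - 1)) * nrm F l) \<longlonglongrightarrow>
          norm (c ^ (k - 1)) * 0 + norm (c ^ (k - 1) - c ^ (k - 1)) * nrm F l"
        by (intro tendsto_intros a l(2))
      moreover have "norm (nrm F (P (t n) - scl F (c ^ (k - 1)) l)) \<le>
          norm (?a n) * nrm F (T (t n) - l) + norm (?a n - c ^ (k - 1)) * nrm F l" for n
      proof -
        have d: "T (t n) - l \<in> vecs F" by (intro F.vecs_diff Tv tv l(1))
        have "P (t n) - scl F (c ^ (k - 1)) l = scl F (?a n) (T (t n) - l) + scl F (?a n - c ^ (k - 1)) l"
          by (simp add: P_def F.scale_right_diff_distrib F.scale_left_diff_distrib)
        then show ?thesis
          using F.nrm_triangle[OF F.vecs_scl[OF d] F.vecs_scl[OF l(1)], of "?a n" "?a n - c ^ (k - 1)"]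
            F.nrm_nonneg[OF F.vecs_diff[OF Pv[OF tv] F.vecs_scl[OF l(1)]], of n "c ^ (k - 1)"]
          by (simp add: F.nrm_scl[OF d] F.nrm_scl[OF l(1)])
      qed
      ultimately have "(\<lambda>n. nrm F (P (t n) - scl F (c ^ (k - 1)) l)) \<longlonglongrightarrow> 0"
        by (intro Lim_null_comparison[of "\<lambda>n. nrm F (P (t n) - scl F (c ^ (k - 1)) l)"] always_eventually allI) simp_all
      then have "limitin (norm_top F) (\<lambda>n. P (t n)) (scl F (c ^ (k - 1)) l) sequentially"
        unfolding F.limitin_norm_top using Pv[OF tv] F.vecs_scl[OF l(1)] by simp
      then show "\<exists>l. limitin (norm_top F) (\<lambda>n. P (\<Sum>i\<le>n. w i)) l sequentially" unfolding t_def by blast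
    qed
    then have wcP: "weakly_compact E F P" using uc F P unfolding uc_polys_weakly_compact_def by blast
    show ?thesis
    proof (rule iffD2[OF weakly_compact_iff], erule Tv, intro allI impI)
      fix U assume U: "ultra U \<and> U \<le> principal (unit_ball E)"
      have Uball: "eventually (\<lambda>x. x \<in> unit_ball E) U" using U by (simp add: le_principal)
      have "eventually (\<lambda>x. norm (\<phi> x) \<le> D) U"
        using Uball
      proof eventually_elim
        case (elim x)
        then show ?case using D(2)[of x] mult_left_le[of "nrm E x" D] D(1) by simp
      qed
      then obtain c where c: "(\<phi> \<longlongrightarrow> c) U" using ultra_bounded_tendsto[OF U[THEN conjunct1]] by blast
      \<comment> \<open>A translate on which \<open>\<phi>\<close> does not tend to \<open>0\<close>, scaled back into the unit ball.\<close>
      obtain s :: 'k where s: "c + s \<noteq> 0" by (metis add.right_neutral add_0 zero_neq_one)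
      define v where "v = scl E s e0"
      have vv: "v \<in> vecs E" unfolding v_def by (intro E.vecs_scl \<phi>(2))
      define R where "R = 1 + nrm E v"
      have R: "R > 0" unfolding R_def using E.nrm_nonneg[OF vv] by linarith
      define r :: 'k where "r = of_real (1 / R)"
      have r0: "r \<noteq> 0" using R by (simp add: r_def)
      define g where "g x = scl E r (x + v)" for x
      have gball: "filtermap g U \<le> principal (unit_ball E)"
        unfolding le_principal eventually_filtermap using Uball
      proof eventually_elim
        case (elim x)
        then have x: "x \<in> vecs E" "nrm E x \<le> 1" by auto
        have "nrm E (g x) = nrm E (x + v) / R"
          using R unfolding g_def r_def E.nrm_scl[OF E.vecs_add[OF x(1) vv]] by (simp add: norm_divide)
        also have "\<dots> \<le> 1" using E.nrm_triangle[OF x(1) vv] x(2) R by (simp add: R_def)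
        finally show ?case using x(1) vv by (simp add: g_def)
      qed
      obtain l where l: "l \<in> vecs F" "\<forall>\<psi>\<in>dual F. ((\<lambda>x. \<psi> (P x)) \<longlongrightarrow> \<psi> l) (filtermap g U)"
        using iffD1[OF weakly_compact_iff wcP, rule_format, OF Pv, of "filtermap g U"]
          ultra_filtermap[of U g] gball U by blast
      define q where "q = (r * (c + s)) ^ (k - 1)"
      have q: "q \<noteq> 0" using r0 s by (simp add: q_def)
      \<comment> \<open>The solution for the limit of \<open>T x\<close> in
        \<open>P (g x) = (r (\<phi> x + s)) ^ (k - 1) r (T x + T v)\<close>, where the scalar power
        tends to \<open>q\<close>.\<close>
      define L where "L = scl F (1 / (q * r)) l - T v"
      have "((\<lambda>x. \<psi> (T x)) \<longlongrightarrow> \<psi> L) U" if \<psi>: "\<psi> \<in> dual F" for \<psi>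
      proof -
        have 1: "((\<lambda>x. \<psi> (P (g x))) \<longlongrightarrow> \<psi> l) U" using l(2)[THEN bspec, OF \<psi>] unfolding filterlim_filtermap .
        have 2: "((\<lambda>x. (r * (\<phi> x + s)) ^ (k - 1)) \<longlongrightarrow> q) U"
          unfolding q_def by (intro tendsto_intros c)
        have ne: "eventually (\<lambda>x. (r * (\<phi> x + s)) ^ (k - 1) \<noteq> 0) U"
          using tendsto_imp_eventually_ne[OF 2 q] .
        have "((\<lambda>x. \<psi> (P (g x)) / ((r * (\<phi> x + s)) ^ (k - 1) * r) - \<psi> (T v)) \<longlongrightarrow> \<psi> l / (q * r) - \<psi> (T v)) U"
          by (intro tendsto_intros 1 2) (use q r0 in simp)
        moreover have "eventually (\<lambda>x. \<psi> (P (g x)) / ((r * (\<phi> x + s)) ^ (k - 1) * r) - \<psi> (T v) = \<psi> (T x)) U"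
          using Uball ne
        proof eventually_elim
          case (elim x)
          have x: "x \<in> vecs E" using elim by blast
          have xv: "x + v \<in> vecs E" by (rule E.vecs_add[OF x vv])
          have "\<phi> (g x) = r * (\<phi> x + s)"
            unfolding g_def dual_scl[OF \<phi>(1) xv] dual_add[OF \<phi>(1) x vv] by (simp add: v_def dual_scl[OF \<phi>(1) \<phi>(2)] \<phi>(3))
          moreover have "T (g x) = scl F r (T x + T v)"
            unfolding g_def bounded_ops_scl[OF T xv] bounded_ops_add[OF T x vv] ..
          ultimately have "\<psi> (P (g x)) = (r * (\<phi> x + s)) ^ (k - 1) * (r * (\<psi> (T x) + \<psi> (T v)))"
            unfolding P_def by (simp add: dual_scl[OF \<psi>] dual_add[OF \<psi>] Tv x vv)
          then have "\<psi> (P (g x)) / (a * r) - \<psi> (T v) = \<psi> (T x)"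
            if "a = (r * (\<phi> x + s)) ^ (k - 1)" "a \<noteq> 0" for a
            unfolding that(1)[symmetric] using that(2) r0 by (simp add: field_simps)
          then show ?case using elim(2) by blast
        qed
        moreover have "\<psi> L = \<psi> l / (q * r) - \<psi> (T v)"
          unfolding L_def by (simp add: F.dual_diff[OF \<psi>] dual_scl[OF \<psi>] Tv vv l(1))
        ultimately show ?thesis by (simp add: Lim_transform_eventually)
      qed
      moreover have "L \<in> vecs F" unfolding L_def by (intro F.vecs_diff F.vecs_scl Tv vv l(1))
      ultimately show "\<exists>l\<in>vecs F. \<forall>\<psi>\<in>dual F. ((\<lambda>x. \<psi> (T x)) \<longlongrightarrow> \<psi> l) U" by blast
    qed
  qed
qed

section \<open>Blocks of an unconditional expansion\<close>

lemma bounded_ops_weighted_sum: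
  assumes E: "banach_space E" and A: "\<And>i. A i \<in> bounded_ops E E"
  shows "(\<lambda>x. \<Sum>i\<in>(S::nat set). scl E (c i) (A i x)) \<in> bounded_ops E E"
proof -
  interpret banach_space E by (rule E)
  have "\<exists>C\<ge>0. \<forall>x\<in>vecs E. nrm E (A i x) \<le> C * nrm E x" for i
    by (rule bounded_ops_bound[OF E A[of i]]) blast
  then have "\<forall>i. \<exists>C. C \<ge> 0 \<and> (\<forall>x\<in>vecs E. nrm E (A i x) \<le> C * nrm E x)" by blast
  then obtain C where C: "\<forall>i. C i \<ge> 0 \<and> (\<forall>x\<in>vecs E. nrm E (A i x) \<le> C i * nrm E x)"
    unfolding choice_iff by blast
  have Av: "A i x \<in> vecs E" if "x \<in> vecs E" for i x by (rule bounded_ops_vecs[OF A that])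
  show ?thesis
  proof (rule bounded_opsI[where C = "\<Sum>i\<in>S. norm (c i) * C i"])
    fix x assume x: "x \<in> vecs E"
    show "(\<Sum>i\<in>S. scl E (c i) (A i x)) \<in> vecs E" by (intro vecs_sum vecs_scl Av x)
    have "nrm E (\<Sum>i\<in>S. scl E (c i) (A i x)) \<le> (\<Sum>i\<in>S. nrm E (scl E (c i) (A i x)))"
      by (rule nrm_sum) (intro vecs_scl Av x)
    also have "\<dots> \<le> (\<Sum>i\<in>S. norm (c i) * C i * nrm E x)"
      unfolding nrm_scl[OF Av[OF x]] mult.assoc using C x by (intro sum_mono mult_left_mono) auto
    finally show "nrm E (\<Sum>i\<in>S. scl E (c i) (A i x)) \<le> (\<Sum>i\<in>S. norm (c i) * C i) * nrm E x"
      by (simp add: sum_distrib_right)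
  next
    fix x y assume x: "x \<in> vecs E" and y: "y \<in> vecs E"
    show "(\<Sum>i\<in>S. scl E (c i) (A i (x + y))) = (\<Sum>i\<in>S. scl E (c i) (A i x)) + (\<Sum>i\<in>S. scl E (c i) (A i y))"
      unfolding bounded_ops_add[OF A x y] scale_right_distrib sum.distrib ..
  next
    fix a x assume x: "x \<in> vecs E"
    show "(\<Sum>i\<in>S. scl E (c i) (A i (scl E a x))) = scl E a (\<Sum>i\<in>S. scl E (c i) (A i x))"
      unfolding bounded_ops_scl[OF A x] scale_sum_right by (simp add: mult.commute)
  qed
qed

lemma bounded_ops_sum_fun:
  assumes E: "banach_space E" and A: "\<And>i. A i \<in> bounded_ops E E"
  shows "(\<lambda>x. \<Sum>i\<in>(S::nat set). A i x) \<in> bounded_ops E E"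
proof -
  interpret banach_space E by (rule E)
  show ?thesis using bounded_ops_weighted_sum[OF E A, where c = "\<lambda>_. 1" and S = S] by simp
qed

text \<open>The polynomial \<open>x \<mapsto> (\<phi>(x) ^ (k - card I) * B(\<sigma> n x, \<dots>, \<sigma> n x))\<^sub>n\<close> takes values in \<open>\<ell>\<^sub>1\<close> and
  converges unconditionally; its weak compactness makes the coordinates small uniformly on balls.
  Adding \<open>2 e0\<close> to \<open>x\<close> makes the factor \<open>\<phi>(x)\<close> large and hardly changes \<open>\<sigma> n x\<close>.\<close>

lemma diagonal_operators_vanish:
  fixes E :: "('k::rc_field, 'e::ab_group_add) nspace" and \<sigma> :: "nat \<Rightarrow> 'e \<Rightarrow> 'e"
  assumes E: "banach_space E" and uc: "uc_polys_weakly_compact TYPE(('e \<Rightarrow> 'k) \<Rightarrow> 'k) k E"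
    and B: "multilinear E scalar_space I B" and I: "I \<subseteq> {..<k}" "I \<noteq> {}"
    and \<sigma>: "\<And>n. \<sigma> n \<in> bounded_ops E E"
    and C: "C \<ge> 0" "\<forall>c N x. (\<forall>n. norm (c n) \<le> 1) \<longrightarrow> x \<in> vecs E \<longrightarrow>
        nrm E (\<Sum>n<N. scl E (c n) (\<sigma> n x)) \<le> C * nrm E x"
    and null: "\<And>x. x \<in> vecs E \<Longrightarrow> (\<lambda>n. nrm E (\<sigma> n x)) \<longlonglongrightarrow> 0" and e: "e > 0"
  shows "\<exists>N. \<forall>n\<ge>N. \<forall>x\<in>unit_ball E. norm (B (\<lambda>_. \<sigma> n x)) \<le> e"
proof (cases "\<exists>x\<in>vecs E. x \<noteq> 0")
  case False
  interpret B: multilinear E scalar_space I B by (rule B)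
  obtain i where i: "i \<in> I" using I by blast
  have "B (\<lambda>_. \<sigma> n x) = 0" if "x \<in> vecs E" for n x
  proof -
    have "\<sigma> n x = 0" using False bounded_ops_vecs[OF \<sigma>[of n] that] by blast
    moreover have "B ((\<lambda>_. 0)(i := 0)) = 0" by (rule B.zero[OF i]) simp
    moreover have "(\<lambda>_. 0)(i := 0) = (\<lambda>_. 0 :: 'e)" by auto
    ultimately show ?thesis by simp
  qed
  then show ?thesis using e by auto
next
  case True
  interpret E: banach_space E by (rule E)
  interpret B: multilinear E scalar_space I B by (rule B)
  obtain \<phi> e0 where \<phi>: "\<phi> \<in> dual E" "\<forall>y\<in>vecs E. norm (\<phi> y) \<le> nrm E y" "e0 \<in> vecs E" "\<phi> e0 = 1"
    using True E.functional_exists by blast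
  \<comment> \<open>Constant functions serve as labels of the coordinates; they are distinct because
    the scalars have characteristic \<open>0\<close>.\<close>
  define \<iota> where "\<iota> n = (\<lambda>_::'e. of_nat n :: 'k)" for n :: nat
  have \<iota>: "inj \<iota>"
  proof (rule injI)
    fix m n assume "\<iota> m = \<iota> n"
    from fun_cong[OF this, of 0] show "m = n" by (simp add: \<iota>_def)
  qed
  let ?L = "l1_space \<iota> :: ('k, ('e \<Rightarrow> 'k) \<Rightarrow> 'k) nspace"
  \<comment> \<open>The slots that \<open>B\<close> leaves free; they are filled with
    \<open>\<phi>\<close> to reach degree \<open>k\<close>.\<close>
  define K where "K = {..<k} - I"
  have KI: "K \<union> I = {..<k}" "K \<inter> I = {}" "finite K" using I by (auto simp: K_def)
  define G where "G n y = (\<Prod>s\<in>K. \<phi> (y s)) * B (\<lambda>i. \<sigma> n (y i))" for n y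
  have Gm: "multilinear E scalar_space {..<k} (G n)" for n
  proof -
    have "multilinear E scalar_space (K \<union> I) (\<lambda>y. (\<Prod>s\<in>K. \<phi> (y s)) * B (\<lambda>i. \<sigma> n (y i)))"
      by (rule multilinear_times_functionals[OF B.precompose[of "\<lambda>_. \<sigma> n"] \<phi>(1) KI(3,2)]) (rule \<sigma>)
    then show ?thesis unfolding KI(1) G_def .
  qed
  obtain M where M: "M \<ge> 0" "\<And>x. (\<And>i. i \<in> I \<Longrightarrow> x i \<in> vecs E) \<Longrightarrow> norm (B x) \<le> M * (\<Prod>i\<in>I. nrm E (x i))"
    using B.bound by auto
  have Gsum: "(\<Sum>n<N. norm (G n y)) \<le> M * C ^ card I * (\<Prod>i\<in>{..<k}. nrm E (y i))"
    if y: "\<forall>i\<in>{..<k}. y i \<in> vecs E" for y N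
  proof -
    have yI: "y i \<in> vecs E" if "i \<in> I" for i using y that I by blast
    have eq: "B (\<lambda>i. if i \<in> I then \<sigma> n (y i) else y i) = B (\<lambda>i. \<sigma> n (y i))" for n by (rule B.cong) simp
    have "(\<Sum>n<N. norm (B (\<lambda>i. if i \<in> I then \<sigma> n (y i) else y i)))
        \<le> M * (\<Prod>i\<in>I. C * nrm E (y i)) * (\<Prod>i\<in>I - I. nrm E (y i))"
    proof (rule multilinear_diagonal_sum[where v = "\<lambda>s n. \<sigma> n (y s)", OF B M(1) M(2) subset_refl I(2)])
      show "\<sigma> n (y s) \<in> vecs E" if "s \<in> I" for s n by (rule bounded_ops_vecs[OF \<sigma> yI[OF that]])
      show "nrm E (\<Sum>n<N. scl E (c n) (\<sigma> n (y s))) \<le> C * nrm E (y s)"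
        if "s \<in> I" "\<And>n. norm (c n) \<le> 1" for s c using C(2) that yI by blast
    qed auto
    then have 1: "(\<Sum>n<N. norm (B (\<lambda>i. \<sigma> n (y i)))) \<le> M * C ^ card I * (\<Prod>i\<in>I. nrm E (y i))"
      unfolding eq by (simp add: prod.distrib mult.assoc)
    have 2: "(\<Prod>s\<in>K. norm (\<phi> (y s))) \<le> (\<Prod>s\<in>K. nrm E (y s))"
      using \<phi>(2) y by (intro prod_mono) (auto simp: K_def)
    have "(\<Sum>n<N. norm (G n y)) = (\<Prod>s\<in>K. norm (\<phi> (y s))) * (\<Sum>n<N. norm (B (\<lambda>i. \<sigma> n (y i))))"
      by (simp add: G_def norm_mult prod_norm sum_distrib_left)
    also have "\<dots> \<le> (\<Prod>s\<in>K. nrm E (y s)) * (M * C ^ card I * (\<Prod>i\<in>I. nrm E (y i)))"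
      using 1 2 y by (intro mult_mono prod_nonneg sum_nonneg) (auto simp: K_def E.nrm_nonneg)
    also have "\<dots> = M * C ^ card I * (\<Prod>i\<in>K \<union> I. nrm E (y i))"
      using KI(2,3) B.finite_slots by (subst prod.union_disjoint) auto
    finally show ?thesis unfolding KI(1) .
  qed
  define A where "A x = (\<lambda>a. if a \<in> range \<iota> then G (inv \<iota> a) x else 0)" for x
  have A: "multilinear E ?L {..<k} A"
    unfolding A_def
    by (rule multilinear_into_l1[OF \<iota> E Gm, of "M * C ^ card I"]) (use M(1) C(1) Gsum in auto)
  have A\<iota>: "A x (\<iota> n) = G n x" for x n by (simp add: A_def inv_f_f[OF \<iota>])
  let ?P = "\<lambda>x. A (\<lambda>_. x)"
  have P: "?P \<in> polys k E ?L" by (rule multilinear.polysI[OF A refl]) (rule refl)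
  have Pv: "?P x \<in> vecs ?L" if "x \<in> vecs E" for x by (rule multilinear.vecs_app[OF A]) (rule that)
  have wc: "weakly_compact E ?L ?P"
    using uc banach_l1[OF \<iota>] P multilinear_l1_unconditionally_converging[OF \<iota> A]
    unfolding uc_polys_weakly_compact_def by blast
  have n0: "nrm E e0 \<ge> 0" by (rule E.nrm_nonneg[OF \<phi>(3)])
  define R where "R = 1 + 2 * nrm E e0"
  have R: "R \<ge> 1" using n0 by (simp add: R_def)
  \<comment> \<open>\<open>R ^ k\<close> pays for scaling \<open>x + 2 e0\<close>, of norm at most
    \<open>R\<close>, into the unit ball; the other half of \<open>e\<close> is kept for the passage
    from \<open>x + 2 e0\<close> back to \<open>x\<close>.\<close>
  have e': "e / (2 * R ^ k) > 0" using e R by simp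
  obtain N1 where N1: "\<forall>n\<ge>N1. \<forall>x\<in>unit_ball E. norm (?P x (\<iota> n)) < e / (2 * R ^ k)"
    using l1_weakly_compact_coordinates[OF \<iota> Pv wc e'] by blast
  obtain M2 where M2: "M2 \<ge> 0" "\<And>x R i u. R \<ge> 1 \<Longrightarrow> i \<in> I \<Longrightarrow> (\<And>j. j \<in> I \<Longrightarrow> j \<noteq> i \<Longrightarrow> x j \<in> vecs E \<and> nrm E (x j) \<le> R) \<Longrightarrow> u \<in> vecs E \<Longrightarrow>
       norm (B (x(i := u))) \<le> M2 * R ^ card I * nrm E u"
    using B.bound_slot by auto
  define R2 where "R2 = C * R + 1"
  have R2: "R2 \<ge> 1" using C(1) R by (simp add: R2_def)
  have "(\<lambda>n. \<Sum>i\<in>I. M2 * R2 ^ card I * (2 * nrm E (\<sigma> n e0))) \<longlonglongrightarrow> (\<Sum>i\<in>I. M2 * R2 ^ card I * (2 * 0))"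
    by (intro tendsto_intros null \<phi>(3))
  then have "eventually (\<lambda>n. (\<Sum>i\<in>I. M2 * R2 ^ card I * (2 * nrm E (\<sigma> n e0))) < e / 2) sequentially"
    using e by (intro order_tendstoD) auto
  then obtain N2 where N2: "\<forall>n\<ge>N2. (\<Sum>i\<in>I. M2 * R2 ^ card I * (2 * nrm E (\<sigma> n e0))) < e / 2"
    unfolding eventually_sequentially by blast
  have single: "nrm E (\<sigma> n x) \<le> C * nrm E x" if x: "x \<in> vecs E" for n x
  proof -
    \<comment> \<open>Multipliers concentrated at \<open>n\<close> turn the bound for sums into one
      for the single operator \<open>\<sigma> n\<close>.\<close>
    define c where "c m = (if m = n then 1 else 0 :: 'k)" for m
    have c: "\<forall>m. norm (c m) \<le> 1" by (simp add: c_def)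
    have "(\<Sum>m<Suc n. scl E (c m) (\<sigma> m x)) = \<sigma> n x" by (simp add: c_def)
    then show ?thesis using C(2)[THEN spec, THEN spec, THEN spec, THEN mp, OF c, THEN mp, OF x, of "Suc n"] by simp
  qed
  have "norm (B (\<lambda>_. \<sigma> n x)) \<le> e" if n: "n \<ge> max N1 N2" and x: "x \<in> vecs E" "nrm E x \<le> 1" for n x
  proof -
    define x' where "x' = x + scl E 2 e0"
    have e2: "scl E 2 e0 \<in> vecs E" by (rule E.vecs_scl[OF \<phi>(3)])
    have x': "x' \<in> vecs E" unfolding x'_def by (rule E.vecs_add[OF x(1) e2])
    have nx': "nrm E x' \<le> R"
      using E.nrm_triangle[OF x(1) e2] x(2) unfolding x'_def R_def E.nrm_scl[OF \<phi>(3)] by simp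
    have v: "\<sigma> n x \<in> vecs E" "\<sigma> n x' \<in> vecs E" "\<sigma> n e0 \<in> vecs E"
      by (rule bounded_ops_vecs[OF \<sigma>], rule x(1) x' \<phi>(3))+
    have \<sigma>x': "\<sigma> n x' - \<sigma> n x = scl E 2 (\<sigma> n e0)"
      unfolding x'_def bounded_ops_add[OF \<sigma> x(1) e2] bounded_ops_scl[OF \<sigma> \<phi>(3)] by simp
    have b: "nrm E (\<sigma> n x) \<le> R2" "nrm E (\<sigma> n x') \<le> R2"
    proof -
      have "C * nrm E x \<le> C * R" "C * nrm E x' \<le> C * R" using C(1) x(2) nx' R by (intro mult_left_mono; linarith)+
      then show "nrm E (\<sigma> n x) \<le> R2" "nrm E (\<sigma> n x') \<le> R2"
        using single[OF x(1), of n] single[OF x', of n] unfolding R2_def by linarith+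
    qed
    have "nrm scalar_space (B (\<lambda>_. \<sigma> n x') - B (\<lambda>_. \<sigma> n x)) \<le> (\<Sum>i\<in>I. M2 * R2 ^ card I * (2 * nrm E (\<sigma> n e0)))"
    proof (rule B.telescope)
      fix i z assume i: "i \<in> I" and z: "\<And>j. j \<in> I \<Longrightarrow> z j = \<sigma> n x' \<or> z j = \<sigma> n x"
      have "norm (B (z(i := \<sigma> n x' - \<sigma> n x))) \<le> M2 * R2 ^ card I * nrm E (\<sigma> n x' - \<sigma> n x)"
      proof (rule M2(2)[OF R2 i])
        show "z j \<in> vecs E \<and> nrm E (z j) \<le> R2" if "j \<in> I" for j using z[OF that] v b by auto
        show "\<sigma> n x' - \<sigma> n x \<in> vecs E" by (rule E.vecs_diff[OF v(2,1)])
      qed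
      then show "nrm scalar_space (B (z(i := \<sigma> n x' - \<sigma> n x))) \<le> M2 * R2 ^ card I * (2 * nrm E (\<sigma> n e0))"
        unfolding \<sigma>x' E.nrm_scl[OF v(3)] by simp
    qed (use v in auto)
    then have diff: "norm (B (\<lambda>_. \<sigma> n x') - B (\<lambda>_. \<sigma> n x)) < e / 2" using N2 n by fastforce
    define r :: 'k where "r = of_real (1 / R)"
    have nr: "norm r = 1 / R" using R by (simp add: r_def norm_divide)
    have "scl E r x' \<in> unit_ball E"
      using x' nx' R by (simp add: E.nrm_scl nr)
    then have "norm (G n (\<lambda>_. scl E r x')) < e / (2 * R ^ k)"
      using N1[THEN spec[of _ n], THEN mp, THEN bspec, of "scl E r x'"] n unfolding A\<iota> by linarith
    moreover have "G n (\<lambda>_. scl E r x') = (\<Prod>i<k. r) * G n (\<lambda>_. x')"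
    proof -
      interpret G: multilinear E scalar_space "{..<k}" "G n" by (rule Gm)
      have "G n (\<lambda>i. scl E r x') = scl scalar_space (\<Prod>i<k. r) (G n (\<lambda>_. x'))"
      proof (rule multilinear_scaling[where A = "G n" and x = "\<lambda>_. x'" and c = "\<lambda>_. r" and I = "{..<k}", OF E banach_scalar finite_lessThan])
        show "G n (x(i := scl E c u)) = scl scalar_space c (G n (x(i := u)))"
          if "i \<in> {..<k}" "\<And>j. j \<in> {..<k} \<Longrightarrow> x j \<in> vecs E" "u \<in> vecs E" for x i c u
          by (rule G.scl) (use that in auto)
        show "G n x = G n y" if "\<And>i. i \<in> {..<k} \<Longrightarrow> x i = y i" for x y by (rule G.cong) (rule that)
      qed (rule x')
      then show ?thesis by simp
    qed
    ultimately have "norm (G n (\<lambda>_. x')) < e / 2"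
      using R by (simp add: norm_mult norm_power nr power_divide field_simps)
    then have *: "norm (\<phi> x') ^ card K * norm (B (\<lambda>_. \<sigma> n x')) < e / 2"
      by (simp add: G_def norm_mult norm_power)
    \<comment> \<open>The reason for the factor \<open>2\<close>:
      \<open>\<phi> x' = 2 + \<phi> x\<close> with \<open>norm (\<phi> x) \<le> 1\<close>. So the
      factor in front of \<open>B\<close> can only enlarge it.\<close>
    have "norm (\<phi> x') \<ge> 1"
    proof -
      have "\<phi> x' = 2 - (- \<phi> x)" unfolding x'_def dual_add[OF \<phi>(1) x(1) e2] dual_scl[OF \<phi>(1,3)] by (simp add: \<phi>(4))
      then have "norm (\<phi> x') \<ge> norm (2::'k) - norm (- \<phi> x)" by (simp only: norm_triangle_ineq2)
      moreover have "norm (\<phi> x) \<le> 1" using \<phi>(2) x by force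
      ultimately show ?thesis by simp
    qed
    then have "1 * norm (B (\<lambda>_. \<sigma> n x')) \<le> norm (\<phi> x') ^ card K * norm (B (\<lambda>_. \<sigma> n x'))"
      by (intro mult_right_mono one_le_power) auto
    then have "norm (B (\<lambda>_. \<sigma> n x')) < e / 2" using * by linarith
    then show ?thesis
      using diff norm_triangle_ineq2[of "B (\<lambda>_. \<sigma> n x)" "B (\<lambda>_. \<sigma> n x')"] unfolding norm_minus_commute[of "B (\<lambda>_. \<sigma> n x)"]
      by linarith
  qed
  then show ?thesis by blast
qed

section \<open>Weak continuity from an unconditional finite dimensional expansion\<close>

locale fd_expansion = banach_space E
  for E :: "('k::rc_field, 'e::ab_group_add) nspace" +
  fixes A :: "nat \<Rightarrow> 'e \<Rightarrow> 'e"
  assumes expansion: "unconditional_fd_expansion E A"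
begin

lemma A_op: "A n \<in> bounded_ops E E" and A_rank: "finite_rank E (A n)"
  using expansion unfolding unconditional_fd_expansion_def by blast+

lemma A_vecs: "x \<in> vecs E \<Longrightarrow> A n x \<in> vecs E"
  by (rule bounded_ops_vecs[OF A_op])

lemma expansion_tendsto:
  assumes "x \<in> vecs E" shows "(\<lambda>n. nrm E ((\<Sum>i<n. A i x) - x)) \<longlonglongrightarrow> 0"
  using expansion assms unfolding unconditional_fd_expansion_def limitin_norm_top by blast

text \<open>A functional carries every rearrangement of the expansion to a convergent scalar series,
  and scalar series with this property converge absolutely.\<close>

lemma wuC_expansion:
  assumes x: "x \<in> vecs E" shows "wuC E (\<lambda>n. A n x)"
  unfolding wuC_def
proof (intro conjI ballI)
  show "range (\<lambda>n. A n x) \<subseteq> vecs E" using A_vecs[OF x] by blast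
  fix \<phi> assume \<phi>: "\<phi> \<in> dual E"
  show "summable (\<lambda>n. norm (\<phi> (A n x)))"
  proof (rule rearrangements_convergent_imp_summable_norm)
    fix \<pi> :: "nat \<Rightarrow> nat" assume "bij \<pi>"
    then obtain l where "limitin (norm_top E) (\<lambda>n. \<Sum>i<n. A (\<pi> i) x) l sequentially"
      using expansion x unfolding unconditional_fd_expansion_def unconditionally_convergent_series_def by blast
    then have l: "l \<in> vecs E" "(\<lambda>n. nrm E ((\<Sum>i<n. A (\<pi> i) x) - l)) \<longlonglongrightarrow> 0"
      unfolding limitin_norm_top by blast+
    have "(\<lambda>n. \<phi> (\<Sum>i<n. A (\<pi> i) x)) \<longlonglongrightarrow> \<phi> l"
      by (rule dual_tendsto[OF \<phi> _ l]) (intro always_eventually allI vecs_sum A_vecs x)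
    moreover have "\<phi> (\<Sum>i<n. A (\<pi> i) x) = (\<Sum>i<n. \<phi> (A (\<pi> i) x))" for n
      by (rule dual_sum[OF \<phi>]) (rule A_vecs[OF x])
    ultimately show "convergent (\<lambda>n. \<Sum>i<n. \<phi> (A (\<pi> i) x))" unfolding convergent_def by auto
  qed
qed

text \<open>For each \<open>x\<close> the weighted sums are bounded because the series of
  \<open>A n x\<close> is w.u.C.; uniform boundedness makes the constant independent of
  \<open>x\<close>.\<close>

lemma multipliers_bounded:
  "\<exists>C\<ge>0. \<forall>c N x. (\<forall>i. norm (c i) \<le> 1) \<longrightarrow> x \<in> vecs E \<longrightarrow>
    nrm E (\<Sum>i<N. scl E (c i) (A i x)) \<le> C * nrm E x"
proof -
  note E = banach_space_axioms
  define \<P> where "\<P> = {\<lambda>x. nrm E (\<Sum>i<N. scl E (c i) (A i x)) |c N. \<forall>i. norm (c i) \<le> 1}"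
  have T: "(\<lambda>x. \<Sum>i<N. scl E (c i) (A i x)) \<in> bounded_ops E E" for c and N :: nat
    by (rule bounded_ops_weighted_sum[OF E A_op])
  have Tv: "(\<Sum>i<N. scl E (c i) (A i x)) \<in> vecs E" if "x \<in> vecs E" for c and N :: nat and x
    by (rule bounded_ops_vecs[OF T that])
  have "\<exists>C. \<forall>p\<in>\<P>. \<forall>x\<in>vecs E. p x \<le> C * nrm E x"
  proof (rule uniform_boundedness)
    fix p assume "p \<in> \<P>"
    then obtain c N where p: "p = (\<lambda>x. nrm E (\<Sum>i<N. scl E (c i) (A i x)))" unfolding \<P>_def by blast
    show "p (x + y) \<le> p x + p y" if "x \<in> vecs E" "y \<in> vecs E" for x y
      unfolding p bounded_ops_add[OF T that] by (intro nrm_triangle Tv that)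
    show "p (scl E a x) = norm a * p x" if "x \<in> vecs E" for a x
      unfolding p bounded_ops_scl[OF T that] by (intro nrm_scl Tv that)
    show "\<exists>C. \<forall>x\<in>vecs E. p x \<le> C * nrm E x"
      unfolding p by (rule bounded_ops_bound[OF E T[of c N]]) blast
  next
    fix x assume x: "x \<in> vecs E"
    obtain C where "\<And>c N. (\<And>i. norm (c i) \<le> 1) \<Longrightarrow> nrm E (\<Sum>i<N. scl E (c i) (A i x)) \<le> C"
      by (rule wuC_bounded_multipliers[OF wuC_expansion[OF x]]) blast
    then show "\<exists>B. \<forall>p\<in>\<P>. p x \<le> B" unfolding \<P>_def by blast
  qed
  then obtain C where C: "\<forall>p\<in>\<P>. \<forall>x\<in>vecs E. p x \<le> C * nrm E x" by blast
  have "nrm E (\<Sum>i<N. scl E (c i) (A i x)) \<le> max C 0 * nrm E x"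
    if c: "\<forall>i. norm (c i) \<le> 1" and x: "x \<in> vecs E" for c N x
  proof -
    have "(\<lambda>x. nrm E (\<Sum>i<N. scl E (c i) (A i x))) \<in> \<P>" unfolding \<P>_def using c by blast
    from C[THEN bspec, OF this, THEN bspec, OF x]
    have "nrm E (\<Sum>i<N. scl E (c i) (A i x)) \<le> C * nrm E x" .
    also have "\<dots> \<le> max C 0 * nrm E x" by (rule mult_right_mono) (simp_all add: nrm_nonneg[OF x])
    finally show ?thesis .
  qed
  then show ?thesis by (intro exI[of _ "max C 0"]) simp
qed

text \<open>Each weight \<open>c j\<close> is repeated along its block and \<open>0\<close> is put
  in the gaps, so weighted sums of blocks inherit the bound of \<open>multipliers_bounded\<close>
  with the same constant.\<close>

lemma block_sum_multipliers:
  fixes b m n :: "nat \<Rightarrow> nat" and c :: "nat \<Rightarrow> 'k"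
  assumes c: "\<forall>j. norm (c j) \<le> 1" and mn: "\<forall>j. m j \<le> n j \<and> n j \<le> m (Suc j)"
  shows "\<exists>c'. (\<forall>i. norm (c' i) \<le> 1) \<and>
    (\<forall>x. (\<Sum>j<N. scl E (c j) (\<Sum>i\<in>{m j..<n j}. A i x)) = (\<Sum>i<m N. scl E (c' i) (A i x)))"
proof (induction N)
  case 0
  then show ?case by (intro exI[of _ "\<lambda>_. 0"]) simp
next
  case (Suc N)
  then obtain c' where c': "\<forall>i. norm (c' i) \<le> 1"
    "\<forall>x. (\<Sum>j<N. scl E (c j) (\<Sum>i\<in>{m j..<n j}. A i x)) = (\<Sum>i<m N. scl E (c' i) (A i x))" by blast
  define d where "d i = (if i < m N then c' i else if i < n N then c N else 0)" for i
  have "(\<Sum>i<m (Suc N). scl E (d i) (A i x)) = (\<Sum>i<m N. scl E (c' i) (A i x)) + scl E (c N) (\<Sum>i\<in>{m N..<n N}. A i x)" for x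
  proof -
    have le: "m N \<le> n N" "n N \<le> m (Suc N)" using mn by blast+
    have "(\<Sum>i<m (Suc N). scl E (d i) (A i x)) = (\<Sum>i<m N. scl E (d i) (A i x)) +
        ((\<Sum>i\<in>{m N..<n N}. scl E (d i) (A i x)) + (\<Sum>i\<in>{n N..<m (Suc N)}. scl E (d i) (A i x)))"
      unfolding lessThan_atLeast0 sum.atLeastLessThan_concat[OF le]
      by (rule sum.atLeastLessThan_concat[symmetric]) (use le in linarith)+
    moreover have "(\<Sum>i<m N. scl E (d i) (A i x)) = (\<Sum>i<m N. scl E (c' i) (A i x))"
      by (rule sum.cong) (auto simp: d_def)
    moreover have "(\<Sum>i\<in>{m N..<n N}. scl E (d i) (A i x)) = scl E (c N) (\<Sum>i\<in>{m N..<n N}. A i x)"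
      unfolding scale_sum_right by (rule sum.cong) (auto simp: d_def)
    moreover have "(\<Sum>i\<in>{n N..<m (Suc N)}. scl E (d i) (A i x)) = 0"
      by (rule sum.neutral) (use le in \<open>auto simp: d_def\<close>)
    ultimately show ?thesis by simp
  qed
  moreover have "\<forall>i. norm (d i) \<le> 1" using c c'(1) by (simp add: d_def)
  ultimately show ?case using c'(2) by (intro exI[of _ d]) simp
qed

lemma partial_sum_diff:
  fixes m n :: nat
  assumes "m \<le> n" shows "(\<Sum>i<n. A i x) - (\<Sum>i<m. A i x) = (\<Sum>i\<in>{m..<n}. A i x)"
  using sum_diff_nat_ivl[of 0 m n "\<lambda>i. A i x"] assms by (simp add: lessThan_atLeast0)

text \<open>Otherwise bad blocks can be chosen one after the other, each beyond the end of the
  previous one. Their sums \<open>\<sigma> j\<close> share a bound for multipliers and tend to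
  \<open>0\<close> pointwise, so \<open>diagonal_operators_vanish\<close> contradicts their
  choice.\<close>

lemma blocks_vanish:
  assumes uc: "uc_polys_weakly_compact TYPE(('e \<Rightarrow> 'k) \<Rightarrow> 'k) k E"
    and B: "multilinear E scalar_space I B" and I: "I \<subseteq> {..<k}" "I \<noteq> {}" and e: "e > 0"
  shows "\<exists>N. \<forall>m\<ge>N. \<forall>n\<ge>m. \<forall>x\<in>unit_ball E. norm (B (\<lambda>_. \<Sum>i\<in>{m..<n}. A i x)) \<le> e"
proof (rule ccontr)
  assume "\<not> ?thesis"
  then have "\<forall>N. \<exists>m n x. N \<le> m \<and> m \<le> n \<and> x \<in> unit_ball E \<and> \<not> norm (B (\<lambda>_. \<Sum>i\<in>{m..<n}. A i x)) \<le> e"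
    by blast
  then obtain m n x where mnx: "\<forall>N. N \<le> m N \<and> m N \<le> n N \<and> x N \<in> unit_ball E \<and>
      \<not> norm (B (\<lambda>_. \<Sum>i\<in>{m N..<n N}. A i (x N))) \<le> e"
    unfolding choice_iff by blast
  define b where "b = rec_nat 0 (\<lambda>_. n)"
  have bS: "b (Suc j) = n (b j)" for j by (simp add: b_def)
  define M where "M j = m (b j)" for j
  define L where "L j = n (b j)" for j
  have blk: "\<forall>j. M j \<le> L j \<and> L j \<le> M (Suc j)"
    using mnx unfolding M_def L_def bS by blast
  define \<sigma> where "\<sigma> j u = (\<Sum>i\<in>{M j..<L j}. A i u)" for j u
  have \<sigma>: "\<sigma> j \<in> bounded_ops E E" for j
    unfolding \<sigma>_def by (rule bounded_ops_sum_fun[OF banach_space_axioms A_op])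
  obtain C where C: "C \<ge> 0" "\<forall>c N x. (\<forall>i. norm (c i) \<le> 1) \<longrightarrow> x \<in> vecs E \<longrightarrow>
    nrm E (\<Sum>i<N. scl E (c i) (A i x)) \<le> C * nrm E x" using multipliers_bounded by blast
  have C\<sigma>: "\<forall>c N x. (\<forall>j. norm (c j) \<le> 1) \<longrightarrow> x \<in> vecs E \<longrightarrow> nrm E (\<Sum>j<N. scl E (c j) (\<sigma> j x)) \<le> C * nrm E x"
  proof (intro allI impI)
    fix c :: "nat \<Rightarrow> 'k" and N x assume c: "\<forall>j. norm (c j) \<le> 1" and x: "x \<in> vecs E"
    obtain c' where c': "\<forall>i. norm (c' i) \<le> 1"
      "\<forall>x. (\<Sum>j<N. scl E (c j) (\<sigma> j x)) = (\<Sum>i<M N. scl E (c' i) (A i x))"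
      using block_sum_multipliers[OF c blk, of N] unfolding \<sigma>_def by blast
    show "nrm E (\<Sum>j<N. scl E (c j) (\<sigma> j x)) \<le> C * nrm E x"
      unfolding c'(2)[THEN spec, of x] by (rule C(2)[THEN spec, THEN spec, THEN spec, THEN mp, OF c'(1), THEN mp, OF x])
  qed
  have bj: "j \<le> M j" for j
  proof (induction j)
    case (Suc j)
    \<comment> \<open>An empty block gives the value of \<open>B\<close> at \<open>0\<close>, which
      is \<open>0\<close> and not bad. Hence the blocks advance and eventually lie beyond every
      index.\<close>
    have "M j < L j"
    proof (rule ccontr)
      assume "\<not> M j < L j"
      then have emp: "{m (b j)..<n (b j)} = {}" by (simp add: M_def L_def)
      obtain i where i: "i \<in> I" using I(2) by blast
      have "B ((\<lambda>_. 0)(i := 0)) = 0" by (rule multilinear.zero[OF B i]) simp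
      moreover have "(\<lambda>_. 0)(i := 0) = (\<lambda>_. 0 :: 'e)" by auto
      ultimately have "norm (B (\<lambda>_. \<Sum>i\<in>{m (b j)..<n (b j)}. A i (x (b j)))) = 0" unfolding emp by simp
      then show False using mnx[THEN spec, of "b j"] e by linarith
    qed
    then show ?case using Suc blk[THEN spec, of j] by linarith
  qed simp
  have null: "(\<lambda>j. nrm E (\<sigma> j u)) \<longlonglongrightarrow> 0" if u: "u \<in> vecs E" for u
  proof (rule LIMSEQ_I)
    fix r :: real assume r: "r > 0"
    have Sv: "(\<Sum>i<n. A i u) \<in> vecs E" for n :: nat by (intro vecs_sum A_vecs u)
    obtain N where N: "\<forall>m\<ge>N. \<forall>n\<ge>N. nrm E ((\<Sum>i<m. A i u) - (\<Sum>i<n. A i u)) < r"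
      using nrm_Cauchy_if_convergent[OF Sv u expansion_tendsto[OF u] r] by blast
    have "nrm E (\<sigma> j u) < r" if "j \<ge> N" for j
    proof -
      have "N \<le> M j" "M j \<le> L j" using that bj[of j] blk by (auto intro: order_trans)
      then have "nrm E ((\<Sum>i<L j. A i u) - (\<Sum>i<M j. A i u)) < r" using N order_trans by blast
      then show ?thesis unfolding \<sigma>_def partial_sum_diff[OF \<open>M j \<le> L j\<close>] .
    qed
    then show "\<exists>N. \<forall>j\<ge>N. norm (nrm E (\<sigma> j u) - 0) < r"
      using nrm_nonneg[OF bounded_ops_vecs[OF \<sigma> u]] by auto
  qed
  obtain N where "\<forall>n\<ge>N. \<forall>x\<in>unit_ball E. norm (B (\<lambda>_. \<sigma> n x)) \<le> e"
    using diagonal_operators_vanish[where \<sigma> = \<sigma>, OF banach_space_axioms uc B I \<sigma> C(1) C\<sigma> null e] by blast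
  then have "norm (B (\<lambda>_. \<sigma> N (x (b N)))) \<le> e" using mnx by blast
  then show False using mnx unfolding \<sigma>_def M_def L_def by blast
qed

text \<open>The tail is the limit of the blocks \<open>{m..<n}\<close> as \<open>n\<close> grows, so
  their uniform bound passes to it; homogeneity of degree \<open>card I\<close> carries it from the
  unit ball to radius \<open>R\<close>.\<close>

lemma tails_vanish:
  assumes uc: "uc_polys_weakly_compact TYPE(('e \<Rightarrow> 'k) \<Rightarrow> 'k) k E"
    and B: "multilinear E scalar_space I B" and I: "I \<subseteq> {..<k}" "I \<noteq> {}" and e: "e > 0"
  shows "\<exists>m. \<forall>x\<in>vecs E. nrm E x \<le> R \<longrightarrow> norm (B (\<lambda>_. x - (\<Sum>i<m. A i x))) \<le> e"
proof -
  interpret B: multilinear E scalar_space I B by (rule B)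
  \<comment> \<open>\<open>R\<close> is an arbitrary real number; the maximum makes it fit for
    division.\<close>
  define Q where "Q = max R 1"
  have Q: "Q \<ge> 1" "R \<le> Q" by (simp_all add: Q_def)
  have "e / Q ^ card I > 0" using e Q by simp
  from blocks_vanish[OF uc B I this] obtain m where
    m: "\<forall>m'\<ge>m. \<forall>n\<ge>m'. \<forall>x\<in>unit_ball E. norm (B (\<lambda>_. \<Sum>i\<in>{m'..<n}. A i x)) \<le> e / Q ^ card I" by blast
  have ball: "norm (B (\<lambda>_. x - (\<Sum>i<m. A i x))) \<le> e / Q ^ card I" if x: "x \<in> unit_ball E" for x
  proof -
    have xv: "x \<in> vecs E" using x by blast
    have Sv: "(\<Sum>i\<in>S. A i x) \<in> vecs E" for S by (intro vecs_sum A_vecs xv)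
    let ?t = "x - (\<Sum>i<m. A i x)"
    have tv: "?t \<in> vecs E" by (intro vecs_diff xv Sv)
    have "(\<lambda>n. nrm E ((\<Sum>i\<in>{m..<n}. A i x) - ?t)) \<longlonglongrightarrow> 0"
    proof (rule Lim_transform_eventually[OF expansion_tendsto[OF xv]])
      show "eventually (\<lambda>n. nrm E ((\<Sum>i<n. A i x) - x) = nrm E ((\<Sum>i\<in>{m..<n}. A i x) - ?t)) sequentially"
        using eventually_ge_at_top[of m]
      proof eventually_elim
        case (elim n)
        show ?case unfolding partial_sum_diff[OF elim, symmetric] by simp
      qed
    qed
    from B.tendsto_diag[OF Sv tv this]
    have "(\<lambda>n. B (\<lambda>_. \<Sum>i\<in>{m..<n}. A i x)) \<longlonglongrightarrow> B (\<lambda>_. ?t)"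
      unfolding scalar_space_simps tendsto_norm_zero_iff by (rule LIM_zero_cancel)
    then have "(\<lambda>n. norm (B (\<lambda>_. \<Sum>i\<in>{m..<n}. A i x))) \<longlonglongrightarrow> norm (B (\<lambda>_. ?t))" by (rule tendsto_norm)
    then show ?thesis
      by (rule tendsto_upperbound) (use m x in \<open>auto simp: eventually_sequentially intro!: exI[of _ m]\<close>)
  qed
  have "norm (B (\<lambda>_. x - (\<Sum>i<m. A i x))) \<le> e" if x: "x \<in> vecs E" "nrm E x \<le> R" for x
  proof -
    define r :: 'k where "r = of_real (1 / Q)"
    have nr: "norm r = 1 / Q" using Q by (simp add: r_def norm_divide)
    let ?t = "x - (\<Sum>i<m. A i x)"
    have tv: "?t \<in> vecs E" by (intro vecs_diff vecs_sum A_vecs x(1))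
    have rx: "scl E r x \<in> unit_ball E" using x Q by (simp add: nrm_scl nr)
    have "scl E r x - (\<Sum>i<m. A i (scl E r x)) = scl E r ?t"
      unfolding bounded_ops_scl[OF A_op x(1)] by (simp add: scale_sum_right scale_right_diff_distrib)
    then have "norm (B (\<lambda>_. scl E r ?t)) \<le> e / Q ^ card I" using ball[OF rx] by simp
    moreover have "B (\<lambda>i. scl E r ?t) = scl scalar_space (\<Prod>i\<in>I. r) (B (\<lambda>_. ?t))"
    proof (rule multilinear_scaling[where A = B and x = "\<lambda>_. ?t" and c = "\<lambda>_. r" and I = I, OF banach_space_axioms banach_scalar B.finite_slots])
      show "B (x(i := scl E c u)) = scl scalar_space c (B (x(i := u)))"
        if "i \<in> I" "\<And>j. j \<in> I \<Longrightarrow> x j \<in> vecs E" "u \<in> vecs E" for x i c u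
        by (rule B.scl) (use that in auto)
      show "B x = B y" if "\<And>i. i \<in> I \<Longrightarrow> x i = y i" for x y by (rule B.cong) (rule that)
    qed (rule tv)
    ultimately have "norm (B (\<lambda>_. ?t)) / Q ^ card I \<le> e / Q ^ card I"
      by (simp add: norm_mult norm_power nr power_divide)
    moreover have "Q ^ card I > 0" using Q by simp
    ultimately show ?thesis by (simp add: divide_le_cancel)
  qed
  then show ?thesis by blast
qed

lemma partial_sum_representation:
  "\<exists>(d::nat) f g. (\<forall>i<d. f i \<in> dual E \<and> g i \<in> vecs E) \<and>
    (\<forall>x\<in>vecs E. (\<Sum>i<m. A i x) = (\<Sum>i<d. scl E (f i x) (g i)))"
proof (rule finite_rank_representation)
  show "(\<lambda>x. \<Sum>i<m. A i x) \<in> bounded_ops E E" by (rule bounded_ops_sum_fun[OF banach_space_axioms A_op])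
  have "\<forall>n. \<exists>S. S \<subseteq> vecs E \<and> finite S \<and> A n ` vecs E \<subseteq> span S"
    using A_rank unfolding finite_rank_def by blast
  then obtain S where S: "\<forall>n. S n \<subseteq> vecs E \<and> finite (S n) \<and> A n ` vecs E \<subseteq> span (S n)"
    unfolding choice_iff by blast
  have "(\<Sum>i<m. A i x) \<in> span (\<Union>i<m. S i)" if x: "x \<in> vecs E" for x
  proof (rule span_sum)
    fix i assume "i \<in> {..<m}"
    then have "S i \<subseteq> (\<Union>i<m. S i)" by blast
    then show "A i x \<in> span (\<Union>i<m. S i)" using S x span_mono by blast
  qed
  then show "finite_rank E (\<lambda>x. \<Sum>i<m. A i x)"
    unfolding finite_rank_def using S by (intro exI[of _ "\<Union>i<m. S i"]) auto
qed

text \<open>Changing \<open>x\<close> into its tail \<open>\<tau> x\<close> in one more slot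
  subtracts \<open>B\<close> with a partial sum in that slot. Writing the partial sum as a
  combination of fixed vectors \<open>g i\<close> with coefficients \<open>f i x\<close> pulls out
  functionals and leaves forms with that slot fixed at \<open>g i\<close>. The remaining slots hold
  a mixture of \<open>x\<close> and \<open>\<tau> x\<close>, but this is a precomposition with
  operators, so the induction hypothesis applies.\<close>

lemma multilinear_weakly_cont:
  assumes uc: "uc_polys_weakly_compact TYPE(('e \<Rightarrow> 'k) \<Rightarrow> 'k) k E"
    and B: "multilinear E scalar_space I B" and I: "I \<subseteq> {..<k}"
  shows "weakly_cont_on_bounded E (\<lambda>x. B (\<lambda>_. x))"
  using B I
proof (induction "card I" arbitrary: I B rule: less_induct)
  case less
  interpret B: multilinear E scalar_space I B by (rule less.prems)
  show ?case
  proof (cases "I = {}")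
    case True
    have "B (\<lambda>_. 0) = B (\<lambda>_. x)" for x by (rule B.cong) (simp add: True)
    then show ?thesis by (intro weakly_cont_cong[OF weakly_cont_const])
  next
    case False
    show ?thesis
    proof (rule weakly_cont_uniform_limit)
      fix R e :: real assume e: "e > 0"
      obtain m where m: "\<forall>x\<in>vecs E. nrm E x \<le> R \<longrightarrow> norm (B (\<lambda>_. x - (\<Sum>i<m. A i x))) \<le> e"
        using tails_vanish[OF uc less.prems False e] by blast
      obtain d :: nat and f g where d: "\<forall>i<d. f i \<in> dual E \<and> g i \<in> vecs E"
          "\<forall>x\<in>vecs E. (\<Sum>i<m. A i x) = (\<Sum>i<d. scl E (f i x) (g i))"
        using partial_sum_representation[of m] by (elim exE conjE)
      define \<tau> where "\<tau> x = x - (\<Sum>i<m. A i x)" for x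
      have Sop: "(\<lambda>x. \<Sum>i<m. A i x) \<in> bounded_ops E E" by (rule bounded_ops_sum_fun[OF banach_space_axioms A_op])
      have \<tau>v: "\<tau> x \<in> vecs E" if "x \<in> vecs E" for x unfolding \<tau>_def by (intro vecs_diff vecs_sum A_vecs that)
      have id: "(\<lambda>x. x) \<in> bounded_ops E E" by (rule bounded_opsI[where C = 1]) auto
      have \<tau>: "\<tau> \<in> bounded_ops E E"
      proof -
        obtain D where D: "D \<ge> 0" "\<And>x. x \<in> vecs E \<Longrightarrow> nrm E (\<Sum>i<m. A i x) \<le> D * nrm E x"
          using bounded_ops_bound[OF banach_space_axioms Sop] by blast
        show ?thesis
        proof (rule bounded_opsI[where C = "1 + D"])
          fix x assume x: "x \<in> vecs E"
          show "nrm E (\<tau> x) \<le> (1 + D) * nrm E x"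
            using nrm_diff_triangle[OF x bounded_ops_vecs[OF Sop x]] D(2)[OF x]
            by (simp add: \<tau>_def algebra_simps)
        qed (simp_all add: \<tau>v, simp_all add: \<tau>_def bounded_ops_add[OF Sop] bounded_ops_scl[OF Sop] scale_right_diff_distrib)
      qed
      have step: "weakly_cont_on_bounded E (\<lambda>x. B (\<lambda>i. if i \<in> J then \<tau> x else x) - B (\<lambda>_. x))"
        if "finite J" "J \<subseteq> I" for J
        using that
      proof (induction J rule: finite_induct)
        case empty
        then show ?case by (simp add: weakly_cont_const)
      next
        case (insert s J)
        have s: "s \<in> I" using insert.prems by blast
        define z where "z x = (\<lambda>i. if i \<in> J then \<tau> x else x)" for x
        have zv: "z x i \<in> vecs E" if "x \<in> vecs E" for x i using \<tau>v that by (simp add: z_def)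
        have slot: "weakly_cont_on_bounded E (\<lambda>x. B ((z x)(s := a)))" if a: "a \<in> vecs E" for a
        proof -
          have m1: "multilinear E scalar_space (I - {s}) (\<lambda>x. B (\<lambda>i. if i \<in> I - {s} then x i else a))"
            by (rule B.fix_slots) (use a in auto)
          have m2: "multilinear E scalar_space (I - {s})
              (\<lambda>x. B (\<lambda>i. if i \<in> I - {s} then (if i \<in> J then \<tau> else (\<lambda>x. x)) (x i) else a))"
            by (rule multilinear.precompose[OF m1, of "\<lambda>i. if i \<in> J then \<tau> else (\<lambda>x. x)"]) (simp add: \<tau> id)
          have "card (I - {s}) < card I" using s B.finite_slots by (rule card_Diff1_less[rotated])
          from less.hyps[OF this m2] less.prems(2)
          have w: "weakly_cont_on_bounded E (\<lambda>x. B (\<lambda>i. if i \<in> I - {s} then (if i \<in> J then \<tau> else (\<lambda>x. x)) x else a))"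
            by blast
          show ?thesis
            by (rule weakly_cont_cong[OF w]) (rule B.cong, use insert.hyps in \<open>auto simp: z_def\<close>)
        qed
        have w: "weakly_cont_on_bounded E (\<lambda>x. (B (z x) - B (\<lambda>_. x)) + (\<Sum>i<d. (- f i x) * B ((z x)(s := g i))))"
        proof (intro weakly_cont_add weakly_cont_sum weakly_cont_mult slot)
          show "weakly_cont_on_bounded E (\<lambda>x. B (z x) - B (\<lambda>_. x))"
            unfolding z_def using insert by blast
          fix i assume "i \<in> {..<d}"
          then have fg: "f i \<in> dual E" "g i \<in> vecs E" using d(1) by blast+
          show "g i \<in> vecs E" by (rule fg)
          have "(\<lambda>x. (-1) * f i x) \<in> dual E" by (rule dual_scl_fun[OF fg(1)])
          then show "weakly_cont_on_bounded E (\<lambda>x. - f i x)" using weakly_cont_dual by fastforce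
        qed
        show ?case
        proof (rule weakly_cont_cong[OF w])
          fix x assume x: "x \<in> vecs E"
          have Sx: "(\<Sum>i<m. A i x) \<in> vecs E" by (rule bounded_ops_vecs[OF Sop x])
          have zs: "(z x)(s := x) = z x" using insert.hyps by (auto simp: z_def)
          have "B (\<lambda>i. if i \<in> insert s J then \<tau> x else x) = B ((z x)(s := x - (\<Sum>i<m. A i x)))"
            by (rule arg_cong[of _ _ B]) (auto simp: z_def \<tau>_def)
          also have "\<dots> = B ((z x)(s := x)) - B ((z x)(s := (\<Sum>i<m. A i x)))"
            by (rule B.diff[OF s zv[OF x] x Sx])
          also have "B ((z x)(s := (\<Sum>i<m. A i x))) = (\<Sum>i<d. B ((z x)(s := scl E (f i x) (g i))))"
            unfolding d(2)[THEN bspec, OF x] by (rule B.sum[OF s zv[OF x]]) (use d(1) in auto)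
          also have "\<dots> = (\<Sum>i<d. f i x * B ((z x)(s := g i)))"
          proof (rule sum.cong[OF refl])
            fix i assume "i \<in> {..<d}"
            then have "g i \<in> vecs E" using d(1) by blast
            from B.scl[OF s zv[OF x] this] show "B ((z x)(s := scl E (f i x) (g i))) = f i x * B ((z x)(s := g i))"
              by simp
          qed
          finally show "(B (z x) - B (\<lambda>_. x)) + (\<Sum>i<d. (- f i x) * B ((z x)(s := g i)))
              = B (\<lambda>i. if i \<in> insert s J then \<tau> x else x) - B (\<lambda>_. x)"
            unfolding zs by (simp add: sum_negf)
        qed
      qed
      have "weakly_cont_on_bounded E (\<lambda>x. B (\<lambda>i. if i \<in> I then \<tau> x else x) - B (\<lambda>_. x))"
        by (rule step[OF B.finite_slots subset_refl])
      from weakly_cont_mult[OF weakly_cont_const[of E "-1"] this]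
      have w: "weakly_cont_on_bounded E (\<lambda>x. - 1 * (B (\<lambda>i. if i \<in> I then \<tau> x else x) - B (\<lambda>_. x)))" .
      \<comment> \<open>What separates \<open>B (\<lambda>_. x)\<close> from the weakly continuous
        function just found is \<open>B (\<lambda>_. \<tau> x)\<close>, and \<open>m\<close> was
        chosen to make this at most \<open>e\<close> on the ball.\<close>
      have "B (\<lambda>i. if i \<in> I then \<tau> x else x) = B (\<lambda>_. \<tau> x)" for x by (rule B.cong) simp
      then have "\<forall>x\<in>vecs E. nrm E x \<le> R \<longrightarrow>
          norm (B (\<lambda>_. x) - (- 1 * (B (\<lambda>i. if i \<in> I then \<tau> x else x) - B (\<lambda>_. x)))) \<le> e"
        using m unfolding \<tau>_def by simp
      then show "\<exists>h. weakly_cont_on_bounded E h \<and>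
          (\<forall>x\<in>vecs E. nrm E x \<le> R \<longrightarrow> norm (B (\<lambda>_. x) - h x) \<le> e)"
        using w by (intro exI conjI)
    qed
  qed
qed

lemma polys_eq_polys_wb:
  assumes uc: "uc_polys_weakly_compact TYPE(('e \<Rightarrow> 'k) \<Rightarrow> 'k) k E" and k: "k \<ge> 1"
  shows "polys k E scalar_space = polys_wb k E scalar_space"
proof -
  have "weakly_cont_on_bounded E P" if P: "P \<in> polys k E scalar_space" for P
  proof -
    obtain B where B: "multilinear E scalar_space {..<k} B" "\<And>x. x \<in> vecs E \<Longrightarrow> P x = B (\<lambda>_. x)"
      using polys_multilinear[OF banach_space_axioms banach_scalar k P] by blast
    show ?thesis
      by (rule weakly_cont_cong[OF multilinear_weakly_cont[OF uc B(1) subset_refl]]) (simp add: B(2))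
  qed
  then show ?thesis using polys_wb_scalar_iff by blast
qed

end

theorem theorem10:
  fixes E :: "('k::rc_field, 'e::ab_group_add) nspace" and k :: nat
  assumes "banach_space E" and "k \<ge> 1"
  shows
    "(property_V TYPE(('e \<Rightarrow> 'k) \<Rightarrow> 'k) E
        \<and> polys k E scalar_space = polys_wb k E scalar_space
      \<longrightarrow> uc_polys_weakly_compact TYPE('f::ab_group_add) k E)
     \<and>
     ((\<exists>A. unconditional_fd_expansion E A)
      \<longrightarrow> uc_polys_weakly_compact TYPE(('e \<Rightarrow> 'k) \<Rightarrow> 'k) k E
      \<longrightarrow> property_V TYPE('f) E
        \<and> polys k E scalar_space = polys_wb k E scalar_space)"
proof (intro conjI impI)
  assume "property_V TYPE(('e \<Rightarrow> 'k) \<Rightarrow> 'k) E \<and> polys k E scalar_space = polys_wb k E scalar_space"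
  then show "uc_polys_weakly_compact TYPE('f) k E"
    using property_V_imp_uc_polys_weakly_compact[OF assms] by blast
next
  assume uc: "uc_polys_weakly_compact TYPE(('e \<Rightarrow> 'k) \<Rightarrow> 'k) k E"
  \<comment> \<open>Assertion (b) gives property (V) for its own target type;
    \<open>property_V_any_type\<close> then passes to \<open>'f\<close>.\<close>
  then show "property_V TYPE('f) E"
    using property_V_any_type property_V_of_uc_polys assms by blast
  assume "\<exists>A. unconditional_fd_expansion E A"
  then obtain A where "unconditional_fd_expansion E A" by blast
  then have "fd_expansion E A"
    using assms(1) by (simp add: fd_expansion_def fd_expansion_axioms_def)
  then show "polys k E scalar_space = polys_wb k E scalar_space"
    using uc assms(2) by (rule fd_expansion.polys_eq_polys_wb)
qed

end
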